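(* Let $k$ be a field of characteristic $p>0$, $\mathfrak g$ a finite dimensional $p$-Lie algebra over $k$ and $\xi\in\mathfrak g^*$. The algebra $U_\xi(\mathfrak g)$ is $\mathfrak g$-Galois if and only if $U_\xi(\mathfrak g)$ is central simple. In this case the left $U_0(\mathfrak g)$-comodule structure $$\Delta:U_\xi(\mathfrak g)\to U_0(\mathfrak g)\otimes U_\xi(\mathfrak g),\qquad x\mapsto1\otimes x+x\otimes1\ \text{ for }x\in\mathfrak g$$ (an algebra homomorphism) corresponds to the Miyashita–Ulbrich action of $U_0(\mathfrak g)^*$ on $U_\xi(\mathfrak g)$.
   Context: $U_\xi(\mathfrak g)$ is the reduced enveloping algebra: the factor algebra of the universal enveloping algebra $U(\mathfrak g)$ by the ideal generated by the central elements $x^p-x^{[p]}-\xi(x)^p1$, $x\in\mathfrak g$; $\mathfrak g$ is identified with its image in $U_\xi(\mathfrak g)$. $U_0(\mathfrak g)$ is a cocommutative Hopf algebra in which the elements of $\mathfrak g$ are primitive. $U_\xi(\mathfrak g)$ is a left $U_0(\mathfrak g)$-module algebra via the adjoint action: $x\in\mathfrak g$ acts by $u\mapsto xu-ux$. For a finite dimensional Hopf algebra $H$ over $k$, a left $H$-module algebra $A$ is called $H^*$-Galois if the map $\pi:A\otimes H\to\operatorname{End}A$, $\pi(a\otimes h)(b)=a(hb)$, is bijective (equivalently, by a known fact, if any one of the following maps is bijective: $A\otimes H\to\operatorname{End}A$, $a\otimes h\mapsto(b\mapsto(hb)a)$; $A\otimes A\to\operatorname{Hom}(H,A)\cong A\otimes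 H^*$, $a\otimes b\mapsto(h\mapsto a(hb))$; $a\otimes b\mapsto(h\mapsto(ha)b)$). $U_\xi(\mathfrak g)$ is called $\mathfrak g$-Galois if it is $U_0(\mathfrak g)^*$-Galois with respect to the adjoint action. If $A$ is $H^*$-Galois, the Miyashita–Ulbrich action of $H^*$ on $A$ is the unique right $H^*$-module structure on $A$ such that $ba=\sum_i(h_ia)(bh_i^* )$ for all $a,b\in A$, where $\{h_i\}$, $\{h_i^*\}$ are dual bases of $H$ and $H^*$. A left $H$-comodule structure on $A$ corresponds to a right $H^*$-module structure if it is given by $b\mapsto\sum_ih_i\otimes bh_i^*$. *)

theory Defs
  imports "HOL-Algebra.Module" "HOL-Algebra.QuotRing" "HOL-Library.FuncSet"
begin

section \<open>Vector spaces and associative algebras\<close>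

definition has_char :: "('k, 'm) ring_scheme \<Rightarrow> nat \<Rightarrow> bool" where
  "has_char K p \<longleftrightarrow> (\<forall>n::nat. [n] \<cdot>\<^bsub>K\<^esub> \<one>\<^bsub>K\<^esub> = \<zero>\<^bsub>K\<^esub> \<longleftrightarrow> p dvd n)"

definition self_algebra :: "('k, 'm) ring_scheme \<Rightarrow> ('k, 'k) module" where
  "self_algebra K = \<lparr>carrier = carrier K, mult = mult K, one = \<one>\<^bsub>K\<^esub>, zero = \<zero>\<^bsub>K\<^esub>, add = add K,
     smult = mult K\<rparr>"

text \<open>All sets of maps consist of extensional functions, so that equality of maps is equality
  in HOL.\<close>

definition lin_maps ::
  "('k, 'm) ring_scheme \<Rightarrow> ('k, 'a, 'n) module_scheme \<Rightarrow> ('k, 'b, 'o) module_scheme \<Rightarrow> ('a \<Rightarrow> 'b) set"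
  where "lin_maps K M N = {f \<in> carrier M \<rightarrow>\<^sub>E carrier N.
     (\<forall>x\<in>carrier M. \<forall>y\<in>carrier M. f (x \<oplus>\<^bsub>M\<^esub> y) = f x \<oplus>\<^bsub>N\<^esub> f y) \<and>
     (\<forall>c\<in>carrier K. \<forall>x\<in>carrier M. f (c \<odot>\<^bsub>M\<^esub> x) = c \<odot>\<^bsub>N\<^esub> f x)}"

abbreviation dual_space :: "('k, 'm) ring_scheme \<Rightarrow> ('k, 'a, 'n) module_scheme \<Rightarrow> ('a \<Rightarrow> 'k) set" where
  "dual_space K M \<equiv> lin_maps K M (self_algebra K)"

definition basis :: "('k, 'm) ring_scheme \<Rightarrow> ('k, 'a, 'n) module_scheme \<Rightarrow> nat \<Rightarrow> (nat \<Rightarrow> 'a) \<Rightarrow> bool" where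
  "basis K M n h \<longleftrightarrow> h \<in> {..<n} \<rightarrow> carrier M \<and>
     (\<forall>v\<in>carrier M. \<exists>!c. c \<in> {..<n} \<rightarrow>\<^sub>E carrier K \<and> v = (\<Oplus>\<^bsub>M\<^esub>i\<in>{..<n}. c i \<odot>\<^bsub>M\<^esub> h i))"

definition finite_dim :: "('k, 'm) ring_scheme \<Rightarrow> ('k, 'a, 'n) module_scheme \<Rightarrow> bool" where
  "finite_dim K M \<longleftrightarrow> (\<exists>n h. basis K M n h)"

definition dual_bases ::
  "('k, 'm) ring_scheme \<Rightarrow> ('k, 'a, 'n) module_scheme \<Rightarrow> nat \<Rightarrow> (nat \<Rightarrow> 'a) \<Rightarrow> (nat \<Rightarrow> 'a \<Rightarrow> 'k) \<Rightarrow> bool"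
  where "dual_bases K M n h h' \<longleftrightarrow> basis K M n h \<and>
     (\<forall>i<n. h' i \<in> dual_space K M \<and>
       (\<forall>j<n. h' i (h j) = (if i = j then \<one>\<^bsub>K\<^esub> else \<zero>\<^bsub>K\<^esub>)))"

text \<open>The library locale \<open>algebra\<close> is about commutative algebras only.\<close>

locale assoc_algebra = field K + module K A + ring A for K (structure) and A (structure) +
  assumes smult_mult_left:
      "\<lbrakk>c \<in> carrier K; x \<in> carrier A; y \<in> carrier A\<rbrakk> \<Longrightarrow> (c \<odot>\<^bsub>A\<^esub> x) \<otimes>\<^bsub>A\<^esub> y = c \<odot>\<^bsub>A\<^esub> (x \<otimes>\<^bsub>A\<^esub> y)"
    and smult_mult_right:
      "\<lbrakk>c \<in> carrier K; x \<in> carrier A; y \<in> carrier A\<rbrakk> \<Longrightarrow> x \<otimes>\<^bsub>A\<^esub> (c \<odot>\<^bsub>A\<^esub> y) = c \<odot>\<^bsub>A\<^esub> (x \<otimes>\<^bsub>A\<^esub> y)"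

definition alg_homs ::
  "('k, 'm) ring_scheme \<Rightarrow> ('k, 'a, 'n) module_scheme \<Rightarrow> ('k, 'b, 'o) module_scheme \<Rightarrow> ('a \<Rightarrow> 'b) set"
  where "alg_homs K A B = lin_maps K A B \<inter> ring_hom A B"

definition end_algebra :: "('k, 'm) ring_scheme \<Rightarrow> ('k, 'a, 'n) module_scheme \<Rightarrow> ('k, 'a \<Rightarrow> 'a) module" where
  "end_algebra K M = \<lparr>carrier = lin_maps K M M,
     mult = compose (carrier M), one = (\<lambda>x\<in>carrier M. x),
     zero = (\<lambda>x\<in>carrier M. \<zero>\<^bsub>M\<^esub>), add = (\<lambda>f g. \<lambda>x\<in>carrier M. f x \<oplus>\<^bsub>M\<^esub> g x),
     smult = (\<lambda>c f. \<lambda>x\<in>carrier M. c \<odot>\<^bsub>M\<^esub> f x)\<rparr>"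

definition quot_algebra :: "('k, 'a, 'm) module_scheme \<Rightarrow> 'a set \<Rightarrow> ('k, 'a set) module" where
  "quot_algebra A I = \<lparr>carrier = carrier (A Quot I), mult = mult (A Quot I), one = \<one>\<^bsub>A Quot I\<^esub>,
     zero = \<zero>\<^bsub>A Quot I\<^esub>, add = add (A Quot I),
     smult = (\<lambda>c X. \<Union>x\<in>X. I +>\<^bsub>A\<^esub> (c \<odot>\<^bsub>A\<^esub> x))\<rparr>"

definition submodule_span ::
  "('k, 'm) ring_scheme \<Rightarrow> ('k, 'a, 'n) module_scheme \<Rightarrow> 'a set \<Rightarrow> 'a set" where
  "submodule_span K M S = \<Inter>{N. submodule N K M \<and> S \<subseteq> N}"

text \<open>Central simple algebras are understood to be finite dimensional; reduced enveloping
  algebras of finite dimensional \<open>p\<close>-Lie algebras always are.\<close>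

definition central_simple :: "('k, 'm) ring_scheme \<Rightarrow> ('k, 'a, 'n) module_scheme \<Rightarrow> bool" where
  "central_simple K A \<longleftrightarrow> assoc_algebra K A \<and> finite_dim K A \<and>
     {z \<in> carrier A. \<forall>a\<in>carrier A. z \<otimes>\<^bsub>A\<^esub> a = a \<otimes>\<^bsub>A\<^esub> z} = (\<lambda>c. c \<odot>\<^bsub>A\<^esub> \<one>\<^bsub>A\<^esub>) ` carrier K \<and>
     carrier A \<noteq> {\<zero>\<^bsub>A\<^esub>} \<and> (\<forall>I. ideal I A \<longrightarrow> I = {\<zero>\<^bsub>A\<^esub>} \<or> I = carrier A)"


section \<open>Monoid algebras and tensor products\<close>

definition monoid_algebra :: "('k, 'm) ring_scheme \<Rightarrow> ('x, 'n) monoid_scheme \<Rightarrow> ('k, 'x \<Rightarrow> 'k) module" where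
  "monoid_algebra K X = \<lparr>
     carrier = {f \<in> carrier X \<rightarrow>\<^sub>E carrier K. finite {x \<in> carrier X. f x \<noteq> \<zero>\<^bsub>K\<^esub>}},
     mult = (\<lambda>f g. \<lambda>z\<in>carrier X.
       \<Oplus>\<^bsub>K\<^esub>q \<in> {(x, y). x \<in> carrier X \<and> y \<in> carrier X \<and>
                   f x \<noteq> \<zero>\<^bsub>K\<^esub> \<and> g y \<noteq> \<zero>\<^bsub>K\<^esub> \<and> x \<otimes>\<^bsub>X\<^esub> y = z}. f (fst q) \<otimes>\<^bsub>K\<^esub> g (snd q)),
     one = (\<lambda>z\<in>carrier X. if z = \<one>\<^bsub>X\<^esub> then \<one>\<^bsub>K\<^esub> else \<zero>\<^bsub>K\<^esub>),
     zero = (\<lambda>z\<in>carrier X. \<zero>\<^bsub>K\<^esub>),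
     add = (\<lambda>f g. \<lambda>z\<in>carrier X. f z \<oplus>\<^bsub>K\<^esub> g z),
     smult = (\<lambda>c f. \<lambda>z\<in>carrier X. c \<otimes>\<^bsub>K\<^esub> f z)\<rparr>"

definition delta :: "('k, 'm) ring_scheme \<Rightarrow> ('x, 'n) monoid_scheme \<Rightarrow> 'x \<Rightarrow> 'x \<Rightarrow> 'k" where
  "delta K X x = (\<lambda>z\<in>carrier X. if z = x then \<one>\<^bsub>K\<^esub> else \<zero>\<^bsub>K\<^esub>)"

text \<open>The tensor product of two algebras is the free vector space on the set of pairs modulo the
  subspace spanned by the bilinearity relations. The free vector space is the monoid algebra of
  the product of the multiplicative monoids; this gives the multiplication
  \<open>(a \<otimes> b)(a' \<otimes> b') = aa' \<otimes> bb'\<close>.\<close>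

definition bilinear_rels ::
  "('k, 'm) ring_scheme \<Rightarrow> ('k, 'a, 'n) module_scheme \<Rightarrow> ('k, 'b, 'o) module_scheme \<Rightarrow> ('a \<times> 'b \<Rightarrow> 'k) set"
  where "bilinear_rels K A B =
    (let F = monoid_algebra K (A \<times>\<times> B); d = (\<lambda>a b. delta K (A \<times>\<times> B) (a, b)) in
     {d (a \<oplus>\<^bsub>A\<^esub> a') b \<ominus>\<^bsub>F\<^esub> (d a b \<oplus>\<^bsub>F\<^esub> d a' b) | a a' b.
        a \<in> carrier A \<and> a' \<in> carrier A \<and> b \<in> carrier B} \<union>
     {d a (b \<oplus>\<^bsub>B\<^esub> b') \<ominus>\<^bsub>F\<^esub> (d a b \<oplus>\<^bsub>F\<^esub> d a b') | a b b'.
        a \<in> carrier A \<and> b \<in> carrier B \<and> b' \<in> carrier B} \<union>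
     {d (c \<odot>\<^bsub>A\<^esub> a) b \<ominus>\<^bsub>F\<^esub> (c \<odot>\<^bsub>F\<^esub> d a b) | c a b.
        c \<in> carrier K \<and> a \<in> carrier A \<and> b \<in> carrier B} \<union>
     {d a (c \<odot>\<^bsub>B\<^esub> b) \<ominus>\<^bsub>F\<^esub> (c \<odot>\<^bsub>F\<^esub> d a b) | c a b.
        c \<in> carrier K \<and> a \<in> carrier A \<and> b \<in> carrier B})"

definition tensor_null ::
  "('k, 'm) ring_scheme \<Rightarrow> ('k, 'a, 'n) module_scheme \<Rightarrow> ('k, 'b, 'o) module_scheme \<Rightarrow> ('a \<times> 'b \<Rightarrow> 'k) set"
  where "tensor_null K A B = submodule_span K (monoid_algebra K (A \<times>\<times> B)) (bilinear_rels K A B)"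

definition tensor ::
  "('k, 'm) ring_scheme \<Rightarrow> ('k, 'a, 'n) module_scheme \<Rightarrow> ('k, 'b, 'o) module_scheme
    \<Rightarrow> ('k, ('a \<times> 'b \<Rightarrow> 'k) set) module"
  where "tensor K A B = quot_algebra (monoid_algebra K (A \<times>\<times> B)) (tensor_null K A B)"

definition tens ::
  "('k, 'm) ring_scheme \<Rightarrow> ('k, 'a, 'n) module_scheme \<Rightarrow> ('k, 'b, 'o) module_scheme
    \<Rightarrow> 'a \<Rightarrow> 'b \<Rightarrow> ('a \<times> 'b \<Rightarrow> 'k) set"
  where "tens K A B a b =
    tensor_null K A B +>\<^bsub>monoid_algebra K (A \<times>\<times> B)\<^esub> delta K (A \<times>\<times> B) (a, b)"

text \<open>The linear map on \<open>A \<otimes> B\<close> induced by a bilinear map \<open>\<beta>\<close>.\<close>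

definition tensor_lift ::
  "('k, 'm) ring_scheme \<Rightarrow> ('k, 'a, 'n) module_scheme \<Rightarrow> ('k, 'b, 'o) module_scheme
    \<Rightarrow> ('k, 'c, 'q) module_scheme \<Rightarrow> ('a \<Rightarrow> 'b \<Rightarrow> 'c) \<Rightarrow> ('a \<times> 'b \<Rightarrow> 'k) set \<Rightarrow> 'c"
  where "tensor_lift K A B N \<beta> = (THE f. f \<in> lin_maps K (tensor K A B) N \<and>
     (\<forall>a\<in>carrier A. \<forall>b\<in>carrier B. f (tens K A B a b) = \<beta> a b))"

definition tensor_map ::
  "('k, 'm) ring_scheme \<Rightarrow> ('k, 'a, 'n) module_scheme \<Rightarrow> ('k, 'b, 'o) module_scheme
    \<Rightarrow> ('k, 'c, 'q) module_scheme \<Rightarrow> ('k, 'd, 'r) module_scheme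
    \<Rightarrow> ('a \<Rightarrow> 'c) \<Rightarrow> ('b \<Rightarrow> 'd) \<Rightarrow> ('a \<times> 'b \<Rightarrow> 'k) set \<Rightarrow> ('c \<times> 'd \<Rightarrow> 'k) set"
  where "tensor_map K A B C D f g =
    tensor_lift K A B (tensor K C D) (\<lambda>a b. tens K C D (f a) (g b))"

text \<open>The canonical map from \<open>(A \<otimes> B) \<otimes> C\<close> to \<open>A \<otimes> (B \<otimes> C)\<close>.\<close>

definition tensor_assoc ::
  "('k, 'm) ring_scheme \<Rightarrow> ('k, 'a, 'n) module_scheme \<Rightarrow> ('k, 'b, 'o) module_scheme
    \<Rightarrow> ('k, 'c, 'q) module_scheme
    \<Rightarrow> (('a \<times> 'b \<Rightarrow> 'k) set \<times> 'c \<Rightarrow> 'k) set \<Rightarrow> ('a \<times> ('b \<times> 'c \<Rightarrow> 'k) set \<Rightarrow> 'k) set"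
  where "tensor_assoc K A B C =
    tensor_lift K (tensor K A B) C (tensor K A (tensor K B C))
      (\<lambda>t c. tensor_lift K A B (tensor K A (tensor K B C))
        (\<lambda>a b. tens K A (tensor K B C) a (tens K B C b c)) t)"


section \<open>Hopf algebras, module algebras and Galois extensions\<close>

definition hopf_algebra ::
  "('k, 'm) ring_scheme \<Rightarrow> ('k, 'h, 'n) module_scheme
    \<Rightarrow> ('h \<Rightarrow> ('h \<times> 'h \<Rightarrow> 'k) set) \<Rightarrow> ('h \<Rightarrow> 'k) \<Rightarrow> bool"
  where "hopf_algebra K H \<Delta> \<epsilon> \<longleftrightarrow> assoc_algebra K H \<and>
     \<Delta> \<in> alg_homs K H (tensor K H H) \<and> \<epsilon> \<in> alg_homs K H (self_algebra K) \<and>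
     (\<forall>h\<in>carrier H.
        tensor_assoc K H H H (tensor_map K H H (tensor K H H) H \<Delta> (\<lambda>x. x) (\<Delta> h)) =
          tensor_map K H H H (tensor K H H) (\<lambda>x. x) \<Delta> (\<Delta> h) \<and>
        tensor_lift K H H H (\<lambda>x y. \<epsilon> x \<odot>\<^bsub>H\<^esub> y) (\<Delta> h) = h \<and>
        tensor_lift K H H H (\<lambda>x y. \<epsilon> y \<odot>\<^bsub>H\<^esub> x) (\<Delta> h) = h) \<and>
     (\<exists>S\<in>lin_maps K H H. \<forall>h\<in>carrier H.
        tensor_lift K H H H (\<lambda>x y. S x \<otimes>\<^bsub>H\<^esub> y) (\<Delta> h) = \<epsilon> h \<odot>\<^bsub>H\<^esub> \<one>\<^bsub>H\<^esub> \<and>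
        tensor_lift K H H H (\<lambda>x y. x \<otimes>\<^bsub>H\<^esub> S y) (\<Delta> h) = \<epsilon> h \<odot>\<^bsub>H\<^esub> \<one>\<^bsub>H\<^esub>)"

definition module_algebra ::
  "('k, 'm) ring_scheme \<Rightarrow> ('k, 'h, 'n) module_scheme
    \<Rightarrow> ('h \<Rightarrow> ('h \<times> 'h \<Rightarrow> 'k) set) \<Rightarrow> ('h \<Rightarrow> 'k)
    \<Rightarrow> ('k, 'a, 'o) module_scheme \<Rightarrow> ('h \<Rightarrow> 'a \<Rightarrow> 'a) \<Rightarrow> bool"
  where "module_algebra K H \<Delta> \<epsilon> A act \<longleftrightarrow> assoc_algebra K A \<and>
     act \<in> alg_homs K H (end_algebra K A) \<and>
     (\<forall>h\<in>carrier H. act h \<one>\<^bsub>A\<^esub> = \<epsilon> h \<odot>\<^bsub>A\<^esub> \<one>\<^bsub>A\<^esub>) \<and>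
     (\<forall>h\<in>carrier H. \<forall>a\<in>carrier A. \<forall>b\<in>carrier A.
        act h (a \<otimes>\<^bsub>A\<^esub> b) = tensor_lift K H H A (\<lambda>x y. act x a \<otimes>\<^bsub>A\<^esub> act y b) (\<Delta> h))"

definition galois_map ::
  "('k, 'm) ring_scheme \<Rightarrow> ('k, 'h, 'n) module_scheme \<Rightarrow> ('k, 'a, 'o) module_scheme
    \<Rightarrow> ('h \<Rightarrow> 'a \<Rightarrow> 'a) \<Rightarrow> ('a \<times> 'h \<Rightarrow> 'k) set \<Rightarrow> 'a \<Rightarrow> 'a"
  where "galois_map K H A act =
    tensor_lift K A H (end_algebra K A) (\<lambda>a h. \<lambda>b\<in>carrier A. a \<otimes>\<^bsub>A\<^esub> act h b)"

definition dual_galois ::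
  "('k, 'm) ring_scheme \<Rightarrow> ('k, 'h, 'n) module_scheme
    \<Rightarrow> ('h \<Rightarrow> ('h \<times> 'h \<Rightarrow> 'k) set) \<Rightarrow> ('h \<Rightarrow> 'k)
    \<Rightarrow> ('k, 'a, 'o) module_scheme \<Rightarrow> ('h \<Rightarrow> 'a \<Rightarrow> 'a) \<Rightarrow> bool"
  where "dual_galois K H \<Delta> \<epsilon> A act \<longleftrightarrow>
     hopf_algebra K H \<Delta> \<epsilon> \<and> finite_dim K H \<and> module_algebra K H \<Delta> \<epsilon> A act \<and>
     bij_betw (galois_map K H A act) (carrier (tensor K A H)) (carrier (end_algebra K A))"

text \<open>The dual algebra \<open>H*\<close>, with the convolution product.\<close>

definition dual_algebra ::
  "('k, 'm) ring_scheme \<Rightarrow> ('k, 'h, 'n) module_scheme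
    \<Rightarrow> ('h \<Rightarrow> ('h \<times> 'h \<Rightarrow> 'k) set) \<Rightarrow> ('h \<Rightarrow> 'k) \<Rightarrow> ('k, 'h \<Rightarrow> 'k) module"
  where "dual_algebra K H \<Delta> \<epsilon> = \<lparr>carrier = dual_space K H,
     mult = (\<lambda>f g. \<lambda>h\<in>carrier H.
       tensor_lift K H H (self_algebra K) (\<lambda>x y. f x \<otimes>\<^bsub>K\<^esub> g y) (\<Delta> h)),
     one = \<epsilon>, zero = (\<lambda>h\<in>carrier H. \<zero>\<^bsub>K\<^esub>),
     add = (\<lambda>f g. \<lambda>h\<in>carrier H. f h \<oplus>\<^bsub>K\<^esub> g h),
     smult = (\<lambda>c f. \<lambda>h\<in>carrier H. c \<otimes>\<^bsub>K\<^esub> f h)\<rparr>"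

definition right_module ::
  "('k, 'm) ring_scheme \<Rightarrow> ('k, 'd, 'n) module_scheme \<Rightarrow> ('k, 'a, 'o) module_scheme
    \<Rightarrow> ('a \<Rightarrow> 'd \<Rightarrow> 'a) \<Rightarrow> bool"
  where "right_module K D V ract \<longleftrightarrow>
     (\<forall>v\<in>carrier V. \<forall>f\<in>carrier D. ract v f \<in> carrier V) \<and>
     (\<forall>v\<in>carrier V. \<forall>w\<in>carrier V. \<forall>f\<in>carrier D. ract (v \<oplus>\<^bsub>V\<^esub> w) f = ract v f \<oplus>\<^bsub>V\<^esub> ract w f) \<and>
     (\<forall>v\<in>carrier V. \<forall>f\<in>carrier D. \<forall>g\<in>carrier D. ract v (f \<oplus>\<^bsub>D\<^esub> g) = ract v f \<oplus>\<^bsub>V\<^esub> ract v g) \<and>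
     (\<forall>c\<in>carrier K. \<forall>v\<in>carrier V. \<forall>f\<in>carrier D.
        ract (c \<odot>\<^bsub>V\<^esub> v) f = c \<odot>\<^bsub>V\<^esub> ract v f \<and> ract v (c \<odot>\<^bsub>D\<^esub> f) = c \<odot>\<^bsub>V\<^esub> ract v f) \<and>
     (\<forall>v\<in>carrier V. \<forall>f\<in>carrier D. \<forall>g\<in>carrier D. ract (ract v f) g = ract v (f \<otimes>\<^bsub>D\<^esub> g)) \<and>
     (\<forall>v\<in>carrier V. ract v \<one>\<^bsub>D\<^esub> = v)"

definition mu_compatible ::
  "('k, 'm) ring_scheme \<Rightarrow> ('k, 'h, 'n) module_scheme
    \<Rightarrow> ('h \<Rightarrow> ('h \<times> 'h \<Rightarrow> 'k) set) \<Rightarrow> ('h \<Rightarrow> 'k)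
    \<Rightarrow> ('k, 'a, 'o) module_scheme \<Rightarrow> ('h \<Rightarrow> 'a \<Rightarrow> 'a) \<Rightarrow> ('a \<Rightarrow> ('h \<Rightarrow> 'k) \<Rightarrow> 'a) \<Rightarrow> bool"
  where "mu_compatible K H \<Delta> \<epsilon> A act ract \<longleftrightarrow>
     right_module K (dual_algebra K H \<Delta> \<epsilon>) A ract \<and>
     (\<forall>n h h'. dual_bases K H n h h' \<longrightarrow> (\<forall>a\<in>carrier A. \<forall>b\<in>carrier A.
        b \<otimes>\<^bsub>A\<^esub> a = (\<Oplus>\<^bsub>A\<^esub>i\<in>{..<n}. act (h i) a \<otimes>\<^bsub>A\<^esub> ract b (h' i))))"

definition miyashita_ulbrich ::
  "('k, 'm) ring_scheme \<Rightarrow> ('k, 'h, 'n) module_scheme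
    \<Rightarrow> ('h \<Rightarrow> ('h \<times> 'h \<Rightarrow> 'k) set) \<Rightarrow> ('h \<Rightarrow> 'k)
    \<Rightarrow> ('k, 'a, 'o) module_scheme \<Rightarrow> ('h \<Rightarrow> 'a \<Rightarrow> 'a) \<Rightarrow> ('a \<Rightarrow> ('h \<Rightarrow> 'k) \<Rightarrow> 'a) \<Rightarrow> bool"
  where "miyashita_ulbrich K H \<Delta> \<epsilon> A act ract \<longleftrightarrow>
     mu_compatible K H \<Delta> \<epsilon> A act ract \<and>
     (\<forall>ract'. mu_compatible K H \<Delta> \<epsilon> A act ract' \<longrightarrow>
        (\<forall>b\<in>carrier A. \<forall>f\<in>dual_space K H. ract' b f = ract b f))"

definition left_comodule ::
  "('k, 'm) ring_scheme \<Rightarrow> ('k, 'h, 'n) module_scheme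
    \<Rightarrow> ('h \<Rightarrow> ('h \<times> 'h \<Rightarrow> 'k) set) \<Rightarrow> ('h \<Rightarrow> 'k)
    \<Rightarrow> ('k, 'a, 'o) module_scheme \<Rightarrow> ('a \<Rightarrow> ('h \<times> 'a \<Rightarrow> 'k) set) \<Rightarrow> bool"
  where "left_comodule K H \<Delta> \<epsilon> A \<rho> \<longleftrightarrow> \<rho> \<in> lin_maps K A (tensor K H A) \<and>
     (\<forall>b\<in>carrier A.
        tensor_assoc K H H A (tensor_map K H A (tensor K H H) A \<Delta> (\<lambda>x. x) (\<rho> b)) =
          tensor_map K H A H (tensor K H A) (\<lambda>x. x) \<rho> (\<rho> b) \<and>
        tensor_lift K H A A (\<lambda>x y. \<epsilon> x \<odot>\<^bsub>A\<^esub> y) (\<rho> b) = b)"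

definition corresponds ::
  "('k, 'm) ring_scheme \<Rightarrow> ('k, 'h, 'n) module_scheme \<Rightarrow> ('k, 'a, 'o) module_scheme
    \<Rightarrow> ('a \<Rightarrow> ('h \<times> 'a \<Rightarrow> 'k) set) \<Rightarrow> ('a \<Rightarrow> ('h \<Rightarrow> 'k) \<Rightarrow> 'a) \<Rightarrow> bool"
  where "corresponds K H A \<rho> ract \<longleftrightarrow>
     (\<forall>n h h'. dual_bases K H n h h' \<longrightarrow> (\<forall>b\<in>carrier A.
        \<rho> b = (\<Oplus>\<^bsub>tensor K H A\<^esub>i\<in>{..<n}. tens K H A (h i) (ract b (h' i)))))"


section \<open>Restricted Lie algebras and their reduced enveloping algebras\<close>

text \<open>The inherited fields \<open>mult\<close> and \<open>one\<close> play no role: as everywhere in the library,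
  the record of modules extends that of rings.\<close>

record ('k, 'g) p_lie = "('k, 'g) module" +
  lie_bracket :: "'g \<Rightarrow> 'g \<Rightarrow> 'g"
  p_power :: "'g \<Rightarrow> 'g"

text \<open>\<open>jacobson_coeff L x y n j\<close> is the coefficient of \<open>t^j\<close> in \<open>(ad (t x + y))^n (x)\<close>.\<close>

fun jacobson_coeff :: "('k, 'g, 'm) p_lie_scheme \<Rightarrow> 'g \<Rightarrow> 'g \<Rightarrow> nat \<Rightarrow> nat \<Rightarrow> 'g" where
  "jacobson_coeff L x y 0 0 = x"
| "jacobson_coeff L x y 0 (Suc j) = \<zero>\<^bsub>L\<^esub>"
| "jacobson_coeff L x y (Suc n) 0 = lie_bracket L y (jacobson_coeff L x y n 0)"
| "jacobson_coeff L x y (Suc n) (Suc j) =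
     lie_bracket L x (jacobson_coeff L x y n j) \<oplus>\<^bsub>L\<^esub> lie_bracket L y (jacobson_coeff L x y n (Suc j))"

text \<open>\<open>i s\<^sub>i(x,y)\<close> is the coefficient of \<open>t^(i-1)\<close> in \<open>(ad (t x + y))^(p-1) (x)\<close>.\<close>

definition jacobson_s ::
  "('k, 'm) ring_scheme \<Rightarrow> nat \<Rightarrow> ('k, 'g, 'n) p_lie_scheme \<Rightarrow> nat \<Rightarrow> 'g \<Rightarrow> 'g \<Rightarrow> 'g" where
  "jacobson_s K p L i x y = inv\<^bsub>K\<^esub> ([i] \<cdot>\<^bsub>K\<^esub> \<one>\<^bsub>K\<^esub>) \<odot>\<^bsub>L\<^esub> jacobson_coeff L x y (p - 1) (i - 1)"

locale lie_algebra = field K + module K L for K (structure) and L (structure) +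
  assumes bracket_closed:
      "\<lbrakk>x \<in> carrier L; y \<in> carrier L\<rbrakk> \<Longrightarrow> lie_bracket L x y \<in> carrier L"
    and bracket_add_left:
      "\<lbrakk>x \<in> carrier L; y \<in> carrier L; z \<in> carrier L\<rbrakk> \<Longrightarrow>
        lie_bracket L (x \<oplus>\<^bsub>L\<^esub> y) z = lie_bracket L x z \<oplus>\<^bsub>L\<^esub> lie_bracket L y z"
    and bracket_add_right:
      "\<lbrakk>x \<in> carrier L; y \<in> carrier L; z \<in> carrier L\<rbrakk> \<Longrightarrow>
        lie_bracket L x (y \<oplus>\<^bsub>L\<^esub> z) = lie_bracket L x y \<oplus>\<^bsub>L\<^esub> lie_bracket L x z"
    and bracket_smult_left:
      "\<lbrakk>c \<in> carrier K; x \<in> carrier L; y \<in> carrier L\<rbrakk> \<Longrightarrow>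
        lie_bracket L (c \<odot>\<^bsub>L\<^esub> x) y = c \<odot>\<^bsub>L\<^esub> lie_bracket L x y"
    and bracket_smult_right:
      "\<lbrakk>c \<in> carrier K; x \<in> carrier L; y \<in> carrier L\<rbrakk> \<Longrightarrow>
        lie_bracket L x (c \<odot>\<^bsub>L\<^esub> y) = c \<odot>\<^bsub>L\<^esub> lie_bracket L x y"
    and bracket_self: "x \<in> carrier L \<Longrightarrow> lie_bracket L x x = \<zero>\<^bsub>L\<^esub>"
    and jacobi:
      "\<lbrakk>x \<in> carrier L; y \<in> carrier L; z \<in> carrier L\<rbrakk> \<Longrightarrow>
        lie_bracket L x (lie_bracket L y z) \<oplus>\<^bsub>L\<^esub> lie_bracket L y (lie_bracket L z x) \<oplus>\<^bsub>L\<^esub>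
          lie_bracket L z (lie_bracket L x y) = \<zero>\<^bsub>L\<^esub>"

locale p_lie_algebra = lie_algebra K L for K (structure) and L (structure) and p :: nat +
  assumes p_pos: "0 < p"
    and char_p: "has_char K p"
    and p_power_closed: "x \<in> carrier L \<Longrightarrow> p_power L x \<in> carrier L"
    and ad_p_power:
      "\<lbrakk>x \<in> carrier L; z \<in> carrier L\<rbrakk> \<Longrightarrow>
        lie_bracket L (p_power L x) z = (lie_bracket L x ^^ p) z"
    and p_power_smult:
      "\<lbrakk>c \<in> carrier K; x \<in> carrier L\<rbrakk> \<Longrightarrow>
        p_power L (c \<odot>\<^bsub>L\<^esub> x) = (c [^]\<^bsub>K\<^esub> p) \<odot>\<^bsub>L\<^esub> p_power L x"
    and p_power_add:
      "\<lbrakk>x \<in> carrier L; y \<in> carrier L\<rbrakk> \<Longrightarrow>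
        p_power L (x \<oplus>\<^bsub>L\<^esub> y) =
          p_power L x \<oplus>\<^bsub>L\<^esub> p_power L y \<oplus>\<^bsub>L\<^esub> (\<Oplus>\<^bsub>L\<^esub>i\<in>{1..<p}. jacobson_s K p L i x y)"

definition free_monoid :: "'x set \<Rightarrow> 'x list monoid" where
  "free_monoid X = \<lparr>carrier = lists X, mult = (@), one = []\<rparr>"

abbreviation free_algebra :: "('k, 'm) ring_scheme \<Rightarrow> 'x set \<Rightarrow> ('k, 'x list \<Rightarrow> 'k) module" where
  "free_algebra K X \<equiv> monoid_algebra K (free_monoid X)"

text \<open>The first two families of relations cut the free algebra on the set \<open>L\<close> down to the
  tensor algebra of the vector space \<open>L\<close>.\<close>

definition env_rels :: "('k, 'm) ring_scheme \<Rightarrow> ('k, 'g, 'n) p_lie_scheme \<Rightarrow> ('g list \<Rightarrow> 'k) set" where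
  "env_rels K L =
    (let F = free_algebra K (carrier L); e = (\<lambda>x. delta K (free_monoid (carrier L)) [x]) in
     {e (x \<oplus>\<^bsub>L\<^esub> y) \<ominus>\<^bsub>F\<^esub> (e x \<oplus>\<^bsub>F\<^esub> e y) | x y. x \<in> carrier L \<and> y \<in> carrier L} \<union>
     {e (c \<odot>\<^bsub>L\<^esub> x) \<ominus>\<^bsub>F\<^esub> (c \<odot>\<^bsub>F\<^esub> e x) | c x. c \<in> carrier K \<and> x \<in> carrier L} \<union>
     {(e x \<otimes>\<^bsub>F\<^esub> e y) \<ominus>\<^bsub>F\<^esub> (e y \<otimes>\<^bsub>F\<^esub> e x) \<ominus>\<^bsub>F\<^esub> e (lie_bracket L x y) | x y.
        x \<in> carrier L \<and> y \<in> carrier L})"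

definition env_ideal :: "('k, 'm) ring_scheme \<Rightarrow> ('k, 'g, 'n) p_lie_scheme \<Rightarrow> ('g list \<Rightarrow> 'k) set" where
  "env_ideal K L = Idl\<^bsub>free_algebra K (carrier L)\<^esub> (env_rels K L)"

definition env_algebra ::
  "('k, 'm) ring_scheme \<Rightarrow> ('k, 'g, 'n) p_lie_scheme \<Rightarrow> ('k, ('g list \<Rightarrow> 'k) set) module" where
  "env_algebra K L = quot_algebra (free_algebra K (carrier L)) (env_ideal K L)"

definition env_incl ::
  "('k, 'm) ring_scheme \<Rightarrow> ('k, 'g, 'n) p_lie_scheme \<Rightarrow> 'g \<Rightarrow> ('g list \<Rightarrow> 'k) set" where
  "env_incl K L x =
    env_ideal K L +>\<^bsub>free_algebra K (carrier L)\<^esub> delta K (free_monoid (carrier L)) [x]"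

definition red_ideal ::
  "('k, 'm) ring_scheme \<Rightarrow> nat \<Rightarrow> ('k, 'g, 'n) p_lie_scheme \<Rightarrow> ('g \<Rightarrow> 'k) \<Rightarrow> ('g list \<Rightarrow> 'k) set set" where
  "red_ideal K p L \<xi> = (let U = env_algebra K L; \<iota> = env_incl K L in
     Idl\<^bsub>U\<^esub> {\<iota> x [^]\<^bsub>U\<^esub> p \<ominus>\<^bsub>U\<^esub> \<iota> (p_power L x) \<ominus>\<^bsub>U\<^esub> ((\<xi> x [^]\<^bsub>K\<^esub> p) \<odot>\<^bsub>U\<^esub> \<one>\<^bsub>U\<^esub>) | x. x \<in> carrier L})"

type_synonym ('k, 'g) red_env = "('g list \<Rightarrow> 'k) set set"

definition red_env_algebra ::
  "('k, 'm) ring_scheme \<Rightarrow> nat \<Rightarrow> ('k, 'g, 'n) p_lie_scheme \<Rightarrow> ('g \<Rightarrow> 'k) \<Rightarrow> ('k, ('k, 'g) red_env) module"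
  where "red_env_algebra K p L \<xi> = quot_algebra (env_algebra K L) (red_ideal K p L \<xi>)"

definition red_env_incl ::
  "('k, 'm) ring_scheme \<Rightarrow> nat \<Rightarrow> ('k, 'g, 'n) p_lie_scheme \<Rightarrow> ('g \<Rightarrow> 'k) \<Rightarrow> 'g \<Rightarrow> ('k, 'g) red_env"
  where "red_env_incl K p L \<xi> x = red_ideal K p L \<xi> +>\<^bsub>env_algebra K L\<^esub> env_incl K L x"

text \<open>The algebra homomorphism from \<open>U\<^sub>\<xi>(L)\<close> to \<open>B\<close> with prescribed values on \<open>L\<close>.\<close>

definition red_env_lift ::
  "('k, 'm) ring_scheme \<Rightarrow> nat \<Rightarrow> ('k, 'g, 'n) p_lie_scheme \<Rightarrow> ('g \<Rightarrow> 'k)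
    \<Rightarrow> ('k, 'b, 'o) module_scheme \<Rightarrow> ('g \<Rightarrow> 'b) \<Rightarrow> ('k, 'g) red_env \<Rightarrow> 'b"
  where "red_env_lift K p L \<xi> B \<phi> = (THE f. f \<in> alg_homs K (red_env_algebra K p L \<xi>) B \<and>
     (\<forall>x\<in>carrier L. f (red_env_incl K p L \<xi> x) = \<phi> x))"

text \<open>The restricted enveloping algebra \<open>U\<^sub>0(L)\<close> with its Hopf algebra structure.\<close>

abbreviation zero_form :: "('k, 'm) ring_scheme \<Rightarrow> ('k, 'g, 'n) p_lie_scheme \<Rightarrow> 'g \<Rightarrow> 'k" where
  "zero_form K L \<equiv> (\<lambda>x\<in>carrier L. \<zero>\<^bsub>K\<^esub>)"

abbreviation restr_env_algebra ::
  "('k, 'm) ring_scheme \<Rightarrow> nat \<Rightarrow> ('k, 'g, 'n) p_lie_scheme \<Rightarrow> ('k, ('k, 'g) red_env) module" where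
  "restr_env_algebra K p L \<equiv> red_env_algebra K p L (zero_form K L)"

abbreviation restr_env_incl ::
  "('k, 'm) ring_scheme \<Rightarrow> nat \<Rightarrow> ('k, 'g, 'n) p_lie_scheme \<Rightarrow> 'g \<Rightarrow> ('k, 'g) red_env" where
  "restr_env_incl K p L \<equiv> red_env_incl K p L (zero_form K L)"

definition restr_comult ::
  "('k, 'm) ring_scheme \<Rightarrow> nat \<Rightarrow> ('k, 'g, 'n) p_lie_scheme
    \<Rightarrow> ('k, 'g) red_env \<Rightarrow> (('k, 'g) red_env \<times> ('k, 'g) red_env \<Rightarrow> 'k) set"
  where "restr_comult K p L = (let H = restr_env_algebra K p L; \<iota> = restr_env_incl K p L in
     red_env_lift K p L (zero_form K L) (tensor K H H)
       (\<lambda>x. tens K H H (\<iota> x) \<one>\<^bsub>H\<^esub> \<oplus>\<^bsub>tensor K H H\<^esub> tens K H H \<one>\<^bsub>H\<^esub> (\<iota> x)))"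

definition restr_counit ::
  "('k, 'm) ring_scheme \<Rightarrow> nat \<Rightarrow> ('k, 'g, 'n) p_lie_scheme \<Rightarrow> ('k, 'g) red_env \<Rightarrow> 'k"
  where "restr_counit K p L =
    red_env_lift K p L (zero_form K L) (self_algebra K) (\<lambda>x. \<zero>\<^bsub>K\<^esub>)"

definition adjoint_action ::
  "('k, 'm) ring_scheme \<Rightarrow> nat \<Rightarrow> ('k, 'g, 'n) p_lie_scheme \<Rightarrow> ('g \<Rightarrow> 'k)
    \<Rightarrow> ('k, 'g) red_env \<Rightarrow> ('k, 'g) red_env \<Rightarrow> ('k, 'g) red_env"
  where "adjoint_action K p L \<xi> = (let A = red_env_algebra K p L \<xi>; \<iota> = red_env_incl K p L \<xi> in
     red_env_lift K p L (zero_form K L) (end_algebra K A)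
       (\<lambda>x. \<lambda>u\<in>carrier A. (\<iota> x \<otimes>\<^bsub>A\<^esub> u) \<ominus>\<^bsub>A\<^esub> (u \<otimes>\<^bsub>A\<^esub> \<iota> x)))"

definition lie_galois ::
  "('k, 'm) ring_scheme \<Rightarrow> nat \<Rightarrow> ('k, 'g, 'n) p_lie_scheme \<Rightarrow> ('g \<Rightarrow> 'k) \<Rightarrow> bool"
  where "lie_galois K p L \<xi> \<longleftrightarrow>
     dual_galois K (restr_env_algebra K p L) (restr_comult K p L) (restr_counit K p L)
       (red_env_algebra K p L \<xi>) (adjoint_action K p L \<xi>)"

definition coaction ::
  "('k, 'm) ring_scheme \<Rightarrow> nat \<Rightarrow> ('k, 'g, 'n) p_lie_scheme \<Rightarrow> ('g \<Rightarrow> 'k)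
    \<Rightarrow> ('k, 'g) red_env \<Rightarrow> (('k, 'g) red_env \<times> ('k, 'g) red_env \<Rightarrow> 'k) set"
  where "coaction K p L \<xi> =
    (let H = restr_env_algebra K p L; A = red_env_algebra K p L \<xi> in
     red_env_lift K p L \<xi> (tensor K H A)
       (\<lambda>x. tens K H A \<one>\<^bsub>H\<^esub> (red_env_incl K p L \<xi> x) \<oplus>\<^bsub>tensor K H A\<^esub>
            tens K H A (restr_env_incl K p L x) \<one>\<^bsub>A\<^esub>))"

end

theory Submission
 imports Defs "HOL-Library.Multiset"
begin

text \<open>Write \<open>A\<close> for \<open>U\<^sub>\<xi>(L)\<close> and \<open>H\<close> for \<open>U\<^sub>0(L)\<close>. For an associative algebra \<open>A\<close> the maps \<open>u \<mapsto> a u b\<close> form an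
  algebra homomorphism \<open>two_sided_mult\<close> from \<open>A \<otimes> A\<^sup>o\<^sup>p\<close> to \<open>End A\<close>, and a nonzero finite dimensional \<open>A\<close> is
  central simple exactly when this homomorphism is bijective (\<open>central_simple_iff_bij\<close>): one direction is the
  density theorem for the simple \<open>A \<otimes> A\<^sup>o\<^sup>p\<close>-module \<open>A\<close>, whose endomorphisms are the scalars; the other one tests
  central elements and ideals against endomorphisms of rank one.

  Since \<open>x \<in> L\<close> acts on \<open>A\<close> by a left minus a right multiplication, the Galois map \<open>a \<otimes> h \<mapsto> (b \<mapsto> a (h \<cdot> b))\<close> is
  composed of \<open>two_sided_mult\<close> and the map \<open>a \<otimes> h \<mapsto> (a \<otimes> 1) \<psi>(h)\<close>, where \<open>\<psi>\<close> from \<open>H\<close> to \<open>A \<otimes> A\<^sup>o\<^sup>p\<close> is the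
  homomorphism with \<open>\<psi>(x) = x \<otimes> 1 - 1 \<otimes> x\<close>. It exists because the \<open>p\<close>-characters of the two summands cancel.
  That map is always bijective: it is inverted by \<open>a \<otimes> b \<mapsto> (a \<otimes> 1) \<nu>(b)\<close>, where \<open>\<nu>\<close> from \<open>A\<close> to \<open>A \<otimes> H\<^sup>o\<^sup>p\<close> is the
  homomorphism with \<open>\<nu>(x) = x \<otimes> 1 - 1 \<otimes> x\<close> (\<open>twisted_mult_bij\<close>). Hence the Galois map is bijective if and only if
  \<open>two_sided_mult\<close> is, and the criterion follows.

  This uses that \<open>A\<close> and \<open>H\<close> have finite dimension (\<open>finite_dim_Uxi\<close>) and that \<open>A\<close> is not zero (\<open>red_env_nonzero\<close>).
  A monomial in a basis of \<open>L\<close> may be reordered at the cost of shorter monomials, and in a long monomial some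
  basis element occurs \<open>p\<close> times, so that its \<open>p\<close>-th power can be replaced; this gives the first fact. The second
  one is the part of the theorem of Poincare, Birkhoff and Witt that says \<open>1 \<noteq> 0\<close>. It is proved by constructing, by
  recursion on the length of words, a linear form on the tensor algebra that is \<open>1\<close> at the empty word and respects
  the commutation relations and the \<open>p\<close>-th power relations of the basis elements (\<open>straightened_form\<close>). The linear
  forms with this property are a nonzero representation of \<open>L\<close>, and Jacobson's formula extends the \<open>p\<close>-th power
  relation from a basis to all of \<open>L\<close>.

  The comodule structure \<open>b \<mapsto> \<Sum> b\<^sub>-\<^sub>1 \<otimes> b\<^sub>0\<close> defines the right action \<open>dual_action\<close> of \<open>H\<^sup>*\<close> by \<open>b f = \<Sum> f(b\<^sub>-\<^sub>1) b\<^sub>0\<close>. The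
  identity \<open>b a = \<Sum> (b\<^sub>-\<^sub>1 \<cdot> a) b\<^sub>0\<close> (\<open>adjoint_coact\<close>) is the identity of Miyashita and Ulbrich. If a second action
  satisfies it, the elements \<open>\<Sum> b h\<^sub>i\<^sup>* \<otimes> h\<^sub>i\<close> formed with the two actions have the same image under
  \<open>d \<otimes> h \<mapsto> (a \<mapsto> (h \<cdot> a) d)\<close>. This is the Galois map of the opposite algebra \<open>A\<^sup>o\<^sup>p\<close>, which is central simple together with
  \<open>A\<close>; so it is injective and the actions agree (\<open>dual_action_unique\<close>).\<close>

text \<open>The ring and module operations with the structure in brackets instead of a subscript.\<close>

abbreviation add_in ("(_ +[_]/ _)" [65, 0, 66] 65) where "x +[R] y == x \<oplus>\<^bsub>R\<^esub> y"
abbreviation diff_in ("(_ -[_]/ _)" [65, 0, 66] 65) where "x -[R] y == x \<ominus>\<^bsub>R\<^esub> y"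
abbreviation mult_in ("(_ *[_]/ _)" [70, 0, 71] 70) where "x *[R] y == x \<otimes>\<^bsub>R\<^esub> y"
abbreviation smult_in ("(_ \<odot>[_]/ _)" [70, 0, 71] 70) where "c \<odot>[M] x == c \<odot>\<^bsub>M\<^esub> x"
abbreviation neg_in ("(-[_]/ _)" [0, 81] 80) where "-[R] x == \<ominus>\<^bsub>R\<^esub> x"
abbreviation pow_in ("(_ ^[_]/ _)" [75, 0, 75] 75) where "x ^[R] n == x [^]\<^bsub>R\<^esub> n"
abbreviation mem_in ("(_ \<in>[_])" [51, 0] 50) where "x \<in>[R] == x \<in> carrier R"
abbreviation zero_in ("\<zero>[_]") where "\<zero>[R] == \<zero>\<^bsub>R\<^esub>"
abbreviation one_in ("\<one>[_]") where "\<one>[R] == \<one>\<^bsub>R\<^esub>"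

section \<open>Linear maps and spanning sets\<close>

lemma algD:
 assumes "assoc_algebra K A"
 shows "field K" "module K A" "ring A"
 using assms by (simp_all add: assoc_algebra_def)

lemma alg_smult:
 assumes "assoc_algebra K A" "c \<in>[K]" "x \<in>[A]" "y \<in>[A]"
 shows "(c \<odot>[A] x) *[A] y = c \<odot>[A] (x *[A] y)"
  and "x *[A] (c \<odot>[A] y) = c \<odot>[A] (x *[A] y)"
 using assms by (simp_all add: assoc_algebra_def assoc_algebra_axioms_def)

lemma assoc_algebraI:
 assumes "field K" "module K A" "ring A"
  and "!!c x y. [|c \<in>[K]; x \<in>[A]; y \<in>[A]|] ==> (c \<odot>[A] x) *[A] y = c \<odot>[A] (x *[A] y)"
  and "!!c x y. [|c \<in>[K]; x \<in>[A]; y \<in>[A]|] ==> x *[A] (c \<odot>[A] y) = c \<odot>[A] (x *[A] y)"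
 shows "assoc_algebra K A"
 using assms by (simp add: assoc_algebra_def assoc_algebra_axioms_def)

lemma (in abelian_group) minus_zero_iff:
 "[|x \<in>[G]; y \<in>[G]|] ==> x \<ominus> y = \<zero> \<longleftrightarrow> x = y"
proof -
 assume c: "x \<in>[G]" "y \<in>[G]"
 show ?thesis
 proof
  assume "x \<ominus> y = \<zero>"
  then have "\<ominus> (\<ominus> y) = x" using c by (intro minus_equality) (simp_all add: a_minus_def)
  then show "x = y" using c by simp
 qed (use c in \<open>simp add: a_minus_def r_neg\<close>)
qed

lemma lin_mapsI:
 assumes "!!x. x \<in>[M] ==> f x \<in>[N]"
  and "!!x. x \<notin> carrier M ==> f x = undefined"
  and "!!x y. [|x \<in>[M]; y \<in>[M]|] ==> f (x +[M] y) = f x +[N] f y"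
  and "!!c x. [|c \<in>[K]; x \<in>[M]|] ==> f (c \<odot>[M] x) = c \<odot>[N] f x"
 shows "f \<in> lin_maps K M N"
 using assms by (auto simp: lin_maps_def)

lemma lin_closed: "[|f \<in> lin_maps K M N; x \<in>[M]|] ==> f x \<in>[N]"
 by (auto simp: lin_maps_def)

lemma lin_add: "[|f \<in> lin_maps K M N; x \<in>[M]; y \<in>[M]|] ==> f (x +[M] y) = f x +[N] f y"
 by (auto simp: lin_maps_def)

lemma lin_smult: "[|f \<in> lin_maps K M N; c \<in>[K]; x \<in>[M]|] ==> f (c \<odot>[M] x) = c \<odot>[N] f x"
 by (auto simp: lin_maps_def)

lemma lin_undefined: "[|f \<in> lin_maps K M N; x \<notin> carrier M|] ==> f x = undefined"
 by (auto simp: lin_maps_def)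

lemma lin_ext:
 assumes "f \<in> lin_maps K M N" "g \<in> lin_maps K M N'" "!!x. x \<in>[M] ==> f x = g x"
 shows "f = g"
 using assms by (intro ext) (metis lin_undefined)

lemma lin_restrictI:
 assumes "module K M"
  and "!!x. x \<in>[M] ==> f x \<in>[N]"
  and "!!x y. [|x \<in>[M]; y \<in>[M]|] ==> f (x +[M] y) = f x +[N] f y"
  and "!!c x. [|c \<in>[K]; x \<in>[M]|] ==> f (c \<odot>[M] x) = c \<odot>[N] f x"
 shows "(\<lambda>x\<in>carrier M. f x) \<in> lin_maps K M N"
proof -
 interpret M: module K M by fact
 show ?thesis using assms(2-) by (intro lin_mapsI) (auto simp: M.M.a_closed)
qed

lemma lin_zero:
 assumes "module K M" "module K N" "f \<in> lin_maps K M N"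
 shows "f \<zero>[M] = \<zero>[N]"
proof -
 interpret M: module K M by fact
 interpret N: module K N by fact
 have "f (\<zero>[K] \<odot>[M] \<zero>[M]) = \<zero>[K] \<odot>[N] f \<zero>[M]"
  by (rule lin_smult[OF assms(3)]) auto
 then show ?thesis using lin_closed[OF assms(3), of "\<zero>[M]"] by simp
qed

lemma lin_neg:
 assumes "module K M" "module K N" "f \<in> lin_maps K M N" "x \<in>[M]"
 shows "f (-[M] x) = -[N] f x"
proof -
 interpret M: module K M by fact
 interpret N: module K N by fact
 have "f (-[M] x) +[N] f x = f (-[M] x +[M] x)"
  using assms by (simp add: lin_add)
 also have "... = \<zero>[N]" using assms by (simp add: M.M.l_neg lin_zero)
 finally show ?thesis
  using assms lin_closed[OF assms(3)] by (metis N.M.minus_equality M.M.a_inv_closed)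
qed

lemma lin_diff:
 assumes "module K M" "module K N" "f \<in> lin_maps K M N" "x \<in>[M]" "y \<in>[M]"
 shows "f (x -[M] y) = f x -[N] f y"
proof -
 interpret M: module K M by fact
 show ?thesis using assms by (simp add: a_minus_def lin_add lin_neg)
qed

lemma lin_finsum:
 assumes "module K M" "module K N" "f \<in> lin_maps K M N" "finite I" "g \<in> I \<rightarrow> carrier M"
 shows "f (\<Oplus>\<^bsub>M\<^esub>i\<in>I. g i) = (\<Oplus>\<^bsub>N\<^esub>i\<in>I. f (g i))"
proof -
 interpret M: module K M by fact
 interpret N: module K N by fact
 show ?thesis using assms(4,5)
 proof (induction I rule: finite_induct)
  case empty then show ?case using assms by (simp add: lin_zero)
 next
  case (insert x F)
  then have g: "g \<in> F \<rightarrow> carrier M" "g x \<in>[M]" by auto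
  then have "(\<lambda>i. f (g i)) \<in> F \<rightarrow> carrier N" "f (g x) \<in>[N]"
   using lin_closed[OF assms(3)] by auto
  then show ?case using insert g assms(3) by (simp add: lin_add)
 qed
qed

lemma lin_compose:
 assumes "module K M" "f \<in> lin_maps K M N" "g \<in> lin_maps K N P"
 shows "(\<lambda>x\<in>carrier M. g (f x)) \<in> lin_maps K M P"
 using assms by (intro lin_restrictI) (simp_all add: lin_closed lin_add lin_smult)

lemma submoduleD:
 assumes "submodule N K M"
 shows "\<zero>[M] \<in> N" "!!a b. [|a \<in> N; b \<in> N|] ==> a +[M] b \<in> N" "N <= carrier M"
  "!!c a. [|c \<in>[K]; a \<in> N|] ==> c \<odot>[M] a \<in> N"
proof -
 interpret submodule N K M by fact
 show "\<zero>[M] \<in> N" using one_closed by simp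
 show "!!a b. [|a \<in> N; b \<in> N|] ==> a +[M] b \<in> N" using m_closed by simp
 show "N <= carrier M" using subset by simp
 show "!!c a. [|c \<in>[K]; a \<in> N|] ==> c \<odot>[M] a \<in> N" by simp
qed

lemma submoduleI':
 assumes "module K M" "H <= carrier M" "\<zero>[M] \<in> H"
  and "!!a b. [|a \<in> H; b \<in> H|] ==> a +[M] b \<in> H"
  and "!!c x. [|c \<in>[K]; x \<in> H|] ==> c \<odot>[M] x \<in> H"
 shows "submodule H K M"
proof -
 interpret M: module K M by fact
 have "-[M] a \<in> H" if "a \<in> H" for a
 proof -
  have "a \<in>[M]" using that assms by auto
  then have "-[M] a = (-[K] \<one>[K]) \<odot>[M] a" by (simp add: M.smult_l_minus)
  then show ?thesis using assms(5) that by simp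
 qed
 then show ?thesis using assms by (intro M.submoduleI) auto
qed

lemma submodule_diff:
 assumes "module K M" "submodule N K M" "a \<in> N" "b \<in> N"
 shows "a -[M] b \<in> N"
 using module.submoduleE(3,5)[OF assms(1,2)] assms(3,4) by (simp add: a_minus_def)

lemma submodule_finsum:
 assumes "module K M" "submodule N K M" "finite I" "g \<in> I \<rightarrow> N"
 shows "(\<Oplus>\<^bsub>M\<^esub>i\<in>I. g i) \<in> N"
proof -
 interpret M: module K M by fact
 note N = submoduleD[OF assms(2)]
 show ?thesis using assms(3,4)
 proof (induction I rule: finite_induct)
  case (insert x F)
  then have "g \<in> F \<rightarrow> carrier M" "g x \<in>[M]" using N(3) by auto
  then show ?case using insert N by (auto simp: Pi_iff)
 qed (simp add: N)
qed

lemma submodule_equalizer: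
 assumes "module K M" "module K N" "f \<in> lin_maps K M N" "g \<in> lin_maps K M N"
 shows "submodule {x \<in> carrier M. f x = g x} K M"
proof -
 interpret M: module K M by fact
 show ?thesis using assms
  by (intro submoduleI') (auto simp: lin_zero[OF assms(1,2)] lin_add lin_smult)
qed

lemma submodule_preimage:
 assumes "module K M" "module K N" "f \<in> lin_maps K M N" "submodule P K N"
 shows "submodule {x \<in> carrier M. f x \<in> P} K M"
proof -
 interpret M: module K M by fact
 show ?thesis using assms submoduleD[OF assms(4)]
  by (intro submoduleI') (auto simp: lin_zero[OF assms(1,2)] lin_add lin_smult)
qed

definition spanning :: "('k, 'm) ring_scheme => ('k, 'a, 'n) module_scheme => 'a set => bool" where
 "spanning K M S \<longleftrightarrow> S <= carrier M \<and> (\<forall>N. submodule N K M --> S <= N --> carrier M <= N)"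

lemma spanning_induct [consumes 3, case_names gen zero add smult]:
 assumes "module K M" "spanning K M S" "x \<in>[M]"
  and gen: "!!s. s \<in> S ==> P s" and zero: "P \<zero>[M]"
  and add: "!!a b. [|a \<in>[M]; b \<in>[M]; P a; P b|] ==> P (a +[M] b)"
  and smult: "!!c a. [|c \<in>[K]; a \<in>[M]; P a|] ==> P (c \<odot>[M] a)"
 shows "P x"
proof -
 interpret M: module K M by fact
 have "submodule {x \<in> carrier M. P x} K M"
  using zero add smult by (intro submoduleI'[OF assms(1)]) auto
 moreover have "S <= {x \<in> carrier M. P x}" using assms(2) gen by (auto simp: spanning_def)
 ultimately show ?thesis using assms(2,3) unfolding spanning_def by blast
qed

lemma lin_eq_on_spanning:
 assumes "module K M" "module K N" "spanning K M S" "f \<in> lin_maps K M N" "g \<in> lin_maps K M N"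
  and "!!s. s \<in> S ==> f s = g s"
 shows "f = g"
proof (rule lin_ext[OF assms(4,5)])
 fix x assume "x \<in>[M]"
 with assms(1,3) show "f x = g x"
  by (induction rule: spanning_induct)
   (simp_all add: assms(6) lin_zero[OF assms(1,2)] lin_add[OF assms(4)] lin_add[OF assms(5)] lin_smult[OF assms(4)] lin_smult[OF assms(5)] assms(4,5))
qed

section \<open>Finite bases\<close>

lemma submodule_combinations:
 assumes "module K M" "finite S" "h \<in> S \<rightarrow> carrier M"
 shows "submodule {\<Oplus>\<^bsub>M\<^esub>s\<in>S. c s \<odot>[M] h s | c. c \<in> S \<rightarrow> carrier K} K M" (is "submodule ?N K M")
proof -
 interpret M: module K M by fact
 have cl: "(\<lambda>s. c s \<odot>[M] h s) \<in> S \<rightarrow> carrier M" if "c \<in> S \<rightarrow> carrier K" for c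
  using that assms(3) by auto
 show ?thesis
 proof (rule submoduleI'[OF assms(1)])
  show "?N <= carrier M" using cl by (auto intro!: M.M.finsum_closed)
  have "\<zero>[M] = (\<Oplus>\<^bsub>M\<^esub>s\<in>S. (\<lambda>_. \<zero>[K]) s \<odot>[M] h s)"
   using assms(3) by (subst M.M.add.finprod_one_eqI) (auto simp: Pi_iff)
  then show "\<zero>[M] \<in> ?N" by fast
 next
  fix a b assume "a \<in> ?N" "b \<in> ?N"
  then obtain c d where c: "c \<in> S \<rightarrow> carrier K" "d \<in> S \<rightarrow> carrier K"
   "a = (\<Oplus>\<^bsub>M\<^esub>s\<in>S. c s \<odot>[M] h s)" "b = (\<Oplus>\<^bsub>M\<^esub>s\<in>S. d s \<odot>[M] h s)" by auto
  have "a +[M] b = (\<Oplus>\<^bsub>M\<^esub>s\<in>S. c s \<odot>[M] h s +[M] d s \<odot>[M] h s)"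
   using cl c by (simp add: M.M.finsum_addf)
  also have "... = (\<Oplus>\<^bsub>M\<^esub>s\<in>S. (\<lambda>s. c s +[K] d s) s \<odot>[M] h s)"
   using c(1,2) assms(3) by (intro M.M.finsum_cong') (auto simp: M.smult_l_distr Pi_iff)
  finally show "a +[M] b \<in> ?N"
   by (auto intro!: exI[of _ "\<lambda>s. c s +[K] d s"] M.R.a_closed) (use c(1,2) in \<open>auto\<close>)
 next
  fix e a assume e: "e \<in>[K]" and "a \<in> ?N"
  then obtain c where c: "c \<in> S \<rightarrow> carrier K" "a = (\<Oplus>\<^bsub>M\<^esub>s\<in>S. c s \<odot>[M] h s)" by auto
  have "e \<odot>[M] a = (\<Oplus>\<^bsub>M\<^esub>s\<in>S. e \<odot>[M] (c s \<odot>[M] h s))"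
   using cl c e assms(2) by (simp add: M.finsum_smult_ldistr)
  also have "... = (\<Oplus>\<^bsub>M\<^esub>s\<in>S. (\<lambda>s. e *[K] c s) s \<odot>[M] h s)"
   using c(1) e assms(3) by (intro M.M.finsum_cong') (auto simp: M.smult_assoc1 Pi_iff)
  finally show "e \<odot>[M] a \<in> ?N"
   by (auto intro!: exI[of _ "\<lambda>s. e *[K] c s"]) (use c(1) e in \<open>auto\<close>)
 qed
qed

lemma finsum_delta:
 assumes "module K M" "finite S" "j \<in> S" "h \<in> S \<rightarrow> carrier M"
 shows "(\<Oplus>\<^bsub>M\<^esub>s\<in>S. (if s = j then \<one>[K] else \<zero>[K]) \<odot>[M] h s) = h j"
proof -
 interpret M: module K M by fact
 have "(\<Oplus>\<^bsub>M\<^esub>s\<in>S. (if s = j then \<one>[K] else \<zero>[K]) \<odot>[M] h s) = (\<Oplus>\<^bsub>M\<^esub>s\<in>S. if j = s then h s else \<zero>[M])"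
  using assms(4) by (intro M.M.finsum_cong') (auto simp: Pi_iff)
 also have "... = h j" using assms by (intro M.M.finsum_singleton) auto
 finally show ?thesis .
qed

text \<open>The linear combinations of \<open>S\<close> form a submodule that contains \<open>S\<close>.\<close>

lemma spanning_combination:
 assumes "module K M" "spanning K M S" "finite S" "v \<in>[M]"
 shows "\<exists>c. c \<in> S \<rightarrow> carrier K \<and> v = (\<Oplus>\<^bsub>M\<^esub>s\<in>S. c s \<odot>[M] s)"
proof -
 interpret M: module K M by fact
 have S: "S <= carrier M" using assms by (simp add: spanning_def)
 let ?N = "{\<Oplus>\<^bsub>M\<^esub>s\<in>S. c s \<odot>[M] s | c. c \<in> S \<rightarrow> carrier K}"
 have "submodule ?N K M" by (rule submodule_combinations[OF assms(1,3)]) (use S in auto)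
 moreover have "S <= ?N"
 proof
  fix j assume "j \<in> S"
  then have "j = (\<Oplus>\<^bsub>M\<^esub>s\<in>S. (if s = j then \<one>[K] else \<zero>[K]) \<odot>[M] s)"
   using finsum_delta[OF assms(1,3) \<open>j \<in> S\<close>, where h="\<lambda>s. s"] S by force
  then show "j \<in> ?N" by (auto intro!: exI[of _ "\<lambda>s. if s = j then \<one>[K] else \<zero>[K]"])
 qed
 ultimately have "carrier M <= ?N" using assms(2) unfolding spanning_def by (elim conjE allE impE)
 then have "v \<in> ?N" using assms(4) by (rule subsetD)
 then show ?thesis by blast
qed

text \<open>A spanning set of least cardinality is a basis: in a nontrivial relation some element
  could be expressed by the others.\<close>

lemma finite_dimI:
 assumes "field K" "module K M" "finite S" "spanning K M S"
 shows "finite_dim K M"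
proof -
 interpret K: field K by fact
 interpret M: module K M by fact
 define m where "m = (LEAST m. \<exists>S. finite S \<and> spanning K M S \<and> card S = m)"
 have "\<exists>S. finite S \<and> spanning K M S \<and> card S = m"
  unfolding m_def by (rule LeastI_ex) (use assms in auto)
 then obtain S where S: "finite S" "spanning K M S" "card S = m" by auto
 have least: "m \<le> card T" if "finite T" "spanning K M T" for T
  unfolding m_def by (rule Least_le) (use that in auto)
 have Sc: "S <= carrier M" using S by (simp add: spanning_def)
 have unique: "c s = d s"
  if c: "c \<in> S \<rightarrow> carrier K" and d: "d \<in> S \<rightarrow> carrier K"
   and eq: "(\<Oplus>\<^bsub>M\<^esub>s\<in>S. c s \<odot>[M] s) = (\<Oplus>\<^bsub>M\<^esub>s\<in>S. d s \<odot>[M] s)" and s: "s \<in> S" for c d s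
 proof (rule ccontr)
  assume ne: "c s ~= d s"
  let ?T = "S - {s}"
  have cs: "c s \<in>[K]" "d s \<in>[K]" "s \<in>[M]" using c d s Sc by auto
  have "S = insert s ?T" using s by auto
  then have split: "(\<Oplus>\<^bsub>M\<^esub>s\<in>S. c s \<odot>[M] s) = c s \<odot>[M] s +[M] (\<Oplus>\<^bsub>M\<^esub>s\<in>?T. c s \<odot>[M] s)"
   if "c \<in> S \<rightarrow> carrier K" for c
   using that S(1) Sc M.M.finsum_insert[of ?T s "\<lambda>s. c s \<odot>[M] s"] by (auto simp: Pi_iff subset_iff)
  let ?C = "\<Oplus>\<^bsub>M\<^esub>s\<in>?T. c s \<odot>[M] s" and ?D = "\<Oplus>\<^bsub>M\<^esub>s\<in>?T. d s \<odot>[M] s"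
  have C: "?C \<in>[M]" "?D \<in>[M]"
   using c d Sc by (auto intro!: M.M.finsum_closed)
  have "c s \<odot>[M] s +[M] ?C = d s \<odot>[M] s +[M] ?D" using eq split c d by simp
  then have "c s \<odot>[M] s -[M] d s \<odot>[M] s = ?D -[M] ?C"
  proof -
   assume 1: "c s \<odot>[M] s +[M] ?C = d s \<odot>[M] s +[M] ?D"
   have x: "c s \<odot>[M] s \<in>[M]" "d s \<odot>[M] s \<in>[M]" using cs by auto
   have "c s \<odot>[M] s -[M] d s \<odot>[M] s = (c s \<odot>[M] s +[M] ?C) -[M] ?C -[M] d s \<odot>[M] s"
    using C x by (simp add: a_minus_def M.M.a_assoc M.M.r_neg)
   also have "... = ?D -[M] ?C"
    unfolding 1 using C x by (simp add: a_minus_def M.M.a_ac M.M.r_neg1 M.M.r_neg2)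
   finally show ?thesis .
  qed
  moreover have "(c s -[K] d s) \<odot>[M] s = c s \<odot>[M] s -[M] d s \<odot>[M] s"
   using cs by (simp add: a_minus_def M.smult_l_distr M.smult_l_minus)
  ultimately have dep: "(c s -[K] d s) \<odot>[M] s = ?D -[M] ?C" by simp
  have "c s -[K] d s ~= \<zero>[K]" using ne cs by (simp add: K.minus_zero_iff)
  then have u: "c s -[K] d s \<in> Units K" using cs by (simp add: K.field_Units)
  have "spanning K M ?T"
   unfolding spanning_def
  proof (intro conjI allI impI)
   show "?T <= carrier M" using Sc by auto
   fix N assume N: "submodule N K M" "?T <= N"
   have "?C \<in> N" "?D \<in> N"
    using N c d S(1) by (auto intro!: submodule_finsum[OF assms(2)] submoduleD(4)[OF N(1)])
   then have "(c s -[K] d s) \<odot>[M] s \<in> N"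
    unfolding dep by (intro submodule_diff[OF assms(2) N(1)])
   then have "inv\<^bsub>K\<^esub> (c s -[K] d s) \<odot>[M] ((c s -[K] d s) \<odot>[M] s) \<in> N"
    by (rule submoduleD(4)[OF N(1) K.Units_inv_closed[OF u]])
   moreover have "inv\<^bsub>K\<^esub> (c s -[K] d s) \<odot>[M] ((c s -[K] d s) \<odot>[M] s) = s"
    using u cs by (simp add: M.smult_assoc1[symmetric] K.Units_l_inv)
   ultimately have "S <= N" using N(2) by auto
   then show "carrier M <= N" using S(2) N(1) by (simp add: spanning_def)
  qed
  then have "m \<le> card ?T" using S(1) by (intro least) auto
  then show False using S s by (metis S(1) card_Diff1_less not_le)
 qed
 obtain h where h: "bij_betw h {..<m} S"
  using ex_bij_betw_nat_finite[OF S(1)] S(3) by (auto simp: atLeast0LessThan)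
 have hc: "h \<in> {..<m} \<rightarrow> carrier M" using h Sc by (auto simp: bij_betw_def)
 have S_h: "S = h ` {..<m}" and inj: "inj_on h {..<m}" using h by (auto simp: bij_betw_def)
 have reind: "(\<Oplus>\<^bsub>M\<^esub>s\<in>S. c s \<odot>[M] s) = (\<Oplus>\<^bsub>M\<^esub>i\<in>{..<m}. c (h i) \<odot>[M] h i)"
  if "c \<in> S \<rightarrow> carrier K" for c
  unfolding S_h using that inj Sc S_h by (intro M.M.finsum_reindex) auto
 have "basis K M m h"
  unfolding basis_def
 proof (intro conjI ballI hc)
  fix v assume v: "v \<in>[M]"
  obtain c where c: "c \<in> S \<rightarrow> carrier K" "v = (\<Oplus>\<^bsub>M\<^esub>s\<in>S. c s \<odot>[M] s)"
   using spanning_combination[OF assms(2) S(2,1) v] by auto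
  show "\<exists>!c. c \<in> {..<m} \<rightarrow>\<^sub>E carrier K \<and> v = (\<Oplus>\<^bsub>M\<^esub>i\<in>{..<m}. c i \<odot>[M] h i)"
  proof (rule ex1I[of _ "\<lambda>i\<in>{..<m}. c (h i)"], intro conjI)
   show "(\<lambda>i\<in>{..<m}. c (h i)) \<in> {..<m} \<rightarrow>\<^sub>E carrier K" using c(1) S_h by auto
   show "v = (\<Oplus>\<^bsub>M\<^esub>i\<in>{..<m}. (\<lambda>i\<in>{..<m}. c (h i)) i \<odot>[M] h i)"
    unfolding c(2) reind[OF c(1)] using c(1) S_h hc by (intro M.M.finsum_cong') (auto simp: Pi_iff)
  next
   fix d assume d: "d \<in> {..<m} \<rightarrow>\<^sub>E carrier K \<and> v = (\<Oplus>\<^bsub>M\<^esub>i\<in>{..<m}. d i \<odot>[M] h i)"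
   define e where "e = (\<lambda>s. d (the_inv_into {..<m} h s))"
   have eh: "e (h i) = d i" if "i < m" for i
    using that inj by (simp add: e_def the_inv_into_f_f)
   have e: "e \<in> S \<rightarrow> carrier K" using d S_h eh by auto
   have "v = (\<Oplus>\<^bsub>M\<^esub>i\<in>{..<m}. e (h i) \<odot>[M] h i)"
    unfolding conjunct2[OF d] using d hc by (intro M.M.finsum_cong') (auto simp: eh PiE_iff Pi_iff)
   then have "v = (\<Oplus>\<^bsub>M\<^esub>s\<in>S. e s \<odot>[M] s)" using reind[OF e] by simp
   then have "e (h i) = c (h i)" if "i < m" for i
    using unique[OF e c(1)] c(2) that S_h by auto
   then show "d = (\<lambda>i\<in>{..<m}. c (h i))"
    using d eh by (intro extensionalityI[of _ "{..<m}"]) (auto simp: PiE_iff)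
  qed
 qed
 then show ?thesis by (auto simp: finite_dim_def)
qed

lemma basis_unique:
 assumes "basis K M n h" "c \<in> {..<n} \<rightarrow>\<^sub>E carrier K" "d \<in> {..<n} \<rightarrow>\<^sub>E carrier K"
  "(\<Oplus>\<^bsub>M\<^esub>i\<in>{..<n}. c i \<odot>[M] h i) = (\<Oplus>\<^bsub>M\<^esub>i\<in>{..<n}. d i \<odot>[M] h i)"
  "(\<Oplus>\<^bsub>M\<^esub>i\<in>{..<n}. c i \<odot>[M] h i) \<in>[M]"
 shows "c = d"
proof -
 have "\<exists>!e. e \<in> {..<n} \<rightarrow>\<^sub>E carrier K \<and> (\<Oplus>\<^bsub>M\<^esub>i\<in>{..<n}. c i \<odot>[M] h i) = (\<Oplus>\<^bsub>M\<^esub>i\<in>{..<n}. e i \<odot>[M] h i)"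
  using assms(1,5) unfolding basis_def by blast
 then show ?thesis using assms(2-4) by blast
qed

lemma module_self: assumes "field K" shows "module K (self_algebra K)"
proof -
 interpret K: field K by fact
 have "\<exists>y\<in>carrier K. y +[K] x = \<zero>[K]" if "x \<in>[K]" for x
  using that by (intro bexI[of _ "-[K] x"]) (auto simp: K.l_neg)
 then show ?thesis
  by (intro moduleI abelian_groupI K.is_cring)
   (simp_all add: self_algebra_def K.a_ac K.l_distr K.r_distr K.m_assoc)
qed

lemma assoc_self: assumes "field K" shows "assoc_algebra K (self_algebra K)"
proof -
 interpret K: field K by fact
 have "ring (self_algebra K)"
  by (intro ringI monoidI module.axioms(2)[OF module_self[OF assms]])
   (auto simp: self_algebra_def K.l_distr K.r_distr K.m_assoc)
 then show ?thesis
  by (intro assoc_algebraI assms module_self) (auto simp: self_algebra_def K.m_ac)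
qed

lemma carrier_self [simp]: "carrier (self_algebra K) = carrier K"
 and ops_self [simp]: "x +[self_algebra K] y = x +[K] y" "x *[self_algebra K] y = x *[K] y"
  "c \<odot>[self_algebra K] y = c *[K] y" "\<zero>[self_algebra K] = \<zero>[K]" "\<one>[self_algebra K] = \<one>[K]"
 by (simp_all add: self_algebra_def)

lemma finsum_self: "finsum (self_algebra K) f S = finsum K f S"
 by (simp add: finsum_def finprod_def self_algebra_def)

text \<open>The dual basis consists of the coordinate functions; they are linear because coordinates are unique.\<close>

lemma dual_bases_exist:
 assumes "field K" "module K M" "basis K M n h"
 shows "\<exists>h'. dual_bases K M n h h'"
proof -
 interpret K: field K by fact
 interpret M: module K M by fact
 have h: "h \<in> {..<n} \<rightarrow> carrier M" using assms by (simp add: basis_def)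
 define co where "co v = (THE c. c \<in> {..<n} \<rightarrow>\<^sub>E carrier K \<and> v = (\<Oplus>\<^bsub>M\<^esub>i\<in>{..<n}. c i \<odot>[M] h i))" for v
 have co: "co v \<in> {..<n} \<rightarrow>\<^sub>E carrier K" "(\<Oplus>\<^bsub>M\<^esub>i\<in>{..<n}. co v i \<odot>[M] h i) = v" if "v \<in>[M]" for v
  using theI'[of "\<lambda>c. c \<in> {..<n} \<rightarrow>\<^sub>E carrier K \<and> v = (\<Oplus>\<^bsub>M\<^esub>i\<in>{..<n}. c i \<odot>[M] h i)"] that assms(3)
  unfolding basis_def co_def by auto
 have uniq: "co v = c" if "v \<in>[M]" "c \<in> {..<n} \<rightarrow>\<^sub>E carrier K" "v = (\<Oplus>\<^bsub>M\<^esub>i\<in>{..<n}. c i \<odot>[M] h i)" for v c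
  using basis_unique[OF assms(3) co(1)[OF that(1)] that(2)] co(2)[OF that(1)] that by simp
 have co_c: "co v i \<in>[K]" if "v \<in>[M]" "i < n" for v i using co(1)[OF that(1)] that(2) by auto
 have hc: "h i \<in>[M]" if "i < n" for i using h that by auto
 have addc: "co (v +[M] w) = (\<lambda>i\<in>{..<n}. co v i +[K] co w i)" if v: "v \<in>[M]" "w \<in>[M]" for v w
 proof (rule uniq)
  show "(\<lambda>i\<in>{..<n}. co v i +[K] co w i) \<in> {..<n} \<rightarrow>\<^sub>E carrier K" using v co_c by auto
  have "(\<Oplus>\<^bsub>M\<^esub>i\<in>{..<n}. (\<lambda>i\<in>{..<n}. co v i +[K] co w i) i \<odot>[M] h i)
   = (\<Oplus>\<^bsub>M\<^esub>i\<in>{..<n}. co v i \<odot>[M] h i +[M] co w i \<odot>[M] h i)"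
   using v by (intro M.M.finsum_cong') (auto simp: co_c hc M.smult_l_distr)
  also have "... = v +[M] w"
   using v co_c hc by (subst M.M.finsum_addf) (auto simp: co)
  finally show "v +[M] w = (\<Oplus>\<^bsub>M\<^esub>i\<in>{..<n}. (\<lambda>i\<in>{..<n}. co v i +[K] co w i) i \<odot>[M] h i)" by simp
 qed (use v in auto)
 have smc: "co (a \<odot>[M] v) = (\<lambda>i\<in>{..<n}. a *[K] co v i)" if v: "v \<in>[M]" "a \<in>[K]" for v a
 proof (rule uniq)
  show "(\<lambda>i\<in>{..<n}. a *[K] co v i) \<in> {..<n} \<rightarrow>\<^sub>E carrier K" using v co_c by auto
  have "(\<Oplus>\<^bsub>M\<^esub>i\<in>{..<n}. (\<lambda>i\<in>{..<n}. a *[K] co v i) i \<odot>[M] h i)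
   = (\<Oplus>\<^bsub>M\<^esub>i\<in>{..<n}. a \<odot>[M] (co v i \<odot>[M] h i))"
   using v by (intro M.M.finsum_cong') (auto simp: co_c hc M.smult_assoc1)
  also have "... = a \<odot>[M] v"
   using v co_c hc by (subst M.finsum_smult_ldistr[symmetric]) (auto simp: co)
  finally show "a \<odot>[M] v = (\<Oplus>\<^bsub>M\<^esub>i\<in>{..<n}. (\<lambda>i\<in>{..<n}. a *[K] co v i) i \<odot>[M] h i)" by simp
 qed (use v in auto)
 have deltac: "co (h j) = (\<lambda>i\<in>{..<n}. if i = j then \<one>[K] else \<zero>[K])" if "j < n" for j
 proof (rule uniq)
  have "(\<Oplus>\<^bsub>M\<^esub>i\<in>{..<n}. (\<lambda>i\<in>{..<n}. if i = j then \<one>[K] else \<zero>[K]) i \<odot>[M] h i)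
    = (\<Oplus>\<^bsub>M\<^esub>i\<in>{..<n}. (if i = j then \<one>[K] else \<zero>[K]) \<odot>[M] h i)"
   by (intro M.M.finsum_cong') (auto simp: hc)
  also have "... = h j" using that h by (intro finsum_delta[OF assms(2)]) auto
  finally show "h j = (\<Oplus>\<^bsub>M\<^esub>i\<in>{..<n}. (\<lambda>i\<in>{..<n}. if i = j then \<one>[K] else \<zero>[K]) i \<odot>[M] h i)" by simp
 qed (use that hc in auto)
 have "(\<lambda>v\<in>carrier M. co v i) \<in> dual_space K M" if "i < n" for i
  using that by (intro lin_restrictI[OF assms(2)]) (auto simp: co_c addc smc)
 then have "dual_bases K M n h (\<lambda>i. \<lambda>v\<in>carrier M. co v i)"
  unfolding dual_bases_def using assms(3) hc by (auto simp: deltac)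
 then show ?thesis by blast
qed

lemma dual_bases_expand:
 assumes "field K" "module K M" "dual_bases K M n h h'" "v \<in>[M]"
 shows "v = (\<Oplus>\<^bsub>M\<^esub>i\<in>{..<n}. h' i v \<odot>[M] h i)"
proof -
 interpret K: field K by fact
 interpret M: module K M by fact
 have h: "h i \<in>[M]" if "i < n" for i using assms that by (auto simp: dual_bases_def basis_def)
 have h': "h' i \<in> dual_space K M" if "i < n" for i using assms that by (auto simp: dual_bases_def)
 have "basis K M n h" using assms(3) by (simp add: dual_bases_def)
 then have "\<exists>!c. c \<in> {..<n} \<rightarrow>\<^sub>E carrier K \<and> v = (\<Oplus>\<^bsub>M\<^esub>i\<in>{..<n}. c i \<odot>[M] h i)"
  using assms(4) unfolding basis_def by blast
 then obtain c where c: "c \<in> {..<n} \<rightarrow>\<^sub>E carrier K" "v = (\<Oplus>\<^bsub>M\<^esub>i\<in>{..<n}. c i \<odot>[M] h i)"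
  by blast
 have cc: "c i \<in>[K]" if "i < n" for i using c(1) that by auto
 have "h' j v = c j" if j: "j < n" for j
 proof -
  have "h' j v = (\<Oplus>\<^bsub>self_algebra K\<^esub>i\<in>{..<n}. h' j (c i \<odot>[M] h i))"
   unfolding c(2) using c(1) h by (intro lin_finsum[OF assms(2) module_self[OF assms(1)] h'[OF j]]) auto
  also have "... = (\<Oplus>\<^bsub>K\<^esub>i\<in>{..<n}. if j = i then c i else \<zero>[K])"
   unfolding finsum_self
  proof (rule K.finsum_cong')
   fix i assume i: "i \<in> {..<n}"
   then have "c i \<in>[K]" using c(1) by auto
   moreover have "h' j (h i) = (if j = i then \<one>[K] else \<zero>[K])"
    using assms(3) i j unfolding dual_bases_def by simp
   ultimately show "h' j (c i \<odot>[M] h i) = (if j = i then c i else \<zero>[K])"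
    using i h lin_smult[OF h'[OF j], of "c i" "h i"] by simp
  next
   show "(\<lambda>i. if j = i then c i else \<zero>[K]) \<in> {..<n} \<rightarrow> carrier K"
    by (simp add: Pi_iff cc)
  qed simp
  also have "... = c j" using j cc by (intro K.finsum_singleton) (auto simp: Pi_iff)
  finally show ?thesis .
 qed
 note hv = this
 have "(\<Oplus>\<^bsub>M\<^esub>i\<in>{..<n}. h' i v \<odot>[M] h i) = v"
 proof -
  have "(\<Oplus>\<^bsub>M\<^esub>i\<in>{..<n}. h' i v \<odot>[M] h i) = (\<Oplus>\<^bsub>M\<^esub>i\<in>{..<n}. c i \<odot>[M] h i)"
   by (intro M.M.finsum_cong') (simp_all add: hv cc h Pi_iff)
  then show ?thesis using c(2) by simp
 qed
 then show ?thesis by simp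
qed

section \<open>Constructions of algebras\<close>

text \<open>Quotients are shown to be algebras by this transport of the axioms along a surjection that
  respects the operations.\<close>

lemma assoc_algebra_image:
 assumes "assoc_algebra K A" and surj: "carrier Q = h ` carrier A"
  and add: "!!x y. [|x \<in>[A]; y \<in>[A]|] ==> h x +[Q] h y = h (x +[A] y)"
  and mult: "!!x y. [|x \<in>[A]; y \<in>[A]|] ==> h x *[Q] h y = h (x *[A] y)"
  and smult: "!!c x. [|c \<in>[K]; x \<in>[A]|] ==> c \<odot>[Q] h x = h (c \<odot>[A] x)"
  and zero: "\<zero>[Q] = h \<zero>[A]" and one: "\<one>[Q] = h \<one>[A]"
 shows "assoc_algebra K Q"
proof -
 note A = algD[OF assms(1)]
 interpret K: field K by fact
 interpret A: ring A by fact
 interpret MA: module K A by fact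
 note smA = alg_smult[OF assms(1)]
 have neg: "h (-[A] x) +[Q] h x = \<zero>[Q]" if "x \<in>[A]" for x
  using that by (simp add: add A.l_neg zero)
 have ag: "abelian_group Q"
 proof (rule abelian_groupI)
  show "\<exists>y\<in>carrier Q. y +[Q] x = \<zero>[Q]" if "x \<in>[Q]" for x
   using that neg A.a_inv_closed unfolding surj by blast
 qed (auto simp: surj add zero A.a_ac)
 have "Group.monoid Q"
  by (rule monoidI) (auto simp: surj mult one A.m_assoc)
 then have "ring Q"
  using ag by (rule_tac ringI) (auto simp: surj mult add A.l_distr A.r_distr)
 moreover have "module K Q"
  by (rule moduleI[OF K.is_cring ag]) (auto simp: surj smult add MA.smult_l_distr MA.smult_r_distr MA.smult_assoc1)
 ultimately show ?thesis
  by (intro assoc_algebraI A) (auto simp: surj smult mult smA)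
qed

definition op_algebra :: "('k, 'a, 'n) module_scheme => ('k, 'a) module" where
 "op_algebra A = \<lparr>carrier = carrier A, monoid.mult = (\<lambda>x y. y *[A] x), one = \<one>[A], zero = \<zero>[A], add = add A,
   smult = smult A\<rparr>"

lemma op_algebra_simps [simp]:
 "carrier (op_algebra A) = carrier A" "x *[op_algebra A] y = y *[A] x" "\<one>[op_algebra A] = \<one>[A]"
 "\<zero>[op_algebra A] = \<zero>[A]" "x +[op_algebra A] y = x +[A] y" "c \<odot>[op_algebra A] y = c \<odot>[A] y"
 by (simp_all add: op_algebra_def)

lemma assoc_op:
 assumes "assoc_algebra K A" shows "assoc_algebra K (op_algebra A)"
proof -
 note A = algD[OF assms(1)]
 interpret K: field K by fact
 interpret A: ring A by fact
 interpret MA: module K A by fact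
 note smA = alg_smult[OF assms(1)]
 have neg: "\<exists>y\<in>carrier A. y +[A] x = \<zero>[A]" if "x \<in>[A]" for x
  using that A.l_neg A.a_inv_closed by blast
 have ag: "abelian_group (op_algebra A)"
  by (rule abelian_groupI) (simp_all add: A.a_ac neg)
 have "Group.monoid (op_algebra A)"
  by (rule monoidI) (simp_all add: A.m_assoc)
 then have "ring (op_algebra A)"
  using ag by (rule_tac ringI) (simp_all add: A.l_distr A.r_distr)
 moreover have "module K (op_algebra A)"
  by (rule moduleI[OF K.is_cring ag]) (simp_all add: MA.smult_l_distr MA.smult_r_distr MA.smult_assoc1)
 ultimately show ?thesis
  by (intro assoc_algebraI A) (simp_all add: smA)
qed

lemma carrier_end [simp]: "carrier (end_algebra K M) = lin_maps K M M"
 by (simp add: end_algebra_def)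

lemma end_apply:
 assumes "x \<in>[M]"
 shows "(f +[end_algebra K M] g) x = f x +[M] g x" "(f *[end_algebra K M] g) x = f (g x)"
  "\<one>[end_algebra K M] x = x" "\<zero>[end_algebra K M] x = \<zero>[M]" "(c \<odot>[end_algebra K M] f) x = c \<odot>[M] f x"
 using assms by (simp_all add: end_algebra_def compose_def)

lemma end_consts_closed:
 assumes "module K M"
 shows "\<one>[end_algebra K M] \<in> lin_maps K M M" "\<zero>[end_algebra K M] \<in> lin_maps K M M"
proof -
 interpret M: module K M by fact
 have "(\<lambda>x\<in>carrier M. x) \<in> lin_maps K M M"
  by (rule lin_restrictI[OF assms(1)]) simp_all
 then show "\<one>[end_algebra K M] \<in> lin_maps K M M" by (simp add: end_algebra_def)
 have "(\<lambda>x\<in>carrier M. \<zero>[M]) \<in> lin_maps K M M"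
  by (rule lin_restrictI[OF assms(1)]) simp_all
 then show "\<zero>[end_algebra K M] \<in> lin_maps K M M" by (simp add: end_algebra_def)
qed

lemma end_closed:
 assumes "module K M" and f: "f \<in> lin_maps K M M" and g: "g \<in> lin_maps K M M"
 shows "f +[end_algebra K M] g \<in> lin_maps K M M" "f *[end_algebra K M] g \<in> lin_maps K M M"
  "c \<in>[K] ==> c \<odot>[end_algebra K M] f \<in> lin_maps K M M"
proof -
 interpret M: module K M by fact
 note fg = lin_closed[OF f] lin_closed[OF g] lin_add[OF f] lin_add[OF g] lin_smult[OF f] lin_smult[OF g]
 have "(\<lambda>x\<in>carrier M. f x +[M] g x) \<in> lin_maps K M M"
  by (rule lin_restrictI[OF assms(1)]) (simp_all add: fg M.smult_r_distr M.M.a_ac)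
 then show "f +[end_algebra K M] g \<in> lin_maps K M M" by (simp add: end_algebra_def)
 show "f *[end_algebra K M] g \<in> lin_maps K M M"
  using lin_compose[OF assms(1) g f] by (simp add: end_algebra_def compose_def)
 assume c: "c \<in>[K]"
 have "(\<lambda>x\<in>carrier M. c \<odot>[M] f x) \<in> lin_maps K M M"
  by (rule lin_restrictI[OF assms(1)])
   (simp_all add: fg c M.smult_r_distr M.smult_assoc1[symmetric] M.R.m_comm[OF c])
 then show "c \<odot>[end_algebra K M] f \<in> lin_maps K M M" by (simp add: end_algebra_def)
qed

lemma assoc_end:
 assumes "field K" "module K M" shows "assoc_algebra K (end_algebra K M)"
proof -
 interpret K: field K by fact
 interpret M: module K M by fact
 let ?E = "end_algebra K M"
 note cl = end_closed[OF assms(2)] end_consts_closed[OF assms(2)]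
 have eqI: "f = g" if "f \<in> lin_maps K M M" "g \<in> lin_maps K M M" "!!x. x \<in>[M] ==> f x = g x" for f g
  using lin_ext[OF that] .
 have lc: "f x \<in>[M]" if "f \<in> lin_maps K M M" "x \<in>[M]" for f x
  using that by (rule lin_closed)
 have ag: "abelian_group ?E"
 proof (rule abelian_groupI; unfold carrier_end)
  show "\<zero>[?E] \<in> lin_maps K M M" by (rule cl)
  fix f assume f: "f \<in> lin_maps K M M"
  show "\<zero>[?E] +[?E] f = f"
   by (rule eqI) (simp_all add: cl(1,3-) f end_apply lc)
  have n: "(-[K] \<one>[K]) \<odot>[?E] f \<in> lin_maps K M M"
   by (rule cl(3)[OF f f]) simp
  have "(-[K] \<one>[K]) \<odot>[?E] f +[?E] f = \<zero>[?E]"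
   by (rule eqI) (simp_all add: cl(1)[OF n f] cl(5) end_apply lc[OF f] M.smult_l_minus M.M.l_neg)
  with n show "\<exists>g\<in>lin_maps K M M. g +[?E] f = \<zero>[?E]" by blast
  fix g assume g: "g \<in> lin_maps K M M"
  show "f +[?E] g \<in> lin_maps K M M" by (rule cl(1)[OF f g])
  show "f +[?E] g = g +[?E] f"
   by (rule eqI) (simp_all add: cl(1) f g end_apply lc M.M.a_comm)
  fix h assume h: "h \<in> lin_maps K M M"
  show "f +[?E] g +[?E] h = f +[?E] (g +[?E] h)"
   by (rule eqI) (simp_all add: cl(1) f g h end_apply lc M.M.a_assoc)
 qed
 have "Group.monoid ?E"
 proof (rule monoidI; unfold carrier_end)
  show "\<one>[?E] \<in> lin_maps K M M" by (rule cl)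
  fix f assume f: "f \<in> lin_maps K M M"
  show "\<one>[?E] *[?E] f = f" "f *[?E] \<one>[?E] = f"
   by (rule eqI; simp add: cl(2,4) f end_apply lc)+
  fix g assume g: "g \<in> lin_maps K M M"
  show "f *[?E] g \<in> lin_maps K M M" by (rule cl(2)[OF f g])
  fix h assume h: "h \<in> lin_maps K M M"
  show "f *[?E] g *[?E] h = f *[?E] (g *[?E] h)"
   by (rule eqI) (simp_all add: cl(2) f g h end_apply lc)
 qed
 have "ring ?E"
 proof (rule ringI[OF ag \<open>Group.monoid ?E\<close>]; unfold carrier_end)
  fix f g h assume f: "f \<in> lin_maps K M M" "g \<in> lin_maps K M M" "h \<in> lin_maps K M M"
  show "(f +[?E] g) *[?E] h = f *[?E] h +[?E] g *[?E] h"
   by (rule eqI) (simp_all add: cl(1,2) f end_apply lc)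
  show "h *[?E] (f +[?E] g) = h *[?E] f +[?E] h *[?E] g"
   by (rule eqI) (simp_all add: cl(1,2) f end_apply lc lin_add[OF f(3)])
 qed
 have cl3: "c \<odot>[?E] f \<in> lin_maps K M M" if "c \<in>[K]" "f \<in> lin_maps K M M" for c f
  using cl(3)[OF that(2,2,1)] .
 have "module K ?E"
 proof (rule moduleI[OF K.is_cring ag]; unfold carrier_end)
  fix c f assume c: "c \<in>[K]" and f: "f \<in> lin_maps K M M"
  show "c \<odot>[?E] f \<in> lin_maps K M M" by (rule cl3[OF c f])
  fix d assume d: "d \<in>[K]"
  show "(c +[K] d) \<odot>[?E] f = c \<odot>[?E] f +[?E] d \<odot>[?E] f"
   by (rule eqI) (simp_all add: cl(1) cl3 c d f end_apply lc M.smult_l_distr)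
  show "(c *[K] d) \<odot>[?E] f = c \<odot>[?E] (d \<odot>[?E] f)"
   by (rule eqI) (simp_all add: cl3 c d f end_apply lc M.smult_assoc1)
 next
  fix c f g assume c: "c \<in>[K]" and f: "f \<in> lin_maps K M M" "g \<in> lin_maps K M M"
  show "c \<odot>[?E] (f +[?E] g) = c \<odot>[?E] f +[?E] c \<odot>[?E] g"
   by (rule eqI) (simp_all add: cl(1) cl3 c f end_apply lc M.smult_r_distr)
 next
  fix f assume f: "f \<in> lin_maps K M M"
  show "\<one>[K] \<odot>[?E] f = f"
   by (rule eqI) (simp_all add: cl3 f end_apply lc)
 qed
 show ?thesis
 proof (rule assoc_algebraI[OF assms(1) \<open>module K ?E\<close> \<open>ring ?E\<close>]; unfold carrier_end)
  fix c f g assume c: "c \<in>[K]" and f: "f \<in> lin_maps K M M" "g \<in> lin_maps K M M"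
  show "(c \<odot>[?E] f) *[?E] g = c \<odot>[?E] (f *[?E] g)"
   by (rule eqI) (simp_all add: cl(2) cl3 c f end_apply lc)
  show "f *[?E] (c \<odot>[?E] g) = c \<odot>[?E] (f *[?E] g)"
   by (rule eqI) (simp_all add: cl(2) cl3 c f end_apply lc lin_smult[OF f(1)])
 qed
qed

lemma hom_lin: "f \<in> alg_homs K A B ==> f \<in> lin_maps K A B"
 by (simp add: alg_homs_def)

lemma hom_mult: "[|f \<in> alg_homs K A B; x \<in>[A]; y \<in>[A]|] ==> f (x *[A] y) = f x *[B] f y"
 by (simp add: alg_homs_def ring_hom_def)

lemma hom_one: "f \<in> alg_homs K A B ==> f \<one>[A] = \<one>[B]"
 by (simp add: alg_homs_def ring_hom_def)

lemma alg_homsI: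
 assumes "f \<in> lin_maps K A B" "f \<one>[A] = \<one>[B]"
  and "!!x y. [|x \<in>[A]; y \<in>[A]|] ==> f (x *[A] y) = f x *[B] f y"
 shows "f \<in> alg_homs K A B"
 using assms by (auto simp: alg_homs_def ring_hom_def lin_closed lin_add)

lemma alg_homs_pow:
 assumes "assoc_algebra K A" "assoc_algebra K B" "f \<in> alg_homs K A B" "x \<in>[A]"
 shows "f (x ^[A] (n::nat)) = f x ^[B] n"
proof -
 interpret A: ring A by (rule algD[OF assms(1)])
 interpret B: ring B by (rule algD[OF assms(2)])
 show ?thesis using assms(3,4)
  by (induction n) (simp_all add: hom_one hom_mult)
qed

lemma alg_homs_compose:
 assumes "assoc_algebra K A" "f \<in> alg_homs K A B" "g \<in> alg_homs K B C"
 shows "(\<lambda>x\<in>carrier A. g (f x)) \<in> alg_homs K A C"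
proof -
 interpret A: ring A by (rule algD[OF assms(1)])
 show ?thesis
  using assms lin_compose[OF algD(2)[OF assms(1)] hom_lin[OF assms(2)] hom_lin[OF assms(3)]]
  by (intro alg_homsI) (simp_all add: hom_one hom_mult lin_closed[OF hom_lin])
qed

lemma ideal_smult:
 assumes "assoc_algebra K A" "ideal I A" "c \<in>[K]" "x \<in> I"
 shows "c \<odot>[A] x \<in> I"
proof -
 note A = algD[OF assms(1)]
 interpret A: ring A by fact
 interpret MA: module K A by fact
 interpret I: ideal I A by fact
 have "(c \<odot>[A] \<one>[A]) *[A] x \<in> I" using assms by (intro I.I_l_closed) auto
 then show ?thesis using assms alg_smult(1)[OF assms(1,3)] I.a_Hcarr by simp
qed

lemma submodule_ideal:
 assumes "assoc_algebra K A" "submodule I K A"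
  and "!!a x. [|a \<in> I; x \<in>[A]|] ==> x *[A] a \<in> I" "!!a x. [|a \<in> I; x \<in>[A]|] ==> a *[A] x \<in> I"
 shows "ideal I A"
 by (intro idealI algD(3)[OF assms(1)] assms(3,4) submodule.axioms(1)[OF assms(2)])

lemma submodule_kernel:
 assumes "module K A" "module K B" "f \<in> lin_maps K A B"
 shows "submodule {x \<in> carrier A. f x = \<zero>[B]} K A"
proof -
 interpret A: module K A by fact
 interpret B: module K B by fact
 show ?thesis
  by (rule submoduleI'[OF assms(1)])
   (auto simp: lin_zero[OF assms] lin_add[OF assms(3)] lin_smult[OF assms(3)])
qed

lemma ideal_kernel:
 assumes "assoc_algebra K A" "assoc_algebra K B" "f \<in> alg_homs K A B"
 shows "ideal {x \<in> carrier A. f x = \<zero>[B]} A"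
proof -
 interpret A: ring A by (rule algD[OF assms(1)])
 interpret B: ring B by (rule algD[OF assms(2)])
 note f = hom_lin[OF assms(3)]
 show ?thesis
  by (rule submodule_ideal[OF assms(1) submodule_kernel[OF algD(2)[OF assms(1)] algD(2)[OF assms(2)] f]])
   (auto simp: hom_mult[OF assms(3)] lin_closed[OF f])
qed

section \<open>Quotient algebras\<close>

context
 fixes K :: "('k, 'm) ring_scheme" and A :: "('k, 'a, 'n) module_scheme" and I
 assumes A: "assoc_algebra K A" and I: "ideal I A"
begin

lemma quot_coset_eq:
 assumes "x \<in>[A]" "y \<in>[A]"
 shows "I +>\<^bsub>A\<^esub> x = I +>\<^bsub>A\<^esub> y \<longleftrightarrow> x -[A] y \<in> I"
 using ring.quotient_eq_iff_same_a_r_cos[OF algD(3)[OF A] I assms] by simp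

lemma quot_carrier: "carrier (quot_algebra A I) = (\<lambda>x. I +>\<^bsub>A\<^esub> x) ` carrier A"
 by (auto simp: quot_algebra_def FactRing_def A_RCOSETS_def' a_r_coset_def')

lemma quot_ops:
 assumes "x \<in>[A]"
 shows "y \<in>[A] ==> (I +>\<^bsub>A\<^esub> x) +[quot_algebra A I] (I +>\<^bsub>A\<^esub> y) = I +>\<^bsub>A\<^esub> (x +[A] y)"
  and "y \<in>[A] ==> (I +>\<^bsub>A\<^esub> x) *[quot_algebra A I] (I +>\<^bsub>A\<^esub> y) = I +>\<^bsub>A\<^esub> (x *[A] y)"
  and "c \<in>[K] ==> c \<odot>[quot_algebra A I] (I +>\<^bsub>A\<^esub> x) = I +>\<^bsub>A\<^esub> (c \<odot>[A] x)"
proof -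
 note A' = algD[OF A]
 interpret A: ring A by fact
 interpret MA: module K A by fact
 interpret I: ideal I A by fact
 show "(I +>\<^bsub>A\<^esub> x) +[quot_algebra A I] (I +>\<^bsub>A\<^esub> y) = I +>\<^bsub>A\<^esub> (x +[A] y)" if "y \<in>[A]"
  using that assms by (simp add: quot_algebra_def FactRing_def I.a_rcos_sum)
 show "(I +>\<^bsub>A\<^esub> x) *[quot_algebra A I] (I +>\<^bsub>A\<^esub> y) = I +>\<^bsub>A\<^esub> (x *[A] y)" if "y \<in>[A]"
  using that assms by (simp add: quot_algebra_def FactRing_def I.rcoset_mult_add)
 assume c: "c \<in>[K]"
 have "I +>\<^bsub>A\<^esub> (c \<odot>[A] y) = I +>\<^bsub>A\<^esub> (c \<odot>[A] x)" if y: "y \<in> I +>\<^bsub>A\<^esub> x" for y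
 proof -
  have yc: "y \<in>[A]" using y assms I.a_elemrcos_carrier by blast
  have "y -[A] x \<in> I" using I.a_rcos_module_minus[OF A'(3) assms yc] y by simp
  then have "c \<odot>[A] (y -[A] x) \<in> I" using ideal_smult[OF A I c] by simp
  also have "c \<odot>[A] (y -[A] x) = c \<odot>[A] y -[A] c \<odot>[A] x"
   using assms yc c by (simp add: a_minus_def MA.smult_r_distr MA.smult_r_minus)
  finally show ?thesis using assms yc c by (subst quot_coset_eq) auto
 qed
 moreover have "x \<in> I +>\<^bsub>A\<^esub> x" using assms by (rule I.a_rcos_self)
 ultimately have "(\<Union>y\<in>I +>\<^bsub>A\<^esub> x. I +>\<^bsub>A\<^esub> (c \<odot>[A] y)) = I +>\<^bsub>A\<^esub> (c \<odot>[A] x)"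
  by (intro UN_constant_eq ballI)
 then show "c \<odot>[quot_algebra A I] (I +>\<^bsub>A\<^esub> x) = I +>\<^bsub>A\<^esub> (c \<odot>[A] x)"
  by (simp add: quot_algebra_def)
qed

lemma quot_consts:
 "\<zero>[quot_algebra A I] = I +>\<^bsub>A\<^esub> \<zero>[A]" "\<one>[quot_algebra A I] = I +>\<^bsub>A\<^esub> \<one>[A]"
proof -
 interpret I: ideal I A by fact
 show "\<zero>[quot_algebra A I] = I +>\<^bsub>A\<^esub> \<zero>[A]" "\<one>[quot_algebra A I] = I +>\<^bsub>A\<^esub> \<one>[A]"
  using I.a_subset by (simp_all add: quot_algebra_def FactRing_def I.a_coset_add_zero)
qed

lemma assoc_quot: "assoc_algebra K (quot_algebra A I)"
 by (rule assoc_algebra_image[OF A quot_carrier]) (simp_all add: quot_ops quot_consts)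

lemma quot_zero_iff:
 assumes "x \<in>[A]"
 shows "I +>\<^bsub>A\<^esub> x = \<zero>[quot_algebra A I] \<longleftrightarrow> x \<in> I"
proof -
 interpret A: ring A by (rule algD[OF A])
 show ?thesis using assms quot_coset_eq[OF assms A.zero_closed] by (simp add: quot_consts a_minus_def)
qed

lemma quot_proj: "(\<lambda>x\<in>carrier A. I +>\<^bsub>A\<^esub> x) \<in> alg_homs K A (quot_algebra A I)"
proof -
 interpret A: ring A by (rule algD[OF A])
 show ?thesis
  by (rule alg_homsI, rule lin_restrictI[OF algD(2)[OF A]])
   (auto simp: quot_ops quot_consts quot_carrier)
qed

lemma quot_lift:
 assumes N: "module K N" and f: "f \<in> lin_maps K A N" and ker: "!!x. x \<in> I ==> f x = \<zero>[N]"
 shows "\<exists>g \<in> lin_maps K (quot_algebra A I) N. \<forall>x\<in>carrier A. g (I +>\<^bsub>A\<^esub> x) = f x"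
proof -
 let ?Q = "quot_algebra A I"
 interpret A: ring A by (rule algD[OF A])
 interpret MA: module K A by (rule algD[OF A])
 interpret N: module K N by fact
 define g where "g = (\<lambda>X\<in>carrier ?Q. f (SOME x. x \<in>[A] \<and> X = I +>\<^bsub>A\<^esub> x))"
 have g: "g (I +>\<^bsub>A\<^esub> x) = f x" if x: "x \<in>[A]" for x
 proof -
  let ?y = "SOME y. y \<in>[A] \<and> I +>\<^bsub>A\<^esub> x = I +>\<^bsub>A\<^esub> y"
  have y: "?y \<in>[A] \<and> I +>\<^bsub>A\<^esub> x = I +>\<^bsub>A\<^esub> ?y" by (rule someI[of _ x]) (use x in simp)
  then have "f (x -[A] ?y) = \<zero>[N]" using quot_coset_eq[OF x] by (intro ker) auto
  then have "f x -[N] f ?y = \<zero>[N]" using lin_diff[OF MA.module_axioms N f x] y by simp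
  then have "f x = f ?y"
   using N.M.minus_zero_iff[OF lin_closed[OF f x] lin_closed[OF f conjunct1[OF y]]] by simp
  moreover have "I +>\<^bsub>A\<^esub> x \<in>[?Q]" using x by (simp add: quot_carrier)
  ultimately show ?thesis by (simp add: g_def)
 qed
 interpret Q: module K ?Q by (rule algD[OF assoc_quot])
 have "g \<in> lin_maps K ?Q N"
 proof (rule lin_mapsI)
  show "g X \<in>[N]" if "X \<in>[?Q]" for X
   using that lin_closed[OF f] by (auto simp: quot_carrier g)
  show "g X = undefined" if "X \<notin> carrier ?Q" for X using that by (simp add: g_def)
  show "g (X +[?Q] Y) = g X +[N] g Y" if "X \<in>[?Q]" "Y \<in>[?Q]" for X Y
   using that by (auto simp: quot_carrier quot_ops g lin_add[OF f])
  show "g (c \<odot>[?Q] X) = c \<odot>[N] g X" if "c \<in>[K]" "X \<in>[?Q]" for c X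
   using that by (auto simp: quot_carrier quot_ops g lin_smult[OF f])
 qed
 then show ?thesis using g by blast
qed

lemma quot_lift_hom:
 assumes B: "assoc_algebra K B" and f: "f \<in> alg_homs K A B" and ker: "!!x. x \<in> I ==> f x = \<zero>[B]"
 shows "\<exists>g \<in> alg_homs K (quot_algebra A I) B. \<forall>x\<in>carrier A. g (I +>\<^bsub>A\<^esub> x) = f x"
proof -
 interpret A: ring A by (rule algD[OF A])
 obtain g where g: "g \<in> lin_maps K (quot_algebra A I) B" "!!x. x \<in>[A] ==> g (I +>\<^bsub>A\<^esub> x) = f x"
  using quot_lift[OF algD(2)[OF B] hom_lin[OF f] ker] by blast
 have "g \<in> alg_homs K (quot_algebra A I) B"
  by (rule alg_homsI[OF g(1)])
   (auto simp: quot_carrier quot_ops quot_consts g(2) hom_mult[OF f] hom_one[OF f])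
 then show ?thesis using g(2) by blast
qed

end

section \<open>Monoid algebras\<close>

context
 fixes K :: "('k, 'm) ring_scheme" and X :: "('x, 'n) monoid_scheme"
 assumes K: "field K" and X: "Group.monoid X"
begin

interpretation K: field K by (rule K)
interpretation X: Group.monoid X by (rule X)

private abbreviation "F == monoid_algebra K X"
private abbreviation "supp f == {x \<in> carrier X. f x ~= \<zero>[K]}"

lemma ma_mem_iff: "f \<in>[F] \<longleftrightarrow> f \<in> carrier X \<rightarrow>\<^sub>E carrier K \<and> finite (supp f)"
 by (simp add: monoid_algebra_def)

lemma ma_closed: "[|f \<in>[F]; x \<in>[X]|] ==> f x \<in>[K]"
 by (auto simp: ma_mem_iff)

lemma ma_memI:
 assumes "!!x. x \<in>[X] ==> f x \<in>[K]" "!!x. x \<notin> carrier X ==> f x = undefined"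
  "finite S" "!!x. [|x \<in>[X]; x \<notin> S|] ==> f x = \<zero>[K]"
 shows "f \<in>[F]"
 unfolding ma_mem_iff
proof
 show "f \<in> carrier X \<rightarrow>\<^sub>E carrier K" using assms(1,2) by (simp add: PiE_iff extensional_def)
 show "finite (supp f)" by (rule finite_subset[OF _ assms(3)]) (use assms(4) in auto)
qed

lemma ma_ext:
 assumes "f \<in>[F]" "g \<in>[F]" "!!x. x \<in>[X] ==> f x = g x"
 shows "f = g"
 using assms(1,2) by (intro PiE_ext[of f "carrier X" "\<lambda>_. carrier K" g] assms(3)) (simp_all add: ma_mem_iff)

lemma ma_apply:
 assumes "z \<in>[X]"
 shows "(f +[F] g) z = f z +[K] g z" "(c \<odot>[F] f) z = c *[K] f z" "\<zero>[F] z = \<zero>[K]"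
  "\<one>[F] z = (if z = \<one>[X] then \<one>[K] else \<zero>[K])" "delta K X x z = (if z = x then \<one>[K] else \<zero>[K])"
 using assms by (simp_all add: monoid_algebra_def delta_def)

lemma ma_ops_closed:
 assumes "f \<in>[F]"
 shows "g \<in>[F] ==> f +[F] g \<in>[F]" "c \<in>[K] ==> c \<odot>[F] f \<in>[F]" "\<zero>[F] \<in>[F]"
proof -
 have fin: "finite (supp f)" using assms by (simp add: ma_mem_iff)
 show "f +[F] g \<in>[F]" if g: "g \<in>[F]"
 proof (rule ma_memI[of _ "supp f \<union> supp g"])
  show "finite (supp f \<union> supp g)" using fin g by (simp add: ma_mem_iff)
 qed (simp_all add: ma_apply ma_closed[OF assms] ma_closed[OF g], simp add: monoid_algebra_def)
 show "c \<odot>[F] f \<in>[F]" if c: "c \<in>[K]"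
 proof (rule ma_memI[of _ "supp f"])
  show "finite (supp f)" by (rule fin)
 qed (simp_all add: ma_apply ma_closed[OF assms] c, simp add: monoid_algebra_def)
 show "\<zero>[F] \<in>[F]"
  by (rule ma_memI[of _ "{}"]) (simp_all add: ma_apply, simp add: monoid_algebra_def)
qed

lemma delta_closed: "x \<in>[X] ==> delta K X x \<in>[F]"
 by (rule ma_memI[of _ "{x}"]) (simp_all add: ma_apply, simp add: delta_def)

lemma ma_one: "\<one>[F] = delta K X \<one>[X]"
 by (simp add: monoid_algebra_def delta_def)

lemma ma_module: "module K F"
proof -
 have ag: "abelian_group F"
 proof (rule abelian_groupI)
  fix f assume f: "f \<in>[F]"
  show "\<exists>g\<in>carrier F. g +[F] f = \<zero>[F]"
  proof (rule bexI)
   show "(-[K] \<one>[K]) \<odot>[F] f +[F] f = \<zero>[F]"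
    by (rule ma_ext) (simp_all add: ma_ops_closed(1,2) ma_ops_closed(3)[OF f] f ma_apply ma_closed[OF f] K.l_minus K.l_neg)
  qed (simp add: ma_ops_closed f)
  show "\<zero>[F] +[F] f = f"
   by (rule ma_ext) (simp_all add: ma_ops_closed(1,2) ma_ops_closed(3)[OF f] f ma_apply ma_closed[OF f])
  fix g assume g: "g \<in>[F]"
  show "f +[F] g \<in>[F]" by (rule ma_ops_closed(1)[OF f g])
  show "f +[F] g = g +[F] f"
   by (rule ma_ext) (simp_all add: ma_ops_closed(1) f g ma_apply ma_closed[OF f] ma_closed[OF g] K.a_comm)
  fix h assume h: "h \<in>[F]"
  show "f +[F] g +[F] h = f +[F] (g +[F] h)"
   by (rule ma_ext) (simp_all add: ma_ops_closed(1) f g h ma_apply ma_closed[OF f] ma_closed[OF g] ma_closed[OF h] K.a_assoc)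
 next
  show "\<zero>[F] \<in>[F]" by (rule ma_ops_closed(3)[OF delta_closed[OF X.one_closed]])
 qed
 show ?thesis
  by (rule moduleI[OF K.is_cring ag]; (rule ma_ext)?)
   (simp_all add: ma_ops_closed(1,2) ma_apply ma_closed K.l_distr K.r_distr K.m_assoc)
qed

lemma ma_spanning: "spanning K F (delta K X ` carrier X)"
 unfolding spanning_def
proof (intro conjI allI impI)
 show "delta K X ` carrier X <= carrier F" using delta_closed by auto
 fix N assume N: "submodule N K F" "delta K X ` carrier X <= N"
 note N' = submoduleD[OF N(1)]
 have "\<forall>f\<in>carrier F. (\<forall>x\<in>carrier X. x \<notin> S --> f x = \<zero>[K]) --> f \<in> N" if "finite S" for S
  using that
 proof (induction S rule: finite_induct)
  case empty
  have "f = \<zero>[F]" if f: "f \<in>[F]" "\<forall>x\<in>carrier X. x \<notin> {} --> f x = \<zero>[K]" for f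
   using f by (intro ma_ext[OF f(1) ma_ops_closed(3)[OF f(1)]]) (simp add: ma_apply)
  then show ?case using N'(1) by blast
 next
  case (insert x S)
  show ?case
  proof (intro ballI impI)
   fix f assume f: "f \<in>[F]" "\<forall>y\<in>carrier X. y \<notin> insert x S --> f y = \<zero>[K]"
   show "f \<in> N"
   proof (cases "x \<in>[X]")
    case False
    then have "\<forall>y\<in>carrier X. y \<notin> S --> f y = \<zero>[K]" using f(2) by auto
    then show ?thesis using insert.IH f(1) by blast
   next
    case True
    let ?g = "f(x := \<zero>[K])"
    have g: "?g \<in>[F]"
     by (rule ma_memI[of _ "supp f"]) (use f(1) True in \<open>auto simp: ma_mem_iff\<close>)
    have gN: "?g \<in> N" using insert.IH g f(2) by auto
    have "f = f x \<odot>[F] delta K X x +[F] ?g"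
     by (rule ma_ext[OF f(1)])
      (simp_all add: ma_ops_closed(1,2) ma_closed[OF f(1)] True g delta_closed ma_apply)
    moreover have "f x \<odot>[F] delta K X x +[F] ?g \<in> N"
     using N(2) True by (intro N'(2,4) gN ma_closed[OF f(1)]) auto
    ultimately show ?thesis by simp
   qed
  qed
 qed
 moreover have "finite (supp f)" "\<forall>x\<in>carrier X. x \<notin> supp f --> f x = \<zero>[K]" if "f \<in>[F]" for f
  using that by (simp_all add: ma_mem_iff)
 ultimately show "carrier F <= N" by blast
qed

text \<open>The sum that defines the product runs over the pairs in the supports. Sums over larger finite sets of pairs
  are needed to compare the products of different elements.\<close>

lemma ma_mult_apply:
 assumes "f \<in>[F]" "g \<in>[F]" "finite S" "finite T" "S <= carrier X" "T <= carrier X"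
  and "!!x. [|x \<in>[X]; x \<notin> S|] ==> f x = \<zero>[K]" "!!x. [|x \<in>[X]; x \<notin> T|] ==> g x = \<zero>[K]"
  and z: "z \<in>[X]"
 shows "(f *[F] g) z = (\<Oplus>\<^bsub>K\<^esub>q\<in>S \<times> T. if fst q *[X] snd q = z then f (fst q) *[K] g (snd q) else \<zero>[K])"
proof -
 note fc = ma_closed[OF assms(1)] and gc = ma_closed[OF assms(2)]
 let ?P = "{(x, y). x \<in>[X] \<and> y \<in>[X] \<and> f x ~= \<zero>[K] \<and> g y ~= \<zero>[K] \<and> x *[X] y = z}"
 have "(f *[F] g) z = (\<Oplus>\<^bsub>K\<^esub>q \<in> ?P. f (fst q) *[K] g (snd q))"
  using z by (simp add: monoid_algebra_def)
 also have "... = (\<Oplus>\<^bsub>K\<^esub>q\<in>S \<times> T. if fst q *[X] snd q = z then f (fst q) *[K] g (snd q) else \<zero>[K])"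
 proof (rule K.add.finprod_mono_neutral_cong_left)
  show "finite (S \<times> T)" using assms by simp
  show "?P <= S \<times> T" using assms(7,8) by auto
  show "(\<lambda>q. if fst q *[X] snd q = z then f (fst q) *[K] g (snd q) else \<zero>[K]) \<in> S \<times> T \<rightarrow> carrier K"
   using assms(5,6) fc gc by (auto simp: subset_iff)
  show "(if fst q *[X] snd q = z then f (fst q) *[K] g (snd q) else \<zero>[K]) = \<zero>[K]" if q: "q \<in> S \<times> T - ?P" for q
  proof -
   have "fst q \<in>[X]" "snd q \<in>[X]" using q assms(5,6) by auto
   then show ?thesis using q fc gc by (cases q) auto
  qed
 qed auto
 finally show ?thesis .
qed

lemma ma_mult_closed:
 assumes "f \<in>[F]" "g \<in>[F]"
 shows "f *[F] g \<in>[F]"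
proof -
 have fin: "finite (supp f)" "finite (supp g)" using assms by (simp_all add: ma_mem_iff)
 have eq: "(f *[F] g) z = (\<Oplus>\<^bsub>K\<^esub>q\<in>supp f \<times> supp g. if fst q *[X] snd q = z then f (fst q) *[K] g (snd q) else \<zero>[K])"
  if "z \<in>[X]" for z
  using that fin by (intro ma_mult_apply assms) auto
 show ?thesis
 proof (rule ma_memI[of _ "(\<lambda>q. fst q *[X] snd q) ` (supp f \<times> supp g)"])
  show "(f *[F] g) z \<in>[K]" if "z \<in>[X]" for z
   unfolding eq[OF that] using ma_closed[OF assms(1)] ma_closed[OF assms(2)]
   by (intro K.finsum_closed) auto
  show "(f *[F] g) z = undefined" if "z \<notin> carrier X" for z
   using that by (simp add: monoid_algebra_def)
  show "(f *[F] g) z = \<zero>[K]" if z: "z \<in>[X]" "z \<notin> (\<lambda>q. fst q *[X] snd q) ` (supp f \<times> supp g)" for z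
   unfolding eq[OF z(1)] using z(2) by (intro K.add.finprod_one_eqI) force
 qed (use fin in simp)
qed

lemma ma_mult_delta:
 assumes "x \<in>[X]" "y \<in>[X]"
 shows "delta K X x *[F] delta K X y = delta K X (x *[X] y)"
proof (rule ma_ext)
 fix z assume z: "z \<in>[X]"
 have "(delta K X x *[F] delta K X y) z = (\<Oplus>\<^bsub>K\<^esub>q\<in>{x} \<times> {y}. if fst q *[X] snd q = z
   then delta K X x (fst q) *[K] delta K X y (snd q) else \<zero>[K])"
  using assms z by (intro ma_mult_apply) (auto simp: delta_closed ma_apply)
 also have "... = delta K X (x *[X] y) z"
  using assms z by (simp add: ma_apply)
 finally show "(delta K X x *[F] delta K X y) z = delta K X (x *[X] y) z" .
qed (use assms in \<open>simp_all add: ma_mult_closed delta_closed\<close>)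

lemma ma_mult_distr:
 assumes f: "f \<in>[F]" and g: "g \<in>[F]" and h: "h \<in>[F]"
 shows "(f +[F] g) *[F] h = f *[F] h +[F] g *[F] h" and "h *[F] (f +[F] g) = h *[F] f +[F] h *[F] g"
proof -
 let ?S = "supp f \<union> supp g" and ?T = "supp h"
 have fin: "finite ?S" "finite ?T" using assms by (simp_all add: ma_mem_iff)
 note c = ma_closed[OF f] ma_closed[OF g] ma_closed[OF h] ma_ops_closed[OF f] ma_mult_closed
 have s: "f x = \<zero>[K]" "g x = \<zero>[K]" if "x \<in>[X]" "x \<notin> ?S" for x using that by auto
 have t: "h x = \<zero>[K]" if "x \<in>[X]" "x \<notin> ?T" for x using that by auto
 have sub: "?S <= carrier X" "?T <= carrier X" by auto
 have fg: "(f +[F] g) x = \<zero>[K]" if "x \<in>[X]" "x \<notin> ?S" for x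
  using s[OF that] that(1) by (simp add: ma_apply)
 show "(f +[F] g) *[F] h = f *[F] h +[F] g *[F] h"
 proof (rule ma_ext)
  fix z assume z: "z \<in>[X]"
  have "((f +[F] g) *[F] h) z = (\<Oplus>\<^bsub>K\<^esub>q\<in>?S \<times> ?T. if fst q *[X] snd q = z then (f +[F] g) (fst q) *[K] h (snd q) else \<zero>[K])"
   by (rule ma_mult_apply[OF c(4)[OF g] h fin sub fg t z])
  also have "... = (\<Oplus>\<^bsub>K\<^esub>q\<in>?S \<times> ?T. (if fst q *[X] snd q = z then f (fst q) *[K] h (snd q) else \<zero>[K])
    +[K] (if fst q *[X] snd q = z then g (fst q) *[K] h (snd q) else \<zero>[K]))"
   by (rule K.finsum_cong') (auto simp add: Pi_iff c ma_apply K.l_distr)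
  also have "... = (\<Oplus>\<^bsub>K\<^esub>q\<in>?S \<times> ?T. if fst q *[X] snd q = z then f (fst q) *[K] h (snd q) else \<zero>[K]) +[K] (\<Oplus>\<^bsub>K\<^esub>q\<in>?S \<times> ?T. if fst q *[X] snd q = z then g (fst q) *[K] h (snd q) else \<zero>[K])"
   by (rule K.finsum_addf) (auto simp add: Pi_iff c)
  also have "(\<Oplus>\<^bsub>K\<^esub>q\<in>?S \<times> ?T. if fst q *[X] snd q = z then f (fst q) *[K] h (snd q) else \<zero>[K]) = (f *[F] h) z" by (rule ma_mult_apply[OF f h fin sub s(1) t z, symmetric])
  also have "(\<Oplus>\<^bsub>K\<^esub>q\<in>?S \<times> ?T. if fst q *[X] snd q = z then g (fst q) *[K] h (snd q) else \<zero>[K]) = (g *[F] h) z" by (rule ma_mult_apply[OF g h fin sub s(2) t z, symmetric])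
  finally show "((f +[F] g) *[F] h) z = ((f *[F] h) +[F] (g *[F] h)) z" unfolding ma_apply(1)[OF z] .
 qed (simp_all add: c f g h ma_ops_closed(1))
 show "h *[F] (f +[F] g) = h *[F] f +[F] h *[F] g"
 proof (rule ma_ext)
  fix z assume z: "z \<in>[X]"
  have "(h *[F] (f +[F] g)) z = (\<Oplus>\<^bsub>K\<^esub>q\<in>?T \<times> ?S. if fst q *[X] snd q = z then h (fst q) *[K] (f +[F] g) (snd q) else \<zero>[K])"
   by (rule ma_mult_apply[OF h c(4)[OF g] fin(2,1) sub(2,1) t fg z])
  also have "... = (\<Oplus>\<^bsub>K\<^esub>q\<in>?T \<times> ?S. (if fst q *[X] snd q = z then h (fst q) *[K] f (snd q) else \<zero>[K])
    +[K] (if fst q *[X] snd q = z then h (fst q) *[K] g (snd q) else \<zero>[K]))"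
   by (rule K.finsum_cong') (auto simp add: Pi_iff c ma_apply K.r_distr)
  also have "... = (\<Oplus>\<^bsub>K\<^esub>q\<in>?T \<times> ?S. if fst q *[X] snd q = z then h (fst q) *[K] f (snd q) else \<zero>[K]) +[K] (\<Oplus>\<^bsub>K\<^esub>q\<in>?T \<times> ?S. if fst q *[X] snd q = z then h (fst q) *[K] g (snd q) else \<zero>[K])"
   by (rule K.finsum_addf) (auto simp add: Pi_iff c)
  also have "(\<Oplus>\<^bsub>K\<^esub>q\<in>?T \<times> ?S. if fst q *[X] snd q = z then h (fst q) *[K] f (snd q) else \<zero>[K]) = (h *[F] f) z" by (rule ma_mult_apply[OF h f fin(2,1) sub(2,1) t s(1) z, symmetric])
  also have "(\<Oplus>\<^bsub>K\<^esub>q\<in>?T \<times> ?S. if fst q *[X] snd q = z then h (fst q) *[K] g (snd q) else \<zero>[K]) = (h *[F] g) z" by (rule ma_mult_apply[OF h g fin(2,1) sub(2,1) t s(2) z, symmetric])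
  finally show "(h *[F] (f +[F] g)) z = ((h *[F] f) +[F] (h *[F] g)) z" unfolding ma_apply(1)[OF z] .
 qed (simp_all add: c f g h ma_ops_closed(1))
qed

lemma ma_mult_smult:
 assumes f: "f \<in>[F]" and h: "h \<in>[F]" and a: "a \<in>[K]"
 shows "(a \<odot>[F] f) *[F] h = a \<odot>[F] (f *[F] h)" and "f *[F] (a \<odot>[F] h) = a \<odot>[F] (f *[F] h)"
proof -
 let ?S = "supp f" and ?T = "supp h"
 have fin: "finite ?S" "finite ?T" using assms by (simp_all add: ma_mem_iff)
 note c = ma_closed[OF f] ma_closed[OF h] ma_ops_closed[OF f] ma_mult_closed
 have s: "f x = \<zero>[K]" if "x \<in>[X]" "x \<notin> ?S" for x using that by auto
 have t: "h x = \<zero>[K]" if "x \<in>[X]" "x \<notin> ?T" for x using that by auto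
 have sub: "?S <= carrier X" "?T <= carrier X" by auto
 have as: "(a \<odot>[F] f) x = \<zero>[K]" if "x \<in>[X]" "x \<notin> ?S" for x
  using s[OF that] that(1) a by (simp add: ma_apply)
 have at: "(a \<odot>[F] h) x = \<zero>[K]" if "x \<in>[X]" "x \<notin> ?T" for x
  using t[OF that] that(1) a by (simp add: ma_apply)
 let ?s = "\<lambda>z q. if fst q *[X] snd q = z then f (fst q) *[K] h (snd q) else \<zero>[K]"
 have scale: "a *[K] (\<Oplus>\<^bsub>K\<^esub>q\<in>?S \<times> ?T. ?s z q) = (\<Oplus>\<^bsub>K\<^esub>q\<in>?S \<times> ?T. a *[K] ?s z q)" for z
  using fin a by (intro K.finsum_rdistr) (auto simp: c)
 show "(a \<odot>[F] f) *[F] h = a \<odot>[F] (f *[F] h)"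
 proof (rule ma_ext)
  fix z assume z: "z \<in>[X]"
  have "((a \<odot>[F] f) *[F] h) z = (\<Oplus>\<^bsub>K\<^esub>q\<in>?S \<times> ?T. if fst q *[X] snd q = z
    then (a \<odot>[F] f) (fst q) *[K] h (snd q) else \<zero>[K])"
   by (rule ma_mult_apply[OF c(4)[OF a] h fin sub as t z])
  also have "... = (\<Oplus>\<^bsub>K\<^esub>q\<in>?S \<times> ?T. a *[K] ?s z q)"
   by (rule K.finsum_cong') (auto simp: Pi_iff c a ma_apply K.m_assoc)
  also have "... = (a \<odot>[F] (f *[F] h)) z"
   unfolding scale[symmetric] ma_apply(2)[OF z]
   by (rule arg_cong[where f="\<lambda>u. a *[K] u"], rule ma_mult_apply[OF f h fin sub s t z, symmetric])
  finally show "((a \<odot>[F] f) *[F] h) z = (a \<odot>[F] (f *[F] h)) z" .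
 qed (simp_all add: c f h a ma_ops_closed(2))
 show "f *[F] (a \<odot>[F] h) = a \<odot>[F] (f *[F] h)"
 proof (rule ma_ext)
  fix z assume z: "z \<in>[X]"
  have "(f *[F] (a \<odot>[F] h)) z = (\<Oplus>\<^bsub>K\<^esub>q\<in>?S \<times> ?T. if fst q *[X] snd q = z
    then f (fst q) *[K] (a \<odot>[F] h) (snd q) else \<zero>[K])"
   by (rule ma_mult_apply[OF f ma_ops_closed(2)[OF h a] fin sub s at z])
  also have "... = (\<Oplus>\<^bsub>K\<^esub>q\<in>?S \<times> ?T. a *[K] ?s z q)"
   by (rule K.finsum_cong') (auto simp: Pi_iff c a ma_apply K.m_lcomm)
  also have "... = (a \<odot>[F] (f *[F] h)) z"
   unfolding scale[symmetric] ma_apply(2)[OF z]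
   by (rule arg_cong[where f="\<lambda>u. a *[K] u"], rule ma_mult_apply[OF f h fin sub s t z, symmetric])
  finally show "(f *[F] (a \<odot>[F] h)) z = (a \<odot>[F] (f *[F] h)) z" .
 qed (simp_all add: c f h a ma_ops_closed(2))
qed

text \<open>The product is bilinear and multiplies the basis \<open>delta\<close> as the monoid does, so associativity and the unit
  laws are inherited from the monoid.\<close>

lemma assoc_monoid_algebra: "assoc_algebra K F"
proof -
 interpret F: module K F by (rule ma_module)
 note cl = ma_mult_closed F.M.a_closed F.smult_closed delta_closed
 note bil = ma_mult_distr ma_mult_smult
 note ind = spanning_induct[OF ma_module ma_spanning, consumes 1, case_names gen zero add smult]
 have zero: "\<zero>[F] *[F] g = \<zero>[F]" "g *[F] \<zero>[F] = \<zero>[F]" if "g \<in>[F]" for g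
 proof -
  have "\<zero>[F] = \<zero>[K] \<odot>[F] \<zero>[F]" by simp
  then show "\<zero>[F] *[F] g = \<zero>[F]" "g *[F] \<zero>[F] = \<zero>[F]"
   using that bil(3)[of "\<zero>[F]" g "\<zero>[K]"] bil(4)[of g "\<zero>[F]" "\<zero>[K]"] by (simp_all add: cl)
 qed
 have 1: "delta K X x *[F] delta K X y *[F] h = delta K X x *[F] (delta K X y *[F] h)"
  if "x \<in>[X]" "y \<in>[X]" "h \<in>[F]" for x y h
  using that(3) by (induction rule: ind) (use that(1,2) in \<open>auto simp: ma_mult_delta X.m_assoc bil cl zero\<close>)
 have 2: "delta K X x *[F] g *[F] h = delta K X x *[F] (g *[F] h)"
  if "x \<in>[X]" "g \<in>[F]" "h \<in>[F]" for x g h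
  using that(2) by (induction rule: ind) (use that(1,3) in \<open>auto simp: 1 bil cl zero\<close>)
 have 3: "f *[F] g *[F] h = f *[F] (g *[F] h)"
  if "f \<in>[F]" "g \<in>[F]" "h \<in>[F]" for f g h
  using that(1) by (induction rule: ind) (use that(2,3) in \<open>auto simp: 2 bil cl zero\<close>)
 have 4: "\<one>[F] *[F] f = f \<and> f *[F] \<one>[F] = f" if "f \<in>[F]" for f
  using that unfolding ma_one by (induction rule: ind) (auto simp: ma_mult_delta bil cl zero)
 have "Group.monoid F"
  by (rule monoidI) (auto simp: cl 3 4[unfolded ma_one] ma_one)
 then have "ring F"
  by (intro ringI F.M.abelian_group_axioms) (auto simp: bil)
 then show ?thesis
  by (intro assoc_algebraI K ma_module) (auto simp: bil)
qed

text \<open>The universal property of the free vector space.\<close>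

lemma ma_lift:
 assumes N: "module K N" and \<phi>: "!!x. x \<in>[X] ==> \<phi> x \<in>[N]"
 shows "\<exists>f \<in> lin_maps K F N. \<forall>x\<in>carrier X. f (delta K X x) = \<phi> x"
proof -
 interpret N: module K N by fact
 define f where "f = (\<lambda>g\<in>carrier F. \<Oplus>\<^bsub>N\<^esub>x\<in>supp g. g x \<odot>[N] \<phi> x)"
 have f: "f g = (\<Oplus>\<^bsub>N\<^esub>x\<in>S. g x \<odot>[N] \<phi> x)" if g: "g \<in>[F]" "finite S" "S <= carrier X"
  "!!x. [|x \<in>[X]; x \<notin> S|] ==> g x = \<zero>[K]" for g S
 proof -
  have "(\<Oplus>\<^bsub>N\<^esub>x\<in>supp g. g x \<odot>[N] \<phi> x) = (\<Oplus>\<^bsub>N\<^esub>x\<in>S. g x \<odot>[N] \<phi> x)"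
  proof (rule N.M.add.finprod_mono_neutral_cong_left)
   show "g x \<odot>[N] \<phi> x = \<zero>[N]" if "x \<in> S - supp g" for x
    using that g(3) \<phi> by auto
   show "(\<lambda>x. g x \<odot>[N] \<phi> x) \<in> S \<rightarrow> carrier N"
    using g(3) \<phi> ma_closed[OF g(1)] by (auto simp: subset_iff)
  qed (use g in auto)
  then show ?thesis using g(1) by (simp add: f_def)
 qed
 have fc: "f g \<in>[N]" if "g \<in>[F]" for g
  using that \<phi> ma_closed[OF that] by (auto simp: f_def intro!: N.M.finsum_closed)
 interpret F: module K F by (rule ma_module)
 have "f \<in> lin_maps K F N"
 proof (rule lin_mapsI)
  show "f g = undefined" if "g \<notin> carrier F" for g using that by (simp add: f_def)
  show "f (g +[F] h) = f g +[N] f h" if gh: "g \<in>[F]" "h \<in>[F]" for g h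
  proof -
   let ?S = "supp g \<union> supp h"
   have fin: "finite ?S" "?S <= carrier X" using gh by (auto simp: ma_mem_iff)
   note c = ma_closed[OF gh(1)] ma_closed[OF gh(2)]
   have "f (g +[F] h) = (\<Oplus>\<^bsub>N\<^esub>x\<in>?S. (g +[F] h) x \<odot>[N] \<phi> x)"
    by (rule f[OF F.M.a_closed[OF gh] fin]) (auto simp: ma_apply)
   also have "... = (\<Oplus>\<^bsub>N\<^esub>x\<in>?S. g x \<odot>[N] \<phi> x +[N] h x \<odot>[N] \<phi> x)"
    by (rule N.M.finsum_cong') (auto simp: ma_apply c \<phi> N.smult_l_distr)
   also have "... = (\<Oplus>\<^bsub>N\<^esub>x\<in>?S. g x \<odot>[N] \<phi> x) +[N] (\<Oplus>\<^bsub>N\<^esub>x\<in>?S. h x \<odot>[N] \<phi> x)"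
    by (rule N.M.finsum_addf) (auto simp: c \<phi>)
   also have "(\<Oplus>\<^bsub>N\<^esub>x\<in>?S. g x \<odot>[N] \<phi> x) = f g" by (rule f[OF gh(1) fin, symmetric]) auto
   also have "(\<Oplus>\<^bsub>N\<^esub>x\<in>?S. h x \<odot>[N] \<phi> x) = f h" by (rule f[OF gh(2) fin, symmetric]) auto
   finally show ?thesis .
  qed
  show "f (a \<odot>[F] g) = a \<odot>[N] f g" if ag: "a \<in>[K]" "g \<in>[F]" for a g
  proof -
   have fin: "finite (supp g)" "supp g <= carrier X" using ag by (auto simp: ma_mem_iff)
   note c = ma_closed[OF ag(2)]
   have "f (a \<odot>[F] g) = (\<Oplus>\<^bsub>N\<^esub>x\<in>supp g. (a \<odot>[F] g) x \<odot>[N] \<phi> x)"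
    by (rule f[OF F.smult_closed[OF ag] fin]) (use ag in \<open>auto simp: ma_apply\<close>)
   also have "... = (\<Oplus>\<^bsub>N\<^esub>x\<in>supp g. a \<odot>[N] (g x \<odot>[N] \<phi> x))"
    by (rule N.M.finsum_cong') (auto simp: ma_apply c ag \<phi> N.smult_assoc1)
   also have "... = a \<odot>[N] (\<Oplus>\<^bsub>N\<^esub>x\<in>supp g. g x \<odot>[N] \<phi> x)"
    by (rule N.finsum_smult_ldistr[symmetric]) (auto simp: c ag \<phi> fin)
   also have "... = a \<odot>[N] f g" using ag by (simp add: f_def)
   finally show ?thesis .
  qed
 qed (rule fc)
 moreover have "f (delta K X x) = \<phi> x" if x: "x \<in>[X]" for x
 proof -
  have "f (delta K X x) = (\<Oplus>\<^bsub>N\<^esub>y\<in>{x}. delta K X x y \<odot>[N] \<phi> y)"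
   by (rule f[OF delta_closed[OF x]]) (use x in \<open>auto simp: ma_apply\<close>)
  also have "... = \<phi> x" using x \<phi> by (simp add: ma_apply)
  finally show ?thesis .
 qed
 ultimately show ?thesis by blast
qed

lemma ma_lift_hom:
 assumes B: "assoc_algebra K B" and \<phi>: "!!x. x \<in>[X] ==> \<phi> x \<in>[B]"
  and one: "\<phi> \<one>[X] = \<one>[B]" and mult: "!!x y. [|x \<in>[X]; y \<in>[X]|] ==> \<phi> (x *[X] y) = \<phi> x *[B] \<phi> y"
 shows "\<exists>f \<in> alg_homs K F B. \<forall>x\<in>carrier X. f (delta K X x) = \<phi> x"
proof -
 interpret B: ring B by (rule algD[OF B])
 interpret MB: module K B by (rule algD[OF B])
 interpret F: ring F by (rule algD[OF assoc_monoid_algebra])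
 interpret MF: module K F by (rule ma_module)
 have "\<exists>f \<in> lin_maps K F B. \<forall>x\<in>carrier X. f (delta K X x) = \<phi> x"
  by (rule ma_lift[OF MB.module_axioms \<phi>])
 then obtain f where f: "f \<in> lin_maps K F B" and f': "\<forall>x\<in>carrier X. f (delta K X x) = \<phi> x" by (elim bexE)
 note f = f bspec[OF f']
 note ind = spanning_induct[OF ma_module ma_spanning, consumes 1, case_names gen zero add smult]
 note smF = alg_smult[OF assoc_monoid_algebra] and smB = alg_smult[OF B]
 note lin = lin_add[OF f(1)] lin_smult[OF f(1)] lin_zero[OF ma_module MB.module_axioms f(1)] lin_closed[OF f(1)]
 have 1: "f (delta K X x *[F] h) = f (delta K X x) *[B] f h"
  if "x \<in>[X]" "h \<in>[F]" for x h
  using that(2) by (induction rule: ind)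
   (use that(1) \<phi> in \<open>auto simp: ma_mult_delta delta_closed f(2) mult lin F.r_distr B.r_distr smF smB\<close>)
 have 2: "f (g *[F] h) = f g *[B] f h"
  if "g \<in>[F]" "h \<in>[F]" for g h
  using that(1) by (induction rule: ind)
   (use that(2) in \<open>auto simp: 1 delta_closed lin F.l_distr B.l_distr smF smB\<close>)
 have "f \<in> alg_homs K F B"
  by (rule alg_homsI[OF f(1)]) (simp_all add: 2 ma_one f(2) one)
 then show ?thesis using f(2) by blast
qed

end

section \<open>Tensor products\<close>

definition linear_on ::
 "('k, 'm) ring_scheme => ('k, 'a, 'n) module_scheme => ('k, 'b, 'o) module_scheme => ('a => 'b) => bool"
 where "linear_on K M N f \<longleftrightarrow> (\<lambda>x\<in>carrier M. f x) \<in> lin_maps K M N"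

lemma linear_on_lin:
 assumes "module K M" "f \<in> lin_maps K M N" shows "linear_on K M N f"
 unfolding linear_on_def
 by (rule lin_restrictI[OF assms(1)]) (simp_all add: lin_closed[OF assms(2)] lin_add[OF assms(2)] lin_smult[OF assms(2)])

lemma linear_onI:
 assumes "module K M"
  and "!!x. x \<in>[M] ==> f x \<in>[N]"
  and "!!x y. [|x \<in>[M]; y \<in>[M]|] ==> f (x +[M] y) = f x +[N] f y"
  and "!!c x. [|c \<in>[K]; x \<in>[M]|] ==> f (c \<odot>[M] x) = c \<odot>[N] f x"
 shows "linear_on K M N f"
 unfolding linear_on_def by (rule lin_restrictI[OF assms])

lemma linear_on_id: "module K M ==> linear_on K M M (\<lambda>x. x)"
 by (rule linear_onI) simp_all

lemma linear_onD:
 assumes "module K M" "linear_on K M N f" "x \<in>[M]"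
 shows "f x \<in>[N]"
  "y \<in>[M] ==> f (x +[M] y) = f x +[N] f y"
  "c \<in>[K] ==> f (c \<odot>[M] x) = c \<odot>[N] f x"
proof -
 interpret M: module K M by fact
 note f = assms(2)[unfolded linear_on_def]
 show "f x \<in>[N]" using lin_closed[OF f assms(3)] assms(3) by simp
 show "f (x +[M] y) = f x +[N] f y" if "y \<in>[M]"
  using lin_add[OF f assms(3) that] assms(3) that by simp
 show "f (c \<odot>[M] x) = c \<odot>[N] f x" if "c \<in>[K]"
  using lin_smult[OF f that assms(3)] assms(3) that by simp
qed

definition bilinear_map ::
 "('k, 'm) ring_scheme => ('k, 'a, 'n) module_scheme => ('k, 'b, 'o) module_scheme
  => ('k, 'c, 'q) module_scheme => ('a => 'b => 'c) => bool"
 where "bilinear_map K A B N \<beta> \<longleftrightarrow>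
  (\<forall>b\<in>carrier B. linear_on K A N (\<lambda>a. \<beta> a b)) \<and> (\<forall>a\<in>carrier A. linear_on K B N (\<beta> a))"

lemma bilinear_mapI:
 assumes "module K A" "module K B"
  and "!!a b. [|a \<in>[A]; b \<in>[B]|] ==> \<beta> a b \<in>[N]"
  and "!!a a' b. [|a \<in>[A]; a' \<in>[A]; b \<in>[B]|] ==> \<beta> (a +[A] a') b = \<beta> a b +[N] \<beta> a' b"
  and "!!a b b'. [|a \<in>[A]; b \<in>[B]; b' \<in>[B]|] ==> \<beta> a (b +[B] b') = \<beta> a b +[N] \<beta> a b'"
  and "!!c a b. [|c \<in>[K]; a \<in>[A]; b \<in>[B]|] ==> \<beta> (c \<odot>[A] a) b = c \<odot>[N] \<beta> a b"
  and "!!c a b. [|c \<in>[K]; a \<in>[A]; b \<in>[B]|] ==> \<beta> a (c \<odot>[B] b) = c \<odot>[N] \<beta> a b"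
 shows "bilinear_map K A B N \<beta>"
 unfolding bilinear_map_def using assms(3-)
 by (intro conjI ballI linear_onI[OF assms(1)] linear_onI[OF assms(2)])

lemma bilinear_mapD:
 assumes "module K A" "module K B" "bilinear_map K A B N \<beta>" "a \<in>[A]" "b \<in>[B]"
 shows "\<beta> a b \<in>[N]"
  "a' \<in>[A] ==> \<beta> (a +[A] a') b = \<beta> a b +[N] \<beta> a' b"
  "b' \<in>[B] ==> \<beta> a (b +[B] b') = \<beta> a b +[N] \<beta> a b'"
  "c \<in>[K] ==> \<beta> (c \<odot>[A] a) b = c \<odot>[N] \<beta> a b"
  "c \<in>[K] ==> \<beta> a (c \<odot>[B] b) = c \<odot>[N] \<beta> a b"
proof -
 have l: "linear_on K A N (\<lambda>a. \<beta> a b)" and r: "linear_on K B N (\<beta> a)"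
  using assms by (simp_all add: bilinear_map_def)
 show "\<beta> a b \<in>[N]" by (rule linear_onD(1)[OF assms(2) r assms(5)])
 show "a' \<in>[A] ==> \<beta> (a +[A] a') b = \<beta> a b +[N] \<beta> a' b" by (rule linear_onD(2)[OF assms(1) l assms(4)])
 show "b' \<in>[B] ==> \<beta> a (b +[B] b') = \<beta> a b +[N] \<beta> a b'" by (rule linear_onD(2)[OF assms(2) r assms(5)])
 show "c \<in>[K] ==> \<beta> (c \<odot>[A] a) b = c \<odot>[N] \<beta> a b" by (rule linear_onD(3)[OF assms(1) l assms(4)])
 show "c \<in>[K] ==> \<beta> a (c \<odot>[B] b) = c \<odot>[N] \<beta> a b" by (rule linear_onD(3)[OF assms(2) r assms(5)])
qed

lemma submodule_span:
 assumes "module K M" "S <= carrier M"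
 shows "submodule (submodule_span K M S) K M" "S <= submodule_span K M S"
  "!!N. [|submodule N K M; S <= N|] ==> submodule_span K M S <= N"
proof -
 have "submodule (carrier M) K M" by (rule module.carrier_is_submodule[OF assms(1)])
 then have "submodule_span K M S <= carrier M" using assms(2) unfolding submodule_span_def by blast
 then show "submodule (submodule_span K M S) K M"
 proof (rule submoduleI'[OF assms(1)])
  show "\<zero>[M] \<in> submodule_span K M S"
   unfolding submodule_span_def by (blast intro: submoduleD(1))
  fix a b assume "a \<in> submodule_span K M S" "b \<in> submodule_span K M S"
  then show "a +[M] b \<in> submodule_span K M S"
   unfolding submodule_span_def by (blast intro: submoduleD(2))
 next
  fix c a assume "c \<in>[K]" "a \<in> submodule_span K M S"
  then show "c \<odot>[M] a \<in> submodule_span K M S"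
   unfolding submodule_span_def by (blast intro: submoduleD(4))
 qed
 show "S <= submodule_span K M S" by (auto simp: submodule_span_def)
 show "!!N. [|submodule N K M; S <= N|] ==> submodule_span K M S <= N" by (auto simp: submodule_span_def)
qed

text \<open>Both sides of the multiplicativity are bilinear, hence it can be tested on a spanning set.\<close>

lemma alg_hom_on_spanning:
 assumes A: "assoc_algebra K A" and B: "assoc_algebra K B" and S: "spanning K A S"
  and f: "f \<in> lin_maps K A B" and one: "f \<one>[A] = \<one>[B]"
  and mult: "!!s t. [|s \<in> S; t \<in> S|] ==> f (s *[A] t) = f s *[B] f t"
 shows "f \<in> alg_homs K A B"
proof -
 interpret A: ring A by (rule algD[OF A])
 interpret B: ring B by (rule algD[OF B])
 interpret MA: module K A by (rule algD[OF A])
 interpret MB: module K B by (rule algD[OF B])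
 have Sc: "s \<in>[A]" if "s \<in> S" for s using S that by (auto simp: spanning_def)
 note ind = spanning_induct[OF MA.module_axioms S, consumes 1, case_names gen zero add smult]
 note lin = lin_add[OF f] lin_smult[OF f] lin_zero[OF MA.module_axioms MB.module_axioms f] lin_closed[OF f]
 note sm = alg_smult[OF A] alg_smult[OF B]
 have 1: "f (s *[A] y) = f s *[B] f y" if "s \<in> S" "y \<in>[A]" for s y
  using that(2) by (induction rule: ind)
   (simp_all add: mult[OF that(1)] Sc[OF that(1)] lin A.r_distr B.r_distr sm)
 have 2: "f (x *[A] y) = f x *[B] f y" if "x \<in>[A]" "y \<in>[A]" for x y
  using that(1) by (induction rule: ind)
   (simp_all add: 1 that(2) lin A.l_distr B.l_distr sm)
 show ?thesis by (rule alg_homsI[OF f one 2])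
qed

context
 fixes K :: "('k, 'm) ring_scheme" and A :: "('k, 'a, 'n) module_scheme" and B :: "('k, 'b, 'o) module_scheme"
 assumes A: "assoc_algebra K A" and B: "assoc_algebra K B"
begin

interpretation K: field K by (rule algD[OF A])
interpretation A: ring A by (rule algD[OF A])
interpretation B: ring B by (rule algD[OF B])
interpretation MA: module K A by (rule algD[OF A])
interpretation MB: module K B by (rule algD[OF B])

private abbreviation "X == A \<times>\<times> B"
private abbreviation "FX == monoid_algebra K X"
private abbreviation "d a b == delta K X (a, b)"
private abbreviation "N == tensor_null K A B"
private abbreviation "T == tensor K A B"

private lemma X: "Group.monoid X"
 by (rule DirProd_monoid[OF A.monoid_axioms B.monoid_axioms])

private lemma FX: "assoc_algebra K FX"
 by (rule assoc_monoid_algebra[OF K.field_axioms X])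

interpretation FX: ring FX by (rule algD[OF FX])
interpretation MF: module K FX by (rule algD[OF FX])

private lemma dc: "[|a \<in>[A]; b \<in>[B]|] ==> d a b \<in>[FX]"
 by (rule delta_closed[OF K.field_axioms X]) simp

private lemma dm: "[|a \<in>[A]; b \<in>[B]; a' \<in>[A]; b' \<in>[B]|]
  ==> d a b *[FX] d a' b' = d (a *[A] a') (b *[B] b')"
 using ma_mult_delta[OF K.field_axioms X, of "(a, b)" "(a', b')"] by simp

private lemma spanF: "spanning K FX {d a b |a b. a \<in>[A] \<and> b \<in>[B]}"
proof -
 have "delta K X ` carrier X = {d a b |a b. a \<in>[A] \<and> b \<in>[B]}" by auto
 then show ?thesis using ma_spanning[OF K.field_axioms X] by simp
qed

private lemma rels_cases:
 assumes "r \<in> bilinear_rels K A B"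
  and "!!a a' b. [|r = d (a +[A] a') b -[FX] (d a b +[FX] d a' b); a \<in>[A]; a' \<in>[A]; b \<in>[B]|] ==> P"
  and "!!a b b'. [|r = d a (b +[B] b') -[FX] (d a b +[FX] d a b'); a \<in>[A]; b \<in>[B]; b' \<in>[B]|] ==> P"
  and "!!c a b. [|r = d (c \<odot>[A] a) b -[FX] (c \<odot>[FX] d a b); c \<in>[K]; a \<in>[A]; b \<in>[B]|] ==> P"
  and "!!c a b. [|r = d a (c \<odot>[B] b) -[FX] (c \<odot>[FX] d a b); c \<in>[K]; a \<in>[A]; b \<in>[B]|] ==> P"
 shows P
 using assms(1) unfolding bilinear_rels_def Let_def Un_iff mem_Collect_eq
 by (elim disjE exE conjE)
  ((rule assms(2), assumption, assumption, assumption, assumption)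
  | (rule assms(3), assumption, assumption, assumption, assumption)
  | (rule assms(4), assumption, assumption, assumption, assumption)
  | (rule assms(5), assumption, assumption, assumption, assumption))+

private lemma rels:
 "[|a \<in>[A]; a' \<in>[A]; b \<in>[B]|] ==> d (a +[A] a') b -[FX] (d a b +[FX] d a' b) \<in> bilinear_rels K A B"
 "[|a \<in>[A]; b \<in>[B]; b' \<in>[B]|] ==> d a (b +[B] b') -[FX] (d a b +[FX] d a b') \<in> bilinear_rels K A B"
 "[|c \<in>[K]; a \<in>[A]; b \<in>[B]|] ==> d (c \<odot>[A] a) b -[FX] (c \<odot>[FX] d a b) \<in> bilinear_rels K A B"
 "[|c \<in>[K]; a \<in>[A]; b \<in>[B]|] ==> d a (c \<odot>[B] b) -[FX] (c \<odot>[FX] d a b) \<in> bilinear_rels K A B"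
 unfolding bilinear_rels_def Let_def by blast+

private lemma rels_closed: "bilinear_rels K A B <= carrier FX"
proof
 fix r assume "r \<in> bilinear_rels K A B"
 then show "r \<in>[FX]" by (rule rels_cases) (simp_all add: dc)
qed

private lemma expand:
 assumes "u \<in>[FX]" "f \<in>[FX]" "g \<in>[FX]"
 shows "h \<in>[FX] ==> u *[FX] (f -[FX] (g +[FX] h)) = u *[FX] f -[FX] (u *[FX] g +[FX] u *[FX] h)"
  "h \<in>[FX] ==> (f -[FX] (g +[FX] h)) *[FX] u = f *[FX] u -[FX] (g *[FX] u +[FX] h *[FX] u)"
  "c \<in>[K] ==> u *[FX] (f -[FX] (c \<odot>[FX] g)) = u *[FX] f -[FX] (c \<odot>[FX] (u *[FX] g))"
  "c \<in>[K] ==> (f -[FX] (c \<odot>[FX] g)) *[FX] u = f *[FX] u -[FX] (c \<odot>[FX] (g *[FX] u))"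
 using assms by (simp_all add: a_minus_def FX.r_distr FX.l_distr FX.r_minus FX.l_minus FX.minus_add alg_smult[OF FX])

private lemma rels_mult:
 assumes r: "r \<in> bilinear_rels K A B" and ab: "a \<in>[A]" "b \<in>[B]"
 shows "d a b *[FX] r \<in> bilinear_rels K A B" "r *[FX] d a b \<in> bilinear_rels K A B"
proof -
 note s = expand dc ab dm A.r_distr A.l_distr B.r_distr B.l_distr alg_smult[OF A] alg_smult[OF B] rels
 from r show "d a b *[FX] r \<in> bilinear_rels K A B" by (rule rels_cases) (simp_all add: s)
 from r show "r *[FX] d a b \<in> bilinear_rels K A B" by (rule rels_cases) (simp_all add: s)
qed

text \<open>The product of a basis element with a bilinearity relation is again a bilinearity relation, up to scalars.
  This is why the quotient by the subspace spanned by the relations is an algebra.\<close>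

private lemma N_ideal: "ideal N FX"
proof -
 note sp = submodule_span[OF MF.module_axioms rels_closed]
 have subN: "submodule N K FX" unfolding tensor_null_def by (rule sp)
 have RN: "bilinear_rels K A B <= N" unfolding tensor_null_def by (rule sp)
 note N = submoduleD[OF subN]
 note sm = alg_smult[OF FX]
 have 1: "g *[FX] r \<in> N \<and> r *[FX] g \<in> N" if r: "r \<in> bilinear_rels K A B" and g: "g \<in>[FX]" for r g
 proof -
  have rc: "r \<in>[FX]" using r rels_closed by auto
  from MF.module_axioms spanF g show ?thesis
  proof (induction rule: spanning_induct)
   case (gen s) then show ?case using rels_mult[OF r] RN by auto
  next
   case zero then show ?case using rc N(1) by simp
  next
   case (add f h) then show ?case using rc N(2) by (simp add: FX.l_distr FX.r_distr)
  next
   case (smult c f) then show ?case using rc N(4) by (simp add: sm)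
  qed
 qed
 have "submodule {r \<in> N. \<forall>g\<in>carrier FX. g *[FX] r \<in> N \<and> r *[FX] g \<in> N} K FX" (is "submodule ?M K FX")
 proof (rule submoduleI'[OF MF.module_axioms])
  show "?M <= carrier FX" using N(3) by auto
  show "\<zero>[FX] \<in> ?M" using N(1) by simp
  fix a b assume ab: "a \<in> ?M" "b \<in> ?M"
  then have "a \<in>[FX]" "b \<in>[FX]" using N(3) by auto
  then show "a +[FX] b \<in> ?M" using ab N(2) by (simp add: FX.l_distr FX.r_distr)
 next
  fix c a assume ca: "c \<in>[K]" "a \<in> ?M"
  then have "a \<in>[FX]" using N(3) by auto
  then show "c \<odot>[FX] a \<in> ?M" using ca N(4) by (simp add: sm)
 qed
 moreover have "bilinear_rels K A B <= ?M" using 1 RN by blast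
 ultimately have "N <= ?M" unfolding tensor_null_def[of K A B] by (rule sp(3))
 then show ?thesis by (intro submodule_ideal[OF FX subN]) blast+
qed

lemma assoc_tensor: "assoc_algebra K T"
 unfolding tensor_def by (rule assoc_quot[OF FX N_ideal])

lemma tens_closed [simp]: "[|a \<in>[A]; b \<in>[B]|] ==> tens K A B a b \<in>[T]"
 unfolding tensor_def tens_def quot_carrier[OF FX N_ideal] by (rule imageI[OF dc])

private lemma N_rel:
 assumes "f \<in>[FX]" "g \<in>[FX]" "f -[FX] g \<in> bilinear_rels K A B"
 shows "N +>\<^bsub>FX\<^esub> f = N +>\<^bsub>FX\<^esub> g"
proof -
 have "bilinear_rels K A B <= N" unfolding tensor_null_def by (rule submodule_span[OF MF.module_axioms rels_closed])
 then show ?thesis using assms by (subst quot_coset_eq[OF FX N_ideal]) auto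
qed

lemma tens_add_left:
 assumes "a \<in>[A]" "a' \<in>[A]" "b \<in>[B]"
 shows "tens K A B (a +[A] a') b = tens K A B a b +[T] tens K A B a' b"
 unfolding tensor_def tens_def using assms rels(1)[OF assms]
 by (simp add: quot_ops[OF FX N_ideal] dc N_rel)

lemma tens_add_right:
 assumes "a \<in>[A]" "b \<in>[B]" "b' \<in>[B]"
 shows "tens K A B a (b +[B] b') = tens K A B a b +[T] tens K A B a b'"
 unfolding tensor_def tens_def using assms rels(2)[OF assms]
 by (simp add: quot_ops[OF FX N_ideal] dc N_rel)

lemma tens_smult_left:
 assumes "c \<in>[K]" "a \<in>[A]" "b \<in>[B]"
 shows "tens K A B (c \<odot>[A] a) b = c \<odot>[T] tens K A B a b"
 unfolding tensor_def tens_def using assms rels(3)[OF assms]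
 by (simp add: quot_ops[OF FX N_ideal] dc N_rel)

lemma tens_smult_right:
 assumes "c \<in>[K]" "a \<in>[A]" "b \<in>[B]"
 shows "tens K A B a (c \<odot>[B] b) = c \<odot>[T] tens K A B a b"
 unfolding tensor_def tens_def using assms rels(4)[OF assms]
 by (simp add: quot_ops[OF FX N_ideal] dc N_rel)

lemma tens_mult:
 assumes "a \<in>[A]" "b \<in>[B]" "a' \<in>[A]" "b' \<in>[B]"
 shows "tens K A B a b *[T] tens K A B a' b' = tens K A B (a *[A] a') (b *[B] b')"
 unfolding tensor_def tens_def using assms
 by (simp add: quot_ops[OF FX N_ideal] dc dm)

lemma tens_one: "\<one>[T] = tens K A B \<one>[A] \<one>[B]"
 unfolding tensor_def tens_def
 by (simp add: quot_consts[OF FX N_ideal] ma_one[OF K.field_axioms X])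

lemma tensor_spanning: "spanning K T {tens K A B a b |a b. a \<in>[A] \<and> b \<in>[B]}"
 unfolding spanning_def
proof (intro conjI allI impI)
 show "{tens K A B a b |a b. a \<in>[A] \<and> b \<in>[B]} <= carrier T" by auto
 fix P assume P: "submodule P K T" "{tens K A B a b |a b. a \<in>[A] \<and> b \<in>[B]} <= P"
 let ?q = "\<lambda>x\<in>carrier FX. N +>\<^bsub>FX\<^esub> x"
 have q: "?q \<in> lin_maps K FX T" unfolding tensor_def by (rule hom_lin[OF quot_proj[OF FX N_ideal]])
 have "submodule {x \<in> carrier FX. ?q x \<in> P} K FX"
  by (rule submodule_preimage[OF MF.module_axioms algD(2)[OF assoc_tensor] q P(1)])
 moreover have "{d a b |a b. a \<in>[A] \<and> b \<in>[B]} <= {x \<in> carrier FX. ?q x \<in> P}"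
  using P(2) by (auto simp: dc tens_def)
 ultimately have "carrier FX <= {x \<in> carrier FX. ?q x \<in> P}"
  using spanF unfolding spanning_def by blast
 then show "carrier T <= P" unfolding tensor_def quot_carrier[OF FX N_ideal] by auto
qed

text \<open>Linear maps out of a tensor product need only be compared on tensors of elements of spanning sets.\<close>

lemma tensor_spanning_gen:
 assumes S: "spanning K A S" and S': "spanning K B S'"
 shows "spanning K T {tens K A B a b |a b. a \<in> S \<and> b \<in> S'}"
 unfolding spanning_def
proof (intro conjI allI impI)
 have Sc: "S <= carrier A" "S' <= carrier B" using S S' by (simp_all add: spanning_def)
 then show "{tens K A B a b |a b. a \<in> S \<and> b \<in> S'} <= carrier T" using tens_closed by blast
 fix P assume P: "submodule P K T" "{tens K A B a b |a b. a \<in> S \<and> b \<in> S'} <= P"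
 interpret T: module K T by (rule algD[OF assoc_tensor])
 note P' = submoduleD[OF P(1)]
 have zero: "tens K A B a \<zero>[B] = \<zero>[T]" if "a \<in>[A]" for a
  using that tens_smult_right[of "\<zero>[K]" a "\<zero>[B]"] by simp
 have zero': "tens K A B \<zero>[A] b = \<zero>[T]" if "b \<in>[B]" for b
  using that tens_smult_left[of "\<zero>[K]" "\<zero>[A]" b] by simp
 have 1: "tens K A B a b \<in> P" if a: "a \<in> S" and b: "b \<in>[B]" for a b
 proof -
  have ac: "a \<in>[A]" using a Sc by auto
  from MB.module_axioms S' b show ?thesis
  proof (induction rule: spanning_induct)
   case (gen s) then show ?case using P(2) a by auto
  next
   case zero then show ?case using \<open>!!a. a \<in>[A] ==> tens K A B a \<zero>[B] = \<zero>[T]\<close>[OF ac] P'(1) by simp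
  qed (simp_all add: tens_add_right tens_smult_right ac P'(2,4))
 qed
 have 2: "tens K A B a b \<in> P" if a: "a \<in>[A]" and b: "b \<in>[B]" for a b
  using MA.module_axioms S a
 proof (induction rule: spanning_induct)
  case (gen s) then show ?case using 1 b by simp
 next
  case zero then show ?case using zero'[OF b] P'(1) by simp
 qed (simp_all add: tens_add_left tens_smult_left b P'(2,4))
 then have "{tens K A B a b |a b. a \<in>[A] \<and> b \<in>[B]} <= P" by auto
 then show "carrier T <= P" using tensor_spanning P(1) unfolding spanning_def by blast
qed

lemma tensor_lift:
 assumes Q: "module K Q" and \<beta>: "bilinear_map K A B Q \<beta>"
 shows "tensor_lift K A B Q \<beta> \<in> lin_maps K T Q"
  and "[|a \<in>[A]; b \<in>[B]|] ==> tensor_lift K A B Q \<beta> (tens K A B a b) = \<beta> a b"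
proof -
 interpret Q: module K Q by (rule Q)
 note b = bilinear_mapD[OF MA.module_axioms MB.module_axioms \<beta>]
 have "\<exists>f \<in> lin_maps K FX Q. \<forall>x\<in>carrier X. f (delta K X x) = \<beta> (fst x) (snd x)"
  by (rule ma_lift[OF K.field_axioms X Q]) (use b(1) in auto)
 then obtain f where f: "f \<in> lin_maps K FX Q" and f': "\<forall>x\<in>carrier X. f (delta K X x) = \<beta> (fst x) (snd x)" by (elim bexE)
 have fd: "f (d a b) = \<beta> a b" if "a \<in>[A]" "b \<in>[B]" for a b
  using bspec[OF f', of "(a, b)"] that by simp
 note lin = lin_diff[OF MF.module_axioms Q f] lin_add[OF f] lin_smult[OF f]
 have "bilinear_rels K A B <= {x \<in> carrier FX. f x = \<zero>[Q]}"
 proof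
  fix r assume r: "r \<in> bilinear_rels K A B"
  then have "f r = \<zero>[Q]"
   by (rule rels_cases) (simp_all add: lin dc fd b Q.M.minus_zero_iff)
  then show "r \<in> {x \<in> carrier FX. f x = \<zero>[Q]}" using r rels_closed by auto
 qed
 then have "N <= {x \<in> carrier FX. f x = \<zero>[Q]}"
  unfolding tensor_null_def
  by (rule submodule_span(3)[OF MF.module_axioms rels_closed submodule_kernel[OF MF.module_axioms Q f]])
 then have ker: "f x = \<zero>[Q]" if "x \<in> N" for x using that by auto
 have "\<exists>g \<in> lin_maps K T Q. \<forall>x\<in>carrier FX. g (N +>\<^bsub>FX\<^esub> x) = f x"
  unfolding tensor_def by (rule quot_lift[OF FX N_ideal Q f ker])
 then obtain g where g: "g \<in> lin_maps K T Q" and g': "\<forall>x\<in>carrier FX. g (N +>\<^bsub>FX\<^esub> x) = f x" by (elim bexE)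
 have gt: "\<forall>a\<in>carrier A. \<forall>b\<in>carrier B. g (tens K A B a b) = \<beta> a b"
  unfolding tens_def using g' dc fd by simp
 have "\<exists>!f. f \<in> lin_maps K T Q \<and> (\<forall>a\<in>carrier A. \<forall>b\<in>carrier B. f (tens K A B a b) = \<beta> a b)"
 proof (rule ex1I[of _ g])
  fix g' assume g': "g' \<in> lin_maps K T Q \<and> (\<forall>a\<in>carrier A. \<forall>b\<in>carrier B. g' (tens K A B a b) = \<beta> a b)"
  show "g' = g"
   by (rule lin_eq_on_spanning[OF algD(2)[OF assoc_tensor] Q tensor_spanning conjunct1[OF g'] g])
    (use g' gt in auto)
 qed (use g gt in blast)
 from theI'[OF this] show "tensor_lift K A B Q \<beta> \<in> lin_maps K T Q"
  "[|a \<in>[A]; b \<in>[B]|] ==> tensor_lift K A B Q \<beta> (tens K A B a b) = \<beta> a b"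
  unfolding tensor_lift_def by blast+
qed

lemma tensor_lift_hom:
 assumes C: "assoc_algebra K C" and \<beta>: "bilinear_map K A B C \<beta>"
  and one: "\<beta> \<one>[A] \<one>[B] = \<one>[C]"
  and mult: "!!a b a' b'. [|a \<in>[A]; b \<in>[B]; a' \<in>[A]; b' \<in>[B]|] ==>
    \<beta> (a *[A] a') (b *[B] b') = \<beta> a b *[C] \<beta> a' b'"
 shows "tensor_lift K A B C \<beta> \<in> alg_homs K T C"
proof -
 note l = tensor_lift[OF algD(2)[OF C] \<beta>]
 show ?thesis
  by (rule alg_hom_on_spanning[OF assoc_tensor C tensor_spanning l(1)])
   (auto simp: tens_one tens_mult l(2) one mult)
qed

lemma tensor_lift_eqI:
 assumes "module K Q" "f \<in> lin_maps K T Q" "g \<in> lin_maps K T Q"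
  and "!!a b. [|a \<in>[A]; b \<in>[B]|] ==> f (tens K A B a b) = g (tens K A B a b)"
 shows "f = g"
 by (rule lin_eq_on_spanning[OF algD(2)[OF assoc_tensor] assms(1) tensor_spanning assms(2,3)])
  (use assms(4) in auto)

end

lemma bilinear_tens_maps:
 assumes A: "assoc_algebra K A" and B: "assoc_algebra K B" and C: "assoc_algebra K C" and D: "assoc_algebra K D"
  and f: "linear_on K A C f" and g: "linear_on K B D g"
 shows "bilinear_map K A B (tensor K C D) (\<lambda>a b. tens K C D (f a) (g b))"
proof -
 note f = linear_onD[OF algD(2)[OF A] f] and g = linear_onD[OF algD(2)[OF B] g]
 show ?thesis
  by (rule bilinear_mapI[OF algD(2)[OF A] algD(2)[OF B]])
   (simp_all add: f g tens_closed[OF C D] tens_add_left[OF C D] tens_add_right[OF C D]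
    tens_smult_left[OF C D] tens_smult_right[OF C D])
qed

context
 fixes K A B C D f g
 assumes A: "assoc_algebra K A" and B: "assoc_algebra K B" and C: "assoc_algebra K C" and D: "assoc_algebra K D"
  and f: "linear_on K A C f" and g: "linear_on K B D g"
begin

lemma tensor_map:
 "tensor_map K A B C D f g \<in> lin_maps K (tensor K A B) (tensor K C D)"
 "[|a \<in>[A]; b \<in>[B]|] ==> tensor_map K A B C D f g (tens K A B a b) = tens K C D (f a) (g b)"
 unfolding tensor_map_def
 by (rule tensor_lift[OF A B algD(2)[OF assoc_tensor[OF C D]] bilinear_tens_maps[OF A B C D f g]], assumption?)+

lemma tensor_map_hom:
 assumes "f \<one>[A] = \<one>[C]" "g \<one>[B] = \<one>[D]"
  and "!!x y. [|x \<in>[A]; y \<in>[A]|] ==> f (x *[A] y) = f x *[C] f y"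
  and "!!x y. [|x \<in>[B]; y \<in>[B]|] ==> g (x *[B] y) = g x *[D] g y"
 shows "tensor_map K A B C D f g \<in> alg_homs K (tensor K A B) (tensor K C D)"
 unfolding tensor_map_def
 by (rule tensor_lift_hom[OF A B assoc_tensor[OF C D] bilinear_tens_maps[OF A B C D f g]])
  (simp_all add: assms tens_one[OF C D] tens_mult[OF C D]
   linear_onD(1)[OF algD(2)[OF A] f] linear_onD(1)[OF algD(2)[OF B] g])

end

context
 fixes K A B C
 assumes A: "assoc_algebra K A" and B: "assoc_algebra K B" and C: "assoc_algebra K C"
begin

private lemma BC: "assoc_algebra K (tensor K B C)" and AB: "assoc_algebra K (tensor K A B)"
 by (rule assoc_tensor[OF B C], rule assoc_tensor[OF A B])

private lemma ABC: "assoc_algebra K (tensor K A (tensor K B C))"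
 by (rule assoc_tensor[OF A BC])

private abbreviation "Q == tensor K A (tensor K B C)"
private abbreviation "inner c == tensor_lift K A B Q (\<lambda>a b. tens K A (tensor K B C) a (tens K B C b c))"

private lemma inner:
 assumes c: "c \<in>[C]"
 shows "inner c \<in> lin_maps K (tensor K A B) Q"
  "[|a \<in>[A]; b \<in>[B]|] ==> inner c (tens K A B a b) = tens K A (tensor K B C) a (tens K B C b c)"
proof -
 have "bilinear_map K A B Q (\<lambda>a b. tens K A (tensor K B C) a (tens K B C b c))"
  by (rule bilinear_mapI[OF algD(2)[OF A] algD(2)[OF B]])
   (simp_all add: c tens_closed[OF A BC] tens_closed[OF B C] tens_add_left[OF B C] tens_smult_left[OF B C]
    tens_add_left[OF A BC] tens_add_right[OF A BC] tens_smult_left[OF A BC] tens_smult_right[OF A BC])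
 from tensor_lift[OF A B algD(2)[OF ABC] this]
 show "inner c \<in> lin_maps K (tensor K A B) Q"
  "[|a \<in>[A]; b \<in>[B]|] ==> inner c (tens K A B a b) = tens K A (tensor K B C) a (tens K B C b c)"
  by blast+
qed

private lemma inner_bilinear: "bilinear_map K (tensor K A B) C Q (\<lambda>t c. inner c t)"
proof -
 note mAB = algD(2)[OF AB] and mC = algD(2)[OF C] and mQ = algD(2)[OF ABC]
 interpret AB: module K "tensor K A B" by (rule mAB)
 interpret MC: module K C by (rule mC)
 interpret Q: module K Q by (rule mQ)
 note lin = lin_closed[OF inner(1)] lin_add[OF inner(1)] lin_smult[OF inner(1)] lin_zero[OF mAB mQ inner(1)]
 note cl = tens_closed[OF A BC] tens_closed[OF B C] tens_closed[OF A B]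
 note ind = spanning_induct[OF mAB tensor_spanning[OF A B], consumes 1, case_names gen zero add smult]
 have add: "inner (c +[C] c') t = inner c t +[Q] inner c' t"
  if c: "c \<in>[C]" "c' \<in>[C]" and t: "t \<in>[tensor K A B]" for c c' t
  using t
 proof (induction rule: ind)
  case (gen s)
  then show ?case
   using c by (auto simp: inner(2) tens_add_right[OF B C] tens_add_right[OF A BC] cl)
 next
  case (add s t)
  then show ?case using c by (simp add: lin Q.M.a_ac)
 qed (use c in \<open>simp_all add: lin Q.smult_r_distr\<close>)
 have smult: "inner (e \<odot>[C] c) t = e \<odot>[Q] inner c t"
  if c: "c \<in>[C]" "e \<in>[K]" and t: "t \<in>[tensor K A B]" for c e t
  using t
 proof (induction rule: ind)
  case (gen s)
  then show ?case
   using c by (auto simp: inner(2) tens_smult_right[OF B C] tens_smult_right[OF A BC] cl)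
 next
  case (smult d t)
  then show ?case using c by (simp add: lin Q.smult_assoc1[symmetric] AB.R.m_comm)
 qed (use c in \<open>simp_all add: lin Q.smult_r_distr\<close>)
 show ?thesis
  by (rule bilinear_mapI[OF mAB mC]) (simp_all add: lin add smult)
qed

lemma tensor_assoc:
 "tensor_assoc K A B C \<in> alg_homs K (tensor K (tensor K A B) C) Q"
 "[|a \<in>[A]; b \<in>[B]; c \<in>[C]|] ==>
   tensor_assoc K A B C (tens K (tensor K A B) C (tens K A B a b) c) = tens K A (tensor K B C) a (tens K B C b c)"
proof -
 note l = tensor_lift[OF AB C algD(2)[OF ABC] inner_bilinear, folded tensor_assoc_def]
 show app: "tensor_assoc K A B C (tens K (tensor K A B) C (tens K A B a b) c) = tens K A (tensor K B C) a (tens K B C b c)"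
  if "a \<in>[A]" "b \<in>[B]" "c \<in>[C]" for a b c
  using that by (simp add: l(2) tens_closed[OF A B] inner(2))
 interpret A: ring A by (rule algD[OF A])
 interpret B: ring B by (rule algD[OF B])
 interpret C: ring C by (rule algD[OF C])
 have spC: "spanning K C (carrier C)" by (simp add: spanning_def)
 note sp = tensor_spanning_gen[OF AB C tensor_spanning[OF A B] spC]
 note cl = tens_closed[OF A BC] tens_closed[OF B C] tens_closed[OF A B] tens_closed[OF AB C]
 show "tensor_assoc K A B C \<in> alg_homs K (tensor K (tensor K A B) C) Q"
 proof (rule alg_hom_on_spanning[OF assoc_tensor[OF AB C] ABC sp l(1)])
  show "tensor_assoc K A B C \<one>[tensor K (tensor K A B) C] = \<one>[Q]"
   by (simp add: tens_one[OF AB C] tens_one[OF A B] app tens_one[OF A BC] tens_one[OF B C])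
  fix s t assume st: "s \<in> {tens K (tensor K A B) C a b |a b. a \<in> {tens K A B a b |a b. a \<in>[A] \<and> b \<in>[B]} \<and> b \<in>[C]}"
   "t \<in> {tens K (tensor K A B) C a b |a b. a \<in> {tens K A B a b |a b. a \<in>[A] \<and> b \<in>[B]} \<and> b \<in>[C]}"
  from st(1) obtain a b c where s: "s = tens K (tensor K A B) C (tens K A B a b) c" "a \<in>[A]" "b \<in>[B]" "c \<in>[C]"
   by blast
  from st(2) obtain a' b' c' where t: "t = tens K (tensor K A B) C (tens K A B a' b') c'" "a' \<in>[A]" "b' \<in>[B]" "c' \<in>[C]"
   by blast
  show "tensor_assoc K A B C (s *[tensor K (tensor K A B) C] t) = tensor_assoc K A B C s *[Q] tensor_assoc K A B C t"
   unfolding s(1) t(1) using s(2-) t(2-)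
   by (simp add: tens_mult[OF AB C] tens_mult[OF A B] tens_mult[OF A BC] tens_mult[OF B C] cl app)
 qed
qed

end

section \<open>Binomial expansions in characteristic p\<close>

text \<open>Every binomial expansion below is an instance of this recursion of Pascal's triangle, with
  \<open>b m k l\<close> the element obtained from \<open>b 0 k l\<close> by \<open>m\<close> applications of a sum of two commuting
  operators that raise \<open>k\<close> and \<open>l\<close>.\<close>

lemma (in abelian_monoid) pascal_expansion:
 assumes cl: "!!k l. b 0 k l \<in>[G]"
  and step: "!!m k l. m + k + l < N ==> b (Suc m) k l = b m (Suc k) l \<oplus> b m k (Suc l)"
 shows "n + k + l \<le> N ==> b n k l = (\<Oplus>i\<in>{..n}. [(n choose i)] \<cdot> b 0 (k + i) (l + (n - i)))"
proof (induction n arbitrary: k l)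
 case 0
 show ?case using cl by simp
next
 case (Suc n)
 let ?B = "\<lambda>i. b 0 (k + i) (l + (Suc n - i))"
 have B: "?B i \<in>[G]" for i by (rule cl)
 have cl': "[(j::nat)] \<cdot> b 0 u v \<in>[G]" for j u v using cl by (rule add.nat_pow_closed)
 have 1: "b n (Suc k) l = (\<Oplus>i\<in>{..n}. [(n choose i)] \<cdot> ?B (Suc i))"
  using Suc.IH[of "Suc k" l] Suc.prems by (simp add: cl')
 have 2: "b n k (Suc l) = (\<Oplus>i\<in>{..n}. [(n choose i)] \<cdot> ?B i)"
  by (subst Suc.IH) (use Suc.prems in simp, rule finsum_cong', simp_all add: cl' Suc_diff_le Pi_iff)
 have "(\<Oplus>i\<in>{..n}. [(n choose i)] \<cdot> ?B i) = (\<Oplus>i\<in>{..Suc n}. [(n choose i)] \<cdot> ?B i)"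
  using finsum_Suc[of "\<lambda>i. [(n choose i)] \<cdot> ?B i" n] by (simp add: cl cl' Pi_iff binomial_eq_0)
 also have "... = (\<Oplus>i\<in>{..n}. [(n choose Suc i)] \<cdot> ?B (Suc i)) \<oplus> ?B 0"
  using finsum_Suc2[of "\<lambda>i. [(n choose i)] \<cdot> ?B i" n] by (simp add: cl cl' Pi_iff)
 finally have 3: "b n k (Suc l) = (\<Oplus>i\<in>{..n}. [(n choose Suc i)] \<cdot> ?B (Suc i)) \<oplus> ?B 0"
  using 2 by simp
 have S: "(\<Oplus>i\<in>{..n}. [(n choose i)] \<cdot> ?B (Suc i)) \<in>[G]" "(\<Oplus>i\<in>{..n}. [(n choose Suc i)] \<cdot> ?B (Suc i)) \<in>[G]"
  using cl' by (simp_all add: Pi_iff)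
 have "b (Suc n) k l = (\<Oplus>i\<in>{..n}. [(n choose i)] \<cdot> ?B (Suc i)) \<oplus> ((\<Oplus>i\<in>{..n}. [(n choose Suc i)] \<cdot> ?B (Suc i)) \<oplus> ?B 0)"
  using step[of n k l] Suc.prems 1 3 by simp
 also have "... = ((\<Oplus>i\<in>{..n}. [(n choose i)] \<cdot> ?B (Suc i)) \<oplus> (\<Oplus>i\<in>{..n}. [(n choose Suc i)] \<cdot> ?B (Suc i))) \<oplus> ?B 0"
  using S B[of 0] by (simp only: a_assoc)
 also have "(\<Oplus>i\<in>{..n}. [(n choose i)] \<cdot> ?B (Suc i)) \<oplus> (\<Oplus>i\<in>{..n}. [(n choose Suc i)] \<cdot> ?B (Suc i))
   = (\<Oplus>i\<in>{..n}. [(n choose i)] \<cdot> ?B (Suc i) \<oplus> [(n choose Suc i)] \<cdot> ?B (Suc i))"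
  by (rule finsum_addf[symmetric]) (simp_all add: cl' Pi_iff)
 also have "... = (\<Oplus>i\<in>{..n}. [(Suc n choose Suc i)] \<cdot> ?B (Suc i))"
  by (rule finsum_cong') (simp_all add: cl' cl Pi_iff add.nat_pow_mult)
 also have "(\<Oplus>i\<in>{..n}. [(Suc n choose Suc i)] \<cdot> ?B (Suc i)) \<oplus> ?B 0 = (\<Oplus>i\<in>{..Suc n}. [(Suc n choose i)] \<cdot> ?B i)"
  using finsum_Suc2[of "\<lambda>i. [(Suc n choose i)] \<cdot> ?B i" n] by (simp add: cl cl' Pi_iff)
 finally show ?case .
qed

lemma (in module) nat_smult: "x \<in>[M] ==> ([n] \<cdot>\<^bsub>R\<^esub> \<one>) \<odot>[M] x = [(n::nat)] \<cdot>\<^bsub>M\<^esub> x"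
 by (induction n) (simp_all add: smult_l_distr)

context
 fixes K :: "('k, 'm) ring_scheme" and p :: nat
 assumes K: "field K" and p0: "0 < p" and char: "has_char K p"
begin

interpretation K: field K by (rule K)

lemma char_nonzero: "\<not> p dvd n ==> [n] \<cdot>\<^bsub>K\<^esub> \<one>[K] \<in> carrier K - {\<zero>[K]}"
 using char by (simp add: has_char_def)

lemma char_gt_1: "1 < p"
proof -
 have "[Suc 0] \<cdot>\<^bsub>K\<^esub> \<one>[K] = \<one>[K]" by simp
 then have "\<not> p dvd Suc 0" using char K.one_not_zero unfolding has_char_def by metis
 then show ?thesis using p0 by (cases "p = 1") auto
qed

lemma char_dvd_mult:
 assumes "p dvd a * b" shows "p dvd a \<or> p dvd b"
proof -
 have "[(a * b)] \<cdot>\<^bsub>K\<^esub> \<one>[K] = [a] \<cdot>\<^bsub>K\<^esub> \<one>[K] *[K] [b] \<cdot>\<^bsub>K\<^esub> \<one>[K]"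
  by (simp add: K.add_pow_ldistr K.add.nat_pow_pow mult.commute)
 moreover have "[(a * b)] \<cdot>\<^bsub>K\<^esub> \<one>[K] = \<zero>[K]" using assms char by (simp add: has_char_def)
 ultimately have "[a] \<cdot>\<^bsub>K\<^esub> \<one>[K] = \<zero>[K] \<or> [b] \<cdot>\<^bsub>K\<^esub> \<one>[K] = \<zero>[K]"
  using K.integral_iff[of "[a] \<cdot>\<^bsub>K\<^esub> \<one>[K]" "[b] \<cdot>\<^bsub>K\<^esub> \<one>[K]"] by simp
 then show ?thesis using char by (simp add: has_char_def)
qed

lemma char_dvd_choose:
 assumes "0 < i" "i < p" shows "p dvd p choose i"
proof -
 have "p dvd i * (p choose i)" using assms times_binomial_minus1_eq[of i p] by simp
 moreover have "\<not> p dvd i" using assms by (auto dest: dvd_imp_le)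
 ultimately show ?thesis using char_dvd_mult by blast
qed

lemma char_add_pow:
 assumes "module K M" "x \<in>[M]" "p dvd n"
 shows "[n] \<cdot>\<^bsub>M\<^esub> x = \<zero>[M]"
proof -
 interpret M: module K M by fact
 have "[n] \<cdot>\<^bsub>K\<^esub> \<one>[K] = \<zero>[K]" using assms(3) char by (simp add: has_char_def)
 then show ?thesis using M.nat_smult[OF assms(2), of n] M.smult_l_null[OF assms(2)] by simp
qed

text \<open>In characteristic \<open>p\<close> only the two outer binomial coefficients survive. The recursion is required only as far
  as the total degree stays below \<open>p\<close>, because it will be applied to linear forms that satisfy their relations only
  up to a given length.\<close>

lemma pascal_char_p:
 assumes M: "module K M" and cl: "!!k l. b 0 k l \<in>[M]"
  and step: "!!m k l. m + k + l < p ==> b (Suc m) k l = b m (Suc k) l +[M] b m k (Suc l)"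
 shows "b p 0 0 = b 0 p 0 +[M] b 0 0 p"
proof -
 interpret M: module K M by fact
 have cl': "[(j::nat)] \<cdot>\<^bsub>M\<^esub> b 0 u v \<in>[M]" for j u v using cl by (rule M.M.add.nat_pow_closed)
 have "b p 0 0 = (\<Oplus>\<^bsub>M\<^esub>i\<in>{..p}. [(p choose i)] \<cdot>\<^bsub>M\<^esub> b 0 i (p - i))"
  using M.M.pascal_expansion[of b p p 0 0] by (simp add: cl step)
 also have "... = (\<Oplus>\<^bsub>M\<^esub>i\<in>{0, p}. [(p choose i)] \<cdot>\<^bsub>M\<^esub> b 0 i (p - i))"
 proof (rule M.M.add.finprod_mono_neutral_cong_right)
  fix i assume "i \<in> {..p} - {0, p}"
  then have "0 < i" "i < p" by auto
  then show "[(p choose i)] \<cdot>\<^bsub>M\<^esub> b 0 i (p - i) = \<zero>[M]"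
   by (intro char_add_pow[OF M cl char_dvd_choose])
 qed (simp_all add: Pi_iff cl')
 also have "... = b 0 0 p +[M] b 0 p 0"
  using p0 cl by (simp add: Pi_iff)
 also have "... = b 0 p 0 +[M] b 0 0 p" by (rule M.M.a_comm[OF cl cl])
 finally show ?thesis .
qed

lemma frobenius_add:
 assumes A: "assoc_algebra K A" and u: "u \<in>[A]" and v: "v \<in>[A]"
  and comm: "u *[A] v = v *[A] u"
 shows "(u +[A] v) ^[A] p = u ^[A] p +[A] v ^[A] p"
proof -
 interpret A: ring A by (rule algD[OF A])
 let ?b = "\<lambda>m k l. (u +[A] v) ^[A] (m::nat) *[A] (u ^[A] (k::nat) *[A] v ^[A] (l::nat))"
 have vu: "v *[A] u ^[A] k = u ^[A] k *[A] v" for k :: nat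
 proof (induction k)
  case (Suc k)
  have "v *[A] u ^[A] Suc k = (v *[A] u ^[A] k) *[A] u" using u v by (simp add: A.m_assoc)
  also have "... = u ^[A] k *[A] (v *[A] u)" unfolding Suc using u v by (simp add: A.m_assoc)
  also have "... = u ^[A] Suc k *[A] v" unfolding comm[symmetric] using u v by (simp add: A.m_assoc)
  finally show ?case .
 qed (use v in simp)
 have step: "?b (Suc m) k l = ?b m (Suc k) l +[A] ?b m k (Suc l)" for m k l
 proof -
  have "?b (Suc m) k l = (u +[A] v) ^[A] m *[A] (u *[A] u ^[A] k *[A] v ^[A] l +[A] (v *[A] u ^[A] k) *[A] v ^[A] l)"
   using u v by (simp add: A.m_assoc A.l_distr A.r_distr)
  also have "u *[A] u ^[A] k = u ^[A] Suc k" by (rule A.nat_pow_Suc2[OF u, symmetric])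
  also have "(v *[A] u ^[A] k) *[A] v ^[A] l = u ^[A] k *[A] (v *[A] v ^[A] l)"
   unfolding vu using u v by (simp add: A.m_assoc)
  also have "v *[A] v ^[A] l = v ^[A] Suc l" by (rule A.nat_pow_Suc2[OF v, symmetric])
  finally show ?thesis using u v by (simp only: A.r_distr A.m_closed A.nat_pow_closed A.a_closed)
 qed
 have "?b p 0 0 = ?b 0 p 0 +[A] ?b 0 0 p"
  by (rule pascal_char_p[OF algD(2)[OF A]]) (use u v step in simp_all)
 then show ?thesis using u v by simp
qed

lemma frobenius_diff:
 assumes A: "assoc_algebra K A" and u: "u \<in>[A]" and v: "v \<in>[A]"
  and comm: "u *[A] v = v *[A] u"
 shows "(u -[A] v) ^[A] p = u ^[A] p -[A] v ^[A] p"
proof -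
 interpret A: ring A by (rule algD[OF A])
 have c: "u -[A] v \<in>[A]" using u v by simp
 have "(u -[A] v) *[A] v = v *[A] (u -[A] v)"
  using u v comm by (simp add: a_minus_def A.l_distr A.r_distr A.l_minus A.r_minus)
 from frobenius_add[OF A c v this]
 have "(u -[A] v +[A] v) ^[A] p = (u -[A] v) ^[A] p +[A] v ^[A] p" .
 moreover have "u -[A] v +[A] v = u" using u v by (simp add: a_minus_def A.a_assoc A.l_neg)
 ultimately have "u ^[A] p = (u -[A] v) ^[A] p +[A] v ^[A] p" by simp
 then show ?thesis using c v by (simp add: a_minus_def A.a_assoc A.r_neg)
qed

end

section \<open>Reduced enveloping algebras\<close>

lemma free_monoid_simps [simp]:
 "carrier (free_monoid S) = lists S" "u *[free_monoid S] v = u @ v" "\<one>[free_monoid S] = []"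
 by (simp_all add: free_monoid_def)

lemma monoid_free_monoid: "Group.monoid (free_monoid S)"
 by (rule monoidI) auto

lemma free_hom:
 assumes B: "assoc_algebra K B" and \<phi>: "!!x. x \<in> S ==> \<phi> x \<in>[B]"
 shows "\<exists>f \<in> alg_homs K (free_algebra K S) B. \<forall>x\<in>S. f (delta K (free_monoid S) [x]) = \<phi> x"
proof -
 interpret B: ring B by (rule algD[OF B])
 let ?w = "\<lambda>w. foldr (\<lambda>x b. \<phi> x *[B] b) w \<one>[B]"
 have wc: "?w w \<in>[B]" if "w \<in> lists S" for w
  using that by (induction w) (auto simp: \<phi>)
 have wm: "?w (u @ v) = ?w u *[B] ?w v" if "u \<in> lists S" "v \<in> lists S" for u v
  using that(1) by (induction u) (simp_all add: wc[OF that(2)] wc \<phi> B.m_assoc)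
 have "\<exists>f \<in> alg_homs K (free_algebra K S) B. \<forall>x\<in>carrier (free_monoid S). f (delta K (free_monoid S) x) = ?w x"
  by (rule ma_lift_hom[OF algD(1)[OF B] monoid_free_monoid B]) (simp_all add: wc wm del: foldr_append)
 then obtain f where f: "f \<in> alg_homs K (free_algebra K S) B"
  and f': "\<forall>x\<in>carrier (free_monoid S). f (delta K (free_monoid S) x) = ?w x" by (elim bexE)
 have "f (delta K (free_monoid S) [x]) = \<phi> x" if "x \<in> S" for x
  using bspec[OF f', of "[x]"] that \<phi> by simp
 then show ?thesis using f by blast
qed

context
 fixes K :: "('k, 'm) ring_scheme" and L :: "('k, 'g, 'n) p_lie_scheme" and p :: nat and \<xi> :: "'g => 'k"
 assumes L: "p_lie_algebra K L p" and \<xi>_fun: "\<xi> \<in> carrier L \<rightarrow> carrier K"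
begin

private lemma \<xi>: "x \<in>[L] ==> \<xi> x \<in>[K]"
 by (rule funcset_mem[OF \<xi>_fun])

interpretation K: field K using L by (simp add: p_lie_algebra_def lie_algebra_def)
interpretation VL: module K L using L by (simp add: p_lie_algebra_def lie_algebra_def)
interpretation L: p_lie_algebra K L p by (rule L)

private abbreviation "FL == free_algebra K (carrier L)"
private abbreviation "U == env_algebra K L"
private abbreviation "UA == red_env_algebra K p L \<xi>"
private abbreviation "e x == delta K (free_monoid (carrier L)) [x]"
private abbreviation "\<iota>U == env_incl K L"
private abbreviation "\<iota> == red_env_incl K p L \<xi>"
private abbreviation "I == env_ideal K L"
private abbreviation "J == red_ideal K p L \<xi>"

private lemma FL: "assoc_algebra K FL"
 by (rule assoc_monoid_algebra[OF K.field_axioms monoid_free_monoid])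

interpretation FL: ring FL by (rule algD[OF FL])
interpretation MF: module K FL by (rule algD[OF FL])

private lemma ec: "x \<in>[L] ==> e x \<in>[FL]"
 by (rule delta_closed[OF K.field_axioms monoid_free_monoid]) simp

private lemma env_rels_closed: "env_rels K L <= carrier FL"
 unfolding env_rels_def Let_def by (auto simp: ec L.bracket_closed)

private lemma I: "ideal I FL"
 unfolding env_ideal_def by (rule FL.genideal_ideal[OF env_rels_closed])

private lemma U: "assoc_algebra K U"
 unfolding env_algebra_def by (rule assoc_quot[OF FL I])

interpretation U: ring U by (rule algD[OF U])
interpretation MU: module K U by (rule algD[OF U])

private lemma \<iota>U_closed: "x \<in>[L] ==> \<iota>U x \<in>[U]"
 unfolding env_incl_def env_algebra_def quot_carrier[OF FL I] by (rule imageI[OF ec])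

private abbreviation "red_gen x == \<iota>U x ^[U] p -[U] \<iota>U (p_power L x) -[U] ((\<xi> x ^[K] p) \<odot>[U] \<one>[U])"

private lemma red_gen_closed: "x \<in>[L] ==> red_gen x \<in>[U]"
 by (simp add: \<iota>U_closed L.p_power_closed \<xi>)

private lemma J: "ideal J U"
 unfolding red_ideal_def Let_def by (rule U.genideal_ideal) (auto simp: red_gen_closed)

lemma assoc_red_env: "assoc_algebra K UA"
 unfolding red_env_algebra_def by (rule assoc_quot[OF U J])

interpretation UA: ring UA by (rule algD[OF assoc_red_env])
interpretation MA: module K UA by (rule algD[OF assoc_red_env])

private definition "qU = (\<lambda>x\<in>carrier FL. I +>\<^bsub>FL\<^esub> x)"
private definition "qA = (\<lambda>x\<in>carrier U. J +>\<^bsub>U\<^esub> x)"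

private lemma qU: "qU \<in> alg_homs K FL U"
 unfolding qU_def env_algebra_def by (rule quot_proj[OF FL I])

private lemma qA: "qA \<in> alg_homs K U UA"
 unfolding qA_def red_env_algebra_def by (rule quot_proj[OF U J])

private lemma qU_e: "x \<in>[L] ==> qU (e x) = \<iota>U x"
 by (simp add: qU_def ec env_incl_def)

private lemma qA_\<iota>: "x \<in>[L] ==> qA (\<iota>U x) = \<iota> x"
 by (simp add: qA_def \<iota>U_closed red_env_incl_def)

private lemma qU_zero: "r \<in> env_rels K L ==> qU r = \<zero>[U]"
proof -
 assume r: "r \<in> env_rels K L"
 have rc: "r \<in>[FL]" using env_rels_closed r by auto
 have "r \<in> I" unfolding env_ideal_def using FL.genideal_self[OF env_rels_closed] r by auto
 then show ?thesis using quot_zero_iff[OF FL I rc] rc by (simp add: qU_def env_algebra_def)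
qed

private lemma qA_zero: "x \<in>[L] ==> qA (red_gen x) = \<zero>[UA]"
proof -
 assume x: "x \<in>[L]"
 have "{red_gen x |x. x \<in>[L]} <= J"
  unfolding red_ideal_def Let_def by (rule U.genideal_self) (auto simp: red_gen_closed)
 then have "red_gen x \<in> J" using x by auto
 then show ?thesis using quot_zero_iff[OF U J red_gen_closed[OF x]] red_gen_closed[OF x]
  by (simp add: qA_def red_env_algebra_def)
qed

lemma incl_closed [simp]: "x \<in>[L] ==> \<iota> x \<in>[UA]"
 using lin_closed[OF hom_lin[OF qA] \<iota>U_closed] by (simp add: qA_\<iota>)

private lemmas linU = lin_add[OF hom_lin[OF qU]] lin_smult[OF hom_lin[OF qU]] hom_mult[OF qU]
 lin_diff[OF MF.module_axioms MU.module_axioms hom_lin[OF qU]]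
private lemmas linA = lin_add[OF hom_lin[OF qA]] lin_smult[OF hom_lin[OF qA]] hom_mult[OF qA]
 lin_diff[OF MU.module_axioms MA.module_axioms hom_lin[OF qA]] hom_one[OF qA] alg_homs_pow[OF U assoc_red_env qA]

private lemma rel_add: "[|x \<in>[L]; y \<in>[L]|] ==> e (x +[L] y) -[FL] (e x +[FL] e y) \<in> env_rels K L"
 and rel_smult: "[|c \<in>[K]; x \<in>[L]|] ==> e (c \<odot>[L] x) -[FL] (c \<odot>[FL] e x) \<in> env_rels K L"
 and rel_bracket: "[|x \<in>[L]; y \<in>[L]|] ==>
  (e x *[FL] e y) -[FL] (e y *[FL] e x) -[FL] e (lie_bracket L x y) \<in> env_rels K L"
 unfolding env_rels_def Let_def by blast+

lemma incl_add:
 assumes x: "x \<in>[L]" and y: "y \<in>[L]"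
 shows "\<iota> (x +[L] y) = \<iota> x +[UA] \<iota> y"
proof -
 have "\<iota>U (x +[L] y) -[U] (\<iota>U x +[U] \<iota>U y) = \<zero>[U]"
  using qU_zero[OF rel_add[OF x y]] x y by (simp add: linU ec qU_e)
 then have "\<iota>U (x +[L] y) = \<iota>U x +[U] \<iota>U y" using x y by (simp add: U.minus_zero_iff \<iota>U_closed)
 then have "qA (\<iota>U (x +[L] y)) = qA (\<iota>U x +[U] \<iota>U y)" by simp
 then show ?thesis using x y by (simp add: linA qA_\<iota> \<iota>U_closed)
qed

lemma incl_smult:
 assumes c: "c \<in>[K]" and x: "x \<in>[L]"
 shows "\<iota> (c \<odot>[L] x) = c \<odot>[UA] \<iota> x"
proof -
 have "\<iota>U (c \<odot>[L] x) -[U] (c \<odot>[U] \<iota>U x) = \<zero>[U]"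
  using qU_zero[OF rel_smult[OF c x]] x c by (simp add: linU ec qU_e)
 then have "\<iota>U (c \<odot>[L] x) = c \<odot>[U] \<iota>U x" using x c by (simp add: U.minus_zero_iff \<iota>U_closed)
 then have "qA (\<iota>U (c \<odot>[L] x)) = qA (c \<odot>[U] \<iota>U x)" by simp
 then show ?thesis using x c by (simp add: linA qA_\<iota> \<iota>U_closed)
qed

lemma incl_bracket:
 assumes x: "x \<in>[L]" and y: "y \<in>[L]"
 shows "\<iota> x *[UA] \<iota> y -[UA] \<iota> y *[UA] \<iota> x = \<iota> (lie_bracket L x y)"
proof -
 have b: "lie_bracket L x y \<in>[L]" using x y by (rule L.bracket_closed)
 have "\<iota>U x *[U] \<iota>U y -[U] \<iota>U y *[U] \<iota>U x -[U] \<iota>U (lie_bracket L x y) = \<zero>[U]"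
  using qU_zero[OF rel_bracket[OF x y]] x y b by (simp add: linU ec qU_e)
 then have "\<iota>U x *[U] \<iota>U y -[U] \<iota>U y *[U] \<iota>U x = \<iota>U (lie_bracket L x y)"
  using x y b by (simp add: U.minus_zero_iff \<iota>U_closed)
 then have "qA (\<iota>U x *[U] \<iota>U y -[U] \<iota>U y *[U] \<iota>U x) = qA (\<iota>U (lie_bracket L x y))" by simp
 then show ?thesis using x y b by (simp add: linA qA_\<iota> \<iota>U_closed)
qed

lemma incl_p_power:
 assumes x: "x \<in>[L]"
 shows "\<iota> x ^[UA] p = \<iota> (p_power L x) +[UA] ((\<xi> x ^[K] p) \<odot>[UA] \<one>[UA])"
proof -
 have c: "p_power L x \<in>[L]" "\<xi> x ^[K] p \<in>[K]" using x \<xi> L.p_power_closed by auto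
 let ?s = "(\<xi> x ^[K] p) \<odot>[UA] \<one>[UA]"
 have "\<iota> x ^[UA] p -[UA] \<iota> (p_power L x) -[UA] ?s = \<zero>[UA]"
  using qA_zero[OF x] x c by (simp add: linA qA_\<iota> \<iota>U_closed)
 then have "\<iota> x ^[UA] p -[UA] \<iota> (p_power L x) = ?s" using x c by (simp add: UA.minus_zero_iff)
 moreover have "\<iota> x ^[UA] p = \<iota> (p_power L x) +[UA] (\<iota> x ^[UA] p -[UA] \<iota> (p_power L x))"
 proof -
  have "\<iota> x ^[UA] p \<in>[UA]" "\<iota> (p_power L x) \<in>[UA]" using x c by auto
  then show ?thesis by algebra
 qed
 ultimately show ?thesis by simp
qed

text \<open>Identities in \<open>U\<^sub>\<xi>(L)\<close> and equalities of linear maps on it are all proved by this induction.\<close>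

lemma red_env_induct [consumes 1, case_names one gen add smult]:
 assumes "u \<in>[UA]" and one: "P \<one>[UA]"
  and gen: "!!x v. [|x \<in>[L]; v \<in>[UA]; P v|] ==> P (\<iota> x *[UA] v)"
  and add: "!!v w. [|v \<in>[UA]; w \<in>[UA]; P v; P w|] ==> P (v +[UA] w)"
  and smult: "!!c v. [|c \<in>[K]; v \<in>[UA]; P v|] ==> P (c \<odot>[UA] v)"
 shows "P u"
proof -
 let ?q = "\<lambda>x\<in>carrier FL. qA (qU x)"
 have q: "?q \<in> alg_homs K FL UA" by (rule alg_homs_compose[OF FL qU qA])
 have zero: "P \<zero>[UA]" using smult[OF K.zero_closed UA.one_closed one] by simp
 have "submodule {u \<in> carrier UA. P u} K UA"
  by (rule submoduleI'[OF MA.module_axioms]) (auto simp: zero add smult)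
 then have sub: "submodule {f \<in> carrier FL. ?q f \<in> {u \<in> carrier UA. P u}} K FL"
  by (rule submodule_preimage[OF MF.module_axioms MA.module_axioms hom_lin[OF q]])
 have dc: "delta K (free_monoid (carrier L)) w \<in>[FL]" if "w \<in> lists (carrier L)" for w
  using that by (intro delta_closed[OF K.field_axioms monoid_free_monoid]) simp
 have words: "?q (delta K (free_monoid (carrier L)) w) \<in> {u \<in> carrier UA. P u}" if "w \<in> lists (carrier L)" for w
  using that
 proof (induction w)
  case Nil
  have "?q \<one>[FL] = \<one>[UA]" by (rule hom_one[OF q])
  then show ?case using one ma_one[OF K.field_axioms monoid_free_monoid, of "carrier L"] by simp
 next
  case (Cons x w)
  have "delta K (free_monoid (carrier L)) (x # w) = e x *[FL] delta K (free_monoid (carrier L)) w"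
   using ma_mult_delta[OF K.field_axioms monoid_free_monoid, of "[x]" "carrier L" w] Cons by simp
  then have "?q (delta K (free_monoid (carrier L)) (x # w)) = ?q (e x) *[UA] ?q (delta K (free_monoid (carrier L)) w)"
   using Cons by (simp only: hom_mult[OF q] ec dc)
  also have "?q (e x) = \<iota> x" using Cons by (simp add: ec qU_e qA_\<iota>)
  finally show ?case using Cons gen by simp
 qed
 then have "delta K (free_monoid (carrier L)) ` carrier (free_monoid (carrier L)) <= {f \<in> carrier FL. ?q f \<in> {u \<in> carrier UA. P u}}"
  using dc by auto
 then have all: "carrier FL <= {f \<in> carrier FL. ?q f \<in> {u \<in> carrier UA. P u}}"
  using ma_spanning[OF K.field_axioms monoid_free_monoid, of "carrier L"] sub unfolding spanning_def by blast
 have "u \<in> (\<lambda>x. J +>\<^bsub>U\<^esub> x) ` carrier U" using assms(1) unfolding red_env_algebra_def quot_carrier[OF U J] .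
 then obtain v where v: "v \<in>[U]" "u = qA v" by (auto simp: qA_def)
 then have "v \<in> (\<lambda>x. I +>\<^bsub>FL\<^esub> x) ` carrier FL" unfolding env_algebra_def quot_carrier[OF FL I] by simp
 then obtain f where f: "f \<in>[FL]" "v = qU f" by (auto simp: qU_def)
 have "?q f = u" using f v by simp
 then show ?thesis using all f(1) by auto
qed

lemma red_env_hom_eqI:
 assumes B: "assoc_algebra K B" and f: "f \<in> alg_homs K UA B" and g: "g \<in> alg_homs K UA B"
  and eq: "!!x. x \<in>[L] ==> f (\<iota> x) = g (\<iota> x)"
 shows "f = g"
proof (rule lin_ext[OF hom_lin[OF f] hom_lin[OF g]])
 fix u assume "u \<in>[UA]"
 then show "f u = g u"
  by (induction rule: red_env_induct)
   (simp_all add: hom_one[OF f] hom_one[OF g] hom_mult[OF f] hom_mult[OF g] eq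
    lin_add[OF hom_lin[OF f]] lin_add[OF hom_lin[OF g]] lin_smult[OF hom_lin[OF f]] lin_smult[OF hom_lin[OF g]])
qed

text \<open>The universal property, obtained from those of the free algebra and of the two quotients.\<close>

theorem red_env_lift:
 assumes B: "assoc_algebra K B" and cl: "!!x. x \<in>[L] ==> \<phi> x \<in>[B]"
  and add: "!!x y. [|x \<in>[L]; y \<in>[L]|] ==> \<phi> (x +[L] y) = \<phi> x +[B] \<phi> y"
  and smult: "!!c x. [|c \<in>[K]; x \<in>[L]|] ==> \<phi> (c \<odot>[L] x) = c \<odot>[B] \<phi> x"
  and bracket: "!!x y. [|x \<in>[L]; y \<in>[L]|] ==> \<phi> x *[B] \<phi> y -[B] \<phi> y *[B] \<phi> x = \<phi> (lie_bracket L x y)"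
  and p_power: "!!x. x \<in>[L] ==> \<phi> x ^[B] p = \<phi> (p_power L x) +[B] ((\<xi> x ^[K] p) \<odot>[B] \<one>[B])"
 shows "red_env_lift K p L \<xi> B \<phi> \<in> alg_homs K UA B"
  and "!!x. x \<in>[L] ==> red_env_lift K p L \<xi> B \<phi> (\<iota> x) = \<phi> x"
proof -
 interpret B: ring B by (rule algD[OF B])
 interpret MB: module K B by (rule algD[OF B])
 have "\<exists>f \<in> alg_homs K FL B. \<forall>x\<in>carrier L. f (e x) = \<phi> x"
  by (rule free_hom[OF B cl])
 then obtain f where f: "f \<in> alg_homs K FL B" and fe: "\<forall>x\<in>carrier L. f (e x) = \<phi> x" by (elim bexE)
 note lf = lin_add[OF hom_lin[OF f]] lin_smult[OF hom_lin[OF f]] hom_mult[OF f]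
  lin_diff[OF MF.module_axioms MB.module_axioms hom_lin[OF f]]
 have "env_rels K L <= {x \<in> carrier FL. f x = \<zero>[B]}"
  unfolding env_rels_def Let_def
  by (auto simp: ec L.bracket_closed lf fe cl add smult bracket B.minus_zero_iff)
 then have "I <= {x \<in> carrier FL. f x = \<zero>[B]}"
  unfolding env_ideal_def by (rule FL.genideal_minimal[OF ideal_kernel[OF FL B f]])
 then have ker: "f x = \<zero>[B]" if "x \<in> I" for x using that by auto
 have "\<exists>g \<in> alg_homs K U B. \<forall>x\<in>carrier FL. g (I +>\<^bsub>FL\<^esub> x) = f x"
  unfolding env_algebra_def by (rule quot_lift_hom[OF FL I B f ker])
 then obtain g where g: "g \<in> alg_homs K U B" and g': "\<forall>x\<in>carrier FL. g (I +>\<^bsub>FL\<^esub> x) = f x" by (elim bexE)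
 have g\<iota>: "g (\<iota>U x) = \<phi> x" if "x \<in>[L]" for x
  using bspec[OF g' ec[OF that]] fe that by (simp add: env_incl_def)
 note lg = lin_add[OF hom_lin[OF g]] lin_smult[OF hom_lin[OF g]] hom_mult[OF g]
  lin_diff[OF MU.module_axioms MB.module_axioms hom_lin[OF g]] hom_one[OF g] alg_homs_pow[OF U B g]
 have "g (red_gen x) = \<zero>[B]" if x: "x \<in>[L]" for x
 proof -
  have c: "p_power L x \<in>[L]" "\<xi> x ^[K] p \<in>[K]" using x \<xi> L.p_power_closed by auto
  let ?s = "(\<xi> x ^[K] p) \<odot>[B] \<one>[B]"
  have "g (red_gen x) = \<phi> (p_power L x) +[B] ?s -[B] \<phi> (p_power L x) -[B] ?s"
   using x c by (simp add: lg \<iota>U_closed g\<iota> p_power)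
  also have "... = \<zero>[B]"
  proof -
   have "\<phi> (p_power L x) \<in>[B]" "?s \<in>[B]" using cl c by auto
   then show ?thesis by algebra
  qed
  finally show ?thesis .
 qed
 then have "{red_gen x |x. x \<in>[L]} <= {x \<in> carrier U. g x = \<zero>[B]}" using red_gen_closed by auto
 then have "J <= {x \<in> carrier U. g x = \<zero>[B]}"
  unfolding red_ideal_def Let_def by (rule U.genideal_minimal[OF ideal_kernel[OF U B g]])
 then have ker: "g x = \<zero>[B]" if "x \<in> J" for x using that by auto
 have "\<exists>h \<in> alg_homs K UA B. \<forall>x\<in>carrier U. h (J +>\<^bsub>U\<^esub> x) = g x"
  unfolding red_env_algebra_def by (rule quot_lift_hom[OF U J B g ker])
 then obtain h where h: "h \<in> alg_homs K UA B" and h': "\<forall>x\<in>carrier U. h (J +>\<^bsub>U\<^esub> x) = g x" by (elim bexE)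
 have h\<iota>: "h (\<iota> x) = \<phi> x" if "x \<in>[L]" for x
  using bspec[OF h' \<iota>U_closed[OF that]] g\<iota> that by (simp add: red_env_incl_def)
 have "\<exists>!f. f \<in> alg_homs K UA B \<and> (\<forall>x\<in>carrier L. f (\<iota> x) = \<phi> x)"
 proof (rule ex1I[of _ h])
  fix h2 assume h2: "h2 \<in> alg_homs K UA B \<and> (\<forall>x\<in>carrier L. h2 (\<iota> x) = \<phi> x)"
  show "h2 = h" by (rule red_env_hom_eqI[OF B conjunct1[OF h2] h]) (use h2 h\<iota> in simp)
 qed (use h h\<iota> in blast)
 from theI'[OF this] show "red_env_lift K p L \<xi> B \<phi> \<in> alg_homs K UA B"
  "!!x. x \<in>[L] ==> red_env_lift K p L \<xi> B \<phi> (\<iota> x) = \<phi> x"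
  unfolding red_env_lift_def by blast+
qed

end

section \<open>Representations with a given p-character\<close>

text \<open>The maps that extend to a reduced enveloping algebra. The scalars \<open>s x\<close> stand for \<open>\<xi>(x)\<^sup>p\<close>:
  in this form they add up when two commuting representations are added.\<close>

definition lie_rep ::
 "('k, 'm) ring_scheme => nat => ('k, 'g, 'n) p_lie_scheme => ('g => 'k) => ('k, 'b, 'o) module_scheme => ('g => 'b) => bool"
 where "lie_rep K p L s B \<phi> \<longleftrightarrow> (\<forall>x\<in>carrier L. \<phi> x \<in>[B] \<and> s x \<in>[K] \<and>
   \<phi> x ^[B] p = \<phi> (p_power L x) +[B] (s x \<odot>[B] \<one>[B]) \<and>
   (\<forall>y\<in>carrier L. \<phi> (x +[L] y) = \<phi> x +[B] \<phi> y \<and>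
    \<phi> x *[B] \<phi> y -[B] \<phi> y *[B] \<phi> x = \<phi> (lie_bracket L x y)) \<and>
   (\<forall>c\<in>carrier K. \<phi> (c \<odot>[L] x) = c \<odot>[B] \<phi> x))"

lemma lie_repD:
 assumes "lie_rep K p L s B \<phi>" "x \<in>[L]"
 shows "\<phi> x \<in>[B]" "s x \<in>[K]" "\<phi> x ^[B] p = \<phi> (p_power L x) +[B] (s x \<odot>[B] \<one>[B])"
  "y \<in>[L] ==> \<phi> (x +[L] y) = \<phi> x +[B] \<phi> y"
  "y \<in>[L] ==> \<phi> x *[B] \<phi> y -[B] \<phi> y *[B] \<phi> x = \<phi> (lie_bracket L x y)"
  "c \<in>[K] ==> \<phi> (c \<odot>[L] x) = c \<odot>[B] \<phi> x"
proof -
 note 1 = bspec[OF assms(1)[unfolded lie_rep_def] assms(2)]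
 note 2 = conjunct2[OF 1] note 3 = conjunct2[OF 2] note 4 = conjunct2[OF 3]
 show "\<phi> x \<in>[B]" by (rule conjunct1[OF 1])
 show "s x \<in>[K]" by (rule conjunct1[OF 2])
 show "\<phi> x ^[B] p = \<phi> (p_power L x) +[B] (s x \<odot>[B] \<one>[B])" by (rule conjunct1[OF 3])
 show "\<phi> (x +[L] y) = \<phi> x +[B] \<phi> y" if "y \<in>[L]"
  by (rule conjunct1[OF bspec[OF conjunct1[OF 4] that]])
 show "\<phi> x *[B] \<phi> y -[B] \<phi> y *[B] \<phi> x = \<phi> (lie_bracket L x y)" if "y \<in>[L]"
  by (rule conjunct2[OF bspec[OF conjunct1[OF 4] that]])
 show "\<phi> (c \<odot>[L] x) = c \<odot>[B] \<phi> x" if "c \<in>[K]"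
  by (rule bspec[OF conjunct2[OF 4] that])
qed

lemma lie_repI:
 assumes "!!x. x \<in>[L] ==> \<phi> x \<in>[B]" "!!x. x \<in>[L] ==> s x \<in>[K]"
  "!!x. x \<in>[L] ==> \<phi> x ^[B] p = \<phi> (p_power L x) +[B] (s x \<odot>[B] \<one>[B])"
  "!!x y. [|x \<in>[L]; y \<in>[L]|] ==> \<phi> (x +[L] y) = \<phi> x +[B] \<phi> y"
  "!!x y. [|x \<in>[L]; y \<in>[L]|] ==> \<phi> x *[B] \<phi> y -[B] \<phi> y *[B] \<phi> x = \<phi> (lie_bracket L x y)"
  "!!c x. [|c \<in>[K]; x \<in>[L]|] ==> \<phi> (c \<odot>[L] x) = c \<odot>[B] \<phi> x"
 shows "lie_rep K p L s B \<phi>"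
 unfolding lie_rep_def by (intro ballI conjI; rule assms; assumption)

context
 fixes K :: "('k, 'm) ring_scheme" and L :: "('k, 'g, 'n) p_lie_scheme" and p :: nat
 assumes L: "p_lie_algebra K L p"
begin

interpretation K: field K using L by (simp add: p_lie_algebra_def lie_algebra_def)
interpretation VL: module K L using L by (simp add: p_lie_algebra_def lie_algebra_def)
interpretation L: p_lie_algebra K L p by (rule L)

lemma lie_rep_cong:
 assumes "lie_rep K p L s B \<phi>" "!!x. x \<in>[L] ==> \<phi> x = \<psi> x" "!!x. x \<in>[L] ==> s x = t x"
 shows "lie_rep K p L t B \<psi>"
 using lie_repD[OF assms(1)] assms(2,3)
 by (intro lie_repI) (simp_all add: L.p_power_closed L.bracket_closed)

lemma lie_rep_hom:
 assumes B: "assoc_algebra K B" and C: "assoc_algebra K C" and \<phi>: "lie_rep K p L s B \<phi>" and f: "f \<in> alg_homs K B C"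
 shows "lie_rep K p L s C (\<lambda>x. f (\<phi> x))"
proof -
 interpret B: ring B by (rule algD[OF B])
 interpret MB: module K B by (rule algD[OF B])
 interpret MC: module K C by (rule algD[OF C])
 note r = lie_repD[OF \<phi>] and l = hom_lin[OF f]
 have br: "f (\<phi> x) *[C] f (\<phi> y) -[C] f (\<phi> y) *[C] f (\<phi> x) = f (\<phi> (lie_bracket L x y))"
  if "x \<in>[L]" "y \<in>[L]" for x y
 proof -
  have "f (\<phi> x *[B] \<phi> y -[B] \<phi> y *[B] \<phi> x) = f (\<phi> (lie_bracket L x y))" using r(5)[OF that] by simp
  then show ?thesis using that r(1)
   by (simp add: lin_diff[OF MB.module_axioms MC.module_axioms l] hom_mult[OF f])
 qed
 have pw: "f (\<phi> x) ^[C] p = f (\<phi> (p_power L x)) +[C] (s x \<odot>[C] \<one>[C])" if "x \<in>[L]" for x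
  unfolding alg_homs_pow[OF B C f r(1)[OF that], symmetric] r(3)[OF that] using that
  by (simp add: r(1,2) lin_add[OF l] lin_smult[OF l] hom_one[OF f] L.p_power_closed)
 show ?thesis
  by (rule lie_repI) (simp_all add: r(1,2,4,6) br pw lin_closed[OF l] lin_add[OF l] lin_smult[OF l])
qed

text \<open>For commuting summands the cross terms of the commutator cancel, and the \<open>p\<close>-th power is additive.\<close>

lemma lie_rep_add:
 assumes B: "assoc_algebra K B" and f: "lie_rep K p L s B f" and g: "lie_rep K p L t B g"
  and comm: "!!x y. [|x \<in>[L]; y \<in>[L]|] ==> f x *[B] g y = g y *[B] f x"
 shows "lie_rep K p L (\<lambda>x. s x +[K] t x) B (\<lambda>x. f x +[B] g x)"
proof -
 interpret B: ring B by (rule algD[OF B])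
 interpret MB: module K B by (rule algD[OF B])
 note rf = lie_repD[OF f] and rg = lie_repD[OF g]
 have br: "(f x +[B] g x) *[B] (f y +[B] g y) -[B] (f y +[B] g y) *[B] (f x +[B] g x)
   = f (lie_bracket L x y) +[B] g (lie_bracket L x y)" if x: "x \<in>[L]" and y: "y \<in>[L]" for x y
 proof -
  have "f x \<in>[B]" "f y \<in>[B]" "g x \<in>[B]" "g y \<in>[B]" using x y rf(1) rg(1) by auto
  then have "(f x +[B] g x) *[B] (f y +[B] g y) -[B] (f y +[B] g y) *[B] (f x +[B] g x)
   = (f x *[B] f y -[B] f y *[B] f x) +[B] (g x *[B] g y -[B] g y *[B] g x)
    +[B] (f x *[B] g y -[B] g y *[B] f x) -[B] (f y *[B] g x -[B] g x *[B] f y)"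
   by algebra
  also have "... = f (lie_bracket L x y) +[B] g (lie_bracket L x y)"
   unfolding comm[OF x y] comm[OF y x] rf(5)[OF x y] rg(5)[OF x y]
   using rf(1) rg(1) x y L.bracket_closed[OF x y] by (simp add: a_minus_def B.r_neg)
  finally show ?thesis .
 qed
 have pw: "(f x +[B] g x) ^[B] p = f (p_power L x) +[B] g (p_power L x) +[B] ((s x +[K] t x) \<odot>[B] \<one>[B])"
  if x: "x \<in>[L]" for x
 proof -
  have "(f x +[B] g x) ^[B] p = f x ^[B] p +[B] g x ^[B] p"
   by (rule frobenius_add[OF K.field_axioms L.p_pos L.char_p B rf(1)[OF x] rg(1)[OF x] comm[OF x x]])
  then show ?thesis using x rf rg L.p_power_closed[OF x] by (simp add: MB.smult_l_distr B.a_ac)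
 qed
 show ?thesis
  by (rule lie_repI) (simp_all add: rf rg br pw B.a_ac MB.smult_r_distr)
qed

lemma lie_rep_zero:
 assumes B: "assoc_algebra K B"
 shows "lie_rep K p L (\<lambda>x. \<zero>[K]) B (\<lambda>x. \<zero>[B])"
proof -
 interpret B: ring B by (rule algD[OF B])
 interpret MB: module K B by (rule algD[OF B])
 show ?thesis
  by (rule lie_repI) (simp_all add: a_minus_def B.nat_pow_zero L.p_pos[THEN gr_implies_not0])
qed

text \<open>The sign compensates for the reversal of commutators; it also changes the sign of the \<open>p\<close>-character,
  since \<open>(-u)\<^sup>p = -u\<^sup>p\<close> in characteristic \<open>p\<close>.\<close>

lemma lie_rep_op:
 assumes B: "assoc_algebra K B" and f: "lie_rep K p L s B f"
 shows "lie_rep K p L (\<lambda>x. -[K] s x) (op_algebra B) (\<lambda>x. -[B] f x)"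
proof -
 interpret B: ring B by (rule algD[OF B])
 interpret MB: module K B by (rule algD[OF B])
 interpret O: ring "op_algebra B" by (rule algD[OF assoc_op[OF B]])
 note r = lie_repD[OF f]
 have neg: "-[op_algebra B] u = -[B] u" for u
  by (simp add: a_inv_def m_inv_def op_algebra_def)
 have pow: "u ^[op_algebra B] (n::nat) = u ^[B] n" if u: "u \<in>[B]" for u n
 proof (induction n)
  case (Suc n)
  have "u ^[op_algebra B] Suc n = u *[B] u ^[B] n" using Suc by simp
  also have "... = u ^[B] Suc n" by (rule B.nat_pow_Suc2[OF u, symmetric])
  finally show ?case .
 qed simp
 have negp: "(-[B] u) ^[B] p = -[B] (u ^[B] p)" if u: "u \<in>[B]" for u
 proof -
  have "(\<zero>[B] -[B] u) ^[B] p = \<zero>[B] ^[B] p -[B] u ^[B] p"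
   by (rule frobenius_diff[OF K.field_axioms L.p_pos L.char_p B]) (use u in simp_all)
  then show ?thesis using u by (simp add: B.nat_pow_zero L.p_pos[THEN gr_implies_not0] a_minus_def)
 qed
 have br: "-[B] f y *[B] -[B] f x -[op_algebra B] -[B] f x *[B] -[B] f y = -[B] f (lie_bracket L x y)"
  if x: "x \<in>[L]" and y: "y \<in>[L]" for x y
 proof -
  have c: "f x \<in>[B]" "f y \<in>[B]" using x y r(1) by auto
  have "-[B] f (lie_bracket L x y) = -[B] (f x *[B] f y -[B] f y *[B] f x)" using r(5)[OF x y] by simp
  also have "... = -[B] f y *[B] -[B] f x +[B] -[B] (-[B] f x *[B] -[B] f y)"
   using c by algebra
  finally show ?thesis by (simp add: a_minus_def neg)
 qed
 show ?thesis
  by (rule lie_repI)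
   (simp_all add: r(1,2,4,6) pow negp r(3) br L.p_power_closed MB.smult_l_minus MB.smult_r_minus B.minus_add)
qed

lemma red_env_lift_rep:
 assumes \<xi>: "\<xi> \<in> carrier L \<rightarrow> carrier K" and B: "assoc_algebra K B"
  and \<phi>: "lie_rep K p L (\<lambda>x. \<xi> x ^[K] p) B \<phi>"
 shows "red_env_lift K p L \<xi> B \<phi> \<in> alg_homs K (red_env_algebra K p L \<xi>) B"
  and "x \<in>[L] ==> red_env_lift K p L \<xi> B \<phi> (red_env_incl K p L \<xi> x) = \<phi> x"
proof -
 note r = lie_repD[OF \<phi>]
 have sm: "\<phi> (c \<odot>[L] x) = c \<odot>[B] \<phi> x" if "c \<in>[K]" "x \<in>[L]" for c x by (rule r(6)[OF that(2,1)])
 note l = red_env_lift[OF L \<xi> B r(1) r(4) sm r(5) r(3)]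
 show "red_env_lift K p L \<xi> B \<phi> \<in> alg_homs K (red_env_algebra K p L \<xi>) B" by (rule l(1))
 show "x \<in>[L] ==> red_env_lift K p L \<xi> B \<phi> (red_env_incl K p L \<xi> x) = \<phi> x" by (rule l(2))
qed

lemma lie_rep_incl:
 assumes \<xi>: "\<xi> \<in> carrier L \<rightarrow> carrier K"
 shows "lie_rep K p L (\<lambda>x. \<xi> x ^[K] p) (red_env_algebra K p L \<xi>) (red_env_incl K p L \<xi>)"
 using incl_closed[OF L \<xi>] incl_p_power[OF L \<xi>] incl_add[OF L \<xi>] incl_bracket[OF L \<xi>] incl_smult[OF L \<xi>] funcset_mem[OF \<xi>]
 by (intro lie_repI) simp_all

end

lemma tens_left_hom:
 assumes A: "assoc_algebra K A" and B: "assoc_algebra K B"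
 shows "(\<lambda>a\<in>carrier A. tens K A B a \<one>[B]) \<in> alg_homs K A (tensor K A B)"
proof -
 interpret A: ring A by (rule algD[OF A])
 interpret B: ring B by (rule algD[OF B])
 show ?thesis
  by (intro alg_homsI lin_restrictI[OF algD(2)[OF A]])
   (simp_all add: tens_closed[OF A B] tens_add_left[OF A B] tens_smult_left[OF A B] tens_one[OF A B] tens_mult[OF A B])
qed

lemma tens_right_hom:
 assumes A: "assoc_algebra K A" and B: "assoc_algebra K B"
 shows "(\<lambda>b\<in>carrier B. tens K A B \<one>[A] b) \<in> alg_homs K B (tensor K A B)"
proof -
 interpret A: ring A by (rule algD[OF A])
 interpret B: ring B by (rule algD[OF B])
 show ?thesis
  by (intro alg_homsI lin_restrictI[OF algD(2)[OF B]])
   (simp_all add: tens_closed[OF A B] tens_add_right[OF A B] tens_smult_right[OF A B] tens_one[OF A B] tens_mult[OF A B])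
qed

lemma lie_rep_tensor:
 assumes L: "p_lie_algebra K L p" and A: "assoc_algebra K A" and B: "assoc_algebra K B"
  and f: "lie_rep K p L s A f" and g: "lie_rep K p L t B g"
 shows "lie_rep K p L (\<lambda>x. s x +[K] t x) (tensor K A B)
  (\<lambda>x. tens K A B (f x) \<one>[B] +[tensor K A B] tens K A B \<one>[A] (g x))"
proof -
 interpret A: ring A by (rule algD[OF A])
 interpret B: ring B by (rule algD[OF B])
 note T = assoc_tensor[OF A B]
 have 1: "lie_rep K p L s (tensor K A B) (\<lambda>x. tens K A B (f x) \<one>[B])"
  by (rule lie_rep_cong[OF L lie_rep_hom[OF L A T f tens_left_hom[OF A B]]]) (simp_all add: lie_repD(1)[OF f])
 have 2: "lie_rep K p L t (tensor K A B) (\<lambda>x. tens K A B \<one>[A] (g x))"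
  by (rule lie_rep_cong[OF L lie_rep_hom[OF L B T g tens_right_hom[OF A B]]]) (simp_all add: lie_repD(1)[OF g])
 show ?thesis
  by (rule lie_rep_add[OF L T 1 2]) (simp add: tens_mult[OF A B] lie_repD(1)[OF f] lie_repD(1)[OF g])
qed

section \<open>Multiplication operators\<close>

definition left_mult :: "('k, 'a, 'n) module_scheme => 'a => 'a => 'a" where
 "left_mult A a = (\<lambda>u\<in>carrier A. a *[A] u)"

definition right_mult :: "('k, 'a, 'n) module_scheme => 'a => 'a => 'a" where
 "right_mult A a = (\<lambda>u\<in>carrier A. u *[A] a)"

context
 fixes K A
 assumes A: "assoc_algebra K A"
begin

interpretation K: field K by (rule algD[OF A])
interpretation A: ring A by (rule algD[OF A])
interpretation MA: module K A by (rule algD[OF A])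

lemma mult_ops_lin:
 assumes "a \<in>[A]"
 shows "left_mult A a \<in> lin_maps K A A" "right_mult A a \<in> lin_maps K A A"
 unfolding left_mult_def right_mult_def using assms
 by (auto intro!: lin_restrictI[OF MA.module_axioms] simp: A.l_distr A.r_distr alg_smult[OF A])

lemma left_mult_hom: "(\<lambda>a\<in>carrier A. left_mult A a) \<in> alg_homs K A (end_algebra K A)"
proof -
 have e: "f = g" if "f \<in> lin_maps K A A" "g \<in> lin_maps K A A" "!!u. u \<in>[A] ==> f u = g u" for f g
  by (rule lin_ext[OF that])
 note cl = end_closed[OF MA.module_axioms] end_consts_closed[OF MA.module_axioms] mult_ops_lin
 have add: "left_mult A (a +[A] b) = left_mult A a +[end_algebra K A] left_mult A b" if "a \<in>[A]" "b \<in>[A]" for a b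
  by (rule e) (use that in \<open>simp_all add: cl(1,6) end_apply left_mult_def[of A] A.l_distr mult_ops_lin(1)[unfolded left_mult_def]\<close>)
 have mult: "left_mult A (a *[A] b) = left_mult A a *[end_algebra K A] left_mult A b" if "a \<in>[A]" "b \<in>[A]" for a b
  by (rule e) (use that in \<open>simp_all add: cl(2,6) end_apply left_mult_def[of A] A.m_assoc mult_ops_lin(1)[unfolded left_mult_def]\<close>)
 have smult: "left_mult A (c \<odot>[A] a) = c \<odot>[end_algebra K A] left_mult A a" if "a \<in>[A]" "c \<in>[K]" for a c
  by (rule e[OF mult_ops_lin(1) cl(3)[OF mult_ops_lin(1) mult_ops_lin(1)]])
   (use that in \<open>simp_all add: end_apply left_mult_def[of A] alg_smult[OF A]\<close>)
 have one: "left_mult A \<one>[A] = \<one>[end_algebra K A]"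
  by (rule e) (use mult_ops_lin(1)[OF A.one_closed] in \<open>simp_all add: cl(4) end_apply left_mult_def\<close>)
 show ?thesis
  by (intro alg_homsI lin_restrictI[OF MA.module_axioms]) (simp_all add: mult_ops_lin add mult smult one)
qed

lemma right_mult_hom: "(\<lambda>a\<in>carrier A. right_mult A a) \<in> alg_homs K (op_algebra A) (end_algebra K A)"
proof -
 have e: "f = g" if "f \<in> lin_maps K A A" "g \<in> lin_maps K A A" "!!u. u \<in>[A] ==> f u = g u" for f g
  by (rule lin_ext[OF that])
 note cl = end_closed[OF MA.module_axioms] end_consts_closed[OF MA.module_axioms] mult_ops_lin
 have add: "right_mult A (a +[A] b) = right_mult A a +[end_algebra K A] right_mult A b" if "a \<in>[A]" "b \<in>[A]" for a b
  by (rule e) (use that in \<open>simp_all add: cl(1,7) end_apply right_mult_def[of A] A.r_distr mult_ops_lin(2)[unfolded right_mult_def]\<close>)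
 have mult: "right_mult A (b *[A] a) = right_mult A a *[end_algebra K A] right_mult A b" if "a \<in>[A]" "b \<in>[A]" for a b
  by (rule e) (use that in \<open>simp_all add: cl(2,7) end_apply right_mult_def[of A] A.m_assoc mult_ops_lin(2)[unfolded right_mult_def]\<close>)
 have smult: "right_mult A (c \<odot>[A] a) = c \<odot>[end_algebra K A] right_mult A a" if "a \<in>[A]" "c \<in>[K]" for a c
  by (rule e[OF mult_ops_lin(2) cl(3)[OF mult_ops_lin(2) mult_ops_lin(2)]])
   (use that in \<open>simp_all add: end_apply right_mult_def[of A] alg_smult[OF A]\<close>)
 have one: "right_mult A \<one>[A] = \<one>[end_algebra K A]"
  by (rule e) (use mult_ops_lin(2)[OF A.one_closed] in \<open>simp_all add: cl(4) end_apply right_mult_def\<close>)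
 have "(\<lambda>a\<in>carrier (op_algebra A). right_mult A a) \<in> lin_maps K (op_algebra A) (end_algebra K A)"
  by (rule lin_restrictI[OF algD(2)[OF assoc_op[OF A]]]) (simp_all add: mult_ops_lin add smult)
 then show ?thesis
  by (intro alg_homsI) (simp_all add: mult one)
qed

lemma lie_rep_adjoint:
 assumes L: "p_lie_algebra K L p" and f: "lie_rep K p L s A f"
 shows "lie_rep K p L (\<lambda>x. \<zero>[K]) (end_algebra K A) (\<lambda>x. \<lambda>u\<in>carrier A. (f x *[A] u) -[A] (u *[A] f x))"
proof -
 note E = assoc_end[OF algD(1,2)[OF A]]
 note r = lie_repD[OF f]
 have 1: "lie_rep K p L s (end_algebra K A) (\<lambda>x. left_mult A (f x))"
  by (rule lie_rep_cong[OF L lie_rep_hom[OF L A E f left_mult_hom]]) (simp_all add: r)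
 have 2: "lie_rep K p L (\<lambda>x. -[K] s x) (end_algebra K A) (\<lambda>x. right_mult A (-[A] f x))"
  by (rule lie_rep_cong[OF L lie_rep_hom[OF L assoc_op[OF A] E lie_rep_op[OF L A f] right_mult_hom]]) (simp_all add: r)
 have comm: "left_mult A a *[end_algebra K A] right_mult A b = right_mult A b *[end_algebra K A] left_mult A a"
  if "a \<in>[A]" "b \<in>[A]" for a b
  by (rule lin_ext[of _ K A A _ A])
   (use that in \<open>simp_all add: end_closed[OF MA.module_axioms] mult_ops_lin end_apply left_mult_def[of A] right_mult_def[of A] A.m_assoc
    mult_ops_lin[unfolded right_mult_def left_mult_def]\<close>)
 have "lie_rep K p L (\<lambda>x. s x +[K] -[K] s x) (end_algebra K A)
   (\<lambda>x. left_mult A (f x) +[end_algebra K A] right_mult A (-[A] f x))"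
  by (rule lie_rep_add[OF L E 1 2]) (simp add: comm r)
 then show ?thesis
 proof (rule lie_rep_cong[OF L])
  fix x assume x: "x \<in>[L]"
  show "s x +[K] -[K] s x = \<zero>[K]" using r(2)[OF x] by (rule K.r_neg)
  have fx: "f x \<in>[A]" by (rule r(1)[OF x])
  show "left_mult A (f x) +[end_algebra K A] right_mult A (-[A] f x) = (\<lambda>u\<in>carrier A. (f x *[A] u) -[A] (u *[A] f x))"
   using fx by (auto simp: end_algebra_def left_mult_def right_mult_def a_minus_def A.r_minus fun_eq_iff)
 qed
qed

end

(* The unconditional rule would introduce a case distinction at every application of a restricted map. *)
declare restrict_apply [simp del] and restrict_apply' [simp]

section \<open>The Hopf algebra of a restricted Lie algebra and its coactions\<close>

context
 fixes K :: "('k, 'm) ring_scheme" and L :: "('k, 'g, 'n) p_lie_scheme" and p :: nat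
 assumes L: "p_lie_algebra K L p"
begin

interpretation K: field K using L by (simp add: p_lie_algebra_def lie_algebra_def)
interpretation VL: module K L using L by (simp add: p_lie_algebra_def lie_algebra_def)
interpretation L: p_lie_algebra K L p by (rule L)

private abbreviation "z == zero_form K L"
private abbreviation "H == restr_env_algebra K p L"
private abbreviation "\<iota>H == restr_env_incl K p L"
private abbreviation "eps == restr_counit K p L"

lemma zero_form_closed: "z \<in> carrier L \<rightarrow> carrier K"
 by simp

private lemma zero_form_pow: "x \<in>[L] ==> z x ^[K] p = \<zero>[K]"
 by (simp add: K.nat_pow_zero L.p_pos[THEN gr_implies_not0])

lemma assoc_restr_env: "assoc_algebra K H"
 by (rule assoc_red_env[OF L zero_form_closed])

private lemmas H = assoc_restr_env
interpretation H: ring H by (rule algD[OF H])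
interpretation MH: module K H by (rule algD[OF H])

private lemma \<iota>H [simp]: "x \<in>[L] ==> \<iota>H x \<in>[H]"
 by (rule incl_closed[OF L zero_form_closed])

lemma restr_rep_lift:
 assumes B: "assoc_algebra K B" and \<phi>: "lie_rep K p L (\<lambda>x. \<zero>[K]) B \<phi>"
 shows "red_env_lift K p L z B \<phi> \<in> alg_homs K H B"
  and "x \<in>[L] ==> red_env_lift K p L z B \<phi> (\<iota>H x) = \<phi> x"
proof -
 have "lie_rep K p L (\<lambda>x. z x ^[K] p) B \<phi>"
  by (rule lie_rep_cong[OF L \<phi> refl zero_form_pow[symmetric]])
 note l = red_env_lift_rep[OF L zero_form_closed B this]
 show "red_env_lift K p L z B \<phi> \<in> alg_homs K H B" by (rule l(1))
 show "x \<in>[L] ==> red_env_lift K p L z B \<phi> (\<iota>H x) = \<phi> x" by (rule l(2))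
qed

lemma restr_rep_incl: "lie_rep K p L (\<lambda>x. \<zero>[K]) H \<iota>H"
 by (rule lie_rep_cong[OF L lie_rep_incl[OF L zero_form_closed] refl zero_form_pow])

lemma counit: "eps \<in> alg_homs K H (self_algebra K)" "x \<in>[L] ==> eps (\<iota>H x) = \<zero>[K]"
proof -
 note S = assoc_self[OF K.field_axioms]
 have "lie_rep K p L (\<lambda>x. \<zero>[K]) (self_algebra K) (\<lambda>x. \<zero>[K])"
  using lie_rep_zero[OF L S] by simp
 note l = restr_rep_lift[OF S this]
 show "eps \<in> alg_homs K H (self_algebra K)" unfolding restr_counit_def by (rule l(1))
 show "x \<in>[L] ==> eps (\<iota>H x) = \<zero>[K]" unfolding restr_counit_def by (rule l(2))
qed

private lemma eps_closed [simp]: "h \<in>[H] ==> eps h \<in>[K]"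
 using lin_closed[OF hom_lin[OF counit(1)]] by simp

private lemma eps_rules:
 "[|g \<in>[H]; h \<in>[H]|] ==> eps (g +[H] h) = eps g +[K] eps h"
 "[|c \<in>[K]; h \<in>[H]|] ==> eps (c \<odot>[H] h) = c *[K] eps h"
 "[|g \<in>[H]; h \<in>[H]|] ==> eps (g *[H] h) = eps g *[K] eps h"
 "eps \<one>[H] = \<one>[K]"
 using lin_add[OF hom_lin[OF counit(1)]] lin_smult[OF hom_lin[OF counit(1)]]
  hom_mult[OF counit(1)] hom_one[OF counit(1)] by simp_all

context
 fixes \<xi> :: "'g => 'k"
 assumes \<xi>: "\<xi> \<in> carrier L \<rightarrow> carrier K"
begin

private abbreviation "A == red_env_algebra K p L \<xi>"
private abbreviation "\<iota>A == red_env_incl K p L \<xi>"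
private abbreviation "TA == tensor K H A"
private abbreviation "D == coaction K p L \<xi>"

private lemmas A = assoc_red_env[OF L \<xi>]
private lemmas TA = assoc_tensor[OF H A]
interpretation A: ring A by (rule algD[OF A])
interpretation MA: module K A by (rule algD[OF A])
interpretation TA: ring TA by (rule algD[OF TA])
interpretation MT: module K TA by (rule algD[OF TA])

private lemma \<iota>A [simp]: "x \<in>[L] ==> \<iota>A x \<in>[A]"
 by (rule incl_closed[OF L \<xi>])

lemma coaction:
 "D \<in> alg_homs K A TA"
 "x \<in>[L] ==> D (\<iota>A x) = tens K H A \<one>[H] (\<iota>A x) +[TA] tens K H A (\<iota>H x) \<one>[A]"
proof -
 have "lie_rep K p L (\<lambda>x. \<xi> x ^[K] p) TA (\<lambda>x. tens K H A \<one>[H] (\<iota>A x) +[TA] tens K H A (\<iota>H x) \<one>[A])"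
 proof (rule lie_rep_cong[OF L lie_rep_tensor[OF L H A restr_rep_incl lie_rep_incl[OF L \<xi>]]])
  fix x assume x: "x \<in>[L]"
  show "tens K H A (\<iota>H x) \<one>[A] +[TA] tens K H A \<one>[H] (\<iota>A x) = tens K H A \<one>[H] (\<iota>A x) +[TA] tens K H A (\<iota>H x) \<one>[A]"
   by (rule TA.a_comm) (use x in \<open>auto intro!: tens_closed[OF H A]\<close>)
  show "\<zero>[K] +[K] \<xi> x ^[K] p = \<xi> x ^[K] p"
   using funcset_mem[OF \<xi> x] by simp
 qed
 note l = red_env_lift_rep[OF L \<xi> TA this]
 show "D \<in> alg_homs K A TA" unfolding coaction_def Let_def by (rule l(1))
 show "x \<in>[L] ==> D (\<iota>A x) = tens K H A \<one>[H] (\<iota>A x) +[TA] tens K H A (\<iota>H x) \<one>[A]"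
  unfolding coaction_def Let_def by (rule l(2))
qed

text \<open>The adjoint action exists because left multiplications by \<open>x\<close> and right multiplications by
  \<open>-x\<close> form commuting representations with opposite \<open>p\<close>-characters.\<close>

lemma adjoint:
 "adjoint_action K p L \<xi> \<in> alg_homs K H (end_algebra K A)"
 "[|x \<in>[L]; u \<in>[A]|] ==> adjoint_action K p L \<xi> (\<iota>H x) u = (\<iota>A x *[A] u) -[A] (u *[A] \<iota>A x)"
proof -
 note E = assoc_end[OF K.field_axioms MA.module_axioms]
 note l = restr_rep_lift[OF E lie_rep_adjoint[OF A L lie_rep_incl[OF L \<xi>]]]
 show "adjoint_action K p L \<xi> \<in> alg_homs K H (end_algebra K A)"
  unfolding adjoint_action_def Let_def by (rule l(1))
 show "adjoint_action K p L \<xi> (\<iota>H x) u = (\<iota>A x *[A] u) -[A] (u *[A] \<iota>A x)" if "x \<in>[L]" "u \<in>[A]"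
  unfolding adjoint_action_def Let_def l(2)[OF that(1)] using that(2) by simp
qed

private abbreviation "act == adjoint_action K p L \<xi>"

private lemma act_lin: "h \<in>[H] ==> act h \<in> lin_maps K A A"
 using lin_closed[OF hom_lin[OF adjoint(1)]] by simp

lemma adjoint_closed: "[|h \<in>[H]; a \<in>[A]|] ==> act h a \<in>[A]"
 using lin_closed[OF act_lin] .

lemma adjoint_rules:
 assumes a: "a \<in>[A]"
 shows "[|g \<in>[H]; h \<in>[H]|] ==> act (g +[H] h) a = act g a +[A] act h a"
  "[|c \<in>[K]; h \<in>[H]|] ==> act (c \<odot>[H] h) a = c \<odot>[A] act h a"
  "[|g \<in>[H]; h \<in>[H]|] ==> act (g *[H] h) a = act g (act h a)"
  "act \<one>[H] a = a"
  "[|h \<in>[H]; b \<in>[A]|] ==> act h (a +[A] b) = act h a +[A] act h b"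
  "[|c \<in>[K]; h \<in>[H]|] ==> act h (c \<odot>[A] a) = c \<odot>[A] act h a"
 using lin_add[OF hom_lin[OF adjoint(1)]] lin_smult[OF hom_lin[OF adjoint(1)]]
  hom_mult[OF adjoint(1)] hom_one[OF adjoint(1)] lin_add[OF act_lin a] lin_smult[OF act_lin _ a] a
 by (simp_all add: end_apply)

text \<open>Both sides are homomorphisms that send \<open>x \<in> L\<close> to the sum of the three ways to place \<open>x\<close> beside units. The
  comultiplication enters only through its values on \<open>L\<close>, so that the same proof gives the coassociativity of \<open>U\<^sub>0(L)\<close>.\<close>

lemma coaction_coassoc:
 assumes DH: "\<Delta> \<in> alg_homs K H (tensor K H H)"
  "!!x. x \<in>[L] ==> \<Delta> (\<iota>H x) = tens K H H \<one>[H] (\<iota>H x) +[tensor K H H] tens K H H (\<iota>H x) \<one>[H]"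
  and b: "b \<in>[A]"
 shows "tensor_assoc K H H A (tensor_map K H A (tensor K H H) A \<Delta> (\<lambda>x. x) (D b)) =
     tensor_map K H A H TA (\<lambda>x. x) D (D b)"
proof -
 let ?HH = "tensor K H H" and ?Q = "tensor K H TA"
 note HH = assoc_tensor[OF H H] and Q = assoc_tensor[OF H TA]
 note HHA = assoc_tensor[OF HH A]
 interpret HH: ring ?HH by (rule algD[OF HH])
 interpret Q: ring ?Q by (rule algD[OF Q])
 interpret HHA: ring "tensor K ?HH A" by (rule algD[OF HHA])
 note linD = linear_on_lin[OF MH.module_axioms hom_lin[OF DH(1)]]
 note linC = linear_on_lin[OF MA.module_axioms hom_lin[OF coaction(1)]]
 let ?l = "tensor_map K H A ?HH A \<Delta> (\<lambda>x. x)" and ?r = "tensor_map K H A H TA (\<lambda>x. x) D"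
 note lc = H A HH A linD linear_on_id[OF MA.module_axioms] and rc = H A H TA linear_on_id[OF MH.module_axioms] linC
 have l: "?l \<in> alg_homs K TA (tensor K ?HH A)"
  by (rule tensor_map_hom[OF lc]) (simp_all add: hom_one[OF DH(1)] hom_mult[OF DH(1)])
 have r: "?r \<in> alg_homs K TA ?Q"
  by (rule tensor_map_hom[OF rc]) (simp_all add: hom_one[OF coaction(1)] hom_mult[OF coaction(1)])
 note ta = tensor_assoc[OF H H A]
 note f1 = alg_homs_compose[OF A alg_homs_compose[OF A coaction(1) l] ta(1)]
 note f2 = alg_homs_compose[OF A coaction(1) r]
 note cl = tens_closed[OF H A] tens_closed[OF H H] tens_closed[OF HH A] tens_closed[OF H TA]
 note Dcl = lin_closed[OF hom_lin[OF DH(1)]]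
 have "(\<lambda>b\<in>carrier A. tensor_assoc K H H A ((\<lambda>b\<in>carrier A. ?l (D b)) b)) = (\<lambda>b\<in>carrier A. ?r (D b))"
 proof (rule red_env_hom_eqI[OF L \<xi> Q f1 f2])
  fix x assume x: "x \<in>[L]"
  let ?h = "\<iota>H x" and ?a = "\<iota>A x" and ?eH = "\<one>[H]" and ?eA = "\<one>[A]"
  have "?l (D ?a) = tens K ?HH A (tens K H H ?eH ?eH) ?a +[tensor K ?HH A]
   (tens K ?HH A (tens K H H ?eH ?h) ?eA +[tensor K ?HH A] tens K ?HH A (tens K H H ?h ?eH) ?eA)"
   using x by (simp add: coaction(2) lin_add[OF hom_lin[OF l]] tensor_map(2)[OF lc] cl DH(2)
     hom_one[OF DH(1)] tens_one[OF H H] tens_add_left[OF HH A])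
  then have 1: "tensor_assoc K H H A (?l (D ?a)) = tens K H TA ?eH (tens K H A ?eH ?a) +[?Q]
   (tens K H TA ?eH (tens K H A ?h ?eA) +[?Q] tens K H TA ?h (tens K H A ?eH ?eA))"
   using x by (simp add: lin_add[OF hom_lin[OF ta(1)]] cl ta(2))
  have 2: "?r (D ?a) = (tens K H TA ?eH (tens K H A ?eH ?a) +[?Q] tens K H TA ?eH (tens K H A ?h ?eA))
    +[?Q] tens K H TA ?h (tens K H A ?eH ?eA)"
   using x by (simp add: coaction(2) lin_add[OF hom_lin[OF r]] tensor_map(2)[OF rc] cl
     hom_one[OF coaction(1)] tens_one[OF H A] tens_add_right[OF H TA])
  show "(\<lambda>b\<in>carrier A. tensor_assoc K H H A ((\<lambda>b\<in>carrier A. ?l (D b)) b)) ?a = (\<lambda>b\<in>carrier A. ?r (D b)) ?a"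
   using x 1 2 by (simp add: Q.a_assoc cl)
 qed
 from fun_cong[OF this, of b] show ?thesis using b by simp
qed

lemma coaction_counit:
 assumes b: "b \<in>[A]"
 shows "tensor_lift K H A A (\<lambda>u y. eps u \<odot>[A] y) (D b) = b"
proof -
 have bil: "bilinear_map K H A A (\<lambda>u y. eps u \<odot>[A] y)"
  by (rule bilinear_mapI[OF MH.module_axioms MA.module_axioms])
   (simp_all add: eps_rules MA.smult_l_distr MA.smult_r_distr MA.smult_assoc1[symmetric] K.m_comm)
 note l = tensor_lift[OF H A MA.module_axioms bil]
 have h: "tensor_lift K H A A (\<lambda>u y. eps u \<odot>[A] y) \<in> alg_homs K TA A"
  by (rule tensor_lift_hom[OF H A A bil])
   (simp_all add: eps_rules alg_smult[OF A] MA.smult_assoc1[symmetric] K.m_comm)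
 have i: "(\<lambda>b\<in>carrier A. b) \<in> alg_homs K A A"
  by (rule alg_homsI[OF lin_restrictI[OF MA.module_axioms]]) simp_all
 have "(\<lambda>b\<in>carrier A. tensor_lift K H A A (\<lambda>u y. eps u \<odot>[A] y) (D b)) = (\<lambda>b\<in>carrier A. b)"
  by (rule red_env_hom_eqI[OF L \<xi> A alg_homs_compose[OF A coaction(1) h] i])
   (simp add: coaction(2) lin_add[OF hom_lin[OF h]] l(2) tens_closed[OF H A] eps_rules counit(2))
 from fun_cong[OF this, of b] show ?thesis using b by simp
qed

end

private abbreviation "HH == tensor K H H"
private abbreviation "\<Delta> == restr_comult K p L"

private lemmas zf = zero_form_closed
private lemmas HH = assoc_tensor[OF H H]

interpretation HH: ring HH by (rule algD[OF HH])
interpretation MHH: module K HH by (rule algD[OF HH])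

lemma restr_comult:
 "\<Delta> \<in> alg_homs K H HH"
 "x \<in>[L] ==> \<Delta> (\<iota>H x) = tens K H H (\<iota>H x) \<one>[H] +[HH] tens K H H \<one>[H] (\<iota>H x)"
proof -
 have "lie_rep K p L (\<lambda>x. \<zero>[K]) HH (\<lambda>x. tens K H H (\<iota>H x) \<one>[H] +[HH] tens K H H \<one>[H] (\<iota>H x))"
  by (rule lie_rep_cong[OF L lie_rep_tensor[OF L H H restr_rep_incl restr_rep_incl] refl])
   (rule K.l_zero[OF K.zero_closed])
 note l = restr_rep_lift[OF HH this]
 show "\<Delta> \<in> alg_homs K H HH" unfolding restr_comult_def Let_def by (rule l(1))
 show "x \<in>[L] ==> \<Delta> (\<iota>H x) = tens K H H (\<iota>H x) \<one>[H] +[HH] tens K H H \<one>[H] (\<iota>H x)"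
  unfolding restr_comult_def Let_def by (rule l(2))
qed

lemma restr_comult':
 "x \<in>[L] ==> \<Delta> (\<iota>H x) = tens K H H \<one>[H] (\<iota>H x) +[HH] tens K H H (\<iota>H x) \<one>[H]"
 by (simp add: restr_comult(2) HH.a_comm tens_closed[OF H H])

lemma restr_comult_eq_coaction: "\<Delta> = coaction K p L (zero_form K L)"
 by (rule red_env_hom_eqI[OF L zf HH restr_comult(1) coaction(1)[OF zf]])
  (simp_all add: restr_comult' coaction(2)[OF zf])

private lemma \<Delta>_gen: "[|x \<in>[L]; h \<in>[H]|] ==>
  \<Delta> (\<iota>H x *[H] h) = tens K H H (\<iota>H x) \<one>[H] *[HH] \<Delta> h +[HH] tens K H H \<one>[H] (\<iota>H x) *[HH] \<Delta> h"
 using lin_closed[OF hom_lin[OF restr_comult(1)], of h]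
 by (simp add: hom_mult[OF restr_comult(1)] restr_comult(2) HH.l_distr tens_closed[OF H H])

private lemmas eps_add = eps_rules(1) and eps_smult = eps_rules(2) and eps_mult = eps_rules(3) and eps_one = eps_rules(4)

private lemmas tind = spanning_induct[OF MHH.module_axioms tensor_spanning[OF H H], consumes 1, case_names gen zero add smult]
private lemmas hind = red_env_induct[OF L zf, consumes 1, case_names one gen add smult]

lemma counit_right:
 assumes h: "h \<in>[H]"
 shows "tensor_lift K H H H (\<lambda>x y. eps y \<odot>[H] x) (\<Delta> h) = h"
proof -
 have bil: "bilinear_map K H H H (\<lambda>x y. eps y \<odot>[H] x)"
  by (rule bilinear_mapI[OF MH.module_axioms MH.module_axioms])
   (simp_all add: eps_closed eps_add eps_smult MH.smult_l_distr MH.smult_r_distr MH.smult_assoc1[symmetric] K.m_comm)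
 note l = tensor_lift[OF H H MH.module_axioms bil]
 have f: "tensor_lift K H H H (\<lambda>x y. eps y \<odot>[H] x) \<in> alg_homs K HH H"
  by (rule tensor_lift_hom[OF H H H bil])
   (simp_all add: eps_one eps_mult eps_closed alg_smult[OF H] MH.smult_assoc1[symmetric] K.m_comm)
 have i: "(\<lambda>b\<in>carrier H. b) \<in> alg_homs K H H"
  by (rule alg_homsI[OF lin_restrictI[OF MH.module_axioms]]) simp_all
 have "(\<lambda>b\<in>carrier H. tensor_lift K H H H (\<lambda>x y. eps y \<odot>[H] x) (\<Delta> b)) = (\<lambda>b\<in>carrier H. b)"
  by (rule red_env_hom_eqI[OF L zf H alg_homs_compose[OF H restr_comult(1) f] i])
   (simp add: restr_comult(2) lin_add[OF hom_lin[OF f]] l(2) tens_closed[OF H H] eps_one counit(2))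
 from fun_cong[OF this, of h] show ?thesis using h by simp
qed

definition restr_antipode :: "('k, 'g) red_env => ('k, 'g) red_env" where
 "restr_antipode = red_env_lift K p L (zero_form K L) (op_algebra H) (\<lambda>x. -[H] \<iota>H x)"

private abbreviation "S == restr_antipode"

lemma antipode:
 "S \<in> alg_homs K H (op_algebra H)" "x \<in>[L] ==> S (\<iota>H x) = -[H] \<iota>H x"
proof -
 have "lie_rep K p L (\<lambda>x. \<zero>[K]) (op_algebra H) (\<lambda>x. -[H] \<iota>H x)"
  by (rule lie_rep_cong[OF L lie_rep_op[OF L H restr_rep_incl] refl]) (rule K.minus_zero)
 note l = restr_rep_lift[OF assoc_op[OF H] this]
 show "S \<in> alg_homs K H (op_algebra H)" unfolding restr_antipode_def by (rule l(1))
 show "x \<in>[L] ==> S (\<iota>H x) = -[H] \<iota>H x" unfolding restr_antipode_def by (rule l(2))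
qed

private lemmas S_add = lin_add[OF hom_lin[OF antipode(1)], simplified]
 and S_smult = lin_smult[OF hom_lin[OF antipode(1)], simplified]
 and S_mult = hom_mult[OF antipode(1), simplified]
 and S_one = hom_one[OF antipode(1), simplified]
 and S_closed = lin_closed[OF hom_lin[OF antipode(1)], simplified]

text \<open>The antipode is an antihomomorphism with \<open>S(x) = -x\<close>, so the proof is an induction along left multiplications
  by elements of \<open>L\<close>: the two terms that \<open>\<Delta>(x)\<close> contributes cancel.\<close>

lemma antipode_left:
 assumes h: "h \<in>[H]"
 shows "tensor_lift K H H H (\<lambda>x y. S x *[H] y) (\<Delta> h) = eps h \<odot>[H] \<one>[H]"
proof -
 have bil: "bilinear_map K H H H (\<lambda>x y. S x *[H] y)"
  by (rule bilinear_mapI[OF MH.module_axioms MH.module_axioms])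
   (simp_all add: S_closed S_add S_smult H.l_distr H.r_distr alg_smult[OF H])
 let ?l = "tensor_lift K H H H (\<lambda>x y. S x *[H] y)"
 note l = tensor_lift[OF H H MH.module_axioms bil]
 note ll = lin_add[OF l(1)] lin_smult[OF l(1)] lin_zero[OF MHH.module_axioms MH.module_axioms l(1)] lin_closed[OF l(1)]
 note cl = tens_closed[OF H H] and smT = alg_smult[OF HH]
 have x1: "?l (tens K H H (\<iota>H x) \<one>[H] *[HH] t +[HH] tens K H H \<one>[H] (\<iota>H x) *[HH] t) = \<zero>[H]"
  if x: "x \<in>[L]" and t: "t \<in>[HH]" for x t
  using t
 proof (induction rule: tind)
  case (gen s)
  then obtain u v where s: "s = tens K H H u v" "u \<in>[H]" "v \<in>[H]" by blast
  have "?l (tens K H H (\<iota>H x) \<one>[H] *[HH] s +[HH] tens K H H \<one>[H] (\<iota>H x) *[HH] s)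
   = S u *[H] -[H] \<iota>H x *[H] v +[H] S u *[H] (\<iota>H x *[H] v)"
   using s(2,3) x by (simp add: s(1) tens_mult[OF H H] ll cl l(2) S_mult antipode(2))
  also have "... = \<zero>[H]" using s(2,3) x S_closed[OF s(2)]
   by (simp add: H.m_assoc H.l_minus H.r_minus H.l_neg)
  finally show ?case .
 next
  case zero
  then show ?case using x by (simp add: cl ll)
 next
  case (add s t)
  let ?a = "tens K H H (\<iota>H x) \<one>[H]" and ?b = "tens K H H \<one>[H] (\<iota>H x)"
  have c: "?a \<in>[HH]" "?b \<in>[HH]" using x by (simp_all add: cl)
  have "?a *[HH] (s +[HH] t) +[HH] ?b *[HH] (s +[HH] t) =
    (?a *[HH] s +[HH] ?b *[HH] s) +[HH] (?a *[HH] t +[HH] ?b *[HH] t)"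
   using c add.hyps by (simp add: HH.r_distr HH.a_ac)
  then show ?case using add c by (simp only: lin_add[OF l(1)] HH.a_closed HH.m_closed H.r_zero H.zero_closed)
 next
  case (smult c t)
  let ?a = "tens K H H (\<iota>H x) \<one>[H]" and ?b = "tens K H H \<one>[H] (\<iota>H x)"
  have c: "?a \<in>[HH]" "?b \<in>[HH]" using x by (simp_all add: cl)
  have "?a *[HH] (c \<odot>[HH] t) +[HH] ?b *[HH] (c \<odot>[HH] t) = c \<odot>[HH] (?a *[HH] t +[HH] ?b *[HH] t)"
   using c smult.hyps by (simp add: smT MHH.smult_r_distr)
  then show ?case using smult c by (simp add: lin_smult[OF l(1)])
 qed
 show ?thesis using h
 proof (induction rule: hind)
  case one
  then show ?case by (simp add: hom_one[OF restr_comult(1)] tens_one[OF H H] l(2) S_one eps_one)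
 next
  case (gen x v)
  then show ?case using lin_closed[OF hom_lin[OF restr_comult(1)], of v]
   by (simp add: \<Delta>_gen x1 eps_mult counit(2) eps_closed)
 qed (simp_all add: lin_add[OF hom_lin[OF restr_comult(1)]] lin_smult[OF hom_lin[OF restr_comult(1)]]
   lin_closed[OF hom_lin[OF restr_comult(1)]] ll eps_add eps_smult eps_closed MH.smult_l_distr MH.smult_assoc1)
qed

lemma antipode_right:
 assumes h: "h \<in>[H]"
 shows "tensor_lift K H H H (\<lambda>x y. x *[H] S y) (\<Delta> h) = eps h \<odot>[H] \<one>[H]"
proof -
 have bil: "bilinear_map K H H H (\<lambda>x y. x *[H] S y)"
  by (rule bilinear_mapI[OF MH.module_axioms MH.module_axioms])
   (simp_all add: S_closed S_add S_smult H.l_distr H.r_distr alg_smult[OF H])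
 let ?l = "tensor_lift K H H H (\<lambda>x y. x *[H] S y)"
 note l = tensor_lift[OF H H MH.module_axioms bil]
 note ll = lin_add[OF l(1)] lin_smult[OF l(1)] lin_zero[OF MHH.module_axioms MH.module_axioms l(1)] lin_closed[OF l(1)]
 note cl = tens_closed[OF H H] and smT = alg_smult[OF HH]
 have x1: "?l (tens K H H (\<iota>H x) \<one>[H] *[HH] t +[HH] tens K H H \<one>[H] (\<iota>H x) *[HH] t) = \<iota>H x *[H] ?l t -[H] ?l t *[H] \<iota>H x"
  if x: "x \<in>[L]" and t: "t \<in>[HH]" for x t
  using t
 proof (induction rule: tind)
  case (gen s)
  then obtain u v where s: "s = tens K H H u v" "u \<in>[H]" "v \<in>[H]" by blast
  have "?l (tens K H H (\<iota>H x) \<one>[H] *[HH] s +[HH] tens K H H \<one>[H] (\<iota>H x) *[HH] s)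
   = \<iota>H x *[H] u *[H] S v +[H] u *[H] (S v *[H] -[H] \<iota>H x)"
   using s(2,3) x by (simp add: s(1) tens_mult[OF H H] ll cl l(2) S_mult antipode(2))
  also have "... = \<iota>H x *[H] (u *[H] S v) -[H] (u *[H] S v) *[H] \<iota>H x" using s(2,3) x S_closed[OF s(3)]
   by (simp add: H.m_assoc H.l_minus H.r_minus a_minus_def)
  finally show ?case using s by (simp add: l(2))
 next
  case zero
  then show ?case using x by (simp add: cl ll a_minus_def)
 next
  case (add s t)
  let ?a = "tens K H H (\<iota>H x) \<one>[H]" and ?b = "tens K H H \<one>[H] (\<iota>H x)"
  have c: "?a \<in>[HH]" "?b \<in>[HH]" using x by (simp_all add: cl)
  have 1: "?a *[HH] (s +[HH] t) +[HH] ?b *[HH] (s +[HH] t) =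
    (?a *[HH] s +[HH] ?b *[HH] s) +[HH] (?a *[HH] t +[HH] ?b *[HH] t)"
   using c add.hyps by (simp add: HH.r_distr HH.a_ac)
  have "\<iota>H x \<in>[H]" "?l s \<in>[H]" "?l t \<in>[H]" using x add.hyps ll(4) by auto
  then have 2: "\<iota>H x *[H] (?l s +[H] ?l t) -[H] (?l s +[H] ?l t) *[H] \<iota>H x =
    (\<iota>H x *[H] ?l s -[H] ?l s *[H] \<iota>H x) +[H] (\<iota>H x *[H] ?l t -[H] ?l t *[H] \<iota>H x)"
   by (simp add: a_minus_def H.l_distr H.r_distr H.minus_add H.a_ac)
  show ?case unfolding 1 lin_add[OF l(1) add.hyps] 2 add.IH[symmetric]
   by (rule lin_add[OF l(1)]) (use c add.hyps in simp_all)
 next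
  case (smult c t)
  let ?a = "tens K H H (\<iota>H x) \<one>[H]" and ?b = "tens K H H \<one>[H] (\<iota>H x)"
  have c: "?a \<in>[HH]" "?b \<in>[HH]" using x by (simp_all add: cl)
  have "?a *[HH] (c \<odot>[HH] t) +[HH] ?b *[HH] (c \<odot>[HH] t) = c \<odot>[HH] (?a *[HH] t +[HH] ?b *[HH] t)"
   using c smult.hyps by (simp add: smT MHH.smult_r_distr)
  then show ?case using smult c x
   by (simp add: lin_smult[OF l(1)] ll(4) alg_smult[OF H] a_minus_def MH.smult_r_distr MH.smult_r_minus)
 qed
 show ?thesis using h
 proof (induction rule: hind)
  case one
  then show ?case by (simp add: hom_one[OF restr_comult(1)] tens_one[OF H H] l(2) S_one eps_one)
 next
  case (gen x v)
  then show ?case using lin_closed[OF hom_lin[OF restr_comult(1)], of v]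
   by (simp add: \<Delta>_gen x1 eps_mult counit(2) eps_closed alg_smult[OF H] a_minus_def H.r_neg)
 qed (simp_all add: lin_add[OF hom_lin[OF restr_comult(1)]] lin_smult[OF hom_lin[OF restr_comult(1)]]
   lin_closed[OF hom_lin[OF restr_comult(1)]] ll eps_add eps_smult eps_closed MH.smult_l_distr MH.smult_assoc1)
qed

theorem restr_hopf_algebra: "hopf_algebra K H \<Delta> eps"
proof -
 have S: "S \<in> lin_maps K H H"
  by (rule lin_mapsI) (simp_all add: S_closed S_add S_smult lin_undefined[OF hom_lin[OF antipode(1)]])
 show ?thesis
  unfolding hopf_algebra_def
 proof (intro conjI ballI bexI[of _ S])
  fix h assume h: "h \<in>[H]"
  show "tensor_assoc K H H H (tensor_map K H H HH H \<Delta> (\<lambda>x. x) (\<Delta> h)) = tensor_map K H H H HH (\<lambda>x. x) \<Delta> (\<Delta> h)"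
   using coaction_coassoc[OF zf restr_comult(1) restr_comult' h] by (simp add: restr_comult_eq_coaction[symmetric])
  show "tensor_lift K H H H (\<lambda>x y. eps x \<odot>[H] y) (\<Delta> h) = h"
   using coaction_counit[OF zf h] by (simp add: restr_comult_eq_coaction)
 qed (simp_all add: H restr_comult(1) counit(1) counit_right antipode_left antipode_right S)
qed

end

section \<open>The adjoint action and the coaction\<close>

definition contraction ::
 "('k, 'm) ring_scheme => ('k, 'a, 'n) module_scheme => ('k, 'b, 'o) module_scheme
  => ('a => 'k) => ('a \<times> 'b => 'k) set => 'b" where
 "contraction K A B f = tensor_lift K A B B (\<lambda>h y. f h \<odot>[B] y)"

lemma dual_space_rules:
 assumes "f \<in> dual_space K A" "g \<in>[A]"
 shows "f g \<in>[K]" "h \<in>[A] ==> f (g +[A] h) = f g +[K] f h"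
  "c \<in>[K] ==> f (c \<odot>[A] g) = c *[K] f g"
 using lin_closed[OF assms(1)] lin_add[OF assms(1)] lin_smult[OF assms(1)] assms(2) by simp_all

context
 fixes K A B
 assumes A: "assoc_algebra K A" and B: "assoc_algebra K B"
begin

lemma contraction:
 assumes f: "f \<in> dual_space K A"
 shows "contraction K A B f \<in> lin_maps K (tensor K A B) B"
  "[|h \<in>[A]; y \<in>[B]|] ==> contraction K A B f (tens K A B h y) = f h \<odot>[B] y"
proof -
 interpret K: field K by (rule algD[OF A])
 interpret MA: module K B by (rule algD(2)[OF B])
 note d = dual_space_rules[OF f]
 have "bilinear_map K A B B (\<lambda>h y. f h \<odot>[B] y)"
  by (rule bilinear_mapI[OF algD(2)[OF A] algD(2)[OF B]])
   (simp_all add: d MA.smult_l_distr MA.smult_r_distr MA.smult_assoc1[symmetric] K.m_comm)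
 note l = tensor_lift[OF A B algD(2)[OF B] this]
 show "contraction K A B f \<in> lin_maps K (tensor K A B) B" unfolding contraction_def by (rule l(1))
 show "[|h \<in>[A]; y \<in>[B]|] ==> contraction K A B f (tens K A B h y) = f h \<odot>[B] y"
  unfolding contraction_def by (rule l(2))
qed

text \<open>For pure tensors this is the expansion of the left factor in the basis.\<close>

lemma tensor_contraction_expand:
 assumes d: "dual_bases K A n h h'" and t: "t \<in>[tensor K A B]"
 shows "t = (\<Oplus>\<^bsub>tensor K A B\<^esub>i\<in>{..<n}. tens K A B (h i) (contraction K A B (h' i) t))"
proof -
 interpret K: field K by (rule algD[OF A])
 interpret MH: module K A by (rule algD(2)[OF A])
 interpret MA: module K B by (rule algD(2)[OF B])
 interpret MT: module K "tensor K A B" by (rule algD(2)[OF assoc_tensor[OF A B]])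
 have h: "h i \<in>[A]" and h': "h' i \<in> dual_space K A" if "i < n" for i
  using d that by (auto simp: dual_bases_def basis_def)
 note cc = contraction(1)[OF h']
 note lc = lin_closed[OF cc] lin_add[OF cc] lin_smult[OF cc] lin_zero[OF algD(2)[OF assoc_tensor[OF A B]] algD(2)[OF B] cc]
 note cl = tens_closed[OF A B]
 note ind = spanning_induct[OF algD(2)[OF assoc_tensor[OF A B]] tensor_spanning[OF A B], consumes 1, case_names gen zero add smult]
 have tz: "tens K A B g \<zero>[B] = \<zero>[tensor K A B]" if "g \<in>[A]" for g
  using that tens_smult_right[OF A B, of "\<zero>[K]" g "\<zero>[B]"] by (simp add: cl)
 show ?thesis using t
 proof (induction rule: ind)
  case (gen s)
  then obtain u y where s: "s = tens K A B u y" "u \<in>[A]" "y \<in>[B]" by blast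
  have tl: "(\<lambda>u\<in>carrier A. tens K A B u y) \<in> lin_maps K A (tensor K A B)"
   by (rule lin_restrictI[OF algD(2)[OF A]])
    (simp_all add: s cl tens_add_left[OF A B] tens_smult_left[OF A B])
  have hu: "h' i u \<in>[K]" if "i < n" for i using dual_space_rules(1)[OF h'[OF that] s(2)] .
  have "s = (\<lambda>u\<in>carrier A. tens K A B u y) (\<Oplus>\<^bsub>A\<^esub>i\<in>{..<n}. h' i u \<odot>[A] h i)"
   using dual_bases_expand[OF K.field_axioms algD(2)[OF A] d s(2)] s by simp
  also have "... = (\<Oplus>\<^bsub>tensor K A B\<^esub>i\<in>{..<n}. (\<lambda>u\<in>carrier A. tens K A B u y) (h' i u \<odot>[A] h i))"
   by (rule lin_finsum[OF algD(2)[OF A] algD(2)[OF assoc_tensor[OF A B]] tl]) (simp_all add: Pi_iff hu h)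
  also have "... = (\<Oplus>\<^bsub>tensor K A B\<^esub>i\<in>{..<n}. tens K A B (h i) (contraction K A B (h' i) s))"
   by (rule MT.M.finsum_cong')
    (simp_all add: Pi_iff hu h s contraction(2)[OF h'] tens_smult_left[OF A B] tens_smult_right[OF A B] cl)
  finally show ?case .
 next
  case zero
  have "(\<Oplus>\<^bsub>tensor K A B\<^esub>i\<in>{..<n}. tens K A B (h i) (contraction K A B (h' i) \<zero>[tensor K A B])) = \<zero>[tensor K A B]"
   by (rule MT.M.add.finprod_one_eqI) (simp add: lc(4) h tz)
  then show ?case by simp
 next
  case (add s t)
  have "(\<Oplus>\<^bsub>tensor K A B\<^esub>i\<in>{..<n}. tens K A B (h i) (contraction K A B (h' i) (s +[tensor K A B] t)))
   = (\<Oplus>\<^bsub>tensor K A B\<^esub>i\<in>{..<n}. tens K A B (h i) (contraction K A B (h' i) s) +[tensor K A B] tens K A B (h i) (contraction K A B (h' i) t))"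
   by (rule MT.M.finsum_cong') (simp_all add: Pi_iff h add.hyps lc tens_add_right[OF A B] cl)
  also have "... = (\<Oplus>\<^bsub>tensor K A B\<^esub>i\<in>{..<n}. tens K A B (h i) (contraction K A B (h' i) s)) +[tensor K A B] (\<Oplus>\<^bsub>tensor K A B\<^esub>i\<in>{..<n}. tens K A B (h i) (contraction K A B (h' i) t))"
   by (rule MT.M.finsum_addf) (simp_all add: Pi_iff h add.hyps lc cl)
  finally show ?case using add.IH by simp
 next
  case (smult c t)
  have "(\<Oplus>\<^bsub>tensor K A B\<^esub>i\<in>{..<n}. tens K A B (h i) (contraction K A B (h' i) (c \<odot>[tensor K A B] t)))
   = (\<Oplus>\<^bsub>tensor K A B\<^esub>i\<in>{..<n}. c \<odot>[tensor K A B] tens K A B (h i) (contraction K A B (h' i) t))"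
   by (rule MT.M.finsum_cong') (simp_all add: Pi_iff h smult.hyps lc tens_smult_right[OF A B] cl)
  also have "... = c \<odot>[tensor K A B] (\<Oplus>\<^bsub>tensor K A B\<^esub>i\<in>{..<n}. tens K A B (h i) (contraction K A B (h' i) t))"
   by (rule MT.finsum_smult_ldistr[symmetric]) (simp_all add: Pi_iff h smult.hyps lc cl)
  finally show ?case using smult.IH by simp
 qed
qed

end

locale red_env_setup =
 fixes K :: "('k, 'm) ring_scheme" and L :: "('k, 'g, 'n) p_lie_scheme" and p :: nat and \<xi> :: "'g => 'k"
 assumes L: "p_lie_algebra K L p" and \<xi>: "\<xi> \<in> carrier L \<rightarrow> carrier K"
begin

abbreviation "U0 == restr_env_algebra K p L"
abbreviation "Ux == red_env_algebra K p L \<xi>"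
abbreviation "i0 == restr_env_incl K p L"
abbreviation "ix == red_env_incl K p L \<xi>"
abbreviation "\<Delta>\<^sub>0 == restr_comult K p L"
abbreviation "\<epsilon>\<^sub>0 == restr_counit K p L"
abbreviation "coact == coaction K p L \<xi>"
abbreviation "ad == adjoint_action K p L \<xi>"
abbreviation "\<T> == tensor K U0 Ux"
abbreviation "\<T>\<^sub>0 == tensor K U0 U0"

lemmas zero_fun = zero_form_closed[OF L]
lemmas assoc_U0 = assoc_restr_env[OF L]
lemmas assoc_Uxi = assoc_red_env[OF L \<xi>]
lemmas assoc_T = assoc_tensor[OF assoc_U0 assoc_Uxi]
lemmas assoc_T0 = assoc_tensor[OF assoc_U0 assoc_U0]
lemmas module_U0 = algD(2)[OF assoc_U0]
lemmas module_Uxi = algD(2)[OF assoc_Uxi]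
lemmas module_T = algD(2)[OF assoc_T]
lemmas module_T0 = algD(2)[OF assoc_T0]

lemma incl0_closed [simp]: "x \<in>[L] ==> i0 x \<in>[U0]"
 by (rule incl_closed[OF L zero_fun])

lemma inclxi_closed [simp]: "x \<in>[L] ==> ix x \<in>[Ux]"
 by (rule incl_closed[OF L \<xi>])

lemmas U0_induct = red_env_induct[OF L zero_fun, consumes 1, case_names one gen add smult]
lemmas Uxi_induct = red_env_induct[OF L \<xi>, consumes 1, case_names one gen add smult]
lemmas T_induct = spanning_induct[OF module_T tensor_spanning[OF assoc_U0 assoc_Uxi], consumes 1, case_names gen zero add smult]
lemmas T0_induct = spanning_induct[OF module_T0 tensor_spanning[OF assoc_U0 assoc_U0], consumes 1, case_names gen zero add smult]

lemmas coact_hom = coaction(1)[OF L \<xi>]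
lemmas coact_incl = coaction(2)[OF L \<xi>]
lemmas coact_lin = hom_lin[OF coact_hom]
lemmas coact_closed = lin_closed[OF coact_lin]
lemmas ad_hom = adjoint(1)[OF L \<xi>]
lemmas ad_incl = adjoint(2)[OF L \<xi>]
lemmas ad_closed = adjoint_closed[OF L \<xi>]
lemmas ad_rules = adjoint_rules[OF L \<xi>]
lemmas comult_hom = restr_comult(1)[OF L]
lemmas comult_incl = restr_comult(2)[OF L]
lemmas comult_closed = lin_closed[OF hom_lin[OF comult_hom]]
lemmas counit_hom = counit(1)[OF L]
lemmas counit_incl = counit(2)[OF L]

lemma coact_gen: "[|x \<in>[L]; b \<in>[Ux]|] ==> coact (ix x *[Ux] b) =
  tens K U0 Ux \<one>[U0] (ix x) *[\<T>] coact b +[\<T>] tens K U0 Ux (i0 x) \<one>[Ux] *[\<T>] coact b"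
proof -
 interpret T: ring \<T> by (rule algD[OF assoc_T])
 interpret H: ring U0 by (rule algD[OF assoc_U0])
 interpret A: ring Ux by (rule algD[OF assoc_Uxi])
 show "[|x \<in>[L]; b \<in>[Ux]|] ==> ?thesis"
  using coact_closed[of b] by (simp add: hom_mult[OF coact_hom] coact_incl T.l_distr tens_closed[OF assoc_U0 assoc_Uxi])
qed

lemma comult_gen: "[|x \<in>[L]; h \<in>[U0]|] ==> \<Delta>\<^sub>0 (i0 x *[U0] h) =
  tens K U0 U0 (i0 x) \<one>[U0] *[\<T>\<^sub>0] \<Delta>\<^sub>0 h +[\<T>\<^sub>0] tens K U0 U0 \<one>[U0] (i0 x) *[\<T>\<^sub>0] \<Delta>\<^sub>0 h"
proof -
 interpret T: ring \<T>\<^sub>0 by (rule algD[OF assoc_T0])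
 interpret H: ring U0 by (rule algD[OF assoc_U0])
 show "[|x \<in>[L]; h \<in>[U0]|] ==> ?thesis"
  using comult_closed[of h] by (simp add: hom_mult[OF comult_hom] comult_incl T.l_distr tens_closed[OF assoc_U0 assoc_U0])
qed

text \<open>Elements of \<open>L\<close> act as derivations, and \<open>\<Delta>(x h) = (x \<otimes> 1 + 1 \<otimes> x) \<Delta>(h)\<close> carries the product rule from \<open>h\<close> to \<open>x h\<close>.\<close>

theorem adjoint_module_algebra: "module_algebra K U0 \<Delta>\<^sub>0 \<epsilon>\<^sub>0 Ux ad"
proof -
 interpret K: field K by (rule algD[OF assoc_U0])
 interpret H: ring U0 by (rule algD[OF assoc_U0])
 interpret MH: module K U0 by (rule module_U0)
 interpret A: ring Ux by (rule algD[OF assoc_Uxi])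
 interpret MA: module K Ux by (rule module_Uxi)
 interpret T: ring \<T>\<^sub>0 by (rule algD[OF assoc_T0])
 interpret MT: module K \<T>\<^sub>0 by (rule module_T0)
 note e = lin_add[OF hom_lin[OF counit_hom]] lin_smult[OF hom_lin[OF counit_hom]]
  hom_mult[OF counit_hom] hom_one[OF counit_hom] lin_closed[OF hom_lin[OF counit_hom]]
 have unit: "ad h \<one>[Ux] = \<epsilon>\<^sub>0 h \<odot>[Ux] \<one>[Ux]" if "h \<in>[U0]" for h
  using that
 proof (induction rule: U0_induct)
  case one
  then show ?case using e(4) by (simp add: ad_rules)
 next
  case (gen x h)
  then show ?case using e(3)[of "i0 x" h] e(5)[of h]
   by (simp add: ad_rules counit_incl ad_incl a_minus_def A.r_neg)
 next
  case (add g h)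
  then show ?case using e(1)[of g h] e(5)[of g] e(5)[of h] by (simp add: ad_rules MA.smult_l_distr)
 next
  case (smult c h)
  then show ?case using e(2)[of c h] e(5)[of h] by (simp add: ad_rules MA.smult_assoc1)
 qed
 have mult: "ad h (a *[Ux] b) = tensor_lift K U0 U0 Ux (\<lambda>x y. ad x a *[Ux] ad y b) (\<Delta>\<^sub>0 h)"
  if h: "h \<in>[U0]" and a: "a \<in>[Ux]" and b: "b \<in>[Ux]" for h a b
 proof -
  let ?l = "tensor_lift K U0 U0 Ux (\<lambda>x y. ad x a *[Ux] ad y b)"
  have bil: "bilinear_map K U0 U0 Ux (\<lambda>x y. ad x a *[Ux] ad y b)"
   by (rule bilinear_mapI[OF module_U0 module_U0])
    (simp_all add: ad_closed a b ad_rules A.l_distr A.r_distr alg_smult[OF assoc_Uxi])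
  note l = tensor_lift[OF assoc_U0 assoc_U0 module_Uxi bil]
  note ll = lin_add[OF l(1)] lin_smult[OF l(1)] lin_zero[OF module_T0 module_Uxi l(1)] lin_closed[OF l(1)]
  note cl = tens_closed[OF assoc_U0 assoc_U0] and smT = alg_smult[OF assoc_T0]
  have x1: "?l (tens K U0 U0 (i0 x) \<one>[U0] *[\<T>\<^sub>0] t +[\<T>\<^sub>0] tens K U0 U0 \<one>[U0] (i0 x) *[\<T>\<^sub>0] t) = ad (i0 x) (?l t)"
   if x: "x \<in>[L]" and t: "t \<in>[\<T>\<^sub>0]" for x t
   using t
  proof (induction rule: T0_induct)
   case (gen s)
   then obtain u v where s: "s = tens K U0 U0 u v" "u \<in>[U0]" "v \<in>[U0]" by blast
   have c: "ix x \<in>[Ux]" "ad u a \<in>[Ux]" "ad v b \<in>[Ux]" using s a b x by (simp_all add: ad_closed)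
   have "?l (tens K U0 U0 (i0 x) \<one>[U0] *[\<T>\<^sub>0] s +[\<T>\<^sub>0] tens K U0 U0 \<one>[U0] (i0 x) *[\<T>\<^sub>0] s)
    = (ix x *[Ux] ad u a -[Ux] ad u a *[Ux] ix x) *[Ux] ad v b +[Ux] ad u a *[Ux] (ix x *[Ux] ad v b -[Ux] ad v b *[Ux] ix x)"
    using s(2,3) x a b by (simp add: s(1) tens_mult[OF assoc_U0 assoc_U0] ll cl l(2) ad_rules ad_incl ad_closed)
   also have "... = ix x *[Ux] (ad u a *[Ux] ad v b) -[Ux] (ad u a *[Ux] ad v b) *[Ux] ix x"
    using c by algebra
   finally show ?case using s c x by (simp add: l(2) ad_incl)
  next
   case zero
   then show ?case using x by (simp add: cl ll ad_incl a_minus_def)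
  next
   case (add s t)
   let ?a = "tens K U0 U0 (i0 x) \<one>[U0]" and ?b = "tens K U0 U0 \<one>[U0] (i0 x)"
   have c: "?a \<in>[\<T>\<^sub>0]" "?b \<in>[\<T>\<^sub>0]" using x by (simp_all add: cl)
   have 1: "?a *[\<T>\<^sub>0] (s +[\<T>\<^sub>0] t) +[\<T>\<^sub>0] ?b *[\<T>\<^sub>0] (s +[\<T>\<^sub>0] t) =
     (?a *[\<T>\<^sub>0] s +[\<T>\<^sub>0] ?b *[\<T>\<^sub>0] s) +[\<T>\<^sub>0] (?a *[\<T>\<^sub>0] t +[\<T>\<^sub>0] ?b *[\<T>\<^sub>0] t)"
    using c add.hyps by (simp add: T.r_distr T.a_ac)
   show ?case unfolding 1 using add c x by (simp add: lin_add[OF l(1)] ad_rules ll(4))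
  next
   case (smult c t)
   let ?a = "tens K U0 U0 (i0 x) \<one>[U0]" and ?b = "tens K U0 U0 \<one>[U0] (i0 x)"
   have c: "?a \<in>[\<T>\<^sub>0]" "?b \<in>[\<T>\<^sub>0]" using x by (simp_all add: cl)
   have 1: "?a *[\<T>\<^sub>0] (c \<odot>[\<T>\<^sub>0] t) +[\<T>\<^sub>0] ?b *[\<T>\<^sub>0] (c \<odot>[\<T>\<^sub>0] t) = c \<odot>[\<T>\<^sub>0] (?a *[\<T>\<^sub>0] t +[\<T>\<^sub>0] ?b *[\<T>\<^sub>0] t)"
    using c smult.hyps by (simp add: smT MT.smult_r_distr)
   show ?case unfolding 1 using smult c x by (simp add: lin_smult[OF l(1)] ad_rules ll(4))
  qed
  show ?thesis using h
  proof (induction rule: U0_induct)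
   case one
   then show ?case using a b by (simp add: hom_one[OF comult_hom] tens_one[OF assoc_U0 assoc_U0] l(2) ad_rules)
  next
   case (gen x v)
   then show ?case using comult_closed[of v] a b by (simp add: comult_gen x1 ad_rules)
  next
   case (add u v)
   then show ?case using a b by (simp add: lin_add[OF hom_lin[OF comult_hom]] ll comult_closed ad_rules)
  next
   case (smult c v)
   then show ?case using a b by (simp add: lin_smult[OF hom_lin[OF comult_hom]] ll comult_closed ad_rules)
  qed
 qed
 show ?thesis unfolding module_algebra_def using assoc_Uxi ad_hom unit mult by simp
qed

lemma adjoint_twist_bilinear:
 "a \<in>[Ux] ==> bilinear_map K U0 Ux Ux (\<lambda>h y. ad h a *[Ux] y)"
proof -
 interpret A: ring Ux by (rule algD[OF assoc_Uxi])
 show "a \<in>[Ux] ==> ?thesis"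
  by (rule bilinear_mapI[OF module_U0 module_Uxi])
   (simp_all add: ad_closed ad_rules A.l_distr A.r_distr alg_smult[OF assoc_Uxi])
qed

text \<open>In Sweedler notation this is \<open>(b\<^sub>-\<^sub>1 \<cdot> a) b\<^sub>0 = b a\<close>. For \<open>b\<close> in \<open>L\<close> it is the definition of the
commutator, and it is inherited by products with such elements.\<close>

lemma adjoint_coact:
 assumes a: "a \<in>[Ux]" and b: "b \<in>[Ux]"
 shows "tensor_lift K U0 Ux Ux (\<lambda>h y. ad h a *[Ux] y) (coact b) = b *[Ux] a"
proof -
 interpret H: ring U0 by (rule algD[OF assoc_U0])
 interpret A: ring Ux by (rule algD[OF assoc_Uxi])
 interpret MA: module K Ux by (rule module_Uxi)
 interpret T: ring \<T> by (rule algD[OF assoc_T])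
 interpret MT: module K \<T> by (rule module_T)
 let ?l = "tensor_lift K U0 Ux Ux (\<lambda>h y. ad h a *[Ux] y)"
 note l = tensor_lift[OF assoc_U0 assoc_Uxi module_Uxi adjoint_twist_bilinear[OF a]]
 note ll = lin_add[OF l(1)] lin_smult[OF l(1)] lin_zero[OF module_T module_Uxi l(1)] lin_closed[OF l(1)]
 note cl = tens_closed[OF assoc_U0 assoc_Uxi] and smT = alg_smult[OF assoc_T]
 have x1: "?l (tens K U0 Ux \<one>[U0] (ix x) *[\<T>] t +[\<T>] tens K U0 Ux (i0 x) \<one>[Ux] *[\<T>] t) = ix x *[Ux] ?l t"
  if x: "x \<in>[L]" and t: "t \<in>[\<T>]" for x t
  using t
 proof (induction rule: T_induct)
  case (gen s)
  then obtain u v where s: "s = tens K U0 Ux u v" "u \<in>[U0]" "v \<in>[Ux]" by blast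
  have c: "ix x \<in>[Ux]" "ad u a \<in>[Ux]" "v \<in>[Ux]" using s a x by (simp_all add: ad_closed)
  have "?l (tens K U0 Ux \<one>[U0] (ix x) *[\<T>] s +[\<T>] tens K U0 Ux (i0 x) \<one>[Ux] *[\<T>] s)
   = ad u a *[Ux] (ix x *[Ux] v) +[Ux] (ix x *[Ux] ad u a -[Ux] ad u a *[Ux] ix x) *[Ux] v"
   using s(2,3) x a by (simp add: s(1) tens_mult[OF assoc_U0 assoc_Uxi] ll cl l(2) ad_rules ad_incl ad_closed)
  also have "... = ix x *[Ux] (ad u a *[Ux] v)" using c by algebra
  finally show ?case using s by (simp add: l(2))
 next
  case zero
  then show ?case using x by (simp add: cl ll)
 next
  case (add s t)
  let ?a = "tens K U0 Ux \<one>[U0] (ix x)" and ?b = "tens K U0 Ux (i0 x) \<one>[Ux]"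
  have c: "?a \<in>[\<T>]" "?b \<in>[\<T>]" using x by (simp_all add: cl)
  have 1: "?a *[\<T>] (s +[\<T>] t) +[\<T>] ?b *[\<T>] (s +[\<T>] t) = (?a *[\<T>] s +[\<T>] ?b *[\<T>] s) +[\<T>] (?a *[\<T>] t +[\<T>] ?b *[\<T>] t)"
   using c add.hyps by (simp add: T.r_distr T.a_ac)
  show ?case unfolding 1 using add c x by (simp add: lin_add[OF l(1)] A.r_distr ll(4))
 next
  case (smult c t)
  let ?a = "tens K U0 Ux \<one>[U0] (ix x)" and ?b = "tens K U0 Ux (i0 x) \<one>[Ux]"
  have c: "?a \<in>[\<T>]" "?b \<in>[\<T>]" using x by (simp_all add: cl)
  have 1: "?a *[\<T>] (c \<odot>[\<T>] t) +[\<T>] ?b *[\<T>] (c \<odot>[\<T>] t) = c \<odot>[\<T>] (?a *[\<T>] t +[\<T>] ?b *[\<T>] t)"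
   using c smult.hyps by (simp add: smT MT.smult_r_distr)
  show ?case unfolding 1 using smult c x by (simp add: lin_smult[OF l(1)] ll(4) alg_smult[OF assoc_Uxi])
 qed
 show ?thesis using b
 proof (induction rule: Uxi_induct)
  case one
  then show ?case using a by (simp add: hom_one[OF coact_hom] tens_one[OF assoc_U0 assoc_Uxi] l(2) ad_rules)
 next
  case (gen x v)
  then show ?case using coact_closed[of v] a by (simp add: coact_gen x1 A.m_assoc)
 next
  case (add u v)
  then show ?case using a by (simp add: lin_add[OF coact_lin] ll coact_closed A.l_distr)
 next
  case (smult c v)
  then show ?case using a by (simp add: lin_smult[OF coact_lin] ll coact_closed alg_smult[OF assoc_Uxi])
 qed
qed

lemma coact_comodule: "left_comodule K U0 \<Delta>\<^sub>0 \<epsilon>\<^sub>0 Ux coact"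
 unfolding left_comodule_def
 using coact_lin coaction_coassoc[OF L \<xi> comult_hom restr_comult'[OF L]] coaction_counit[OF L \<xi>] by simp

section \<open>The right action of the dual algebra defined by the coaction\<close>

abbreviation "contract == contraction K U0 Ux"

definition dual_action :: "('k, 'g) red_env => (('k, 'g) red_env => 'k) => ('k, 'g) red_env" where
 "dual_action b f = contract f (coact b)"

lemmas dual_rules = dual_space_rules[of _ K "restr_env_algebra K p L"]
lemmas contract = contraction[OF assoc_U0 assoc_Uxi]
lemmas tensor_contract_expand = tensor_contraction_expand[OF assoc_U0 assoc_Uxi]

lemma dual_action_closed: "[|f \<in> dual_space K U0; b \<in>[Ux]|] ==> dual_action b f \<in>[Ux]"
 unfolding dual_action_def by (rule lin_closed[OF contract(1) coact_closed])

lemma dual_action_corresponds: "corresponds K U0 Ux coact dual_action"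
 unfolding corresponds_def dual_action_def using tensor_contract_expand coact_closed by blast

lemma dual_action_mult:
 assumes d: "dual_bases K U0 n h h'" and a: "a \<in>[Ux]" and b: "b \<in>[Ux]"
 shows "b *[Ux] a = (\<Oplus>\<^bsub>Ux\<^esub>i\<in>{..<n}. ad (h i) a *[Ux] dual_action b (h' i))"
proof -
 interpret A: ring Ux by (rule algD[OF assoc_Uxi])
 let ?l = "tensor_lift K U0 Ux Ux (\<lambda>h y. ad h a *[Ux] y)"
 note l = tensor_lift[OF assoc_U0 assoc_Uxi module_Uxi adjoint_twist_bilinear[OF a]]
 have h: "h i \<in>[U0]" and h': "h' i \<in> dual_space K U0" if "i < n" for i
  using d that by (auto simp: dual_bases_def basis_def)
 note cl = tens_closed[OF assoc_U0 assoc_Uxi]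
 have "b *[Ux] a = ?l (coact b)" by (rule adjoint_coact[OF a b, symmetric])
 also have "... = ?l (\<Oplus>\<^bsub>\<T>\<^esub>i\<in>{..<n}. tens K U0 Ux (h i) (dual_action b (h' i)))"
  using tensor_contract_expand[OF d coact_closed[OF b]] by (simp add: dual_action_def)
 also have "... = (\<Oplus>\<^bsub>Ux\<^esub>i\<in>{..<n}. ?l (tens K U0 Ux (h i) (dual_action b (h' i))))"
  by (rule lin_finsum[OF module_T module_Uxi l(1)]) (simp_all add: Pi_iff cl h dual_action_closed[OF h' b])
 also have "... = (\<Oplus>\<^bsub>Ux\<^esub>i\<in>{..<n}. ad (h i) a *[Ux] dual_action b (h' i))"
  by (rule A.finsum_cong') (simp_all add: Pi_iff h l(2) dual_action_closed[OF h' b] ad_closed a)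
 finally show ?thesis .
qed

lemma contract_combination:
 assumes f: "f \<in> dual_space K U0" and g: "g \<in> dual_space K U0" and c: "c \<in>[K]" and t: "t \<in>[\<T>]"
 shows "(\<lambda>h\<in>carrier U0. f h +[K] g h) \<in> dual_space K U0" "(\<lambda>h\<in>carrier U0. c *[K] f h) \<in> dual_space K U0"
  "contract (\<lambda>h\<in>carrier U0. f h +[K] g h) t = contract f t +[Ux] contract g t"
  "contract (\<lambda>h\<in>carrier U0. c *[K] f h) t = c \<odot>[Ux] contract f t"
proof -
 interpret K: field K by (rule algD[OF assoc_U0])
 interpret MH: module K U0 by (rule module_U0)
 interpret MA: module K Ux by (rule module_Uxi)
 note d = dual_rules[OF f] dual_rules[OF g]
 show s: "(\<lambda>h\<in>carrier U0. f h +[K] g h) \<in> dual_space K U0"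
  by (rule lin_restrictI[OF module_U0]) (simp_all add: d K.a_ac K.r_distr)
 show m: "(\<lambda>h\<in>carrier U0. c *[K] f h) \<in> dual_space K U0"
  by (rule lin_restrictI[OF module_U0]) (simp_all add: d c K.r_distr K.m_lcomm)
 note lf = contract[OF f] and lg = contract[OF g] and ls = contract[OF s] and lm = contract[OF m]
 note lin = lin_closed[OF lf(1)] lin_closed[OF lg(1)] lin_add[OF lf(1)] lin_add[OF lg(1)] lin_add[OF ls(1)] lin_add[OF lm(1)]
  lin_smult[OF lf(1)] lin_smult[OF lg(1)] lin_smult[OF ls(1)] lin_smult[OF lm(1)]
  lin_zero[OF module_T module_Uxi lf(1)] lin_zero[OF module_T module_Uxi lg(1)] lin_zero[OF module_T module_Uxi ls(1)] lin_zero[OF module_T module_Uxi lm(1)]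
 show "contract (\<lambda>h\<in>carrier U0. f h +[K] g h) t = contract f t +[Ux] contract g t"
  using t
 proof (induction rule: T_induct)
  case (gen s)
  then show ?case by (auto simp: lf(2) lg(2) ls(2) d MA.smult_l_distr)
 next
  case (add s t)
  then show ?case by (simp add: lin MA.M.a_ac)
 qed (simp_all add: lin MA.smult_r_distr)
 show "contract (\<lambda>h\<in>carrier U0. c *[K] f h) t = c \<odot>[Ux] contract f t"
  using t
 proof (induction rule: T_induct)
  case (gen s)
  then show ?case using c by (auto simp: lf(2) lm(2) d MA.smult_assoc1)
 next
  case (smult e t)
  then show ?case using c by (simp add: lin MA.smult_assoc1[symmetric] K.m_comm)
 qed (use c in \<open>simp_all add: lin MA.smult_r_distr\<close>)
qed

text \<open>Applying \<open>f \<otimes> g\<close> to the first two of three tensor factors turns the coassociativity of the coaction into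
  the associativity of the action.\<close>

lemma dual_action_convolution:
 assumes f: "f \<in> dual_space K U0" and g: "g \<in> dual_space K U0" and b: "b \<in>[Ux]"
 shows "dual_action (dual_action b f) g = dual_action b (\<lambda>h\<in>carrier U0.
    tensor_lift K U0 U0 (self_algebra K) (\<lambda>x y. f x *[K] g y) (\<Delta>\<^sub>0 h))"
proof -
 interpret K: field K by (rule algD[OF assoc_U0])
 interpret MH: module K U0 by (rule module_U0)
 interpret MA: module K Ux by (rule module_Uxi)
 interpret MT: module K \<T> by (rule module_T)
 interpret MT0: module K \<T>\<^sub>0 by (rule module_T0)
 note HT = assoc_tensor[OF assoc_U0 assoc_T] and T0A = assoc_tensor[OF assoc_T0 assoc_Uxi]
 note mS = module_self[OF K.field_axioms]
 note df = dual_rules[OF f] and dg = dual_rules[OF g]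
 note lf = contract[OF f] and lg = contract[OF g]
 have bil: "bilinear_map K U0 U0 (self_algebra K) (\<lambda>x y. f x *[K] g y)"
  by (rule bilinear_mapI[OF module_U0 module_U0]) (simp_all add: df dg K.l_distr K.r_distr K.m_ac)
 let ?m = "tensor_lift K U0 U0 (self_algebra K) (\<lambda>x y. f x *[K] g y)"
 note m = tensor_lift[OF assoc_U0 assoc_U0 mS bil]
 let ?fg = "\<lambda>h\<in>carrier U0. ?m (\<Delta>\<^sub>0 h)"
 have fg: "?fg \<in> dual_space K U0" by (rule lin_compose[OF module_U0 hom_lin[OF comult_hom] m(1)])
 have "bilinear_map K U0 \<T> Ux (\<lambda>u t. f u \<odot>[Ux] contract g t)"
  by (rule bilinear_mapI[OF module_U0 module_T])
   (simp_all add: df lin_closed[OF lg(1)] lin_add[OF lg(1)] lin_smult[OF lg(1)] MA.smult_l_distr MA.smult_r_distr MA.smult_assoc1[symmetric] K.m_comm)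
 note G = tensor_lift[OF assoc_U0 assoc_T module_Uxi this]
 let ?G = "tensor_lift K U0 \<T> Ux (\<lambda>u t. f u \<odot>[Ux] contract g t)"
 note cl = tens_closed[OF assoc_U0 assoc_Uxi] tens_closed[OF assoc_U0 assoc_U0] tens_closed[OF assoc_T0 assoc_Uxi] tens_closed[OF assoc_U0 assoc_T]
 note lc = linear_on_lin[OF module_Uxi coact_lin] and ld = linear_on_lin[OF module_U0 hom_lin[OF comult_hom]]
 note R = tensor_map[OF assoc_U0 assoc_Uxi assoc_U0 assoc_T linear_on_id[OF module_U0] lc]
 note D = tensor_map[OF assoc_U0 assoc_Uxi assoc_T0 assoc_Uxi ld linear_on_id[OF module_Uxi]]
 note as' = tensor_assoc[OF assoc_U0 assoc_U0 assoc_Uxi]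
 let ?R = "tensor_map K U0 Ux U0 \<T> (\<lambda>x. x) coact"
 let ?D = "tensor_map K U0 Ux \<T>\<^sub>0 Ux \<Delta>\<^sub>0 (\<lambda>x. x)"
 let ?as = "tensor_assoc K U0 U0 Ux"
 have 1: "?G (?R t) = dual_action (contract f t) g" if t: "t \<in>[\<T>]" for t
 proof -
  have a: "(\<lambda>t\<in>carrier \<T>. ?G (?R t)) \<in> lin_maps K \<T> Ux" by (rule lin_compose[OF module_T R(1) G(1)])
  have b: "(\<lambda>t\<in>carrier \<T>. contract g ((\<lambda>t\<in>carrier \<T>. coact (contract f t)) t)) \<in> lin_maps K \<T> Ux"
   by (rule lin_compose[OF module_T lin_compose[OF module_T lf(1) coact_lin] lg(1)])
  have "(\<lambda>t\<in>carrier \<T>. ?G (?R t)) = (\<lambda>t\<in>carrier \<T>. contract g ((\<lambda>t\<in>carrier \<T>. coact (contract f t)) t))"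
   by (rule tensor_lift_eqI[OF assoc_U0 assoc_Uxi module_Uxi a b])
    (simp add: cl R(2) G(2) coact_closed lf(2) df lin_smult[OF coact_lin] lin_smult[OF lg(1)])
  from fun_cong[OF this, of t] show ?thesis using t by (simp add: dual_action_def)
 qed
 have 2: "?G (?as (tens K \<T>\<^sub>0 Ux s y)) = ?m s \<odot>[Ux] y" if y: "y \<in>[Ux]" and s: "s \<in>[\<T>\<^sub>0]" for s y
 proof -
  have ty: "(\<lambda>s\<in>carrier \<T>\<^sub>0. tens K \<T>\<^sub>0 Ux s y) \<in> lin_maps K \<T>\<^sub>0 (tensor K \<T>\<^sub>0 Ux)"
   by (rule lin_restrictI[OF module_T0])
    (simp_all add: y cl tens_add_left[OF assoc_T0 assoc_Uxi] tens_smult_left[OF assoc_T0 assoc_Uxi])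
  have a: "(\<lambda>s\<in>carrier \<T>\<^sub>0. ?G ((\<lambda>s\<in>carrier \<T>\<^sub>0. ?as ((\<lambda>s\<in>carrier \<T>\<^sub>0. tens K \<T>\<^sub>0 Ux s y) s)) s)) \<in> lin_maps K \<T>\<^sub>0 Ux"
   by (rule lin_compose[OF module_T0 lin_compose[OF module_T0 ty hom_lin[OF as'(1)]] G(1)])
  have b: "(\<lambda>s\<in>carrier \<T>\<^sub>0. ?m s \<odot>[Ux] y) \<in> lin_maps K \<T>\<^sub>0 Ux"
   using lin_closed[OF m(1)] lin_add[OF m(1)] lin_smult[OF m(1)]
   by (intro lin_restrictI[OF module_T0]) (simp_all add: y MA.smult_l_distr MA.smult_assoc1)
  have "(\<lambda>s\<in>carrier \<T>\<^sub>0. ?G ((\<lambda>s\<in>carrier \<T>\<^sub>0. ?as ((\<lambda>s\<in>carrier \<T>\<^sub>0. tens K \<T>\<^sub>0 Ux s y) s)) s)) = (\<lambda>s\<in>carrier \<T>\<^sub>0. ?m s \<odot>[Ux] y)"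
   by (rule tensor_lift_eqI[OF assoc_U0 assoc_U0 module_Uxi a b])
    (simp add: y cl as'(2) G(2) lg(2) m(2) df dg MA.smult_assoc1)
  from fun_cong[OF this, of s] show ?thesis using s by simp
 qed
 have 3: "?G (?as (?D t)) = contract ?fg t" if t: "t \<in>[\<T>]" for t
 proof -
  have a: "(\<lambda>t\<in>carrier \<T>. ?G ((\<lambda>t\<in>carrier \<T>. ?as (?D t)) t)) \<in> lin_maps K \<T> Ux"
   by (rule lin_compose[OF module_T lin_compose[OF module_T D(1) hom_lin[OF as'(1)]] G(1)])
  have "(\<lambda>t\<in>carrier \<T>. ?G ((\<lambda>t\<in>carrier \<T>. ?as (?D t)) t)) = contract ?fg"
   by (rule tensor_lift_eqI[OF assoc_U0 assoc_Uxi module_Uxi a contract(1)[OF fg]])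
    (simp add: cl D(2) 2 comult_closed contract(2)[OF fg])
  from fun_cong[OF this, of t] show ?thesis using t by simp
 qed
 have "dual_action (dual_action b f) g = ?G (?R (coact b))"
  unfolding dual_action_def[of b f] by (rule 1[OF coact_closed[OF b], symmetric])
 also have "?R (coact b) = ?as (?D (coact b))"
  by (rule coaction_coassoc[OF L \<xi> comult_hom restr_comult'[OF L] b, symmetric])
 also have "?G (?as (?D (coact b))) = dual_action b ?fg"
  unfolding dual_action_def[of b ?fg] by (rule 3[OF coact_closed[OF b]])
 finally show ?thesis .
qed

theorem dual_action_mu_compatible: "mu_compatible K U0 \<Delta>\<^sub>0 \<epsilon>\<^sub>0 Ux ad dual_action"
proof -
 have one: "dual_action b \<epsilon>\<^sub>0 = b" if "b \<in>[Ux]" for b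
  using coaction_counit[OF L \<xi> that] by (simp add: dual_action_def contraction_def)
 note cc = contract_combination[OF _ _ _ coact_closed]
 have "right_module K (dual_algebra K U0 \<Delta>\<^sub>0 \<epsilon>\<^sub>0) Ux dual_action"
  unfolding right_module_def
 proof (intro conjI ballI)
  fix v f g c assume v: "v \<in>[Ux]" and c: "c \<in>[K]"
   and "f \<in>[dual_algebra K U0 \<Delta>\<^sub>0 \<epsilon>\<^sub>0]" "g \<in>[dual_algebra K U0 \<Delta>\<^sub>0 \<epsilon>\<^sub>0]"
  then have f: "f \<in> dual_space K U0" and g: "g \<in> dual_space K U0" by (simp_all add: dual_algebra_def)
  show "dual_action (c \<odot>[Ux] v) f = c \<odot>[Ux] dual_action v f"
   using c v by (simp add: dual_action_def lin_smult[OF coact_lin] lin_smult[OF contract(1)[OF f]] coact_closed)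
  show "dual_action v (c \<odot>[dual_algebra K U0 \<Delta>\<^sub>0 \<epsilon>\<^sub>0] f) = c \<odot>[Ux] dual_action v f"
   using cc(4)[OF f f c v] by (simp add: dual_algebra_def dual_action_def)
 next
  fix v f g assume v: "v \<in>[Ux]"
   and "f \<in>[dual_algebra K U0 \<Delta>\<^sub>0 \<epsilon>\<^sub>0]" "g \<in>[dual_algebra K U0 \<Delta>\<^sub>0 \<epsilon>\<^sub>0]"
  then have f: "f \<in> dual_space K U0" and g: "g \<in> dual_space K U0" by (simp_all add: dual_algebra_def)
  interpret K: field K by (rule algD[OF assoc_U0])
  show "dual_action v f \<in>[Ux]" by (rule dual_action_closed[OF f v])
  show "dual_action v (f +[dual_algebra K U0 \<Delta>\<^sub>0 \<epsilon>\<^sub>0] g) = dual_action v f +[Ux] dual_action v g"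
   using cc(3)[OF f g K.one_closed v] by (simp add: dual_algebra_def dual_action_def)
  show "dual_action (dual_action v f) g = dual_action v (f *[dual_algebra K U0 \<Delta>\<^sub>0 \<epsilon>\<^sub>0] g)"
   using dual_action_convolution[OF f g v] by (simp add: dual_algebra_def)
 next
  fix v w f assume v: "v \<in>[Ux]" "w \<in>[Ux]" and "f \<in>[dual_algebra K U0 \<Delta>\<^sub>0 \<epsilon>\<^sub>0]"
  then have f: "f \<in> dual_space K U0" by (simp add: dual_algebra_def)
  show "dual_action (v +[Ux] w) f = dual_action v f +[Ux] dual_action w f"
   using v by (simp add: dual_action_def lin_add[OF coact_lin] lin_add[OF contract(1)[OF f]] coact_closed)
 next
  fix v assume "v \<in>[Ux]"
  then show "dual_action v \<one>[dual_algebra K U0 \<Delta>\<^sub>0 \<epsilon>\<^sub>0] = v" using one by (simp add: dual_algebra_def)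
 qed
 then show ?thesis unfolding mu_compatible_def using dual_action_mult by blast
qed

end

section \<open>Central simple algebras and two-sided multiplications\<close>

text \<open>The vector space underlying a tensor product does not depend on the multiplications of the factors.\<close>

lemma tensor_op:
 shows tens_op: "tens K A (op_algebra B) = tens K A B"
  and carrier_tensor_op: "carrier (tensor K A (op_algebra B)) = carrier (tensor K A B)"
  and add_tensor_op: "x +[tensor K A (op_algebra B)] y = x +[tensor K A B] y"
  and smult_tensor_op: "c \<odot>[tensor K A (op_algebra B)] x = c \<odot>[tensor K A B] x"
proof -
 let ?F = "monoid_algebra K (A \<times>\<times> B)" and ?F' = "monoid_algebra K (A \<times>\<times> op_algebra B)"
 have eqs: "carrier ?F' = carrier ?F" "add ?F' = add ?F" "smult ?F' = smult ?F" "zero ?F' = zero ?F"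
  by (simp_all add: monoid_algebra_def)
 have delta: "delta K (A \<times>\<times> op_algebra B) = delta K (A \<times>\<times> B)" by (simp add: delta_def fun_eq_iff)
 have ab: "add_monoid ?F' = add_monoid ?F" by (simp add: eqs)
 have minus: "x -[?F'] y = x -[?F] y" for x y by (simp only: a_minus_def a_inv_def ab eqs)
 have rels: "bilinear_rels K A (op_algebra B) = bilinear_rels K A B"
  unfolding bilinear_rels_def Let_def by (simp add: delta minus eqs)
 have sub: "submodule N K ?F' \<longleftrightarrow> submodule N K ?F" for N
  unfolding submodule_def submodule_axioms_def by (simp only: ab eqs)
 have null: "tensor_null K A (op_algebra B) = tensor_null K A B"
  unfolding tensor_null_def submodule_span_def rels by (simp only: sub)
 have coset: "I +>\<^bsub>?F'\<^esub> x = I +>\<^bsub>?F\<^esub> x" for I x unfolding a_r_coset_def by (simp only: ab)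
 show "tens K A (op_algebra B) = tens K A B"
  by (simp only: fun_eq_iff tens_def null coset delta simp_thms)
 show "carrier (tensor K A (op_algebra B)) = carrier (tensor K A B)"
  unfolding tensor_def quot_algebra_def FactRing_def A_RCOSETS_def null by (simp add: ab)
 show "x +[tensor K A (op_algebra B)] y = x +[tensor K A B] y"
  unfolding tensor_def quot_algebra_def FactRing_def set_add_def by (simp add: ab)
 show "c \<odot>[tensor K A (op_algebra B)] x = c \<odot>[tensor K A B] x"
  unfolding tensor_def quot_algebra_def null by (simp add: coset eqs)
qed

lemma lin_maps_tensor_op:
 "lin_maps K (tensor K A (op_algebra B)) N = lin_maps K (tensor K A B) N"
 "lin_maps K N (tensor K A (op_algebra B)) = lin_maps K N (tensor K A B)"
 by (simp_all add: lin_maps_def carrier_tensor_op add_tensor_op smult_tensor_op)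

definition two_sided_mult ::
 "('k, 'm) ring_scheme => ('k, 'a, 'n) module_scheme => ('a \<times> 'a => 'k) set => 'a => 'a" where
 "two_sided_mult K A = tensor_lift K A (op_algebra A) (end_algebra K A) (\<lambda>a b. \<lambda>x\<in>carrier A. a *[A] x *[A] b)"

context
 fixes K A
 assumes A: "assoc_algebra K A"
begin

interpretation K: field K by (rule algD[OF A])
interpretation A: ring A by (rule algD[OF A])
interpretation MA: module K A by (rule algD[OF A])

private abbreviation "W == tensor K A (op_algebra A)"
private abbreviation "tw == tens K A (op_algebra A)"
private abbreviation "E == end_algebra K A"
private abbreviation "\<mu> == two_sided_mult K A"

private lemmas O = assoc_op[OF A]
private lemmas W = assoc_tensor[OF A assoc_op[OF A]]
private lemmas E = assoc_end[OF K.field_axioms MA.module_axioms]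
private lemmas mW = algD(2)[OF W]
private lemmas mE = algD(2)[OF E]
private lemmas smA = alg_smult[OF A]

interpretation W: ring W by (rule algD[OF W])
interpretation MW: module K W by (rule mW)

lemma mult_both_lin:
 "[|a \<in>[A]; b \<in>[A]|] ==> (\<lambda>x\<in>carrier A. a *[A] x *[A] b) \<in> lin_maps K A A"
 by (rule lin_restrictI[OF MA.module_axioms]) (simp_all add: A.l_distr A.r_distr smA)

private lemma mult_both_eq:
 "f \<in> lin_maps K A A ==> a \<in>[A] ==> b \<in>[A] ==> (!!x. x \<in>[A] ==> a *[A] x *[A] b = f x) ==> (\<lambda>x\<in>carrier A. a *[A] x *[A] b) = f"
 by (rule lin_ext[OF mult_both_lin]) simp_all

lemma two_sided_mult:
 "\<mu> \<in> alg_homs K W E"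
 "[|a \<in>[A]; b \<in>[A]; x \<in>[A]|] ==> \<mu> (tw a b) x = a *[A] x *[A] b"
proof -
 let ?\<beta> = "\<lambda>a b. \<lambda>x\<in>carrier A. a *[A] x *[A] b"
 note ec = end_closed[OF MA.module_axioms] end_consts_closed[OF MA.module_axioms]
 have bil: "bilinear_map K A (op_algebra A) E ?\<beta>"
 proof (rule bilinear_mapI[OF MA.module_axioms algD(2)[OF O]]; unfold carrier_end op_algebra_simps)
  fix a b assume a: "a \<in>[A]" and b: "b \<in>[A]"
  note ab = mult_both_lin[OF a b]
  show "?\<beta> a b \<in> lin_maps K A A" by (rule ab)
  show "?\<beta> (a +[A] a') b = ?\<beta> a b +[E] ?\<beta> a' b" if "a' \<in>[A]" for a'
   by (rule mult_both_eq[OF ec(1)[OF ab mult_both_lin[OF that b]]]) (simp_all add: a b that end_apply A.l_distr)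
  show "?\<beta> a (b +[A] b') = ?\<beta> a b +[E] ?\<beta> a b'" if "b' \<in>[A]" for b'
   by (rule mult_both_eq[OF ec(1)[OF ab mult_both_lin[OF a that]]]) (simp_all add: a b that end_apply A.r_distr)
  show "?\<beta> (c \<odot>[A] a) b = c \<odot>[E] ?\<beta> a b" if "c \<in>[K]" for c
   by (rule mult_both_eq[OF ec(3)[OF ab ab that]]) (simp_all add: a b that end_apply smA)
  show "?\<beta> a (c \<odot>[A] b) = c \<odot>[E] ?\<beta> a b" if "c \<in>[K]" for c
   by (rule mult_both_eq[OF ec(3)[OF ab ab that]]) (simp_all add: a b that end_apply smA)
 qed
 show "\<mu> \<in> alg_homs K W E"
  unfolding two_sided_mult_def
 proof (rule tensor_lift_hom[OF A O E bil]; unfold op_algebra_simps)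
  show "?\<beta> \<one>[A] \<one>[A] = \<one>[E]" by (rule mult_both_eq[OF ec(4)]) (simp_all add: end_apply)
  fix a b a' b' assume c: "a \<in>[A]" "b \<in>[A]" "a' \<in>[A]" "b' \<in>[A]"
  show "?\<beta> (a *[A] a') (b' *[A] b) = ?\<beta> a b *[E] ?\<beta> a' b'"
   by (rule mult_both_eq[OF ec(2)[OF mult_both_lin mult_both_lin]]) (simp_all add: c end_apply A.m_assoc)
 qed
 show "\<mu> (tw a b) x = a *[A] x *[A] b" if "a \<in>[A]" "b \<in>[A]" "x \<in>[A]"
  unfolding two_sided_mult_def using tensor_lift(2)[OF A O mE bil, of a b] that by simp
qed

private lemma \<mu>_lin: "w \<in>[W] ==> \<mu> w \<in> lin_maps K A A"
 using lin_closed[OF hom_lin[OF two_sided_mult(1)]] by simp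

lemma two_sided_mult_rules:
 assumes w: "w \<in>[W]" and x: "x \<in>[A]"
 shows "\<mu> w x \<in>[A]" "w' \<in>[W] ==> \<mu> (w +[W] w') x = \<mu> w x +[A] \<mu> w' x"
  "w' \<in>[W] ==> \<mu> (w -[W] w') x = \<mu> w x -[A] \<mu> w' x"
  "w' \<in>[W] ==> \<mu> (w *[W] w') x = \<mu> w (\<mu> w' x)"
  "c \<in>[K] ==> \<mu> (c \<odot>[W] w) x = c \<odot>[A] \<mu> w x"
  "\<mu> \<zero>[W] x = \<zero>[A]" "\<mu> \<one>[W] x = x" "\<mu> w \<zero>[A] = \<zero>[A]"
  "y \<in>[A] ==> \<mu> w (x +[A] y) = \<mu> w x +[A] \<mu> w y"
  "y \<in>[A] ==> \<mu> w (x -[A] y) = \<mu> w x -[A] \<mu> w y"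
  "c \<in>[K] ==> \<mu> w (c \<odot>[A] x) = c \<odot>[A] \<mu> w x"
proof -
 note h = two_sided_mult(1) and l = hom_lin[OF two_sided_mult(1)]
 note lw = \<mu>_lin[OF w]
 have ev: "(\<lambda>w\<in>carrier W. \<mu> w x) \<in> lin_maps K W A"
  using lin_add[OF l] lin_smult[OF l] x
  by (intro lin_restrictI[OF mW]) (simp_all add: end_apply lin_closed[OF \<mu>_lin])
 show c: "\<mu> w x \<in>[A]" by (rule lin_closed[OF lw x])
 show "\<mu> (w +[W] w') x = \<mu> w x +[A] \<mu> w' x" if "w' \<in>[W]" using lin_add[OF ev w that] w that by simp
 show "\<mu> (w -[W] w') x = \<mu> w x -[A] \<mu> w' x" if "w' \<in>[W]"
  using lin_diff[OF mW MA.module_axioms ev w that] w that by simp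
 show "\<mu> (w *[W] w') x = \<mu> w (\<mu> w' x)" if "w' \<in>[W]"
  using hom_mult[OF h w that] x by (simp add: end_apply)
 show "\<mu> (c \<odot>[W] w) x = c \<odot>[A] \<mu> w x" if "c \<in>[K]" using lin_smult[OF ev that w] w that by simp
 show "\<mu> \<zero>[W] x = \<zero>[A]" using lin_zero[OF mW MA.module_axioms ev] by simp
 show "\<mu> \<one>[W] x = x" using hom_one[OF h] x by (simp add: end_apply)
 show "\<mu> w \<zero>[A] = \<zero>[A]" by (rule lin_zero[OF MA.module_axioms MA.module_axioms lw])
 show "y \<in>[A] ==> \<mu> w (x +[A] y) = \<mu> w x +[A] \<mu> w y" by (rule lin_add[OF lw x])
 show "y \<in>[A] ==> \<mu> w (x -[A] y) = \<mu> w x -[A] \<mu> w y"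
  by (rule lin_diff[OF MA.module_axioms MA.module_axioms lw x])
 show "c \<in>[K] ==> \<mu> w (c \<odot>[A] x) = c \<odot>[A] \<mu> w x" by (rule lin_smult[OF lw _ x])
qed

private lemmas \<mu>r = two_sided_mult_rules(1-5) two_sided_mult_rules(6,7)[OF W.zero_closed] two_sided_mult_rules(8-11)
private lemmas twc = tens_closed[OF A O, simplified]

private lemmas W_induct = spanning_induct[OF mW tensor_spanning[OF A O, simplified], consumes 1, case_names gen zero add smult]

text \<open>If two-sided multiplications give every endomorphism, the rank one maps \<open>x \<mapsto> \<phi>(x) b\<close> commute
  with multiplication by central elements and preserve ideals, which forces \<open>A\<close> to be central simple.\<close>

lemma central_simple_if_surj:
 assumes fin: "finite_dim K A" and nonzero: "\<one>[A] ~= \<zero>[A]"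
  and surj: "carrier E <= \<mu> ` carrier W"
 shows "central_simple K A"
proof -
 obtain n e where b: "basis K A n e" using fin by (auto simp: finite_dim_def)
 obtain e' where d: "dual_bases K A n e e'" using dual_bases_exist[OF K.field_axioms MA.module_axioms b] by auto
 \<comment> \<open>Linear forms separate points: normalize a coordinate that does not vanish at \<open>y\<close>.\<close>
 have form: "\<exists>\<phi> \<in> dual_space K A. \<phi> y = \<one>[K]" if y: "y \<in>[A]" "y ~= \<zero>[A]" for y
 proof -
  have e: "e i \<in>[A]" "e' i \<in> dual_space K A" if "i < n" for i
   using d that by (auto simp: dual_bases_def basis_def)
  have "\<exists>i<n. e' i y ~= \<zero>[K]"
  proof (rule ccontr)
   assume no: "\<not> (\<exists>i<n. e' i y ~= \<zero>[K])"
   have "(\<Oplus>\<^bsub>A\<^esub>i\<in>{..<n}. e' i y \<odot>[A] e i) = \<zero>[A]"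
    by (rule A.add.finprod_one_eqI) (use no e in auto)
   then show False using dual_bases_expand[OF K.field_axioms MA.module_axioms d y(1)] y(2) by simp
  qed
  then obtain i where i: "i < n" "e' i y ~= \<zero>[K]" by auto
  have c: "e' i y \<in> Units K" using i dual_space_rules(1)[OF e(2)[OF i(1)] y(1)] by (simp add: K.field_Units)
  note dr = dual_space_rules[OF e(2)[OF i(1)]]
  have "(\<lambda>x\<in>carrier A. inv\<^bsub>K\<^esub> (e' i y) *[K] e' i x) \<in> dual_space K A"
   by (rule lin_restrictI[OF MA.module_axioms]) (use c in \<open>simp_all add: dr K.r_distr K.m_lcomm\<close>)
  moreover have "(\<lambda>x\<in>carrier A. inv\<^bsub>K\<^esub> (e' i y) *[K] e' i x) y = \<one>[K]" using c y by (simp add: K.Units_l_inv)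
  ultimately show ?thesis by blast
 qed
 have rank1: "\<exists>w\<in>carrier W. \<forall>x\<in>carrier A. \<mu> w x = \<phi> x \<odot>[A] b" if \<phi>: "\<phi> \<in> dual_space K A" and b: "b \<in>[A]" for \<phi> b
 proof -
  have "(\<lambda>x\<in>carrier A. \<phi> x \<odot>[A] b) \<in> lin_maps K A A"
   by (rule lin_restrictI[OF MA.module_axioms]) (simp_all add: dual_space_rules[OF \<phi>] b MA.smult_l_distr MA.smult_assoc1)
  then have "(\<lambda>x\<in>carrier A. \<phi> x \<odot>[A] b) \<in> \<mu> ` carrier W" using surj by auto
  then obtain w where w: "w \<in>[W]" "(\<lambda>x\<in>carrier A. \<phi> x \<odot>[A] b) = \<mu> w" by auto
  have "\<mu> w x = \<phi> x \<odot>[A] b" if "x \<in>[A]" for x using fun_cong[OF w(2), of x] that by simp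
  then show ?thesis using w(1) by blast
 qed
 have center: "z \<in> (\<lambda>c. c \<odot>[A] \<one>[A]) ` carrier K"
  if z: "z \<in>[A]" and comm: "!!a. a \<in>[A] ==> z *[A] a = a *[A] z" for z
 proof -
  obtain \<phi> where \<phi>: "\<phi> \<in> dual_space K A" "\<phi> \<one>[A] = \<one>[K]" using form[of "\<one>[A]"] nonzero by auto
  obtain w where w: "w \<in>[W]" "\<forall>x\<in>carrier A. \<mu> w x = \<phi> x \<odot>[A] \<one>[A]" using rank1[OF \<phi>(1), of "\<one>[A]"] by auto
  have "\<mu> w z = z *[A] \<mu> w \<one>[A]" using w(1)
  proof (induction rule: W_induct)
   case (gen s)
   then obtain a b where s: "s = tw a b" "a \<in>[A]" "b \<in>[A]" by auto
   have "\<mu> s z = (a *[A] z) *[A] b" using s z by (simp add: two_sided_mult(2))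
   also have "a *[A] z = z *[A] a" using comm[OF s(2)] by simp
   finally show ?case using s z by (simp add: two_sided_mult(2) A.m_assoc)
  qed (use z in \<open>simp_all add: \<mu>r A.r_distr smA\<close>)
  then have "\<phi> z \<odot>[A] \<one>[A] = z" using w(2) z \<phi>(2) by simp
  then show ?thesis using dual_space_rules(1)[OF \<phi>(1) z] by (intro image_eqI[of _ _ "\<phi> z"]) auto
 qed
 have simple: "I = {\<zero>[A]} \<or> I = carrier A" if I: "ideal I A" for I
 proof (cases "I = {\<zero>[A]}")
  case False
  interpret I: ideal I A by fact
  obtain y where y: "y \<in> I" "y ~= \<zero>[A]" using False I.zero_closed by blast
  have yc: "y \<in>[A]" using y I.a_subset by auto
  obtain \<phi> where \<phi>: "\<phi> \<in> dual_space K A" "\<phi> y = \<one>[K]" using form[OF yc y(2)] by auto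
  have "b \<in> I" if b: "b \<in>[A]" for b
  proof -
   obtain w where w: "w \<in>[W]" "\<forall>x\<in>carrier A. \<mu> w x = \<phi> x \<odot>[A] b" using rank1[OF \<phi>(1) b] by auto
   have "\<mu> w y \<in> I" using w(1)
   proof (induction rule: W_induct)
    case (gen s)
    then show ?case using yc y(1) by (auto simp: two_sided_mult(2) I.I_l_closed I.I_r_closed)
   qed (simp_all add: \<mu>r yc ideal_smult[OF A I])
   then show ?thesis using w(2) yc \<phi>(2) b by simp
  qed
  then show ?thesis using I.a_subset by auto
 qed simp
 show ?thesis
  unfolding central_simple_def
 proof (intro conjI allI impI)
  show "{z \<in> carrier A. \<forall>a\<in>carrier A. z *[A] a = a *[A] z} = (\<lambda>c. c \<odot>[A] \<one>[A]) ` carrier K"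
   using center by (auto simp: smA)
  show "carrier A ~= {\<zero>[A]}" using nonzero by auto
 qed (use A fin simple in auto)
qed

context
 fixes n e e'
 assumes cs: "central_simple K A" and d: "dual_bases K A n e e'"
begin

private lemma e: "i < n ==> e i \<in>[A]" and e': "i < n ==> e' i \<in> dual_space K A"
 and ee: "i < n ==> j < n ==> e' i (e j) = (if i = j then \<one>[K] else \<zero>[K])"
 using d by (auto simp: dual_bases_def basis_def)

private abbreviation "ann J == {w \<in> carrier W. \<forall>j\<in>J. \<mu> w (e j) = \<zero>[A]}"

text \<open>The elements \<open>w v\<close>, with \<open>w\<close> ranging over an annihilator in \<open>A \<otimes> A\<^sup>o\<^sup>p\<close>, form a two-sided ideal of \<open>A\<close>.\<close>

private lemma ann_orbit:
 assumes J: "J <= {..<n}" and v: "v \<in>[A]" and ne: "\<exists>w\<in>ann J. \<mu> w v ~= \<zero>[A]"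
 shows "\<exists>w\<in>ann J. \<mu> w v = \<one>[A]"
proof -
 have Jc: "!!j. j \<in> J ==> e j \<in>[A]" using J e by auto
 have mult: "tw a b *[W] w \<in> ann J" if "a \<in>[A]" "b \<in>[A]" "w \<in> ann J" for a b w
  using that Jc by (auto simp: \<mu>r twc)
 have "ideal ((\<lambda>w. \<mu> w v) ` ann J) A" (is "ideal ?P A")
 proof (rule submodule_ideal[OF A submoduleI'[OF MA.module_axioms]])
  show "?P <= carrier A" using v by (auto simp: \<mu>r)
  show "\<zero>[A] \<in> ?P" by (rule image_eqI[of _ _ "\<zero>[W]"]) (use v Jc in \<open>auto simp: \<mu>r(6)\<close>)
  fix y z assume "y \<in> ?P" "z \<in> ?P"
  then obtain w w' where "w \<in> ann J" "w' \<in> ann J" "y = \<mu> w v" "z = \<mu> w' v" by auto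
  then show "y +[A] z \<in> ?P" using v Jc by (intro image_eqI[of _ _ "w +[W] w'"]) (auto simp: \<mu>r)
 next
  fix c y assume c: "c \<in>[K]" "y \<in> ?P"
  then obtain w where "w \<in> ann J" "y = \<mu> w v" by auto
  then show "c \<odot>[A] y \<in> ?P" using v c Jc by (intro image_eqI[of _ _ "c \<odot>[W] w"]) (auto simp: \<mu>r)
 next
  fix y a assume y: "y \<in> ?P" and a: "a \<in>[A]"
  then obtain w where w: "w \<in> ann J" "y = \<mu> w v" by auto
  then have yc: "y \<in>[A]" using v by (auto simp: \<mu>r)
  show "a *[A] y \<in> ?P"
   using w mult[OF a A.one_closed w(1)] a v yc
   by (intro image_eqI[of _ _ "tw a \<one>[A] *[W] w"]) (auto simp: \<mu>r twc two_sided_mult(2))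
  show "y *[A] a \<in> ?P"
   using w mult[OF A.one_closed a w(1)] a v yc
   by (intro image_eqI[of _ _ "tw \<one>[A] a *[W] w"]) (auto simp: \<mu>r twc two_sided_mult(2))
 qed
 then have "?P = {\<zero>[A]} \<or> ?P = carrier A" using cs by (simp add: central_simple_def)
 moreover have "?P ~= {\<zero>[A]}" using ne by auto
 ultimately have "\<one>[A] \<in> ?P" by simp
 then show ?thesis by (auto dest: sym)
qed

text \<open>Jacobson density for the simple \<open>A \<otimes> A\<^sup>o\<^sup>p\<close>-module \<open>A\<close>, whose endomorphisms are scalars.\<close>

private lemma density_step:
 assumes "finite J" "J <= {..<n}" "v \<in>[A]" "\<forall>w\<in>ann J. \<mu> w v = \<zero>[A]" "i < n" "i \<notin> J"
 shows "e' i v = \<zero>[K]"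
 using assms
proof (induction J arbitrary: v i rule: finite_induct)
 case empty
 then have "\<mu> \<one>[W] v = \<zero>[A]" by (auto simp: \<mu>r)
 then have "v = \<zero>[A]" using \<mu>r(7)[OF empty.prems(2)] by simp
 then show ?case using lin_zero[OF MA.module_axioms module_self[OF K.field_axioms] e'[OF empty.prems(4)]] by simp
next
 case (insert k J)
 have k: "k < n" and J: "J <= {..<n}" and i: "i ~= k" "i \<notin> J" "i < n" and v: "v \<in>[A]" using insert.prems by auto
 have Jc: "!!j. j \<in> J ==> e j \<in>[A]" using J e by auto
 have "\<exists>w\<in>ann J. \<mu> w (e k) ~= \<zero>[A]"
 proof (rule ccontr)
  assume "\<not> (\<exists>w\<in>ann J. \<mu> w (e k) ~= \<zero>[A])"
  then have "\<forall>w\<in>ann J. \<mu> w (e k) = \<zero>[A]" by blast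
  from insert.IH[OF J e[OF k] this k insert.hyps(2)] show False using ee[OF k k] by simp
 qed
 from ann_orbit[OF J e[OF k] this] obtain w1 where w1: "w1 \<in>[W]" "!!j. j \<in> J ==> \<mu> w1 (e j) = \<zero>[A]" "\<mu> w1 (e k) = \<one>[A]"
  by auto
 \<comment> \<open>The map \<open>w e\<^sub>k \<mapsto> w v\<close> is well defined on the annihilator and commutes with \<open>A \<otimes> A\<^sup>o\<^sup>p\<close>; so \<open>c\<close> is central.\<close>
 define c where "c = \<mu> w1 v"
 have cc: "c \<in>[A]" unfolding c_def by (rule \<mu>r(1)[OF w1(1) v])
 have kill: "\<mu> w v = \<zero>[A]" if "w \<in>[W]" "!!j. j \<in> J ==> \<mu> w (e j) = \<zero>[A]" "\<mu> w (e k) = \<zero>[A]" for w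
  using insert.prems(3) that by blast
 have "c *[A] x = x *[A] c" if x: "x \<in>[A]" for x
 proof -
  let ?w = "tw x \<one>[A] *[W] w1 -[W] tw \<one>[A] x *[W] w1"
  have t: "tw x \<one>[A] \<in>[W]" "tw \<one>[A] x \<in>[W]" using x by (simp_all add: twc)
  have app: "\<mu> ?w u = x *[A] \<mu> w1 u -[A] \<mu> w1 u *[A] x" if "u \<in>[A]" for u
   using that x w1(1) t \<mu>r(1)[OF w1(1) that] by (simp add: \<mu>r two_sided_mult(2))
  have "\<mu> ?w v = \<zero>[A]"
   by (rule kill) (use w1 x t Jc e[OF k] in \<open>simp_all add: app A.minus_zero_iff\<close>)
  then have "x *[A] c -[A] c *[A] x = \<zero>[A]" using app[OF v] by (simp add: c_def)
  then show ?thesis using A.minus_zero_iff x cc by simp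
 qed
 then have "c \<in> {z \<in> carrier A. \<forall>a\<in>carrier A. z *[A] a = a *[A] z}" using cc by simp
 moreover have "{z \<in> carrier A. \<forall>a\<in>carrier A. z *[A] a = a *[A] z} = (\<lambda>c. c \<odot>[A] \<one>[A]) ` carrier K"
  using cs unfolding central_simple_def by (elim conjE)
 ultimately have "c \<in> (\<lambda>c. c \<odot>[A] \<one>[A]) ` carrier K" by (simp only:)
 then obtain r where r: "r \<in>[K]" "c = r \<odot>[A] \<one>[A]" by auto
 \<comment> \<open>With \<open>c = r 1\<close>, the element \<open>v - r e\<^sub>k\<close> is annihilated by everything that annihilates the \<open>e\<^sub>j\<close> with \<open>j \<in> J\<close>.\<close>
 let ?v = "v -[A] r \<odot>[A] e k"
 have vc: "?v \<in>[A]" using v e[OF k] r(1) by simp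
 have "\<forall>w\<in>ann J. \<mu> w ?v = \<zero>[A]"
 proof
  fix w assume w: "w \<in> ann J"
  define y where "y = \<mu> w (e k)"
  have wc: "w \<in>[W]" and yc: "y \<in>[A]" using w e[OF k] by (auto simp: y_def \<mu>r)
  let ?w = "w -[W] tw y \<one>[A] *[W] w1"
  have t: "tw y \<one>[A] \<in>[W]" using yc by (simp add: twc)
  have app: "\<mu> ?w u = \<mu> w u -[A] y *[A] \<mu> w1 u" if "u \<in>[A]" for u
   using that yc wc w1(1) t \<mu>r(1)[OF w1(1) that] by (simp add: \<mu>r two_sided_mult(2))
  have "\<mu> ?w v = \<zero>[A]"
   by (rule kill) (use w w1 wc yc t Jc e[OF k] in \<open>simp_all add: app A.minus_zero_iff y_def[symmetric]\<close>)
  then have "\<mu> w v -[A] y *[A] c = \<zero>[A]" using app[OF v] by (simp add: c_def)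
  also have "y *[A] c = r \<odot>[A] y" using r yc by (simp add: smA)
  finally show "\<mu> w ?v = \<zero>[A]" using v wc r(1) e[OF k] by (simp add: \<mu>r y_def)
 qed
 from insert.IH[OF J vc this i(3,2)] have z: "e' i ?v = \<zero>[K]" .
 have "e' i ?v = e' i v -[self_algebra K] e' i (r \<odot>[A] e k)"
  by (rule lin_diff[OF MA.module_axioms module_self[OF K.field_axioms] e'[OF i(3)] v]) (use r(1) e[OF k] in simp)
 also have "e' i (r \<odot>[A] e k) = \<zero>[self_algebra K]"
  using dual_space_rules(3)[OF e'[OF i(3)] e[OF k] r(1)] ee[OF i(3) k] i(1) r(1) by simp
 also have "e' i v -[self_algebra K] \<zero>[self_algebra K] = e' i v"
 proof -
  interpret S: module K "self_algebra K" by (rule module_self[OF K.field_axioms])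
  have "e' i v \<in>[self_algebra K]" using lin_closed[OF e'[OF i(3)] v] .
  then show ?thesis by (simp add: a_minus_def del: carrier_self ops_self)
 qed
 finally show ?case using z by simp
qed

text \<open>Otherwise \<open>density_step\<close> would make the coordinate \<open>e' k (e k)\<close> vanish.\<close>

private lemma density:
 assumes k: "k < n"
 shows "\<exists>w\<in>carrier W. \<forall>j<n. \<mu> w (e j) = (if j = k then \<one>[A] else \<zero>[A])"
proof -
 let ?J = "{..<n} - {k}"
 have J: "?J <= {..<n}" by auto
 have "\<exists>w\<in>ann ?J. \<mu> w (e k) ~= \<zero>[A]"
 proof (rule ccontr)
  assume "\<not> (\<exists>w\<in>ann ?J. \<mu> w (e k) ~= \<zero>[A])"
  then have "\<forall>w\<in>ann ?J. \<mu> w (e k) = \<zero>[A]" by blast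
  from density_step[OF _ J e[OF k] this k] show False using ee[OF k k] by simp
 qed
 from ann_orbit[OF J e[OF k] this] show ?thesis by (auto intro!: bexI)
qed

text \<open>With \<open>w\<^sub>k\<close> sending \<open>e\<^sub>k\<close> to \<open>1\<close> and the other basis elements to \<open>0\<close>, a linear map \<open>f\<close> is given by
  \<open>\<Sum> (f(e\<^sub>k) \<otimes> 1) w\<^sub>k\<close>.\<close>

lemma two_sided_mult_surj: "f \<in>[E] ==> \<exists>w\<in>carrier W. \<mu> w = f"
proof -
 assume "f \<in>[E]"
 then have f: "f \<in> lin_maps K A A" by simp
 have "\<forall>k\<in>{..<n}. \<exists>w. w \<in>[W] \<and> (\<forall>j<n. \<mu> w (e j) = (if j = k then \<one>[A] else \<zero>[A]))"
  using density by blast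
 from bchoice[OF this] obtain u where "\<forall>k\<in>{..<n}. u k \<in>[W] \<and> (\<forall>j<n. \<mu> (u k) (e j) = (if j = k then \<one>[A] else \<zero>[A]))" ..
 then have u: "!!k. k < n ==> u k \<in>[W]" "!!k j. k < n ==> j < n ==> \<mu> (u k) (e j) = (if j = k then \<one>[A] else \<zero>[A])" by auto
 have fe: "f (e k) \<in>[A]" if "k < n" for k using lin_closed[OF f e[OF that]] .
 have t: "tw (f (e k)) \<one>[A] *[W] u k \<in>[W]" if "k < n" for k using that fe u(1) by (simp add: twc)
 let ?w = "\<Oplus>\<^bsub>W\<^esub>k\<in>{..<n}. tw (f (e k)) \<one>[A] *[W] u k"
 have wc: "?w \<in>[W]" using t by (intro W.finsum_closed) auto
 have val: "\<mu> ?w (e j) = f (e j)" if j: "j < n" for j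
 proof -
  have ev: "(\<lambda>w\<in>carrier W. \<mu> w (e j)) \<in> lin_maps K W A"
   by (rule lin_restrictI[OF mW]) (simp_all add: \<mu>r e[OF j])
  have "\<mu> ?w (e j) = (\<lambda>w\<in>carrier W. \<mu> w (e j)) ?w" using wc by simp
  also have "... = (\<Oplus>\<^bsub>A\<^esub>k\<in>{..<n}. (\<lambda>w\<in>carrier W. \<mu> w (e j)) (tw (f (e k)) \<one>[A] *[W] u k))"
   by (rule lin_finsum[OF mW MA.module_axioms ev]) (simp_all add: Pi_iff t)
  also have "... = (\<Oplus>\<^bsub>A\<^esub>k\<in>{..<n}. if j = k then f (e k) else \<zero>[A])"
  proof (rule A.finsum_cong')
   fix k assume "k \<in> {..<n}"
   then have k: "k < n" by simp
   show "(\<lambda>w\<in>carrier W. \<mu> w (e j)) (tw (f (e k)) \<one>[A] *[W] u k) = (if j = k then f (e k) else \<zero>[A])"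
    using t[OF k] e[OF j] fe[OF k] u(1)[OF k] u(2)[OF k j] by (simp add: \<mu>r twc two_sided_mult(2))
  qed (simp_all add: Pi_iff fe)
  also have "... = f (e j)" using j fe by (intro A.finsum_singleton) (simp_all add: Pi_iff)
  finally show ?thesis .
 qed
 have span: "spanning K A (e ` {..<n})"
  unfolding spanning_def
 proof (intro conjI allI impI)
  show "e ` {..<n} <= carrier A" using e by auto
  fix N assume N: "submodule N K A" "e ` {..<n} <= N"
  show "carrier A <= N"
  proof
   fix v assume v: "v \<in>[A]"
   have "(\<Oplus>\<^bsub>A\<^esub>i\<in>{..<n}. e' i v \<odot>[A] e i) \<in> N"
    by (rule submodule_finsum[OF MA.module_axioms N(1)])
     (use N(2) dual_space_rules(1)[OF e' v] in \<open>auto intro!: submoduleD(4)[OF N(1)]\<close>)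
   then show "v \<in> N" using dual_bases_expand[OF K.field_axioms MA.module_axioms d v] by simp
  qed
 qed
 have "\<mu> ?w = f"
  by (rule lin_eq_on_spanning[OF MA.module_axioms MA.module_axioms span \<mu>_lin[OF wc] f]) (use val in auto)
 then show ?thesis using wc by blast
qed

text \<open>If \<open>w = \<Sum> e\<^sub>i \<otimes> b\<^sub>i\<close> acts as zero, then \<open>\<Sum> m(e\<^sub>i) b\<^sub>i = 0\<close> for every two-sided multiplication \<open>m\<close>,
  and density isolates each \<open>b\<^sub>i\<close>.\<close>

lemma two_sided_mult_inj:
 assumes w: "w \<in>[W]" and zero: "!!x. x \<in>[A] ==> \<mu> w x = \<zero>[A]"
 shows "w = \<zero>[W]"
proof -
 have bil: "bilinear_map K A (op_algebra A) A (\<lambda>a b. \<mu> z a *[A] b)" if z: "z \<in>[W]" for z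
  by (rule bilinear_mapI[OF MA.module_axioms algD(2)[OF O]])
   (simp_all add: \<mu>r z A.l_distr A.r_distr smA)
 let ?G = "\<lambda>z. tensor_lift K A (op_algebra A) A (\<lambda>a b. \<mu> z a *[A] b)"
 note G = tensor_lift[OF A O MA.module_axioms bil, simplified]
 note Gl = lin_closed[OF G(1)] lin_add[OF G(1)] lin_smult[OF G(1)] lin_zero[OF mW MA.module_axioms G(1)]
 have G1: "?G (tw a c) t = a *[A] \<mu> t c" if a: "a \<in>[A]" and c: "c \<in>[A]" and t: "t \<in>[W]" for a c t
  using t
 proof (induction rule: W_induct)
  case (gen s)
  then show ?case using a c by (auto simp: G(2) twc two_sided_mult(2) A.m_assoc)
 qed (use a c in \<open>simp_all add: Gl twc \<mu>r A.r_distr smA\<close>)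
 have G_add: "?G (z +[W] z') t = ?G z t +[A] ?G z' t" if z: "z \<in>[W]" "z' \<in>[W]" and t: "t \<in>[W]" for z z' t
  using t
 proof (induction rule: W_induct)
  case (gen s)
  then show ?case using z by (auto simp: G(2) \<mu>r A.l_distr)
 qed (use z in \<open>simp_all add: Gl A.a_ac MA.smult_r_distr\<close>)
 have G_smult: "?G (c \<odot>[W] z) t = c \<odot>[A] ?G z t" if z: "z \<in>[W]" "c \<in>[K]" and t: "t \<in>[W]" for z c t
  using t
 proof (induction rule: W_induct)
  case (gen s)
  then show ?case using z by (auto simp: G(2) \<mu>r smA)
 next
  case (smult c' t)
  then show ?case using z by (simp add: Gl MA.smult_assoc1[symmetric] K.m_comm)
 qed (use z in \<open>simp_all add: Gl MA.smult_r_distr\<close>)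
 have Gw: "?G z w = \<zero>[A]" if "z \<in>[W]" for z
  using that
 proof (induction rule: W_induct)
  case (gen s)
  then show ?case using w zero by (auto simp: G1)
 next
  case zero
  have "\<zero>[W] = \<zero>[K] \<odot>[W] \<zero>[W]" by simp
  then have "?G \<zero>[W] w = \<zero>[K] \<odot>[A] ?G \<zero>[W] w" using G_smult[OF W.zero_closed K.zero_closed w] by simp
  then show ?case using Gl(1)[OF W.zero_closed w] by simp
 qed (use w in \<open>simp_all add: G_add G_smult\<close>)
 let ?b = "\<lambda>i. contraction K A (op_algebra A) (e' i) w"
 have bc: "?b i \<in>[A]" if "i < n" for i using lin_closed[OF contraction(1)[OF A O e'[OF that]] w] by simp
 have exp: "w = (\<Oplus>\<^bsub>W\<^esub>i\<in>{..<n}. tw (e i) (?b i))" by (rule tensor_contraction_expand[OF A O d w])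
 have b0: "?b k = \<zero>[A]" if k: "k < n" for k
 proof -
  obtain z where z: "z \<in>[W]" "\<forall>j<n. \<mu> z (e j) = (if j = k then \<one>[A] else \<zero>[A])" using density[OF k] by auto
  have "?G z w = ?G z (\<Oplus>\<^bsub>W\<^esub>i\<in>{..<n}. tw (e i) (?b i))" using exp by simp
  also have "... = (\<Oplus>\<^bsub>A\<^esub>i\<in>{..<n}. ?G z (tw (e i) (?b i)))"
   by (rule lin_finsum[OF mW MA.module_axioms G(1)[OF z(1)]]) (simp_all add: Pi_iff twc e bc)
  also have "... = (\<Oplus>\<^bsub>A\<^esub>i\<in>{..<n}. if k = i then ?b i else \<zero>[A])"
   by (rule A.finsum_cong') (auto simp: Pi_iff G(2)[OF z(1)] e bc z(2))
  also have "... = ?b k" using k bc by (intro A.finsum_singleton) (simp_all add: Pi_iff)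
  finally show ?thesis using Gw[OF z(1)] by simp
 qed
 have tz: "tw a \<zero>[A] = \<zero>[W]" if "a \<in>[A]" for a
  using that tens_smult_right[OF A O, of "\<zero>[K]" a "\<zero>[A]"] by (simp add: twc)
 have "(\<Oplus>\<^bsub>W\<^esub>i\<in>{..<n}. tw (e i) (?b i)) = \<zero>[W]"
  by (rule W.add.finprod_one_eqI) (simp add: b0 tz e)
 then show ?thesis using exp by simp
qed

end

theorem central_simple_iff_bij:
 assumes fin: "finite_dim K A" and nonzero: "\<one>[A] ~= \<zero>[A]"
 shows "central_simple K A \<longleftrightarrow> bij_betw \<mu> (carrier W) (carrier E)"
proof
 assume "bij_betw \<mu> (carrier W) (carrier E)"
 then show "central_simple K A" by (intro central_simple_if_surj[OF fin nonzero]) (simp add: bij_betw_def)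
next
 assume cs: "central_simple K A"
 obtain n e where b: "basis K A n e" using fin by (auto simp: finite_dim_def)
 obtain e' where d: "dual_bases K A n e e'" using dual_bases_exist[OF K.field_axioms MA.module_axioms b] by auto
 show "bij_betw \<mu> (carrier W) (carrier E)"
  unfolding bij_betw_def
 proof
  show "inj_on \<mu> (carrier W)"
  proof (rule inj_onI)
   fix u v assume uv: "u \<in>[W]" "v \<in>[W]" "\<mu> u = \<mu> v"
   have "u -[W] v = \<zero>[W]"
    by (rule two_sided_mult_inj[OF cs d]) (use uv in \<open>simp_all add: \<mu>r A.minus_zero_iff\<close>)
   then show "u = v" using uv by (simp add: W.minus_zero_iff)
  qed
  show "\<mu> ` carrier W = carrier E"
   using two_sided_mult_surj[OF cs d] lin_closed[OF hom_lin[OF two_sided_mult(1)]] by fastforce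
 qed
qed

end

section \<open>Comparison of the Galois map with two-sided multiplications\<close>

text \<open>The algebra \<open>G\<close> stands for \<open>U\<^sub>\<xi>(L)\<close> or for its opposite; all that matters is that it is generated by a
  representation \<open>\<gamma>\<close> of \<open>L\<close> and that the homomorphism \<open>\<nu>\<close> exists on it. Modulo the factor \<open>G \<otimes> 1\<close> the elements \<open>x\<close> of
  \<open>U\<^sub>0(L)\<close> and \<open>-1 \<otimes> \<gamma>(x)\<close> of \<open>G \<otimes> G\<^sup>o\<^sup>p\<close> correspond to each other; since \<open>1 \<otimes> \<gamma>(x)\<close> multiplies from the other
  side, the correspondence reverses products, which is why \<open>\<nu>\<close> has its values in \<open>G \<otimes> U\<^sub>0(L)\<^sup>o\<^sup>p\<close>.\<close>

lemma twisted_mult_bij: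
 assumes L: "p_lie_algebra K L p" and G: "assoc_algebra K G" and \<gamma>: "lie_rep K p L s G \<gamma>"
  and ind: "!!Q. [|submodule Q K G; \<one>[G] \<in> Q; !!x u. [|x \<in>[L]; u \<in> Q|] ==> \<gamma> x *[G] u \<in> Q|] ==> carrier G <= Q"
  and \<nu>: "\<nu> \<in> alg_homs K G (tensor K G (op_algebra (restr_env_algebra K p L)))"
  and \<nu>_gen: "!!x. x \<in>[L] ==> \<nu> (\<gamma> x) =
    tens K G (op_algebra (restr_env_algebra K p L)) (\<gamma> x) \<one>[restr_env_algebra K p L]
     -[tensor K G (op_algebra (restr_env_algebra K p L))]
    tens K G (op_algebra (restr_env_algebra K p L)) \<one>[G] (restr_env_incl K p L x)"
  and act: "act \<in> alg_homs K (restr_env_algebra K p L) (end_algebra K G)"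
  and act_gen: "!!x u. [|x \<in>[L]; u \<in>[G]|] ==> act (restr_env_incl K p L x) u = \<gamma> x *[G] u -[G] u *[G] \<gamma> x"
 shows "bij_betw (galois_map K (restr_env_algebra K p L) G act)
   (carrier (tensor K G (restr_env_algebra K p L))) (carrier (end_algebra K G)) \<longleftrightarrow>
  bij_betw (two_sided_mult K G) (carrier (tensor K G (op_algebra G))) (carrier (end_algebra K G))"
proof -
 let ?U = "restr_env_algebra K p L" and ?W = "tensor K G (op_algebra G)" and ?E = "end_algebra K G"
  and ?i = "restr_env_incl K p L" and ?\<mu> = "two_sided_mult K G"
 let ?N = "tensor K G (op_algebra ?U)" and ?tw = "tens K G (op_algebra G)" and ?tn = "tens K G (op_algebra ?U)"
 note U = assoc_restr_env[OF L] and O = assoc_op[OF G]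
 note OU = assoc_op[OF U]
 note W = assoc_tensor[OF G O] and N = assoc_tensor[OF G OU]
 interpret K: field K by (rule algD[OF G])
 interpret G: ring G by (rule algD[OF G])
 interpret U: ring ?U by (rule algD[OF U])
 interpret MG: module K G by (rule algD[OF G])
 interpret MU: module K ?U by (rule algD[OF U])
 interpret W: ring ?W by (rule algD[OF W])
 interpret MW: module K ?W by (rule algD[OF W])
 interpret N: ring ?N by (rule algD[OF N])
 interpret MN: module K ?N by (rule algD[OF N])
 note E = assoc_end[OF K.field_axioms MG.module_axioms]
 note mG = MG.module_axioms and mU = MU.module_axioms and mW = MW.module_axioms and mN = MN.module_axioms
 note g = lie_repD[OF \<gamma>]
 have i [simp]: "x \<in>[L] ==> ?i x \<in>[?U]" for x by (rule incl_closed[OF L zero_form_closed[OF L]])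
 note twc = tens_closed[OF G O, simplified] and tnc = tens_closed[OF G OU, simplified]
 note twm = tens_mult[OF G O, simplified] and tnm = tens_mult[OF G OU, simplified]
 note tw1 = tens_one[OF G O, simplified] and tn1 = tens_one[OF G OU, simplified]
 note smW = alg_smult[OF W] and smN = alg_smult[OF N]
 note W_induct = spanning_induct[OF mW tensor_spanning[OF G O, simplified], consumes 1, case_names gen zero add smult]
 note N_induct = spanning_induct[OF mN tensor_spanning[OF G OU, simplified], consumes 1, case_names gen zero add smult]
 have rep: "lie_rep K p L (\<lambda>x. \<zero>[K]) ?W (\<lambda>x. ?tw (\<gamma> x) \<one>[G] -[?W] ?tw \<one>[G] (\<gamma> x))"
 proof (rule lie_rep_cong[OF L lie_rep_tensor[OF L G O \<gamma> lie_rep_op[OF L G \<gamma>]]])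
  fix x assume x: "x \<in>[L]"
  show "s x +[K] -[K] s x = \<zero>[K]" using g(2)[OF x] by (rule K.r_neg)
  have "?tw \<one>[G] (\<gamma> x) +[?W] ?tw \<one>[G] (-[G] \<gamma> x) = ?tw \<one>[G] \<zero>[G]"
   using g(1)[OF x] tens_add_right[OF G O, of "\<one>[G]" "\<gamma> x" "-[G] \<gamma> x"] by (simp add: G.r_neg)
  also have "... = \<zero>[?W]" using tens_smult_right[OF G O, of "\<zero>[K]" "\<one>[G]" "\<zero>[G]"] by (simp add: twc)
  finally have "-[?W] ?tw \<one>[G] (\<gamma> x) = ?tw \<one>[G] (-[G] \<gamma> x)"
   using g(1)[OF x] by (intro W.minus_equality) (simp_all add: twc W.a_comm)
  then show "?tw (\<gamma> x) \<one>[op_algebra G] +[?W] ?tw \<one>[G] (-[G] \<gamma> x) = ?tw (\<gamma> x) \<one>[G] -[?W] ?tw \<one>[G] (\<gamma> x)"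
   by (simp add: a_minus_def)
 qed
 define \<psi> where "\<psi> = red_env_lift K p L (zero_form K L) ?W (\<lambda>x. ?tw (\<gamma> x) \<one>[G] -[?W] ?tw \<one>[G] (\<gamma> x))"
 note \<psi> = restr_rep_lift[OF L W rep, folded \<psi>_def]
 note \<psi>l = hom_lin[OF \<psi>(1)] and \<nu>l = hom_lin[OF \<nu>]
 note \<psi>c = lin_closed[OF \<psi>l] and \<nu>c = lin_closed[OF \<nu>l]
 have "bilinear_map K G ?U ?W (\<lambda>a h. ?tw a \<one>[G] *[?W] \<psi> h)"
  by (rule bilinear_mapI[OF mG mU])
   (simp_all add: twc \<psi>c tens_add_left[OF G O, simplified] tens_smult_left[OF G O, simplified] lin_add[OF \<psi>l] lin_smult[OF \<psi>l] W.l_distr W.r_distr smW)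
 note P = tensor_lift[OF G U mW this, unfolded lin_maps_tensor_op(1)[of K G ?U, symmetric] tens_op[of K G ?U, symmetric]]
 have "bilinear_map K G (op_algebra G) ?N (\<lambda>a b. ?tn a \<one>[?U] *[?N] \<nu> b)"
  by (rule bilinear_mapI[OF mG algD(2)[OF O]])
   (simp_all add: tnc \<nu>c tens_add_left[OF G OU, simplified] tens_smult_left[OF G OU, simplified] lin_add[OF \<nu>l] lin_smult[OF \<nu>l] N.l_distr N.r_distr smN)
 note Q = tensor_lift[OF G O mN this, simplified]
 define \<Psi> where "\<Psi> = tensor_lift K G ?U ?W (\<lambda>a h. ?tw a \<one>[G] *[?W] \<psi> h)"
 define \<Theta> where "\<Theta> = tensor_lift K G (op_algebra G) ?N (\<lambda>a b. ?tn a \<one>[?U] *[?N] \<nu> b)"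
 note \<Psi> = P[folded \<Psi>_def] and \<Theta> = Q[folded \<Theta>_def]
 note \<Psi>r = lin_closed[OF \<Psi>(1)] lin_add[OF \<Psi>(1)] lin_smult[OF \<Psi>(1)] lin_zero[OF mN mW \<Psi>(1)] lin_diff[OF mN mW \<Psi>(1)]
 note \<Theta>r = lin_closed[OF \<Theta>(1)] lin_add[OF \<Theta>(1)] lin_smult[OF \<Theta>(1)] lin_zero[OF mW mN \<Theta>(1)] lin_diff[OF mW mN \<Theta>(1)]
 have split_w: "?tw a b = ?tw a \<one>[G] *[?W] ?tw \<one>[G] b" if "a \<in>[G]" "b \<in>[G]" for a b
  using that by (simp add: twm)
 have split_n: "?tn a b = ?tn a \<one>[?U] *[?N] ?tn \<one>[G] b" if "a \<in>[G]" "b \<in>[?U]" for a b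
  using that by (simp add: tnm)
 have mul_w: "?tw (a *[G] b) \<one>[G] = ?tw a \<one>[G] *[?W] ?tw b \<one>[G]" if "a \<in>[G]" "b \<in>[G]" for a b
  using that by (simp add: twm)
 have mul_n: "?tn (a *[G] b) \<one>[?U] = ?tn a \<one>[?U] *[?N] ?tn b \<one>[?U]" if "a \<in>[G]" "b \<in>[G]" for a b
  using that by (simp add: tnm)
 have \<Psi>_left: "\<Psi> (?tn a \<one>[?U] *[?N] t) = ?tw a \<one>[G] *[?W] \<Psi> t" if t: "t \<in>[?N]" and a: "a \<in>[G]" for t a
  using t
 proof (induction rule: N_induct)
  case (gen v)
  then obtain b h where v: "v = ?tn b h" "b \<in>[G]" "h \<in>[?U]" by blast
  then show ?case using a by (simp add: tnm \<Psi>(2) mul_w W.m_assoc twc \<psi>c)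
 qed (use a in \<open>simp_all add: \<Psi>r N.r_distr W.r_distr tnc twc smN smW\<close>)
 have \<Theta>_left: "\<Theta> (?tw a \<one>[G] *[?W] t) = ?tn a \<one>[?U] *[?N] \<Theta> t" if t: "t \<in>[?W]" and a: "a \<in>[G]" for t a
  using t
 proof (induction rule: W_induct)
  case (gen v)
  then obtain b h where v: "v = ?tw b h" "b \<in>[G]" "h \<in>[G]" by blast
  then show ?case using a by (simp add: twm \<Theta>(2) mul_n N.m_assoc tnc \<nu>c)
 qed (use a in \<open>simp_all add: \<Theta>r N.r_distr W.r_distr tnc twc smN smW\<close>)
 have \<Psi>_right: "\<Psi> (?tn \<one>[G] (?i x) *[?N] t) = \<Psi> t *[?W] \<psi> (?i x)" if t: "t \<in>[?N]" and x: "x \<in>[L]" for t x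
  using t
 proof (induction rule: N_induct)
  case (gen v)
  then obtain b h where v: "v = ?tn b h" "b \<in>[G]" "h \<in>[?U]" by blast
  then show ?case using x by (simp add: tnm \<Psi>(2) W.m_assoc twc \<psi>c hom_mult[OF \<psi>(1)])
 qed (use x in \<open>simp_all add: \<Psi>r N.r_distr W.l_distr tnc twc smN smW \<psi>c\<close>)
 have \<Theta>_right: "\<Theta> (?tw \<one>[G] (\<gamma> x) *[?W] t) = \<Theta> t *[?N] \<nu> (\<gamma> x)" if t: "t \<in>[?W]" and x: "x \<in>[L]" for t x
  using t
 proof (induction rule: W_induct)
  case (gen v)
  then obtain b h where v: "v = ?tw b h" "b \<in>[G]" "h \<in>[G]" by blast
  then show ?case using g(1)[OF x] by (simp add: twm \<Theta>(2) N.m_assoc tnc \<nu>c hom_mult[OF \<nu>])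
 qed (use g(1)[OF x] in \<open>simp_all add: \<Theta>r N.l_distr W.r_distr tnc twc smN smW \<nu>c\<close>)
 \<comment> \<open>Induction along left multiplications by \<open>\<gamma>(x)\<close>; \<open>\<Psi>\<close> turns left multiplication by \<open>1 \<otimes> x\<close> into right multiplication by \<open>\<psi>(x)\<close>.\<close>
 have \<Psi>\<nu>: "\<Psi> (\<nu> b) = ?tw \<one>[G] b" if "b \<in>[G]" for b
 proof -
  have "(\<lambda>b\<in>carrier G. \<Psi> (\<nu> b)) \<in> lin_maps K G ?W" by (rule lin_compose[OF mG \<nu>l \<Psi>(1)])
  moreover have "(\<lambda>b\<in>carrier G. ?tw \<one>[G] b) \<in> lin_maps K G ?W"
   by (rule lin_restrictI[OF mG]) (simp_all add: twc tens_add_right[OF G O, simplified] tens_smult_right[OF G O, simplified])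
  ultimately have "submodule {b \<in> carrier G. (\<lambda>b\<in>carrier G. \<Psi> (\<nu> b)) b = (\<lambda>b\<in>carrier G. ?tw \<one>[G] b) b} K G"
   by (rule submodule_equalizer[OF mG mW])
  then have "carrier G <= {b \<in> carrier G. (\<lambda>b\<in>carrier G. \<Psi> (\<nu> b)) b = (\<lambda>b\<in>carrier G. ?tw \<one>[G] b) b}"
  proof (rule ind)
   show "\<one>[G] \<in> {b \<in> carrier G. (\<lambda>b\<in>carrier G. \<Psi> (\<nu> b)) b = (\<lambda>b\<in>carrier G. ?tw \<one>[G] b) b}"
    using \<Psi>(2)[OF G.one_closed U.one_closed] by (simp add: hom_one[OF \<nu>] hom_one[OF \<psi>(1)] tn1 tw1 twm)
   fix x b assume x: "x \<in>[L]" and "b \<in> {b \<in> carrier G. (\<lambda>b\<in>carrier G. \<Psi> (\<nu> b)) b = (\<lambda>b\<in>carrier G. ?tw \<one>[G] b) b}"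
   then have "b \<in>[G]" "(\<lambda>b\<in>carrier G. \<Psi> (\<nu> b)) b = (\<lambda>b\<in>carrier G. ?tw \<one>[G] b) b" by (simp_all only: mem_Collect_eq)
   then have b: "b \<in>[G]" "\<Psi> (\<nu> b) = ?tw \<one>[G] b" by simp_all
   note gx = g(1)[OF x]
   have "\<Psi> (\<nu> (\<gamma> x *[G] b)) = \<Psi> (?tn (\<gamma> x) \<one>[?U] *[?N] \<nu> b -[?N] ?tn \<one>[G] (?i x) *[?N] \<nu> b)"
    using gx b(1) x by (simp add: hom_mult[OF \<nu>] \<nu>_gen a_minus_def N.l_distr N.l_minus tnc \<nu>c)
   also have "... = ?tw (\<gamma> x) \<one>[G] *[?W] ?tw \<one>[G] b -[?W] ?tw \<one>[G] b *[?W] \<psi> (?i x)"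
    using gx b x by (simp add: \<Psi>r tnc \<nu>c \<Psi>_left \<Psi>_right)
   also have "... = ?tw (\<gamma> x) b -[?W] (?tw (\<gamma> x) b -[?W] ?tw \<one>[G] (\<gamma> x *[G] b))"
    using gx b(1) x by (simp add: \<psi>(2) a_minus_def W.r_distr W.r_minus twc twm)
   also have "... = ?tw \<one>[G] (\<gamma> x *[G] b)"
    using gx b(1) by (simp add: a_minus_def W.minus_add W.r_neg2 twc)
   finally show "\<gamma> x *[G] b \<in> {b \<in> carrier G. (\<lambda>b\<in>carrier G. \<Psi> (\<nu> b)) b = (\<lambda>b\<in>carrier G. ?tw \<one>[G] b) b}"
    using gx b(1) by simp
  qed
  from subsetD[OF this that] have "(\<lambda>b\<in>carrier G. \<Psi> (\<nu> b)) b = (\<lambda>b\<in>carrier G. ?tw \<one>[G] b) b" by (simp only: mem_Collect_eq)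
  then show ?thesis using that by simp
 qed
 have \<Theta>\<psi>: "\<Theta> (\<psi> h) = ?tn \<one>[G] h" if "h \<in>[?U]" for h
  using that
 proof (induction rule: red_env_induct[OF L zero_form_closed[OF L], consumes 1, case_names one gen add smult])
  case one
  show ?case using \<Theta>(2)[OF G.one_closed G.one_closed] by (simp add: hom_one[OF \<psi>(1)] hom_one[OF \<nu>] tn1 tw1 tnm)
 next
  case (gen x h)
  note x = gen(1) and h = gen(2) and gx = g(1)[OF gen(1)]
  have "\<Theta> (\<psi> (?i x *[?U] h)) = \<Theta> (?tw (\<gamma> x) \<one>[G] *[?W] \<psi> h -[?W] ?tw \<one>[G] (\<gamma> x) *[?W] \<psi> h)"
   using gx h x by (simp add: hom_mult[OF \<psi>(1)] \<psi>(2) a_minus_def W.l_distr W.l_minus twc \<psi>c)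
  also have "... = ?tn (\<gamma> x) \<one>[?U] *[?N] ?tn \<one>[G] h -[?N] ?tn \<one>[G] h *[?N] \<nu> (\<gamma> x)"
   using gx h x gen(3) by (simp add: \<Theta>r twc \<psi>c \<Theta>_left \<Theta>_right)
  also have "... = ?tn (\<gamma> x) h -[?N] (?tn (\<gamma> x) h -[?N] ?tn \<one>[G] (?i x *[?U] h))"
   using gx h x by (simp add: \<nu>_gen a_minus_def N.r_distr N.r_minus tnc tnm)
  also have "... = ?tn \<one>[G] (?i x *[?U] h)"
   using gx h x by (simp add: a_minus_def N.minus_add N.r_neg2 tnc)
  finally show ?case .
 next
  case (add h h')
  then show ?case by (simp add: lin_add[OF \<psi>l] \<Theta>r \<psi>c tens_add_right[OF G OU, simplified])
 next
  case (smult c h)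
  then show ?case by (simp add: lin_smult[OF \<psi>l] \<Theta>r \<psi>c tens_smult_right[OF G OU, simplified])
 qed
 have \<Psi>\<Theta>: "\<Psi> (\<Theta> w) = w" if "w \<in>[?W]" for w
  using that
 proof (induction rule: W_induct)
  case (gen v)
  then obtain a b where v: "v = ?tw a b" "a \<in>[G]" "b \<in>[G]" by blast
  then show ?case by (simp add: \<Theta>(2) \<Psi>_left \<nu>c \<Psi>\<nu> split_w[symmetric])
 qed (simp_all add: \<Theta>r \<Psi>r)
 have \<Theta>\<Psi>: "\<Theta> (\<Psi> t) = t" if "t \<in>[?N]" for t
  using that
 proof (induction rule: N_induct)
  case (gen v)
  then obtain a h where v: "v = ?tn a h" "a \<in>[G]" "h \<in>[?U]" by blast
  then show ?case by (simp add: \<Psi>(2) \<Theta>_left \<psi>c \<Theta>\<psi> split_n[symmetric])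
 qed (simp_all add: \<Theta>r \<Psi>r)
 have bij: "bij_betw \<Psi> (carrier ?N) (carrier ?W)"
  by (rule bij_betwI[of _ _ _ \<Theta>]) (simp_all add: \<Psi>r \<Theta>r \<Psi>\<Theta> \<Theta>\<Psi>)
 note \<mu> = two_sided_mult[OF G] and \<mu>r = two_sided_mult_rules[OF G]
 have act\<psi>: "?\<mu> (\<psi> h) = act h" if h: "h \<in>[?U]" for h
 proof -
  have 1: "(\<lambda>h\<in>carrier ?U. ?\<mu> (\<psi> h)) \<in> alg_homs K ?U ?E" by (rule alg_homs_compose[OF U \<psi>(1) \<mu>(1)])
  have "(\<lambda>h\<in>carrier ?U. ?\<mu> (\<psi> h)) = act"
  proof (rule red_env_hom_eqI[OF L zero_form_closed[OF L] E 1 act])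
   fix x assume x: "x \<in>[L]"
   have "?\<mu> (\<psi> (?i x)) = act (?i x)"
   proof (rule lin_ext)
    show "?\<mu> (\<psi> (?i x)) \<in> lin_maps K G G" using lin_closed[OF hom_lin[OF \<mu>(1)] \<psi>c[OF i[OF x]]] by simp
    show "act (?i x) \<in> lin_maps K G G" using lin_closed[OF hom_lin[OF act] i[OF x]] by simp
    show "?\<mu> (\<psi> (?i x)) u = act (?i x) u" if u: "u \<in>[G]" for u
     using x u g(1)[OF x] by (simp add: \<psi>(2) act_gen \<mu>r(3) \<mu>(2) twc)
   qed
   then show "(\<lambda>h\<in>carrier ?U. ?\<mu> (\<psi> h)) (?i x) = act (?i x)" using x by simp
  qed
  from fun_cong[OF this, of h] show ?thesis using h by simp
 qed
 have actl: "act h \<in> lin_maps K G G" if "h \<in>[?U]" for h using lin_closed[OF hom_lin[OF act] that] by simp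
 note actc = lin_closed[OF actl]
 have act_add: "act (h +[?U] h') u = act h u +[G] act h' u"
  if "h \<in>[?U]" "h' \<in>[?U]" "u \<in>[G]" for h h' u
  using that by (simp add: lin_add[OF hom_lin[OF act]] end_apply)
 have act_smult: "act (c \<odot>[?U] h) u = c \<odot>[G] act h u"
  if "h \<in>[?U]" "u \<in>[G]" "c \<in>[K]" for h u c
  using that by (simp add: lin_smult[OF hom_lin[OF act]] end_apply)
 have actm: "(\<lambda>u\<in>carrier G. a *[G] act h u) \<in> lin_maps K G G" if "a \<in>[G]" "h \<in>[?U]" for a h
  by (rule lin_restrictI[OF mG]) (simp_all add: that actc lin_add[OF actl] lin_smult[OF actl] G.r_distr alg_smult[OF G])
 have gal: "bilinear_map K G ?U ?E (\<lambda>a h. \<lambda>u\<in>carrier G. a *[G] act h u)"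
 proof (rule bilinear_mapI[OF mG mU])
  fix a h assume ah: "a \<in>[G]" "h \<in>[?U]"
  show "(\<lambda>u\<in>carrier G. a *[G] act h u) \<in>[?E]" unfolding carrier_end by (rule actm[OF ah])
 qed (auto simp: end_algebra_def act_add act_smult actc G.l_distr G.r_distr alg_smult[OF G] intro!: restrict_ext)
 note galois = tensor_lift[OF G U algD(2)[OF E] gal, folded galois_map_def,
   unfolded lin_maps_tensor_op(1)[of K G ?U, symmetric] tens_op[of K G ?U, symmetric]]
 have comp: "(\<lambda>t\<in>carrier ?N. ?\<mu> (\<Psi> t)) = galois_map K ?U G act"
 proof (rule tensor_lift_eqI[OF G OU algD(2)[OF E] lin_compose[OF mN \<Psi>(1) hom_lin[OF \<mu>(1)]] galois(1)])
  fix a h assume a: "a \<in>[G]" and "h \<in>[op_algebra ?U]"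
  then have h: "h \<in>[?U]" by simp
  have "?\<mu> (?tw a \<one>[G] *[?W] \<psi> h) = (\<lambda>u\<in>carrier G. a *[G] act h u)"
  proof (rule lin_ext)
   show "?\<mu> (?tw a \<one>[G] *[?W] \<psi> h) \<in> lin_maps K G G"
    using lin_closed[OF hom_lin[OF \<mu>(1)], of "?tw a \<one>[G] *[?W] \<psi> h"] a h by (simp add: twc \<psi>c)
   show "(\<lambda>u\<in>carrier G. a *[G] act h u) \<in> lin_maps K G G" by (rule actm[OF a h])
   show "?\<mu> (?tw a \<one>[G] *[?W] \<psi> h) u = (\<lambda>u\<in>carrier G. a *[G] act h u) u" if "u \<in>[G]" for u
    using a h that by (simp add: \<mu>r(4) twc \<psi>c act\<psi> \<mu>(2) actc)
  qed
  then show "(\<lambda>t\<in>carrier ?N. ?\<mu> (\<Psi> t)) (?tn a h) = galois_map K ?U G act (?tn a h)"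
   using a h by (simp add: tnc galois(2) \<Psi>(2))
 qed
 have "bij_betw (galois_map K ?U G act) (carrier ?N) (carrier ?E) \<longleftrightarrow> bij_betw (?\<mu> \<circ> \<Psi>) (carrier ?N) (carrier ?E)"
  by (rule bij_betw_cong) (simp add: comp[symmetric])
 also have "... \<longleftrightarrow> bij_betw ?\<mu> (carrier ?W) (carrier ?E)"
  by (rule bij_betw_comp_iff[OF bij, symmetric])
 finally show ?thesis by (simp add: carrier_tensor_op)
qed

lemma tens_minus_right:
 assumes A: "assoc_algebra K A" and B: "assoc_algebra K B" and a: "a \<in>[A]" and b: "b \<in>[B]"
 shows "tens K A B a (-[B] b) = -[tensor K A B] tens K A B a b"
proof -
 interpret B: ring B by (rule algD[OF B])
 have "(\<lambda>b\<in>carrier B. tens K A B a b) \<in> lin_maps K B (tensor K A B)"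
  by (rule lin_restrictI[OF algD(2)[OF B]])
   (simp_all add: a tens_closed[OF A B] tens_add_right[OF A B] tens_smult_right[OF A B])
 from lin_neg[OF algD(2)[OF B] algD(2)[OF assoc_tensor[OF A B]] this b] show ?thesis using b by simp
qed

lemma tens_minus_left:
 assumes A: "assoc_algebra K A" and B: "assoc_algebra K B" and a: "a \<in>[A]" and b: "b \<in>[B]"
 shows "tens K A B (-[A] a) b = -[tensor K A B] tens K A B a b"
proof -
 interpret A: ring A by (rule algD[OF A])
 have "(\<lambda>a\<in>carrier A. tens K A B a b) \<in> lin_maps K A (tensor K A B)"
  by (rule lin_restrictI[OF algD(2)[OF A]])
   (simp_all add: b tens_closed[OF A B] tens_add_left[OF A B] tens_smult_left[OF A B])
 from lin_neg[OF algD(2)[OF A] algD(2)[OF assoc_tensor[OF A B]] this a] show ?thesis using a by simp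
qed

lemma op_minus: "-[op_algebra B] u = -[B] u"
 by (simp add: a_inv_def m_inv_def op_algebra_def)

lemma finsum_op: "finsum (op_algebra A) g I = finsum A g I"
 by (simp add: finsum_def finprod_def op_algebra_def)

text \<open>An algebra and its opposite have the same ideals and the same centre.\<close>

lemma central_simple_op:
 assumes "central_simple K A"
 shows "central_simple K (op_algebra A)"
proof -
 have A: "assoc_algebra K A" and fin: "finite_dim K A" and nz: "carrier A ~= {\<zero>[A]}"
  and cen: "{z \<in> carrier A. \<forall>a\<in>carrier A. z *[A] a = a *[A] z} = (\<lambda>c. c \<odot>[A] \<one>[A]) ` carrier K"
  and simple: "!!I. ideal I A ==> I = {\<zero>[A]} \<or> I = carrier A"
  using assms unfolding central_simple_def by blast+
 have fin': "finite_dim K (op_algebra A)"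
  using fin unfolding finite_dim_def basis_def by (simp add: finsum_op)
 have ideal: "ideal I A" if I: "ideal I (op_algebra A)" for I
 proof (rule idealI[OF algD(3)[OF A]])
  show "subgroup I (add_monoid A)" using ideal.axioms(1)[OF I] unfolding additive_subgroup_def subgroup_def m_inv_def by (simp add: op_algebra_def)
  show "x *[A] a \<in> I" "a *[A] x \<in> I" if "a \<in> I" "x \<in>[A]" for a x
   using ideal.I_l_closed[OF I, of a x] ideal.I_r_closed[OF I, of a x] that by simp_all
 qed
 have "{z \<in> carrier A. \<forall>a\<in>carrier A. a *[A] z = z *[A] a} = {z \<in> carrier A. \<forall>a\<in>carrier A. z *[A] a = a *[A] z}"
  by (intro Collect_cong) (simp add: eq_commute)
 then show ?thesis unfolding central_simple_def using assoc_op[OF A] fin' nz cen simple ideal by simp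
qed

text \<open>The form \<open>f\<close> is the combination of the dual basis with coefficients \<open>f(h\<^sub>i)\<close>. The sum is built up term by term
  because the module axioms speak of two summands only.\<close>

lemma right_module_expand:
 assumes H: "assoc_algebra K H" and A: "assoc_algebra K A" and r: "right_module K (dual_algebra K H \<Delta> \<epsilon>) A r"
  and d: "dual_bases K H n h h'" and f: "f \<in> dual_space K H" and b: "b \<in>[A]"
 shows "r b f = (\<Oplus>\<^bsub>A\<^esub>i\<in>{..<n}. f (h i) \<odot>[A] r b (h' i))"
proof -
 interpret K: field K by (rule algD[OF A])
 interpret H: ring H by (rule algD[OF H])
 interpret MH: module K H by (rule algD[OF H])
 interpret A: ring A by (rule algD[OF A])
 interpret MA: module K A by (rule algD[OF A])
 note mS = module_self[OF K.field_axioms]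
 have h: "h i \<in>[H]" and h': "h' i \<in> dual_space K H" if "i < n" for i
  using d that by (auto simp: dual_bases_def basis_def)
 note fr = dual_space_rules[OF f]
 have rc: "r b g \<in>[A]" if "g \<in> dual_space K H" for g
  using r b that by (simp add: right_module_def dual_algebra_def)
 have ra: "r b (\<lambda>u\<in>carrier H. g u +[K] g' u) = r b g +[A] r b g'" if "g \<in> dual_space K H" "g' \<in> dual_space K H" for g g'
  using r b that by (simp add: right_module_def dual_algebra_def)
 have rs: "r b (\<lambda>u\<in>carrier H. c *[K] g u) = c \<odot>[A] r b g" if "g \<in> dual_space K H" "c \<in>[K]" for g c
  using r b that by (simp add: right_module_def dual_algebra_def)
 let ?g = "\<lambda>m. \<lambda>u\<in>carrier H. \<Oplus>\<^bsub>K\<^esub>i\<in>{..<m}. f (h i) *[K] h' i u"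
 have fh: "f (h i) \<in>[K]" if "i < n" for i using fr(1)[OF h[OF that]] .
 have step: "m \<le> n ==> ?g m \<in> dual_space K H \<and> r b (?g m) = (\<Oplus>\<^bsub>A\<^esub>i\<in>{..<m}. f (h i) \<odot>[A] r b (h' i))" for m
 proof (induction m)
  case 0
  have z: "(\<lambda>u\<in>carrier H. \<zero>[K]) \<in> dual_space K H" by (rule lin_restrictI[OF MH.module_axioms]) simp_all
  have "(\<lambda>u\<in>carrier H. \<zero>[K] *[K] (\<lambda>u\<in>carrier H. \<zero>[K]) u) = (\<lambda>u\<in>carrier H. \<zero>[K])" by (auto intro!: restrict_ext)
  then have "r b (\<lambda>u\<in>carrier H. \<zero>[K]) = \<zero>[A]" using rs[OF z K.zero_closed] rc[OF z] by simp
  then show ?case using z by simp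
 next
  case (Suc m)
  then have m: "m < n" and IH: "?g m \<in> dual_space K H" "r b (?g m) = (\<Oplus>\<^bsub>A\<^esub>i\<in>{..<m}. f (h i) \<odot>[A] r b (h' i))" by auto
  let ?t = "\<lambda>u\<in>carrier H. f (h m) *[K] h' m u"
  note dm = dual_space_rules[OF h'[OF m]] and dg = dual_space_rules[OF IH(1)]
  have t: "?t \<in> dual_space K H"
   by (rule lin_restrictI[OF MH.module_axioms]) (simp_all add: dm fh[OF m] K.r_distr K.m_lcomm)
  have s: "(\<lambda>u\<in>carrier H. ?t u +[K] ?g m u) \<in> dual_space K H"
   by (rule lin_restrictI[OF MH.module_axioms]) (simp_all add: dual_space_rules[OF t] dg K.a_ac K.r_distr del: restrict_apply')
  have "?g (Suc m) = (\<lambda>u\<in>carrier H. ?t u +[K] ?g m u)"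
  proof (rule restrict_ext)
   fix u assume u: "u \<in>[H]"
   have c: "f (h i) *[K] h' i u \<in>[K]" if "i < n" for i using fh[OF that] dual_space_rules(1)[OF h'[OF that] u] by simp
   show "(\<Oplus>\<^bsub>K\<^esub>i\<in>{..<Suc m}. f (h i) *[K] h' i u) = ?t u +[K] ?g m u"
    unfolding lessThan_Suc using u c m by (subst K.finsum_insert) (simp_all add: Pi_iff)
  qed
  then have "?g (Suc m) \<in> dual_space K H" "r b (?g (Suc m)) = (f (h m) \<odot>[A] r b (h' m)) +[A] r b (?g m)"
   using s ra[OF t IH(1)] rs[OF h'[OF m] fh[OF m]] by (simp_all only:)
  moreover have "(\<Oplus>\<^bsub>A\<^esub>i\<in>{..<Suc m}. f (h i) \<odot>[A] r b (h' i)) = (f (h m) \<odot>[A] r b (h' m)) +[A] (\<Oplus>\<^bsub>A\<^esub>i\<in>{..<m}. f (h i) \<odot>[A] r b (h' i))"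
   unfolding lessThan_Suc using m fh rc h' by (subst A.finsum_insert) (simp_all add: Pi_iff)
  ultimately show ?case using IH(2) by (simp only: simp_thms)
 qed
 have "?g n = f"
 proof (rule lin_ext[OF conjunct1[OF step[OF le_refl]] f])
  fix u assume u: "u \<in>[H]"
  have hu: "h' i u \<in>[K]" if "i < n" for i using dual_space_rules(1)[OF h'[OF that] u] .
  have "f u = f (\<Oplus>\<^bsub>H\<^esub>i\<in>{..<n}. h' i u \<odot>[H] h i)"
   using dual_bases_expand[OF K.field_axioms MH.module_axioms d u] by simp
  also have "... = (\<Oplus>\<^bsub>self_algebra K\<^esub>i\<in>{..<n}. f (h' i u \<odot>[H] h i))"
   by (rule lin_finsum[OF MH.module_axioms mS f]) (simp_all add: Pi_iff h hu)
  also have "... = (\<Oplus>\<^bsub>K\<^esub>i\<in>{..<n}. f (h' i u \<odot>[H] h i))" by (simp add: finsum_self)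
  also have "... = (\<Oplus>\<^bsub>K\<^esub>i\<in>{..<n}. f (h i) *[K] h' i u)"
   by (rule K.finsum_cong') (simp_all add: Pi_iff h hu fr K.m_comm)
  finally show "?g n u = f u" using u by simp
 qed
 then show ?thesis using step[OF le_refl] by simp
qed

context red_env_setup
begin

lemma galois_bij_iff:
 "bij_betw (galois_map K U0 Ux ad) (carrier (tensor K Ux U0)) (carrier (end_algebra K Ux)) \<longleftrightarrow>
  bij_betw (two_sided_mult K Ux) (carrier (tensor K Ux (op_algebra Ux))) (carrier (end_algebra K Ux))"
proof -
 interpret K: field K by (rule algD[OF assoc_U0])
 interpret H: ring U0 by (rule algD[OF assoc_U0])
 interpret A: ring Ux by (rule algD[OF assoc_Uxi])
 let ?O = "op_algebra U0" and ?N = "tensor K Ux (op_algebra U0)" and ?t = "tens K Ux (op_algebra U0)"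
 note O = assoc_op[OF assoc_U0]
 note N = assoc_tensor[OF assoc_Uxi O]
 note rep = lie_rep_incl[OF L \<xi>]
 have r: "lie_rep K p L (\<lambda>x. \<xi> x ^[K] p) ?N (\<lambda>x. ?t (ix x) \<one>[U0] -[?N] ?t \<one>[Ux] (i0 x))"
 proof (rule lie_rep_cong[OF L lie_rep_tensor[OF L assoc_Uxi O rep lie_rep_op[OF L assoc_U0 restr_rep_incl[OF L]]]])
  fix x assume x: "x \<in>[L]"
  show "\<xi> x ^[K] p +[K] -[K] \<zero>[K] = \<xi> x ^[K] p" using funcset_mem[OF \<xi> x] by simp
  show "?t (ix x) \<one>[?O] +[?N] ?t \<one>[Ux] (-[U0] i0 x) = ?t (ix x) \<one>[U0] -[?N] ?t \<one>[Ux] (i0 x)"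
   using tens_minus_right[OF assoc_Uxi O, of "\<one>[Ux]" "i0 x"] x by (simp add: a_minus_def op_minus)
 qed
 note l = red_env_lift_rep[OF L \<xi> N r]
 show ?thesis
 proof (rule twisted_mult_bij[OF L assoc_Uxi rep _ l(1) l(2) ad_hom ad_incl])
  fix Q assume Q: "submodule Q K Ux" "\<one>[Ux] \<in> Q" "!!x u. [|x \<in>[L]; u \<in> Q|] ==> ix x *[Ux] u \<in> Q"
  show "carrier Ux <= Q"
  proof
   fix u assume "u \<in>[Ux]"
   then show "u \<in> Q"
    by (induction rule: Uxi_induct) (simp_all add: Q(2,3) submoduleD[OF Q(1)])
  qed
 qed
qed

text \<open>The same comparison for the opposite algebra, on which \<open>x\<close> acts as minus right multiplication
  by \<open>\<iota> x\<close>; the Galois map becomes \<open>d \<otimes> h \<mapsto> (a \<mapsto> (h \<cdot> a) d)\<close>.\<close>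

lemma op_galois_bij_iff:
 "bij_betw (galois_map K U0 (op_algebra Ux) ad) (carrier (tensor K (op_algebra Ux) U0)) (carrier (end_algebra K (op_algebra Ux))) \<longleftrightarrow>
  bij_betw (two_sided_mult K (op_algebra Ux)) (carrier (tensor K (op_algebra Ux) (op_algebra (op_algebra Ux)))) (carrier (end_algebra K (op_algebra Ux)))"
proof -
 interpret K: field K by (rule algD[OF assoc_U0])
 interpret H: ring U0 by (rule algD[OF assoc_U0])
 interpret A: ring Ux by (rule algD[OF assoc_Uxi])
 let ?G = "op_algebra Ux" and ?O = "op_algebra U0"
 let ?N = "tensor K ?G ?O" and ?t = "tens K ?G ?O"
 note O = assoc_op[OF assoc_U0] and G = assoc_op[OF assoc_Uxi]
 note N = assoc_tensor[OF G O]
 interpret N: ring ?N by (rule algD[OF N])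
 note rep = lie_rep_op[OF L assoc_Uxi lie_rep_incl[OF L \<xi>]]
 note cl = tens_closed[OF G O, simplified]
 have r: "lie_rep K p L (\<lambda>x. \<xi> x ^[K] p) (op_algebra ?N) (\<lambda>x. ?t (ix x) \<one>[U0] +[?N] ?t \<one>[Ux] (i0 x))"
 proof (rule lie_rep_cong[OF L lie_rep_op[OF L N lie_rep_tensor[OF L G O rep lie_rep_op[OF L assoc_U0 restr_rep_incl[OF L]]]]])
  fix x assume x: "x \<in>[L]"
  show "-[K] (-[K] (\<xi> x ^[K] p) +[K] -[K] \<zero>[K]) = \<xi> x ^[K] p" using funcset_mem[OF \<xi> x] by simp
  show "-[?N] (?t (-[Ux] ix x) \<one>[?O] +[?N] ?t \<one>[?G] (-[U0] i0 x)) = ?t (ix x) \<one>[U0] +[?N] ?t \<one>[Ux] (i0 x)"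
   using tens_minus_right[OF G O, of "\<one>[Ux]" "i0 x"] tens_minus_left[OF G O, of "ix x" "\<one>[U0]"] x
   by (simp add: op_minus N.minus_add cl)
 qed
 note l = red_env_lift_rep[OF L \<xi> assoc_op[OF N] r]
 let ?\<nu> = "red_env_lift K p L \<xi> (op_algebra ?N) (\<lambda>x. ?t (ix x) \<one>[U0] +[?N] ?t \<one>[Ux] (i0 x))"
 have \<nu>: "?\<nu> \<in> alg_homs K ?G ?N"
  using l(1) by (simp add: alg_homs_def lin_maps_def ring_hom_def)
 have \<nu>_gen: "?\<nu> (-[Ux] ix x) = ?t (-[Ux] ix x) \<one>[U0] -[?N] ?t \<one>[?G] (i0 x)" if x: "x \<in>[L]" for x
  using lin_neg[OF module_Uxi algD(2)[OF assoc_op[OF N]] hom_lin[OF l(1)] inclxi_closed[OF x]] x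
   tens_minus_left[OF G O, of "ix x" "\<one>[U0]"]
  by (simp add: op_minus l(2) a_minus_def N.minus_add cl)
 have ad': "ad \<in> alg_homs K U0 (end_algebra K ?G)"
 proof -
  have "end_algebra K ?G = end_algebra K Ux" by (simp add: end_algebra_def lin_maps_def)
  then show ?thesis using ad_hom by simp
 qed
 show ?thesis
 proof (rule twisted_mult_bij[OF L G rep _ \<nu> \<nu>_gen ad'])
  fix Q assume Q: "submodule Q K ?G" "\<one>[?G] \<in> Q" "!!x u. [|x \<in>[L]; u \<in> Q|] ==> -[Ux] ix x *[?G] u \<in> Q"
  have sub: "Q <= carrier Ux" using submoduleD(3)[OF Q(1)] by simp
  have right: "u *[Ux] ix x \<in> Q" if "x \<in>[L]" "u \<in> Q" for u x
  proof -
   have "-[K] \<one>[K] \<odot>[?G] (-[Ux] ix x *[?G] u) \<in> Q"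
    using Q(3)[OF that] submoduleD(4)[OF Q(1)] by simp
   moreover interpret MA: module K Ux by (rule module_Uxi)
   have "-[K] \<one>[K] \<odot>[?G] (-[Ux] ix x *[?G] u) = u *[Ux] ix x"
    using that subsetD[OF sub that(2)] by (simp add: A.r_minus MA.smult_l_minus MA.smult_r_minus)
   ultimately show ?thesis by simp
  qed
  have "\<forall>v\<in>Q. v *[Ux] u \<in> Q" if "u \<in>[Ux]" for u
   using that
  proof (induction rule: Uxi_induct)
   case one
   then show ?case using sub by auto
  next
   case (gen x u)
   show ?case
   proof
    fix v assume v: "v \<in> Q"
    show "v *[Ux] (ix x *[Ux] u) \<in> Q"
     using bspec[OF gen(3) right[OF gen(1) v]] gen(1,2) subsetD[OF sub v] by (simp add: A.m_assoc)
   qed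
  next
   case (add u w)
   then show ?case using sub submoduleD(2)[OF Q(1)] by (simp add: A.r_distr subset_iff)
  next
   case (smult c u)
   then show ?case using sub submoduleD(4)[OF Q(1)] by (simp add: alg_smult[OF assoc_Uxi] subset_iff)
  qed
  from bspec[OF this Q(2)[simplified]] show "carrier ?G <= Q" by auto
 next
  fix x u assume "x \<in>[L]" "u \<in>[?G]"
  then show "ad (i0 x) u = -[Ux] ix x *[?G] u -[?G] u *[?G] -[Ux] ix x"
   by (simp add: ad_incl a_minus_def op_minus A.l_minus A.r_minus A.a_comm)
 qed
qed

text \<open>The element \<open>\<Sum> b h\<^sub>i\<^sup>* \<otimes> h\<^sub>i\<close> determines the action on \<open>b\<close> and is determined by its image \<open>a \<mapsto> b a\<close> under the
  Galois map of the opposite algebra.\<close>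

lemma dual_action_unique:
 assumes bij: "bij_betw (galois_map K U0 (op_algebra Ux) ad) (carrier (tensor K (op_algebra Ux) U0)) (carrier (end_algebra K (op_algebra Ux)))"
  and fin: "finite_dim K U0" and r: "mu_compatible K U0 \<Delta>\<^sub>0 \<epsilon>\<^sub>0 Ux ad r"
  and b: "b \<in>[Ux]" and f: "f \<in> dual_space K U0"
 shows "r b f = dual_action b f"
proof -
 interpret K: field K by (rule algD[OF assoc_U0])
 interpret H: ring U0 by (rule algD[OF assoc_U0])
 interpret A: ring Ux by (rule algD[OF assoc_Uxi])
 interpret MA: module K Ux by (rule module_Uxi)
 let ?G = "op_algebra Ux"
 let ?T = "tensor K ?G U0" and ?t = "tens K ?G U0"
 note G = assoc_op[OF assoc_Uxi]
 note mG = algD(2)[OF G]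
 note T = assoc_tensor[OF G assoc_U0]
 note mT = algD(2)[OF T]
 interpret T: ring ?T by (rule algD[OF T])
 note cl = tens_closed[OF G assoc_U0, simplified]
 obtain n h where bas: "basis K U0 n h" using fin by (auto simp: finite_dim_def)
 obtain h' where d: "dual_bases K U0 n h h'" using dual_bases_exist[OF K.field_axioms module_U0 bas] by auto
 have h: "h i \<in>[U0]" and h': "h' i \<in> dual_space K U0" if "i < n" for i
  using d that by (auto simp: dual_bases_def basis_def)
 have gal: "bilinear_map K ?G U0 (end_algebra K ?G) (\<lambda>a h. \<lambda>u\<in>carrier ?G. a *[?G] ad h u)"
 proof (rule bilinear_mapI[OF mG module_U0])
  show "(\<lambda>u\<in>carrier ?G. a *[?G] ad h u) \<in>[end_algebra K ?G]" if "a \<in>[?G]" "h \<in>[U0]" for a h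
   unfolding carrier_end using that
   by (intro lin_restrictI[OF mG]) (simp_all add: ad_closed ad_rules A.l_distr alg_smult[OF assoc_Uxi])
 qed (auto simp: end_algebra_def ad_rules ad_closed A.l_distr A.r_distr alg_smult[OF assoc_Uxi] intro!: restrict_ext)
 have mE: "module K (end_algebra K ?G)" by (rule algD(2)[OF assoc_end[OF K.field_axioms mG]])
 note galois = tensor_lift[OF G assoc_U0 mE gal, folded galois_map_def, simplified]
 have "bilinear_map K ?G U0 Ux (\<lambda>y h. f h \<odot>[Ux] y)"
  by (rule bilinear_mapI[OF mG module_U0])
   (simp_all add: dual_rules[OF f] MA.smult_l_distr MA.smult_r_distr MA.smult_assoc1[symmetric] K.m_comm)
 note F = tensor_lift[OF G assoc_U0 module_Uxi this, simplified]
 have key: "\<exists>t\<in>carrier ?T. galois_map K U0 ?G ad t = (\<lambda>a\<in>carrier Ux. b *[Ux] a) \<and>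
   tensor_lift K ?G U0 Ux (\<lambda>y h. f h \<odot>[Ux] y) t = q b f"
  if q: "mu_compatible K U0 \<Delta>\<^sub>0 \<epsilon>\<^sub>0 Ux ad q" for q
 proof -
  have rm: "right_module K (dual_algebra K U0 \<Delta>\<^sub>0 \<epsilon>\<^sub>0) Ux q" using q unfolding mu_compatible_def by (rule conjunct1)
  have qc: "q b g \<in>[Ux]" if "g \<in> dual_space K U0" for g
   using rm b that by (simp add: right_module_def dual_algebra_def)
  note qh = qc[OF h']
  let ?s = "\<Oplus>\<^bsub>?T\<^esub>i\<in>{..<n}. ?t (q b (h' i)) (h i)"
  have sc: "?s \<in>[?T]" by (rule T.finsum_closed) (simp add: Pi_iff cl qh h)
  have "galois_map K U0 ?G ad ?s = (\<lambda>a\<in>carrier Ux. b *[Ux] a)"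
  proof (rule lin_ext)
   show "galois_map K U0 ?G ad ?s \<in> lin_maps K ?G ?G" using lin_closed[OF galois(1) sc] by simp
   show "(\<lambda>a\<in>carrier Ux. b *[Ux] a) \<in> lin_maps K ?G ?G"
    unfolding op_algebra_simps(1)[of Ux, symmetric]
    by (rule lin_restrictI[OF mG]) (simp_all add: b A.r_distr alg_smult[OF assoc_Uxi])
   fix a assume "a \<in>[?G]"
   then have a: "a \<in>[Ux]" by simp
   have gc: "galois_map K U0 ?G ad t \<in> lin_maps K ?G ?G" if "t \<in>[?T]" for t using lin_closed[OF galois(1) that] by simp
   have ev: "(\<lambda>t\<in>carrier ?T. galois_map K U0 ?G ad t a) \<in> lin_maps K ?T ?G"
    by (rule lin_restrictI[OF mT])
     (use lin_closed[OF gc] in \<open>simp_all add: a end_apply lin_add[OF galois(1)] lin_smult[OF galois(1)]\<close>)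
   have "galois_map K U0 ?G ad ?s a = (\<lambda>t\<in>carrier ?T. galois_map K U0 ?G ad t a) ?s" using sc by simp
   also have "... = (\<Oplus>\<^bsub>?G\<^esub>i\<in>{..<n}. (\<lambda>t\<in>carrier ?T. galois_map K U0 ?G ad t a) (?t (q b (h' i)) (h i)))"
    by (rule lin_finsum[OF mT mG ev]) (simp_all add: Pi_iff cl qh h)
   also have "... = (\<Oplus>\<^bsub>Ux\<^esub>i\<in>{..<n}. ad (h i) a *[Ux] q b (h' i))"
    unfolding finsum_op by (rule A.finsum_cong') (simp_all add: Pi_iff cl qh h galois(2) a ad_closed)
   also have "... = b *[Ux] a"
    using q d a b unfolding mu_compatible_def by (metis (no_types, lifting))
   finally show "galois_map K U0 ?G ad ?s a = (\<lambda>a\<in>carrier Ux. b *[Ux] a) a" using a by simp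
  qed
  moreover have "tensor_lift K ?G U0 Ux (\<lambda>y h. f h \<odot>[Ux] y) ?s = q b f"
  proof -
   have "tensor_lift K ?G U0 Ux (\<lambda>y h. f h \<odot>[Ux] y) ?s
     = (\<Oplus>\<^bsub>Ux\<^esub>i\<in>{..<n}. tensor_lift K ?G U0 Ux (\<lambda>y h. f h \<odot>[Ux] y) (?t (q b (h' i)) (h i)))"
    by (rule lin_finsum[OF mT module_Uxi F(1)]) (simp_all add: Pi_iff cl qh h)
   also have "... = (\<Oplus>\<^bsub>Ux\<^esub>i\<in>{..<n}. f (h i) \<odot>[Ux] q b (h' i))"
    by (rule A.finsum_cong') (simp_all add: Pi_iff qh h F(2) dual_rules[OF f])
   also have "... = q b f" by (rule right_module_expand[OF assoc_U0 assoc_Uxi rm d f b, symmetric])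
   finally show ?thesis .
  qed
  ultimately show ?thesis using sc by blast
 qed
 from key[OF r] obtain s where s: "s \<in>[?T]" "galois_map K U0 ?G ad s = (\<lambda>a\<in>carrier Ux. b *[Ux] a)"
  "tensor_lift K ?G U0 Ux (\<lambda>y h. f h \<odot>[Ux] y) s = r b f" by (elim bexE conjE)
 from key[OF dual_action_mu_compatible] obtain t where t: "t \<in>[?T]" "galois_map K U0 ?G ad t = (\<lambda>a\<in>carrier Ux. b *[Ux] a)"
  "tensor_lift K ?G U0 Ux (\<lambda>y h. f h \<odot>[Ux] y) t = dual_action b f" by (elim bexE conjE)
 have "s = t" using bij s(1,2) t(1,2) by (simp add: bij_betw_def inj_on_def)
 then show ?thesis using s(3) t(3) by simp
qed

end

section \<open>Finite dimension of reduced enveloping algebras\<close>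

text \<open>The pigeonhole principle.\<close>

lemma long_word_repeats:
 assumes "set w <= {..<n}" "n * (p - 1) < length w" "0 < p"
 shows "\<exists>i<n. \<exists>v. mset w = mset (replicate p i @ v)"
proof -
 have "\<exists>i\<in>{..<n}. p \<le> count_list w i"
 proof (rule ccontr)
  assume "\<not> (\<exists>i\<in>{..<n}. p \<le> count_list w i)"
  then have "!!i. i \<in> {..<n} ==> count_list w i \<le> p - 1" by (force simp: not_le)
  then have "sum (count_list w) {..<n} \<le> n * (p - 1)" using sum_bounded_above[of "{..<n}" "count_list w" "p - 1"] by simp
  then show False using sum_count_set[OF assms(1)] assms(2) by simp
 qed
 then obtain i where i: "i < n" "replicate_mset p i \<subseteq># mset w"
  by (auto simp: count_mset count_le_replicate_mset_subset_eq[symmetric])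
 obtain v where "mset v = mset w - replicate_mset p i" using ex_mset by blast
 then have "mset w = mset (replicate p i @ v)" using i(2) by simp
 then show ?thesis using i(1) by blast
qed

context red_env_setup
begin

text \<open>Let \<open>V m\<close> be spanned by the monomials of length at most \<open>m\<close>. Reordering a monomial of length \<open>m\<close> changes it by an
  element of \<open>V (m - 1)\<close>. A monomial of length greater than \<open>n (p - 1)\<close> can be reordered to begin with a \<open>p\<close>-th power,
  whose replacement makes it shorter. Hence the \<open>V m\<close> become stationary at \<open>m = n (p - 1)\<close>.\<close>

lemma finite_dim_Uxi:
 assumes "finite_dim K L"
 shows "finite_dim K Ux"
proof -
 interpret L: p_lie_algebra K L p by (rule L)
 interpret A: ring Ux by (rule algD[OF assoc_Uxi])
 interpret MA: module K Ux by (rule module_Uxi)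
 obtain n e where bas: "basis K L n e" using assms by (auto simp: finite_dim_def)
 obtain c where d: "dual_bases K L n e c" using dual_bases_exist[OF L.field_axioms L.module_axioms bas] by auto
 have e: "e i \<in>[L]" and c: "c i \<in> dual_space K L" if "i < n" for i
  using d that by (auto simp: dual_bases_def basis_def)
 note inc = lie_repD[OF lie_rep_incl[OF L \<xi>]]
 define word where "word w = foldr (\<lambda>i u. ix (e i) *[Ux] u) w \<one>[Ux]" for w
 have word_simps: "word [] = \<one>[Ux]" "word (i # w) = ix (e i) *[Ux] word w" for i w by (simp_all add: word_def)
 have wc: "set w <= {..<n} ==> word w \<in>[Ux]" for w
  by (induction w) (simp_all add: word_simps e)
 let ?S = "\<lambda>m. {word w |w. set w <= {..<n} \<and> length w \<le> m}"
 have S: "?S m <= carrier Ux" for m using wc by auto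
 define V where "V m = submodule_span K Ux (?S m)" for m
 note span = submodule_span[OF module_Uxi S]
 have Vsub: "submodule (V m) K Ux" for m unfolding V_def by (rule span(1))
 have gen: "word w \<in> V m" if "set w <= {..<n}" "length w \<le> m" for w m
  unfolding V_def using span(2)[of m] that by blast
 have least: "V m <= N" if "submodule N K Ux" "!!w. [|set w <= {..<n}; length w \<le> m|] ==> word w \<in> N" for m N
  unfolding V_def by (rule span(3)[OF that(1)]) (use that(2) in auto)
 have mono: "V m <= V m'" if "m \<le> m'" for m m'
  by (rule least[OF Vsub]) (use that in \<open>simp add: gen\<close>)
 have Vc: "u \<in>[Ux]" if "u \<in> V m" for u m using submoduleD(3)[OF Vsub] that by blast
 have lm: "left_mult Ux a \<in> lin_maps K Ux Ux" if "a \<in>[Ux]" for a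
  using mult_ops_lin(1)[OF assoc_Uxi that] .
 have step_gen: "ix (e i) *[Ux] u \<in> V (Suc m)" if i: "i < n" and u: "u \<in> V m" for i u m
 proof -
  have "V m <= {u \<in> carrier Ux. left_mult Ux (ix (e i)) u \<in> V (Suc m)}"
  proof (rule least[OF submodule_preimage[OF module_Uxi module_Uxi lm Vsub]])
   fix w assume w: "set w <= {..<n}" "length w \<le> m"
   then have "word (i # w) \<in> V (Suc m)" using i by (intro gen) simp_all
   then show "word w \<in> {u \<in> carrier Ux. left_mult Ux (ix (e i)) u \<in> V (Suc m)}"
    using wc[OF w(1)] by (simp add: left_mult_def word_simps)
  qed (use e[OF i] in simp)
  then show ?thesis using u Vc[OF u] by (auto simp: left_mult_def)
 qed
 have step: "ix y *[Ux] u \<in> V (Suc m)" if y: "y \<in>[L]" and u: "u \<in> V m" for y u m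
 proof -
  note uc = Vc[OF u]
  have l: "(\<lambda>y\<in>carrier L. ix y *[Ux] u) \<in> lin_maps K L Ux"
   by (rule lin_restrictI[OF L.module_axioms]) (simp_all add: uc inc(4,6) A.l_distr alg_smult[OF assoc_Uxi])
  have ck: "c i y \<in>[K]" if "i < n" for i using dual_space_rules(1)[OF c[OF that] y] .
  have "ix y *[Ux] u = (\<lambda>y\<in>carrier L. ix y *[Ux] u) (\<Oplus>\<^bsub>L\<^esub>i\<in>{..<n}. c i y \<odot>[L] e i)"
   using dual_bases_expand[OF L.field_axioms L.module_axioms d y] y by simp
  also have "... = (\<Oplus>\<^bsub>Ux\<^esub>i\<in>{..<n}. (\<lambda>y\<in>carrier L. ix y *[Ux] u) (c i y \<odot>[L] e i))"
   by (rule lin_finsum[OF L.module_axioms module_Uxi l]) (simp_all add: Pi_iff ck e)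
  also have "... \<in> V (Suc m)"
   by (rule submodule_finsum[OF module_Uxi Vsub])
    (simp_all add: Pi_iff ck e inc(6) uc alg_smult[OF assoc_Uxi] submoduleD(4)[OF Vsub] step_gen[OF _ u])
  finally show ?thesis .
 qed
 have trans: "a -[Ux] c \<in> V m" if "a -[Ux] b \<in> V m" "b -[Ux] c \<in> V m" "a \<in>[Ux]" "b \<in>[Ux]" "c \<in>[Ux]" for a b c m
 proof -
  have "a -[Ux] c = (a -[Ux] b) +[Ux] (b -[Ux] c)" using that(3-5) by algebra
  then show ?thesis using submoduleD(2)[OF Vsub that(1,2)] by simp
 qed
 have lmult: "ix (e i) *[Ux] a -[Ux] ix (e i) *[Ux] b \<in> V (Suc m)"
  if "i < n" "a -[Ux] b \<in> V m" "a \<in>[Ux]" "b \<in>[Ux]" for i a b m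
 proof -
  have "ix (e i) *[Ux] (a -[Ux] b) = ix (e i) *[Ux] a -[Ux] ix (e i) *[Ux] b"
   using that(1,3,4) e by (simp add: a_minus_def A.r_distr A.r_minus)
  then show ?thesis using step_gen[OF that(1,2)] by simp
 qed
 \<comment> \<open>Moving one letter to the front changes a monomial by shorter ones.\<close>
 have move: "word (u @ i # v) -[Ux] word (i # u @ v) \<in> V (length u + length v)"
  if "set u <= {..<n}" "i < n" "set v <= {..<n}" for u i v
  using that(1)
 proof (induction u)
  case Nil
  have "word (i # v) -[Ux] word (i # v) = \<zero>[Ux]" using wc[of "i # v"] that by (simp add: A.minus_zero_iff)
  then show ?case using submoduleD(1)[OF Vsub] by simp
 next
  case (Cons j u)
  have j: "j < n" and u: "set u <= {..<n}" using Cons.prems by auto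
  have c: "word (u @ i # v) \<in>[Ux]" "word (i # u @ v) \<in>[Ux]" "word (u @ v) \<in>[Ux]"
   using u that by (simp_all add: wc)
  have 1: "word (j # u @ i # v) -[Ux] word (j # i # u @ v) \<in> V (Suc (length u + length v))"
   unfolding word_simps(2)[of j] by (rule lmult[OF j Cons.IH[OF u] c(1,2)])
  have "word (j # i # u @ v) -[Ux] word (i # j # u @ v)
    = (ix (e j) *[Ux] ix (e i) -[Ux] ix (e i) *[Ux] ix (e j)) *[Ux] word (u @ v)"
   using c(3) e j that(2) by (simp add: word_simps a_minus_def A.l_distr A.l_minus A.m_assoc)
  also have "... = ix (lie_bracket L (e j) (e i)) *[Ux] word (u @ v)" using inc(5)[OF e[OF j] e[OF that(2)]] by simp
  also have "... \<in> V (Suc (length u + length v))"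
   by (rule step[OF L.bracket_closed[OF e[OF j] e[OF that(2)]] gen]) (use u that in simp_all)
  finally have 2: "word (j # i # u @ v) -[Ux] word (i # j # u @ v) \<in> V (Suc (length u + length v))" .
  have "word (j # u @ i # v) -[Ux] word (i # j # u @ v) \<in> V (Suc (length u + length v))"
   by (rule trans[OF 1 2]) (use u that j in \<open>simp_all add: wc\<close>)
  then show ?case by simp
 qed
 have perm: "word w -[Ux] word w' \<in> V (length w - 1)" if "mset w = mset w'" "set w <= {..<n}" for w w'
  using that
 proof (induction w arbitrary: w')
  case Nil
  have "word [] -[Ux] word [] = \<zero>[Ux]" using wc[of "[]"] by (simp add: A.minus_zero_iff)
  then show ?case using Nil submoduleD(1)[OF Vsub] by simp
 next
  case (Cons i w)
  have i: "i < n" and w: "set w <= {..<n}" using Cons.prems(2) by auto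
  have sw': "set w' = insert i (set w)" using mset_eq_setD[OF Cons.prems(1)] by simp
  then have "i \<in> set w'" by simp
  from split_list[OF this] obtain u v where w': "w' = u @ i # v" by (elim exE)
  have uv: "set u <= {..<n}" "set v <= {..<n}" using sw' i w w' by auto
  have m: "mset w = mset (u @ v)" using Cons.prems(1) w' by simp
  then have len: "length w = length u + length v" using mset_eq_length by fastforce
  have 1: "word (i # w) -[Ux] word (i # u @ v) \<in> V (length w)"
  proof (cases w)
   case Nil
   then have "u @ v = []" using m by simp
   then have "word (i # w) -[Ux] word (i # u @ v) = \<zero>[Ux]" using wc[of "[i]"] i Nil by (simp add: A.minus_zero_iff)
   then show ?thesis using submoduleD(1)[OF Vsub] by simp
  next
   case (Cons k t)
   then have "word (i # w) -[Ux] word (i # u @ v) \<in> V (Suc (length w - 1))"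
    unfolding word_simps(2)[of i] using lmult[OF i Cons.IH[OF m w]] w uv by (simp add: wc)
   then show ?thesis using Cons by simp
  qed
  have "word (u @ i # v) -[Ux] word (i # u @ v) \<in> V (length w)" using move[OF uv(1) i uv(2)] len by simp
  from submoduleD(4)[OF Vsub _ this, of "-[K] \<one>[K]"]
  have 2: "word (i # u @ v) -[Ux] word (u @ i # v) \<in> V (length w)"
   using i uv by (simp add: wc MA.smult_l_minus A.minus_add a_minus_def A.a_comm)
  have "word (i # w) -[Ux] word (u @ i # v) \<in> V (length w)"
   by (rule trans[OF 1 2]) (use i w uv in \<open>simp_all add: wc\<close>)
  then show ?case using w' by simp
 qed
 have pow: "word (replicate q i @ v) = ix (e i) ^[Ux] q *[Ux] word v" if "i < n" "set v <= {..<n}" for q i v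
 proof (induction q)
  case (Suc q)
  have "ix (e i) ^[Ux] Suc q = ix (e i) *[Ux] ix (e i) ^[Ux] q"
   by (rule A.nat_pow_Suc2) (simp add: e that)
  then show ?case using Suc that wc[OF that(2)] by (simp add: word_simps A.m_assoc e del: A.nat_pow_Suc)
 qed (use that in \<open>simp add: wc\<close>)
 have p1: "1 < p" by (rule char_gt_1[OF L.field_axioms L.p_pos L.char_p])
 have reduce: "word (replicate p i @ v) \<in> V (p + length v - 1)" if "i < n" "set v <= {..<n}" for i v
 proof -
  have s: "\<xi> (e i) ^[K] p \<in>[K]" using funcset_mem[OF \<xi> e[OF that(1)]] by simp
  have "word (replicate p i @ v) = ix (p_power L (e i)) *[Ux] word v +[Ux] ((\<xi> (e i) ^[K] p) \<odot>[Ux] word v)"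
   unfolding pow[OF that] inc(3)[OF e[OF that(1)]]
   using wc[OF that(2)] s L.p_power_closed[OF e[OF that(1)]] by (simp add: A.l_distr alg_smult[OF assoc_Uxi])
  also have "... \<in> V (Suc (length v))"
   using step[OF L.p_power_closed[OF e[OF that(1)]] gen[OF that(2) order_refl]] gen[OF that(2), of "Suc (length v)"] s
   by (simp add: submoduleD(2,4)[OF Vsub])
  finally have "word (replicate p i @ v) \<in> V (Suc (length v))" .
  moreover have "Suc (length v) \<le> p + length v - 1" using p1 by linarith
  ultimately show ?thesis using mono by blast
 qed
 have drop: "word w \<in> V (length w - 1)" if w: "set w <= {..<n}" "n * (p - 1) < length w" for w
 proof -
  have "\<exists>i<n. \<exists>v. mset w = mset (replicate p i @ v)" by (rule long_word_repeats[OF w L.p_pos])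
  then obtain i v where iv: "i < n" "mset w = mset (replicate p i @ v)" by blast
  have len: "length w = p + length v" using mset_eq_length[OF iv(2)] by simp
  have v: "set v <= {..<n}" using mset_eq_setD[OF iv(2)] w(1) by auto
  note a = perm[OF iv(2) w(1)] and b = reduce[OF iv(1) v, folded len]
  have "(word w -[Ux] word (replicate p i @ v)) +[Ux] word (replicate p i @ v) = word w"
   using wc[OF w(1)] Vc[OF b] by (simp add: a_minus_def A.a_assoc A.l_neg)
  then show ?thesis using submoduleD(2)[OF Vsub a b] by simp
 qed
 let ?M = "n * (p - 1)"
 have collapse: "V (Suc ?M) <= V ?M"
 proof (rule least[OF Vsub])
  fix w assume w: "set w <= {..<n}" "length w \<le> Suc ?M"
  show "word w \<in> V ?M"
  proof (cases "length w = Suc ?M")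
   case True
   then show ?thesis using drop[OF w(1)] by simp
  qed (use w in \<open>simp add: gen\<close>)
 qed
 have all: "u \<in> V ?M" if "u \<in>[Ux]" for u
  using that
 proof (induction rule: Uxi_induct)
  case one
  show ?case using gen[of "[]" ?M] by (simp add: word_simps)
 next
  case (gen x u)
  then show ?case using step[OF gen(1,3)] collapse by auto
 qed (simp_all add: submoduleD(2,4)[OF Vsub])
 show ?thesis
 proof (rule finite_dimI[OF L.field_axioms module_Uxi])
  have "?S ?M = word ` {w. set w <= {..<n} \<and> length w \<le> ?M}" by auto
  moreover have "finite {w. set w <= {..<n} \<and> length w \<le> ?M}" by (rule finite_lists_length_le) simp
  ultimately show "finite (?S ?M)" by simp
  show "spanning K Ux (?S ?M)"
   unfolding spanning_def
  proof (intro conjI allI impI)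
   show "?S ?M <= carrier Ux" by (rule S)
   fix N assume "submodule N K Ux" "?S ?M <= N"
   then have "V ?M <= N" unfolding V_def by (rule span(3))
   then show "carrier Ux <= N" using all by auto
  qed
 qed
qed

end

section \<open>Straightening of words\<close>

text \<open>Words stand for monomials in a basis of \<open>L\<close>; the letters beyond the dimension stand for \<open>0\<close>. A linear form on
  the tensor algebra is given by its values on words.\<close>

locale letters =
 fixes K :: "('k, 'm) ring_scheme" and L :: "('k, 'g, 'n) p_lie_scheme" and p :: nat
  and n :: nat and e :: "nat => 'g" and c :: "nat => 'g => 'k" and s :: "nat => 'k"
 assumes L: "p_lie_algebra K L p"
  and e_closed: "e i \<in>[L]" and e_zero: "n \<le> i ==> e i = \<zero>[L]"
  and c_dual: "i < n ==> c i \<in> dual_space K L"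
  and c_e: "[|i < n; j < n|] ==> c i (e j) = (if i = j then \<one>[K] else \<zero>[K])"
  and c_expand: "y \<in>[L] ==> y = (\<Oplus>\<^bsub>L\<^esub>i\<in>{..<n}. c i y \<odot>[L] e i)"
  and s_closed: "s i \<in>[K]" and s_zero: "n \<le> i ==> s i = \<zero>[K]"
begin

sublocale K: field K using L by (simp add: p_lie_algebra_def lie_algebra_def)
sublocale L: p_lie_algebra K L p by (rule L)

lemmas mL = L.module_axioms

definition lin_form :: "('g => 'k) => bool" where
 "lin_form f \<longleftrightarrow> (\<lambda>y\<in>carrier L. f y) \<in> dual_space K L"

lemma lin_formI:
 assumes "!!y. y \<in>[L] ==> f y \<in>[K]"
  and "!!y z. [|y \<in>[L]; z \<in>[L]|] ==> f (y +[L] z) = f y +[K] f z"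
  and "!!a y. [|a \<in>[K]; y \<in>[L]|] ==> f (a \<odot>[L] y) = a *[K] f y"
 shows "lin_form f"
 unfolding lin_form_def by (rule lin_restrictI[OF mL]) (simp_all add: assms)

lemma lin_formD:
 assumes "lin_form f" "y \<in>[L]"
 shows "f y \<in>[K]" "z \<in>[L] ==> f (y +[L] z) = f y +[K] f z"
  "a \<in>[K] ==> f (a \<odot>[L] y) = a *[K] f y"
proof -
 note d = dual_space_rules[OF assms(1)[unfolded lin_form_def] assms(2)]
 show "f y \<in>[K]" using d(1) assms(2) by simp
 show "z \<in>[L] ==> f (y +[L] z) = f y +[K] f z" using d(2) assms(2) by simp
 show "a \<in>[K] ==> f (a \<odot>[L] y) = a *[K] f y" using d(3) assms(2) by simp
qed

lemma lin_form_expand: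
 assumes f: "lin_form f" and y: "y \<in>[L]"
 shows "f y = (\<Oplus>\<^bsub>K\<^esub>i\<in>{..<n}. c i y *[K] f (e i))"
proof -
 let ?f = "\<lambda>y\<in>carrier L. f y"
 have ck: "c i y \<in>[K]" if "i < n" for i using dual_space_rules(1)[OF c_dual[OF that] y] .
 have "?f y = ?f (\<Oplus>\<^bsub>L\<^esub>i\<in>{..<n}. c i y \<odot>[L] e i)" using c_expand[OF y] by simp
 also have "... = (\<Oplus>\<^bsub>self_algebra K\<^esub>i\<in>{..<n}. ?f (c i y \<odot>[L] e i))"
  by (rule lin_finsum[OF mL module_self[OF K.field_axioms] f[unfolded lin_form_def]]) (simp_all add: Pi_iff ck e_closed)
 also have "... = (\<Oplus>\<^bsub>K\<^esub>i\<in>{..<n}. ?f (c i y \<odot>[L] e i))" by (simp add: finsum_self)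
 also have "... = (\<Oplus>\<^bsub>K\<^esub>i\<in>{..<n}. c i y *[K] f (e i))"
  by (rule K.finsum_cong') (simp_all add: Pi_iff ck e_closed lin_formD[OF f])
 finally show ?thesis using y by simp
qed

lemma lin_form_eqI:
 assumes "lin_form f" "lin_form g" "!!i. f (e i) = g (e i)" "y \<in>[L]"
 shows "f y = g y"
 using lin_form_expand[OF assms(1,4)] lin_form_expand[OF assms(2,4)] assms(3) by simp

lemma lin_form_diff: "[|lin_form f; lin_form g|] ==> lin_form (\<lambda>y. f y -[K] g y)"
 by (rule lin_formI) (simp_all add: lin_formD K.r_distr a_minus_def K.minus_add K.a_ac K.r_minus)

lemma lin_form_add: "[|lin_form f; lin_form g|] ==> lin_form (\<lambda>y. f y +[K] g y)"
 by (rule lin_formI) (simp_all add: lin_formD K.r_distr K.a_ac)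

lemma lin_form_scale: "[|lin_form f; a \<in>[K]|] ==> lin_form (\<lambda>y. a *[K] f y)"
 by (rule lin_formI) (simp_all add: lin_formD K.r_distr K.m_lcomm)

lemma lin_form_bracket: "[|lin_form f; x \<in>[L]|] ==> lin_form (\<lambda>y. f (lie_bracket L x y))"
 by (rule lin_formI) (simp_all add: lin_formD L.bracket_closed L.bracket_add_right L.bracket_smult_right)

text \<open>The value of the form at the word \<open>u y v\<close>, where the letter \<open>y\<close> is expanded in the basis; \<open>T2\<close> is the
  analogue for the word \<open>u y w z v\<close>.\<close>

definition T :: "(nat list => 'k) => nat list => 'g => nat list => 'k" where
 "T \<tau> u y v = (\<Oplus>\<^bsub>K\<^esub>k\<in>{..<n}. c k y *[K] \<tau> (u @ k # v))"

definition T2 :: "(nat list => 'k) => nat list => 'g => nat list => 'g => nat list => 'k" where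
 "T2 \<tau> u y w z v = (\<Oplus>\<^bsub>K\<^esub>k\<in>{..<n}. c k y *[K] T \<tau> (u @ k # w) z v)"

text \<open>A form vanishes at words with a letter that stands for \<open>0\<close>. Therefore the relations below hold trivially at
  such words, and they need no condition on the letters.\<close>

definition word_form :: "(nat list => 'k) => bool" where
 "word_form \<tau> \<longleftrightarrow> (\<forall>w. \<tau> w \<in>[K]) \<and> (\<forall>w. \<not> set w <= {..<n} --> \<tau> w = \<zero>[K])"

text \<open>The number \<open>m\<close> is the length of the words whose values are compared; the other words involved are shorter.\<close>

definition comm_rel :: "(nat list => 'k) => nat => bool" where
 "comm_rel \<tau> m \<longleftrightarrow> (\<forall>u v i j. length u + length v + 2 = m -->
   \<tau> (u @ i # j # v) -[K] \<tau> (u @ j # i # v) = T \<tau> u (lie_bracket L (e i) (e j)) v)"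

definition pow_rel :: "(nat list => 'k) => nat => bool" where
 "pow_rel \<tau> m \<longleftrightarrow> (\<forall>u v i. length u + p + length v = m -->
   \<tau> (u @ replicate p i @ v) = T \<tau> u (p_power L (e i)) v +[K] s i *[K] \<tau> (u @ v))"

lemma T_cong: "(!!k. \<tau> (u @ k # v) = \<tau>' (u @ k # v)) ==> T \<tau> u y v = T \<tau>' u y v"
 by (simp add: T_def)

lemma c_rules:
 assumes "k < n" "y \<in>[L]"
 shows "c k y \<in>[K]" "z \<in>[L] ==> c k (y +[L] z) = c k y +[K] c k z" "a \<in>[K] ==> c k (a \<odot>[L] y) = a *[K] c k y"
 using dual_space_rules[OF c_dual[OF assms(1)] assms(2)] by simp_all

lemma lin_form_sum:
 assumes "!!k. t k \<in>[K]"
 shows "lin_form (\<lambda>y. \<Oplus>\<^bsub>K\<^esub>k\<in>{..<n}. c k y *[K] t k)"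
proof (rule lin_formI)
 show "(\<Oplus>\<^bsub>K\<^esub>k\<in>{..<n}. c k y *[K] t k) \<in>[K]" if "y \<in>[L]" for y
  by (rule K.finsum_closed) (simp add: Pi_iff c_rules that assms)
 show "(\<Oplus>\<^bsub>K\<^esub>k\<in>{..<n}. c k (y +[L] z) *[K] t k) = (\<Oplus>\<^bsub>K\<^esub>k\<in>{..<n}. c k y *[K] t k) +[K] (\<Oplus>\<^bsub>K\<^esub>k\<in>{..<n}. c k z *[K] t k)"
  if yz: "y \<in>[L]" "z \<in>[L]" for y z
 proof -
  have "(\<Oplus>\<^bsub>K\<^esub>k\<in>{..<n}. c k (y +[L] z) *[K] t k) = (\<Oplus>\<^bsub>K\<^esub>k\<in>{..<n}. c k y *[K] t k +[K] c k z *[K] t k)"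
   by (rule K.finsum_cong') (simp_all add: Pi_iff c_rules yz assms K.l_distr)
  also have "... = (\<Oplus>\<^bsub>K\<^esub>k\<in>{..<n}. c k y *[K] t k) +[K] (\<Oplus>\<^bsub>K\<^esub>k\<in>{..<n}. c k z *[K] t k)"
   by (rule K.finsum_addf) (simp_all add: Pi_iff c_rules yz assms)
  finally show ?thesis .
 qed
 show "(\<Oplus>\<^bsub>K\<^esub>k\<in>{..<n}. c k (a \<odot>[L] y) *[K] t k) = a *[K] (\<Oplus>\<^bsub>K\<^esub>k\<in>{..<n}. c k y *[K] t k)"
  if ay: "a \<in>[K]" "y \<in>[L]" for a y
 proof -
  have "(\<Oplus>\<^bsub>K\<^esub>k\<in>{..<n}. c k (a \<odot>[L] y) *[K] t k) = (\<Oplus>\<^bsub>K\<^esub>k\<in>{..<n}. a *[K] (c k y *[K] t k))"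
   by (rule K.finsum_cong') (simp_all add: Pi_iff c_rules ay assms K.m_assoc)
  also have "... = a *[K] (\<Oplus>\<^bsub>K\<^esub>k\<in>{..<n}. c k y *[K] t k)"
   by (rule K.finsum_rdistr[symmetric]) (simp_all add: Pi_iff c_rules ay assms)
  finally show ?thesis .
 qed
qed

lemma sum_e:
 assumes "!!k. t k \<in>[K]" "!!k. n \<le> k ==> t k = \<zero>[K]"
 shows "(\<Oplus>\<^bsub>K\<^esub>k\<in>{..<n}. c k (e i) *[K] t k) = t i"
proof (cases "i < n")
 case True
 have "(\<Oplus>\<^bsub>K\<^esub>k\<in>{..<n}. c k (e i) *[K] t k) = (\<Oplus>\<^bsub>K\<^esub>k\<in>{..<n}. if i = k then t k else \<zero>[K])"
  by (rule K.finsum_cong') (simp_all add: Pi_iff c_e True assms)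
 also have "... = t i" using True assms by (intro K.finsum_singleton) (simp_all add: Pi_iff)
 finally show ?thesis .
next
 case False
 have "lin_form (\<lambda>y. \<Oplus>\<^bsub>K\<^esub>k\<in>{..<n}. c k y *[K] t k)" by (rule lin_form_sum) (rule assms(1))
 from lin_formD(3)[OF this e_closed K.zero_closed] lin_formD(1)[OF this e_closed]
 show ?thesis using False assms(2)[of i] e_zero[of i] by (simp add: e_closed)
qed

context
 fixes \<tau> assumes \<tau>: "word_form \<tau>"
begin

lemma word_formD: "\<tau> w \<in>[K]" "\<not> set w <= {..<n} ==> \<tau> w = \<zero>[K]"
 using \<tau> by (auto simp: word_form_def)

lemma T_lin: "lin_form (\<lambda>y. T \<tau> u y v)"
 unfolding T_def by (rule lin_form_sum) (rule word_formD)

lemma T_e: "T \<tau> u (e i) v = \<tau> (u @ i # v)"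
 unfolding T_def by (rule sum_e[of "\<lambda>k. \<tau> (u @ k # v)"]) (simp_all add: word_formD)

lemma T_bad: "\<not> set (u @ v) <= {..<n} ==> T \<tau> u y v = \<zero>[K]" if "y \<in>[L]"
 unfolding T_def
 by (rule K.add.finprod_one_eqI) (use that in \<open>auto simp: word_formD(2) c_rules\<close>)

lemmas T_rules = lin_formD[OF T_lin]

lemma T2_lin_left: "z \<in>[L] ==> lin_form (\<lambda>y. T2 \<tau> u y w z v)"
 unfolding T2_def by (rule lin_form_sum) (rule T_rules(1))

lemma T2_e_left: "z \<in>[L] ==> T2 \<tau> u (e i) w z v = T \<tau> (u @ i # w) z v"
 unfolding T2_def by (rule sum_e[of "\<lambda>k. T \<tau> (u @ k # w) z v"]) (simp_all add: T_rules(1) T_bad)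

lemma T2_e_right: "y \<in>[L] ==> T2 \<tau> u y w (e i) v = T \<tau> u y (w @ i # v)"
 unfolding T2_def T_e by (simp add: T_def)

lemma T2_lin_right: "y \<in>[L] ==> lin_form (\<lambda>z. T2 \<tau> u y w z v)"
proof (rule lin_formI)
 assume y: "y \<in>[L]"
 show "T2 \<tau> u y w z v \<in>[K]" if "z \<in>[L]" for z by (rule lin_formD(1)[OF T2_lin_left[OF that] y])
 show "T2 \<tau> u y w (z +[L] z') v = T2 \<tau> u y w z v +[K] T2 \<tau> u y w z' v" if z: "z \<in>[L]" "z' \<in>[L]" for z z'
  by (rule lin_form_eqI[OF T2_lin_left lin_form_add[OF T2_lin_left T2_lin_left] _ y])
   (simp_all add: z T2_e_left T_rules)
 show "T2 \<tau> u y w (a \<odot>[L] z) v = a *[K] T2 \<tau> u y w z v" if z: "a \<in>[K]" "z \<in>[L]" for a z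
  by (rule lin_form_eqI[OF T2_lin_left lin_form_scale[OF T2_lin_left] _ y])
   (simp_all add: z T2_e_left T_rules)
qed

text \<open>Both sides are linear in \<open>y\<close>; for a basis element this is \<open>comm_rel\<close>. The next two lemmas are proved
  in the same way.\<close>

lemma T_commute:
 assumes r: "comm_rel \<tau> m" and m: "length u + length v + 2 = m" and y: "y \<in>[L]"
 shows "T \<tau> (u @ [i]) y v -[K] T \<tau> u y (i # v) = T \<tau> u (lie_bracket L (e i) y) v"
proof (rule lin_form_eqI[OF lin_form_diff[OF T_lin T_lin]
  lin_form_bracket[OF T_lin e_closed] _ y])
 show "T \<tau> (u @ [i]) (e j) v -[K] T \<tau> u (e j) (i # v) = T \<tau> u (lie_bracket L (e i) (e j)) v" for j
  using r m unfolding comm_rel_def by (simp add: T_e)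
qed

lemma T_swap_left:
 assumes r: "comm_rel \<tau> m" and m: "length u + length w + length v + 3 = m" and y: "y \<in>[L]"
 shows "T \<tau> (u @ i # j # w) y v -[K] T \<tau> (u @ j # i # w) y v = T2 \<tau> u (lie_bracket L (e i) (e j)) w y v"
proof (rule lin_form_eqI[OF lin_form_diff[OF T_lin T_lin] T2_lin_right _ y])
 fix b
 have "\<tau> (u @ i # j # (w @ b # v)) -[K] \<tau> (u @ j # i # (w @ b # v)) = T \<tau> u (lie_bracket L (e i) (e j)) (w @ b # v)"
  by (rule r[unfolded comm_rel_def, rule_format]) (use m in simp)
 then show "T \<tau> (u @ i # j # w) (e b) v -[K] T \<tau> (u @ j # i # w) (e b) v = T2 \<tau> u (lie_bracket L (e i) (e j)) w (e b) v"
  by (simp add: T_e T2_e_right L.bracket_closed e_closed)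
qed (simp add: L.bracket_closed e_closed)

lemma T_swap_right:
 assumes r: "comm_rel \<tau> m" and m: "length u + length w + length v + 3 = m" and y: "y \<in>[L]"
 shows "T \<tau> u y (w @ i # j # v) -[K] T \<tau> u y (w @ j # i # v) = T2 \<tau> u y w (lie_bracket L (e i) (e j)) v"
proof (rule lin_form_eqI[OF lin_form_diff[OF T_lin T_lin] T2_lin_left _ y])
 fix a
 have "\<tau> ((u @ a # w) @ i # j # v) -[K] \<tau> ((u @ a # w) @ j # i # v) = T \<tau> (u @ a # w) (lie_bracket L (e i) (e j)) v"
  by (rule r[unfolded comm_rel_def, rule_format]) (use m in simp)
 then show "T \<tau> u (e a) (w @ i # j # v) -[K] T \<tau> u (e a) (w @ j # i # v) = T2 \<tau> u (e a) w (lie_bracket L (e i) (e j)) v"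
  by (simp add: T_e T2_e_left L.bracket_closed e_closed)
qed (simp add: L.bracket_closed e_closed)

end

end

text \<open>Exchanging a descent lowers this number, which makes straightening terminate.\<close>

fun inversions :: "nat list => nat" where
 "inversions [] = 0"
| "inversions (x # w) = length (filter (\<lambda>y. y < x) w) + inversions w"

lemma inversions_swap: "i < j ==> inversions (u @ j # i # v) = Suc (inversions (u @ i # j # v))"
 by (induction u) auto

lemma inversions_le: "inversions w \<le> length w * length w"
proof (induction w)
 case (Cons x w)
 have "length (filter (\<lambda>y. y < x) w) \<le> length w" by (rule length_filter_le)
 then show ?case using Cons by (simp del: length_filter_le)
qed simp

text \<open>Adjacent transpositions generate all rearrangements.\<close>

lemma swap_invariant:
 assumes swap: "!!a i j b. f (a @ i # j # b) = f (a @ j # i # b)"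
 shows "mset w = mset w' ==> f (a @ w) = f (a @ w')"
proof (induction w arbitrary: a w')
 case (Cons i w)
 have "i \<in> set w'" using mset_eq_setD[OF Cons.prems] by auto
 from split_list[OF this] obtain u v where w': "w' = u @ i # v" by (elim exE)
 have move: "f (a @ i # u @ v) = f (a @ u @ i # v)" for a u v
 proof (induction u arbitrary: a)
  case (Cons j u)
  have "f (a @ i # j # u @ v) = f ((a @ [j]) @ i # u @ v)" using swap[of a i j "u @ v"] by simp
  also have "... = f ((a @ [j]) @ u @ i # v)" by (rule Cons.IH)
  finally show ?case by simp
 qed simp
 have "f ((a @ [i]) @ w) = f ((a @ [i]) @ u @ v)" by (rule Cons.IH) (use Cons.prems w' in simp)
 then show ?case using move[of a u v] w' by simp
qed simp

context letters
begin

lemma bracket_swap: "[|x \<in>[L]; y \<in>[L]|] ==> lie_bracket L y x = -[L] lie_bracket L x y"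
proof -
 assume x: "x \<in>[L]" and y: "y \<in>[L]"
 note cl = L.bracket_closed[OF x x] L.bracket_closed[OF x y] L.bracket_closed[OF y x] L.bracket_closed[OF y y]
 have "lie_bracket L (x +[L] y) (x +[L] y) = \<zero>[L]" using x y by (simp add: L.bracket_self)
 then have "lie_bracket L y x +[L] lie_bracket L x y = \<zero>[L]"
  using x y cl by (simp add: L.bracket_add_left L.bracket_add_right L.bracket_self[OF x] L.bracket_self[OF y] L.M.a_comm)
 from L.M.minus_equality[OF this cl(2,3)] show ?thesis ..
qed

lemma T_minus: "[|word_form \<tau>; y \<in>[L]|] ==> T \<tau> u (-[L] y) v = -[K] T \<tau> u y v"
 using T_rules(3)[of \<tau> y "-[K] \<one>[K]" u v] T_rules(1)[of \<tau> y u v] by (simp add: L.smult_l_minus K.l_minus)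

lemma T_bracket_swap: "[|word_form \<tau>; x \<in>[L]; y \<in>[L]|] ==> T \<tau> u (lie_bracket L y x) v = -[K] T \<tau> u (lie_bracket L x y) v"
 by (subst bracket_swap[of x y]) (simp_all add: T_minus L.bracket_closed)

context
 fixes \<tau> m
 assumes \<tau>: "word_form \<tau>" and r: "comm_rel \<tau> (m - 1)"
begin

private abbreviation "g u j i v == T \<tau> u (lie_bracket L (e j) (e i)) v"

private lemma bc [simp]: "lie_bracket L (e i) (e j) \<in>[L]" by (simp add: L.bracket_closed e_closed)
private lemma gc [simp]: "g u j i v \<in>[K]" by (rule T_rules(1)[OF \<tau>]) simp

text \<open>Fix a form \<open>\<tau>\<close> that satisfies the commutation relations of length \<open>m - 1\<close>. The values at words of length
  \<open>m\<close> are constructed by recursion on the number of inversions: the relations prescribe the value at a word with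
  a descent from a word with fewer inversions.\<close>

definition straight_upto :: "nat => (nat list => 'k) => bool" where
 "straight_upto N f \<longleftrightarrow> word_form f \<and> (\<forall>u v i j. length u + length v + 2 = m --> i < j -->
   inversions (u @ j # i # v) \<le> N --> f (u @ j # i # v) = f (u @ i # j # v) +[K] g u j i v)"

text \<open>The prescribed value depends on the descent that is chosen. Disjoint descents agree by the relations of
  length \<open>m - 1\<close>; two descents in three consecutive letters agree by the Jacobi identity.\<close>

lemma straighten_confluent:
 assumes f: "straight_upto N f" and w: "w = u @ j # i # v" "w = u' @ l # k # v'" and ij: "i < j" "k < l"
  and m: "length w = m" and inv: "inversions w = Suc N" and le: "length u \<le> length u'"
 shows "f (u @ i # j # v) +[K] g u j i v = f (u' @ k # l # v') +[K] g u' l k v'"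
proof -
 have fc [simp]: "f x \<in>[K]" for x using f by (auto simp: straight_upto_def word_form_def)
 have step: "f (u @ j # i # v) = f (u @ i # j # v) +[K] g u j i v"
  if "i < j" "length u + length v + 2 = m" "inversions (u @ j # i # v) \<le> N" for u i j v
  using f that unfolding straight_upto_def by blast
 obtain z where z: "u' = u @ z" "z @ l # k # v' = j # i # v"
 proof -
  have "u = take (length u) u'" using w le by (metis append_eq_append_conv_if)
  then have "u' = u @ drop (length u) u'" by (metis append_take_drop_id)
  moreover from this have "drop (length u) u' @ l # k # v' = j # i # v" using w by (metis append.assoc same_append_eq)
  ultimately show ?thesis using that by blast
 qed
 consider "z = []" | a where "z = [a]" | a b x where "z = a # b # x" by (metis neq_Nil_conv)
 then show ?thesis
 proof cases
  case 1
  then show ?thesis using z by simp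
 next
  case 2
  then have e: "a = j" "l = i" "v = k # v'" "u' = u @ [j]" using z by auto
  have ki: "k < i" "k < j" using e ij by auto
  have len: "length u + length v' + 3 = m" using m w e by simp
  have inv': "inversions (u @ j # i # k # v') = Suc N" using inv w e by simp
  have inv1: "inversions (u @ i # j # k # v') = N" using inv' inversions_swap[OF ij(1), of u "k # v'"] by simp
  have inv2: "inversions (u @ j # k # i # v') = N" using inv' inversions_swap[OF ki(1), of "u @ [j]" v'] by simp
  have inv3: "inversions (u @ i # k # j # v') \<le> N" using inv1 inversions_swap[OF ki(2), of "u @ [i]" v'] by simp
  have inv4: "inversions (u @ k # j # i # v') \<le> N" using inv2 inversions_swap[OF ki(2), of u "i # v'"] by simp
  have s1: "f (u @ i # j # k # v') = f (u @ i # k # j # v') +[K] g (u @ [i]) j k v'"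
   using step[OF ki(2), of "u @ [i]" v'] inv1 len by simp
  have s2: "f (u @ i # k # j # v') = f (u @ k # i # j # v') +[K] g u i k (j # v')"
   using step[OF ki(1), of u "j # v'"] inv3 len by simp
  have s3: "f (u @ j # k # i # v') = f (u @ k # j # i # v') +[K] g u j k (i # v')"
   using step[OF ki(2), of u "i # v'"] inv2 len by simp
  have s4: "f (u @ k # j # i # v') = f (u @ k # i # j # v') +[K] g (u @ [k]) j i v'"
   using step[OF ij(1), of "u @ [k]" v'] inv4 len by simp
  have len': "length u + length v' + 2 = m - 1" using len by simp
  note tc = T_commute[OF \<tau> r len']
  let ?P1 = "g (u @ [j]) i k v'" and ?Q1 = "g u i k (j # v')"
  let ?P2 = "g (u @ [i]) k j v'" and ?Q2 = "g u k j (i # v')"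
  let ?P3 = "g (u @ [k]) j i v'" and ?Q3 = "g u j i (k # v')"
  have d: "?P1 -[K] ?Q1 = T \<tau> u (lie_bracket L (e j) (lie_bracket L (e i) (e k))) v'"
   "?P2 -[K] ?Q2 = T \<tau> u (lie_bracket L (e i) (lie_bracket L (e k) (e j))) v'"
   "?P3 -[K] ?Q3 = T \<tau> u (lie_bracket L (e k) (lie_bracket L (e j) (e i))) v'"
   by (rule tc; simp)+
  have "T \<tau> u (lie_bracket L (e j) (lie_bracket L (e i) (e k)) +[L] lie_bracket L (e i) (lie_bracket L (e k) (e j)) +[L]
    lie_bracket L (e k) (lie_bracket L (e j) (e i))) v' = T \<tau> u \<zero>[L] v'"
   using L.jacobi[of "e j" "e i" "e k"] by (simp add: e_closed)
  also have "T \<tau> u \<zero>[L] v' = \<zero>[K]" using T_rules(3)[OF \<tau>, of "\<zero>[L]" "\<zero>[K]" u v'] T_rules(1)[OF \<tau>, of "\<zero>[L]" u v'] by simp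
  finally have J: "(?P1 -[K] ?Q1) +[K] (?P2 -[K] ?Q2) +[K] (?P3 -[K] ?Q3) = \<zero>[K]"
   unfolding d by (simp add: T_rules[OF \<tau>] L.bracket_closed e_closed)
  define F where "F = f (u @ k # i # j # v')"
  have Fc: "F \<in>[K]" by (simp add: F_def)
  have cl: "?P1 \<in>[K]" "?Q1 \<in>[K]" "?P2 \<in>[K]" "?Q2 \<in>[K]" "?P3 \<in>[K]" "?Q3 \<in>[K]" by simp_all
  have alg: "F +[K] q1 +[K] -[K] p2 +[K] q3 = F +[K] p3 +[K] -[K] q2 +[K] p1"
   if c: "p1 \<in>[K]" "q1 \<in>[K]" "p2 \<in>[K]" "q2 \<in>[K]" "p3 \<in>[K]" "q3 \<in>[K]"
    and z: "(p1 -[K] q1) +[K] (p2 -[K] q2) +[K] (p3 -[K] q3) = \<zero>[K]" for p1 q1 p2 q2 p3 q3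
  proof -
   have "F +[K] p3 +[K] -[K] q2 +[K] p1 = (F +[K] q1 +[K] -[K] p2 +[K] q3) +[K]
     ((p1 -[K] q1) +[K] (p2 -[K] q2) +[K] (p3 -[K] q3))"
    using c Fc by algebra
   then show ?thesis unfolding z using c Fc by simp
  qed
  have n: "g (u @ [i]) j k v' = -[K] ?P2" "g u j k (i # v') = -[K] ?Q2"
   by (rule T_bracket_swap[OF \<tau> e_closed e_closed])+
  have "f (u @ i # j # v) +[K] g u j i v = F +[K] ?Q1 +[K] -[K] ?P2 +[K] ?Q3"
   unfolding e s1 s2 n F_def ..
  also have "... = F +[K] ?P3 +[K] -[K] ?Q2 +[K] ?P1" by (rule alg[OF cl J])
  also have "... = f (u' @ k # l # v') +[K] g u' l k v'"
   unfolding e using s3 s4 n(2) by (simp add: F_def)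
  finally show ?thesis .
 next
  case 3
  then have e: "a = j" "b = i" "v = x @ l # k # v'" "u' = u @ j # i # x" using z by auto
  have len: "length u + length x + length v' + 4 = m" using m w e by simp
  have inv': "inversions (u @ j # i # x @ l # k # v') = Suc N" using inv w e by simp
  have inv1: "inversions (u @ i # j # x @ l # k # v') \<le> N" using inv' inversions_swap[OF ij(1), of u "x @ l # k # v'"] by simp
  have inv2: "inversions (u @ j # i # x @ k # l # v') \<le> N" using inv' inversions_swap[OF ij(2), of "u @ j # i # x" v'] by simp
  have s1: "f (u @ i # j # x @ l # k # v') = f (u @ i # j # x @ k # l # v') +[K] g (u @ i # j # x) l k v'"
   using step[OF ij(2), of "u @ i # j # x" v'] inv1 len by simp
  have s2: "f (u @ j # i # x @ k # l # v') = f (u @ i # j # x @ k # l # v') +[K] g u j i (x @ k # l # v')"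
   using step[OF ij(1), of u "x @ k # l # v'"] inv2 len by simp
  have len': "length u + length x + length v' + 3 = m - 1" using len by simp
  let ?a = "g u j i (x @ l # k # v')" and ?b = "g u j i (x @ k # l # v')" and ?c = "g (u @ j # i # x) l k v'" and ?d = "g (u @ i # j # x) l k v'"
  have "?a -[K] ?b = ?c -[K] ?d"
   using T_swap_right[OF \<tau> r len' bc, of j i l k] T_swap_left[OF \<tau> r len' bc, of j i l k] by simp
  then have eq: "?a = ?c -[K] ?d +[K] ?b"
   using K.a_assoc[of ?a "-[K] ?b" ?b] by (simp only: a_minus_def K.l_neg K.r_zero K.a_inv_closed gc)
  define F where "F = f (u @ i # j # x @ k # l # v')"
  have Fc: "F \<in>[K]" by (simp add: F_def)
  have cl: "?b \<in>[K]" "?c \<in>[K]" "?d \<in>[K]" by simp_all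
  have alg: "F +[K] d +[K] (c -[K] d +[K] b) = F +[K] b +[K] c"
   if "b \<in>[K]" "c \<in>[K]" "d \<in>[K]" for b c d using that Fc by algebra
  show ?thesis using alg[OF cl] s1 s2 eq unfolding e by (simp add: F_def)
 qed
qed

lemma straighten_step:
 assumes f: "straight_upto N f"
 shows "\<exists>f'. straight_upto (Suc N) f'"
proof -
 have fw: "word_form f" using f by (simp add: straight_upto_def)
 let ?Q = "\<lambda>w z. z \<in>[K] \<and> (\<not> set w <= {..<n} --> z = \<zero>[K]) \<and>
   (\<forall>u j i v. w = u @ j # i # v --> i < j --> z = f (u @ i # j # v) +[K] g u j i v)"
 \<comment> \<open>By confluence some \<open>z\<close> fits every descent of \<open>w\<close>.\<close>
 have ex: "\<exists>z. length w = m --> inversions w = Suc N --> ?Q w z" for w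
 proof (cases "length w = m \<and> inversions w = Suc N \<and> (\<exists>u j i v. w = u @ j # i # v \<and> i < j)")
  case True
  then obtain u j i v where w: "length w = m" "inversions w = Suc N" "w = u @ j # i # v" "i < j" by blast
  have "?Q w (f (u @ i # j # v) +[K] g u j i v)"
  proof (intro conjI allI impI)
   show "f (u @ i # j # v) +[K] g u j i v \<in>[K]" using word_formD(1)[OF fw] by simp
   assume bad: "\<not> set w <= {..<n}"
   have 1: "f (u @ i # j # v) = \<zero>[K]" by (rule word_formD(2)[OF fw]) (use bad w(3) in auto)
   have 2: "g u j i v = \<zero>[K]"
   proof (cases "set (u @ v) <= {..<n}")
    case True
    then have "n \<le> i \<or> n \<le> j" using bad w(3) by auto
    then have "lie_bracket L (e j) (e i) = \<zero>[K] \<odot>[L] \<zero>[L]"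
    proof
     assume "n \<le> i"
     then show ?thesis using L.bracket_smult_right[OF K.zero_closed e_closed[of j] L.M.zero_closed] L.bracket_closed[OF e_closed L.M.zero_closed] by (simp add: e_zero)
    next
     assume "n \<le> j"
     then show ?thesis using L.bracket_smult_left[OF K.zero_closed L.M.zero_closed e_closed[of i]] L.bracket_closed[OF L.M.zero_closed e_closed] by (simp add: e_zero)
    qed
    then show ?thesis using T_rules(3)[OF \<tau> L.M.zero_closed K.zero_closed, of u v] T_rules(1)[OF \<tau> L.M.zero_closed] by (simp only: K.l_null)
   qed (simp add: T_bad[OF \<tau>])
   show "f (u @ i # j # v) +[K] g u j i v = \<zero>[K]" unfolding 1 2 by simp
  next
   fix u' l k v' assume w': "w = u' @ l # k # v'" "k < l"
   show "f (u @ i # j # v) +[K] g u j i v = f (u' @ k # l # v') +[K] g u' l k v'"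
   proof (cases "length u \<le> length u'")
    case True
    then show ?thesis by (rule straighten_confluent[OF f w(3) w'(1) w(4) w'(2) w(1,2)])
   next
    case False
    then have "length u' \<le> length u" by simp
    then show ?thesis by (rule straighten_confluent[OF f w'(1) w(3) w'(2) w(4) w(1,2), symmetric])
   qed
  qed
  then show ?thesis by blast
 next
  case False
  then show ?thesis using K.zero_closed by blast
 qed
 define z where "z w = (SOME z. length w = m --> inversions w = Suc N --> ?Q w z)" for w
 have z: "?Q w (z w)" if "length w = m" "inversions w = Suc N" for w
  using someI_ex[OF ex[of w]] that unfolding z_def by blast
 define f' where "f' w = (if length w = m \<and> inversions w = Suc N then z w else f w)" for w
 have "straight_upto (Suc N) f'"
  unfolding straight_upto_def
 proof (intro conjI allI impI)
  show "word_form f'" unfolding word_form_def f'_def using z word_formD[OF fw] by simp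
  fix u v i j assume h: "length u + length v + 2 = m" "i < j" "inversions (u @ j # i # v) \<le> Suc N"
  have sw: "inversions (u @ j # i # v) = Suc (inversions (u @ i # j # v))" by (rule inversions_swap[OF h(2)])
  have low: "f' (u @ i # j # v) = f (u @ i # j # v)" using sw h(3) by (simp add: f'_def)
  show "f' (u @ j # i # v) = f' (u @ i # j # v) +[K] g u j i v"
  proof (cases "inversions (u @ j # i # v) = Suc N")
   case True
   have "z (u @ j # i # v) = f (u @ i # j # v) +[K] g u j i v"
    using z[of "u @ j # i # v"] True h(1,2) by simp
   then show ?thesis unfolding low using True h(1) by (simp add: f'_def)
  next
   case False
   then show ?thesis unfolding low using f h unfolding straight_upto_def f'_def by simp
  qed
 qed
 then show ?thesis by blast
qed

text \<open>A word of length \<open>m\<close> has at most \<open>m\<^sup>2\<close> inversions, so finitely many steps reach all words of length \<open>m\<close>.\<close>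

lemma commuting_extension:
 "\<exists>\<tau>'. word_form \<tau>' \<and> (\<forall>w. length w ~= m --> \<tau>' w = \<tau> w) \<and> comm_rel \<tau>' m"
proof -
 have "\<exists>f. straight_upto N f" for N
 proof (induction N)
  case 0
  have "straight_upto 0 (\<lambda>w. \<zero>[K])" by (simp add: straight_upto_def word_form_def inversions_swap)
  then show ?case by blast
 next
  case (Suc N)
  then show ?case using straighten_step by blast
 qed
 then obtain f where f: "straight_upto (m * m) f" by blast
 have fc [simp]: "f x \<in>[K]" for x using f by (auto simp: straight_upto_def word_form_def)
 have step: "f (u @ j # i # v) = f (u @ i # j # v) +[K] g u j i v"
  if "i < j" "length u + length v + 2 = m" for u i j v
 proof -
  have len: "length (u @ j # i # v) = m" using that(2) by simp
  have "inversions (u @ j # i # v) \<le> m * m" using inversions_le[of "u @ j # i # v"] unfolding len .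
  then show ?thesis using f that unfolding straight_upto_def by blast
 qed
 define \<tau>' where "\<tau>' w = (if length w = m then f w else \<tau> w)" for w
 have fw: "word_form f" using f unfolding straight_upto_def by (rule conjunct1)
 have "word_form \<tau>'" unfolding word_form_def \<tau>'_def using word_formD[OF fw] word_formD[OF \<tau>] by simp
 moreover have "comm_rel \<tau>' m"
  unfolding comm_rel_def
 proof (intro allI impI)
  fix u v :: "nat list" and i j :: nat assume len: "length u + length v + 2 = m"
  have low: "T \<tau>' u (lie_bracket L (e i) (e j)) v = g u i j v"
   by (rule T_cong) (use len in \<open>simp add: \<tau>'_def\<close>)
  have top: "\<tau>' (u @ i # j # v) = f (u @ i # j # v)" "\<tau>' (u @ j # i # v) = f (u @ j # i # v)"
   using len by (simp_all add: \<tau>'_def)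
  show "\<tau>' (u @ i # j # v) -[K] \<tau>' (u @ j # i # v) = T \<tau>' u (lie_bracket L (e i) (e j)) v"
   unfolding low top
  proof (rule linorder_cases[of i j])
   assume "i < j"
   have "g u j i v = -[K] g u i j v" by (rule T_bracket_swap[OF \<tau> e_closed e_closed])
   then show "f (u @ i # j # v) -[K] f (u @ j # i # v) = g u i j v"
    unfolding step[OF \<open>i < j\<close> len] by (simp add: a_minus_def K.minus_add K.a_assoc[symmetric] K.r_neg)
  next
   assume "i = j"
   moreover have "T \<tau> u \<zero>[L] v = \<zero>[K]" using T_rules(3)[OF \<tau>, of "\<zero>[L]" "\<zero>[K]" u v] T_rules(1)[OF \<tau>, of "\<zero>[L]" u v] by simp
   ultimately show "f (u @ i # j # v) -[K] f (u @ j # i # v) = g u i j v"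
    by (simp add: L.bracket_self e_closed a_minus_def K.r_neg)
  next
   assume "j < i"
   from step[OF this len] show "f (u @ i # j # v) -[K] f (u @ j # i # v) = g u i j v"
    by (simp add: a_minus_def K.a_ac K.r_neg2)
  qed
 qed
 ultimately show ?thesis by (intro exI[of _ \<tau>']) (simp add: \<tau>'_def)
qed

end

end

context letters
begin

context
 fixes \<tau> m
 assumes \<tau>: "word_form \<tau>" and comm: "!!k. k \<le> m ==> comm_rel \<tau> k" and pow: "!!k. k < m ==> pow_rel \<tau> k"
begin

private abbreviation "P i == p_power L (e i)"
private lemma P [simp]: "P i \<in>[L]" by (rule L.p_power_closed[OF e_closed])
private lemmas tc [simp] = word_formD(1)[OF \<tau>]
private lemma Tc [simp]: "y \<in>[L] ==> T \<tau> u y v \<in>[K]" by (rule T_rules(1)[OF \<tau>])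
private lemma T2c [simp]: "[|y \<in>[L]; z \<in>[L]|] ==> T2 \<tau> u y w z v \<in>[K]"
 by (rule lin_formD(1)[OF T2_lin_left[OF \<tau>]])
declare s_closed [simp] e_closed [simp] L.bracket_closed [simp]

text \<open>Now let all relations hold below length \<open>m\<close> and the commutation relations also at length \<open>m\<close>. The failure of
  the \<open>p\<close>-th power relation at a word of length \<open>m\<close> will be shown to depend only on the multiset of its letters.
  Then it can be subtracted from \<open>\<tau>\<close> without disturbing the commutation relations.\<close>

definition pow_defect :: "nat list => nat => nat list => 'k" where
 "pow_defect u i v = \<tau> (u @ replicate p i @ v) -[K] (T \<tau> u (P i) v +[K] s i *[K] \<tau> (u @ v))"

lemma p_gt_1: "1 < p" by (rule char_gt_1[OF K.field_axioms L.p_pos L.char_p])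

lemma pow_T_right:
 assumes m: "length u + p + length w + 1 + length v < m" and y: "y \<in>[L]"
 shows "T \<tau> (u @ replicate p i @ w) y v = T2 \<tau> u (P i) w y v +[K] s i *[K] T \<tau> (u @ w) y v"
proof (rule lin_form_eqI[OF T_lin[OF \<tau>] lin_form_add[OF T2_lin_right[OF \<tau>] lin_form_scale[OF T_lin[OF \<tau>]]] _ y])
 fix b
 have "\<tau> (u @ replicate p i @ (w @ b # v)) = T \<tau> u (P i) (w @ b # v) +[K] s i *[K] \<tau> (u @ (w @ b # v))"
  by (rule pow[OF m, unfolded pow_rel_def, rule_format]) simp
 then show "T \<tau> (u @ replicate p i @ w) (e b) v = T2 \<tau> u (P i) w (e b) v +[K] s i *[K] T \<tau> (u @ w) (e b) v"
  by (simp add: T_e[OF \<tau>] T2_e_right[OF \<tau>])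
qed simp_all

lemma pow_T_left:
 assumes m: "length u + p + length w + 1 + length v < m" and y: "y \<in>[L]"
 shows "T \<tau> u y (w @ replicate p i @ v) = T2 \<tau> u y w (P i) v +[K] s i *[K] T \<tau> u y (w @ v)"
proof (rule lin_form_eqI[OF T_lin[OF \<tau>] lin_form_add[OF T2_lin_left[OF \<tau>] lin_form_scale[OF T_lin[OF \<tau>]]] _ y])
 fix b
 have "\<tau> ((u @ b # w) @ replicate p i @ v) = T \<tau> (u @ b # w) (P i) v +[K] s i *[K] \<tau> ((u @ b # w) @ v)"
  by (rule pow[OF m, unfolded pow_rel_def, rule_format]) simp
 then show "T \<tau> u (e b) (w @ replicate p i @ v) = T2 \<tau> u (e b) w (P i) v +[K] s i *[K] T \<tau> u (e b) (w @ v)"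
  by (simp add: T_e[OF \<tau>] T2_e_left[OF \<tau>])
qed simp_all

lemma ad_pow_closed: "y \<in>[L] ==> (lie_bracket L (e i) ^^ k) y \<in>[L]"
 by (induction k) simp_all

text \<open>This is \<open>x\<^sup>p y = ad(x)\<^sup>p(y) + y x\<^sup>p\<close>, a binomial expansion, with \<open>ad(x)\<^sup>p = ad(x\<^sup>[\<^sup>p\<^sup>])\<close>.\<close>

lemma T_move_power:
 assumes m: "length u + length v + 1 + p \<le> m" and y: "y \<in>[L]"
 shows "T \<tau> (u @ replicate p i) y v = T \<tau> u (lie_bracket L (P i) y) v +[K] T \<tau> u y (replicate p i @ v)"
proof -
 let ?b = "\<lambda>a k l. T \<tau> (u @ replicate a i) ((lie_bracket L (e i) ^^ k) y) (replicate l i @ v)"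
 have "?b p 0 0 = ?b 0 p 0 +[self_algebra K] ?b 0 0 p"
 proof (rule pascal_char_p[OF K.field_axioms L.p_pos L.char_p module_self[OF K.field_axioms]])
  show "?b 0 k l \<in>[self_algebra K]" for k l using ad_pow_closed[OF y] by simp
  show "?b (Suc a) k l = ?b a (Suc k) l +[self_algebra K] ?b a k (Suc l)" if akl: "a + k + l < p" for a k l
  proof -
   let ?y = "(lie_bracket L (e i) ^^ k) y"
   have yc: "?y \<in>[L]" by (rule ad_pow_closed[OF y])
   have r: "comm_rel \<tau> (length u + a + (l + length v) + 2)" by (rule comm) (use akl m in simp)
   have "T \<tau> ((u @ replicate a i) @ [i]) ?y (replicate l i @ v) -[K] T \<tau> (u @ replicate a i) ?y (i # replicate l i @ v)
    = T \<tau> (u @ replicate a i) (lie_bracket L (e i) ?y) (replicate l i @ v)"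
    by (rule T_commute[OF \<tau> r _ yc]) simp
   moreover have "replicate (Suc a) i = replicate a i @ [i]" by (simp add: replicate_append_same)
   ultimately have 1: "?b (Suc a) k l -[K] ?b a k (Suc l) = ?b a (Suc k) l" by simp
   have c: "?b (Suc a) k l \<in>[K]" "?b a k (Suc l) \<in>[K]" using yc by simp_all
   have "(?b (Suc a) k l -[K] ?b a k (Suc l)) +[K] ?b a k (Suc l) = ?b (Suc a) k l"
    using c by (simp only: a_minus_def K.a_assoc K.l_neg K.r_zero K.a_inv_closed)
   then show ?thesis unfolding 1 by simp
  qed
 qed
 then show ?thesis by (simp add: L.ad_p_power[OF e_closed y])
qed

lemma defect_move:
 assumes m: "length u + length v + 1 + p = m"
 shows "pow_defect (u @ [j]) i v = pow_defect u i (j # v)"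
proof -
 have 1: "\<tau> (u @ replicate p i @ j # v) = T \<tau> u (lie_bracket L (P i) (e j)) v +[K] \<tau> (u @ j # replicate p i @ v)"
  using T_move_power[of u v "e j" i] m by (simp add: T_e[OF \<tau>])
 have r: "comm_rel \<tau> (length u + length v + 2)" by (rule comm) (use m p_gt_1 in simp)
 have "T \<tau> (u @ [j]) (P i) v -[K] T \<tau> u (P i) (j # v) = T \<tau> u (lie_bracket L (e j) (P i)) v"
  by (rule T_commute[OF \<tau> r refl]) simp
 also have "... = -[K] T \<tau> u (lie_bracket L (P i) (e j)) v" by (rule T_bracket_swap[OF \<tau>]) simp_all
 finally have 2: "T \<tau> (u @ [j]) (P i) v -[K] T \<tau> u (P i) (j # v) = -[K] T \<tau> u (lie_bracket L (P i) (e j)) v" .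
 have alg: "b -[K] (t +[K] x) = (d +[K] b) -[K] (t' +[K] x)"
  if "t -[K] t' = -[K] d" "b \<in>[K]" "t \<in>[K]" "x \<in>[K]" "d \<in>[K]" "t' \<in>[K]" for b t x d t'
 proof -
  have "(d +[K] b) -[K] (t' +[K] x) = b -[K] (t +[K] x) +[K] ((t -[K] t') +[K] d)" using that(2-) by algebra
  then show ?thesis using that by (simp add: K.l_neg)
 qed
 show ?thesis
  unfolding pow_defect_def 1 append_assoc append_Cons append_Nil
  by (rule alg[OF 2]) simp_all
qed

lemma defect_swap:
 assumes m: "length u + p + length w + length v + 2 = m"
 shows "pow_defect u i (w @ j # k # v) = pow_defect u i (w @ k # j # v)"
proof -
 let ?y = "lie_bracket L (e j) (e k)"
 have r: "comm_rel \<tau> m" "comm_rel \<tau> (m - p)" "comm_rel \<tau> (m - p + 1)" by (rule comm; use m p_gt_1 in simp)+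
 have 1: "\<tau> (u @ replicate p i @ w @ j # k # v) -[K] \<tau> (u @ replicate p i @ w @ k # j # v) = T \<tau> (u @ replicate p i @ w) ?y v"
  using r(1)[unfolded comm_rel_def, rule_format, of "u @ replicate p i @ w" v j k] m by simp
 have 2: "\<tau> (u @ w @ j # k # v) -[K] \<tau> (u @ w @ k # j # v) = T \<tau> (u @ w) ?y v"
  using r(2)[unfolded comm_rel_def, rule_format, of "u @ w" v j k] m by simp
 have 3: "T \<tau> u (P i) (w @ j # k # v) -[K] T \<tau> u (P i) (w @ k # j # v) = T2 \<tau> u (P i) w ?y v"
  by (rule T_swap_right[OF \<tau> r(3)]) (use m in simp_all)
 have 4: "T \<tau> (u @ replicate p i @ w) ?y v = T2 \<tau> u (P i) w ?y v +[K] s i *[K] T \<tau> (u @ w) ?y v"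
  by (rule pow_T_right) (use m in simp_all)
 have alg: "a -[K] (t +[K] s i *[K] b) = a' -[K] (t' +[K] s i *[K] b')"
  if "a -[K] a' = (t -[K] t') +[K] s i *[K] (b -[K] b')" and c: "a \<in>[K]" "a' \<in>[K]" "t \<in>[K]" "t' \<in>[K]" "b \<in>[K]" "b' \<in>[K]"
  for a a' b b' t t'
 proof -
  have sc: "s i \<in>[K]" by simp
  have "a -[K] (t +[K] s i *[K] b) = a' -[K] (t' +[K] s i *[K] b') +[K] ((a -[K] a') -[K] ((t -[K] t') +[K] s i *[K] (b -[K] b')))"
   using c sc by algebra
  then show ?thesis unfolding that(1) using c by (simp add: a_minus_def K.r_neg)
 qed
 show ?thesis unfolding pow_defect_def
  by (rule alg) (use 1 2 3 4 in simp_all)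
qed

text \<open>At a word that begins with two \<open>p\<close>-th powers either one can be replaced first; the relations of smaller length
  replace the other one.\<close>

lemma defect_two_powers:
 assumes m: "p + p + length v = m"
 shows "pow_defect [] j (replicate p i @ v) = pow_defect (replicate p j) i v"
proof -
 have pw: "pow_rel \<tau> (p + length v)" by (rule pow) (use m p_gt_1 in simp)
 note pr = pw[unfolded pow_rel_def, rule_format, of "[]" v, simplified]
 have 1: "T \<tau> [] (P j) (replicate p i @ v) = T2 \<tau> [] (P j) [] (P i) v +[K] s i *[K] T \<tau> [] (P j) v"
  using pow_T_left[of "[]" "[]" v "P j" i] m p_gt_1 by simp
 have 2: "T \<tau> (replicate p j) (P i) v = T2 \<tau> [] (P j) [] (P i) v +[K] s j *[K] T \<tau> [] (P i) v"
  using pow_T_right[of "[]" "[]" v "P i" j] m p_gt_1 by simp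
 have alg: "(t +[K] si *[K] a) +[K] sj *[K] (b +[K] si *[K] z) = (t +[K] sj *[K] b) +[K] si *[K] (a +[K] sj *[K] z)"
  if "t \<in>[K]" "a \<in>[K]" "b \<in>[K]" "z \<in>[K]" "si \<in>[K]" "sj \<in>[K]" for t a b z si sj
  using that by (simp add: K.r_distr K.a_ac K.m_lcomm)
 show ?thesis
  unfolding pow_defect_def append_Nil 1 2 pr by (subst alg) simp_all
qed

lemma defect_left: "length u + p + length v = m ==> pow_defect u i v = pow_defect [] i (u @ v)"
proof (induction u arbitrary: v rule: rev_induct)
 case (snoc j u)
 then show ?case using defect_move[of u v j i] snoc.IH[of "j # v"] by simp
qed simp

lemma defect_perm:
 assumes "p + length w = m" "mset w = mset w'"
 shows "pow_defect [] i w = pow_defect [] i w'"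
proof -
 let ?f = "\<lambda>w. if p + length w = m then pow_defect [] i w else \<zero>[K]"
 have "?f ([] @ w) = ?f ([] @ w')"
 proof (rule swap_invariant[OF _ assms(2)])
  show "?f (a @ k # j # b) = ?f (a @ j # k # b)" for a k j b
   using defect_swap[of "[]" a b i k j] by auto
 qed
 then show ?thesis using assms mset_eq_length[OF assms(2)] by simp
qed

text \<open>If the same letter is raised to the power \<open>p\<close>, the remaining letters are rearranged. If the letters \<open>i\<close> and \<open>j\<close>
  differ, each of them occurs at least \<open>p\<close> times, and the passage from one to the other is \<open>defect_two_powers\<close>.\<close>

lemma defect_mset:
 assumes m: "length u + p + length v = m" and eq: "mset (u @ replicate p i @ v) = mset (u' @ replicate p j @ v')"
 shows "pow_defect u i v = pow_defect u' j v'"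
proof -
 have m': "length u' + p + length v' = m" using mset_eq_length[OF eq] m by simp
 show ?thesis
 proof (cases "i = j")
  case True
  then have "mset (u @ v) = mset (u' @ v')" using eq by simp
  then have "pow_defect [] i (u @ v) = pow_defect [] i (u' @ v')" by (intro defect_perm) (use m in simp_all)
  then show ?thesis using defect_left[OF m] defect_left[OF m'] True by simp
 next
  case False
  have "count (mset (u @ replicate p i @ v)) j = count (mset (u' @ replicate p j @ v')) j" using eq by (simp only:)
  then have "p \<le> count (mset (u @ v)) j" using False by simp
  then have sub: "replicate_mset p j \<subseteq># mset (u @ v)" by (simp only: count_le_replicate_mset_subset_eq)
  obtain r where "mset r = mset (u @ v) - replicate_mset p j" using ex_mset by blast
  then have r: "mset (u @ v) = mset (replicate p j @ r)" using sub by simp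
  have "mset (u' @ v') + replicate_mset p j = mset (u @ v) + replicate_mset p i" using eq by (simp add: ac_simps)
  then have r': "mset (u' @ v') = mset (replicate p i @ r)" unfolding r by simp
  have len: "p + p + length r = m" using mset_eq_length[OF r] m by simp
  have "pow_defect u i v = pow_defect [] i (u @ v)" by (rule defect_left[OF m])
  also have "... = pow_defect [] i (replicate p j @ r)" by (rule defect_perm[OF _ r]) (use m in simp)
  also have "... = pow_defect (replicate p j) i r" by (rule defect_left[symmetric]) (use len in simp)
  also have "... = pow_defect [] j (replicate p i @ r)" by (rule defect_two_powers[OF len, symmetric])
  also have "... = pow_defect [] j (u' @ v')" by (rule defect_perm[OF _ r'[symmetric]]) (use len in simp)
  also have "... = pow_defect u' j v'" by (rule defect_left[OF m', symmetric])
  finally show ?thesis .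
 qed
qed

lemma defect_bad:
 assumes "\<not> set (u @ replicate p i @ v) <= {..<n}"
 shows "pow_defect u i v = \<zero>[K]"
proof (cases "set (u @ v) <= {..<n}")
 case True
 then have ni: "n \<le> i" using assms by (auto split: if_splits)
 have "P i = p_power L (\<zero>[K] \<odot>[L] e i)" using ni by (simp add: e_zero)
 also have "... = \<zero>[K] \<odot>[L] P i" using L.p_power_smult[OF K.zero_closed e_closed, of i] L.p_pos by (simp add: K.nat_pow_zero)
 finally have "T \<tau> u (P i) v = \<zero>[K]" using T_rules(3)[OF \<tau> P K.zero_closed, of u i v] by simp
 then show ?thesis using ni assms by (simp add: pow_defect_def s_zero word_formD(2)[OF \<tau>] a_minus_def)
next
 case False
 then show ?thesis using assms by (simp add: pow_defect_def T_bad[OF \<tau>] word_formD(2)[OF \<tau>] a_minus_def)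
qed

lemma power_correction:
 "\<exists>\<tau>'. word_form \<tau>' \<and> (\<forall>w. length w ~= m --> \<tau>' w = \<tau> w) \<and> comm_rel \<tau>' m \<and> pow_rel \<tau>' m"
proof -
 let ?Q = "\<lambda>w z. z \<in>[K] \<and> (\<not> set w <= {..<n} --> z = \<zero>[K]) \<and>
   (\<forall>u i v. length u + p + length v = m --> mset w = mset (u @ replicate p i @ v) --> z = pow_defect u i v)"
 have "\<exists>z. \<forall>w. mset w = M --> ?Q w z" for M
 proof (cases "\<exists>u i v. length u + p + length v = m \<and> M = mset (u @ replicate p i @ v)")
  case True
  then obtain u i v where uiv: "length u + p + length v = m" "M = mset (u @ replicate p i @ v)" by blast
  have "?Q w (pow_defect u i v)" if w: "mset w = M" for w
  proof (intro conjI allI impI)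
   show "pow_defect u i v \<in>[K]" by (simp add: pow_defect_def)
   have "set w = set (u @ replicate p i @ v)" using w uiv(2) by (intro mset_eq_setD) simp
   then show "\<not> set w <= {..<n} ==> pow_defect u i v = \<zero>[K]" using defect_bad[of u i v] by simp
   show "pow_defect u i v = pow_defect u' j v'" if "mset w = mset (u' @ replicate p j @ v')" for u' j v'
    by (rule defect_mset[OF uiv(1)]) (use that w uiv(2) in simp)
  qed
  then show ?thesis by blast
 next
  case False
  then show ?thesis using K.zero_closed by metis
 qed
 then have "\<exists>\<kappa>. \<forall>M w. mset w = M --> ?Q w (\<kappa> M)" by (intro choice allI)
 then obtain \<kappa> where \<kappa>0: "\<forall>M w. mset w = M --> ?Q w (\<kappa> M)" by (elim exE)
 have \<kappa>: "?Q w (\<kappa> (mset w))" for w by (rule mp[OF spec[OF spec[OF \<kappa>0]] refl])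
 have \<kappa>c [simp]: "\<kappa> (mset w) \<in>[K]" for w using \<kappa>[of w] by (rule conjunct1)
 \<comment> \<open>The correction is the same for all arrangements of a multiset of letters.\<close>
 define \<tau>' where "\<tau>' w = (if length w = m then \<tau> w -[K] \<kappa> (mset w) else \<tau> w)" for w
 have "word_form \<tau>'"
  unfolding word_form_def
 proof (intro conjI allI impI)
  show "\<tau>' w \<in>[K]" for w by (simp add: \<tau>'_def)
  fix w assume bad: "\<not> set w <= {..<n}"
  then have "\<kappa> (mset w) = \<zero>[K]" using \<kappa>[of w] by (elim conjE) simp
  then show "\<tau>' w = \<zero>[K]" using word_formD(2)[OF \<tau> bad] by (simp add: \<tau>'_def a_minus_def)
 qed
 moreover have "comm_rel \<tau>' m"
  unfolding comm_rel_def
 proof (intro allI impI)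
  fix u v :: "nat list" and i j :: nat assume len: "length u + length v + 2 = m"
  have low: "T \<tau>' u (lie_bracket L (e i) (e j)) v = T \<tau> u (lie_bracket L (e i) (e j)) v"
   by (rule T_cong) (use len in \<open>simp add: \<tau>'_def\<close>)
  let ?k = "\<kappa> (mset (u @ i # j # v))"
  have ms: "mset (u @ j # i # v) = mset (u @ i # j # v)" by simp
  have top: "\<tau>' (u @ i # j # v) = \<tau> (u @ i # j # v) -[K] ?k" "\<tau>' (u @ j # i # v) = \<tau> (u @ j # i # v) -[K] ?k"
   using len unfolding \<tau>'_def ms by simp_all
  have alg: "(a -[K] k) -[K] (b -[K] k) = a -[K] b" if "a \<in>[K]" "b \<in>[K]" "k \<in>[K]" for a b k
   using that by algebra
  show "\<tau>' (u @ i # j # v) -[K] \<tau>' (u @ j # i # v) = T \<tau>' u (lie_bracket L (e i) (e j)) v"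
   unfolding low top alg[OF tc tc \<kappa>c] by (rule comm[OF order_refl, unfolded comm_rel_def, rule_format, OF len])
 qed
 moreover have "pow_rel \<tau>' m"
  unfolding pow_rel_def
 proof (intro allI impI)
  fix u v :: "nat list" and i :: nat assume len: "length u + p + length v = m"
  have low: "T \<tau>' u (P i) v = T \<tau> u (P i) v" by (rule T_cong) (use len p_gt_1 in \<open>simp add: \<tau>'_def\<close>)
  have low': "\<tau>' (u @ v) = \<tau> (u @ v)" using len p_gt_1 by (simp add: \<tau>'_def)
  have "\<kappa> (mset (u @ replicate p i @ v)) = pow_defect u i v"
   using \<kappa>[of "u @ replicate p i @ v"] len by blast
  then have "\<tau>' (u @ replicate p i @ v) = \<tau> (u @ replicate p i @ v) -[K] pow_defect u i v" using len by (simp add: \<tau>'_def)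
  also have "... = T \<tau> u (P i) v +[K] s i *[K] \<tau> (u @ v)"
  proof -
   have alg: "a -[K] (a -[K] b) = b" if "a \<in>[K]" "b \<in>[K]" for a b using that by algebra
   show ?thesis unfolding pow_defect_def by (rule alg) simp_all
  qed
  finally show "\<tau>' (u @ replicate p i @ v) = T \<tau>' u (P i) v +[K] s i *[K] \<tau>' (u @ v)" unfolding low low' .
 qed
 ultimately show ?thesis by (intro exI[of _ \<tau>']) (simp add: \<tau>'_def)
qed

end

lemma rel_cong:
 assumes "!!w. length w \<le> m ==> \<tau>' w = \<tau> w"
 shows "comm_rel \<tau> m ==> comm_rel \<tau>' m" "pow_rel \<tau> m ==> pow_rel \<tau>' m"
proof -
 have T: "T \<tau>' u y v = T \<tau> u y v" if "length u + length v < m" for u y v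
  by (rule T_cong) (use that assms in simp)
 show "comm_rel \<tau> m ==> comm_rel \<tau>' m" unfolding comm_rel_def using T assms by simp
 have "1 < p" by (rule char_gt_1[OF K.field_axioms L.p_pos L.char_p])
 then show "pow_rel \<tau> m ==> pow_rel \<tau>' m" unfolding pow_rel_def using T assms by simp
qed

text \<open>The forms constructed for increasing lengths agree on short words, so they have a limit.\<close>

theorem straightened_form:
 "\<exists>\<tau>. word_form \<tau> \<and> \<tau> [] = \<one>[K] \<and> (\<forall>m. comm_rel \<tau> m \<and> pow_rel \<tau> m)"
proof -
 let ?Pr = "\<lambda>m \<tau>. word_form \<tau> \<and> \<tau> [] = \<one>[K] \<and> (\<forall>k\<le>m. comm_rel \<tau> k \<and> pow_rel \<tau> k)"
 let ?Qr = "\<lambda>m \<tau> \<tau>'. \<forall>w. length w \<le> (m::nat) --> \<tau>' w = (\<tau> w :: 'k)"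
 have "\<exists>F. \<forall>m. ?Pr m (F m) \<and> ?Qr m (F m) (F (Suc m))"
 proof (rule dependent_nat_choice)
  have "?Pr 0 (\<lambda>w. if w = [] then \<one>[K] else \<zero>[K])"
   using L.p_pos by (simp add: word_form_def comm_rel_def pow_rel_def)
  then show "\<exists>\<tau>. ?Pr 0 \<tau>" by blast
 next
  fix \<tau> m assume h: "?Pr m \<tau>"
  have wf: "word_form \<tau>" and one: "\<tau> [] = \<one>[K]" and rel: "!!k. k \<le> m ==> comm_rel \<tau> k \<and> pow_rel \<tau> k" using h by blast+
  have "comm_rel \<tau> (Suc m - 1)" using rel by simp
  from commuting_extension[OF wf this] obtain \<tau>1
   where 1: "word_form \<tau>1" "!!w. length w ~= Suc m ==> \<tau>1 w = \<tau> w" "comm_rel \<tau>1 (Suc m)" by blast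
  have rel1: "comm_rel \<tau>1 k \<and> pow_rel \<tau>1 k" if "k \<le> m" for k
   using rel[OF that] rel_cong[of k \<tau>1 \<tau>] 1(2) that by simp
  have c1: "comm_rel \<tau>1 k" if "k \<le> Suc m" for k using rel1 1(3) that by (cases "k = Suc m") auto
  have p1: "pow_rel \<tau>1 k" if "k < Suc m" for k using rel1[of k] that by simp
  from power_correction[OF 1(1) c1 p1] obtain \<tau>2
   where 2: "word_form \<tau>2" "!!w. length w ~= Suc m ==> \<tau>2 w = \<tau>1 w" "comm_rel \<tau>2 (Suc m)" "pow_rel \<tau>2 (Suc m)" by blast
  have rel2: "comm_rel \<tau>2 k \<and> pow_rel \<tau>2 k" if "k \<le> m" for k
   using rel1[OF that] rel_cong[of k \<tau>2 \<tau>1] 2(2) that by simp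
  have "comm_rel \<tau>2 k \<and> pow_rel \<tau>2 k" if "k \<le> Suc m" for k using rel2 2(3,4) that by (cases "k = Suc m") auto
  then have "?Pr (Suc m) \<tau>2 \<and> ?Qr m \<tau> \<tau>2" using 1(2) 2(1,2) one by simp
  then show "\<exists>\<tau>'. ?Pr (Suc m) \<tau>' \<and> ?Qr m \<tau> \<tau>'" by blast
 qed
 then obtain F where F: "!!m. ?Pr m (F m)" "!!m. ?Qr m (F m) (F (Suc m))" by blast
 have stab: "F (length w + k) w = F (length w) w" for w k
  by (induction k) (use F(2) in simp_all)
 define \<tau> where "\<tau> w = F (length w) w" for w
 have eq: "\<tau> w = F m w" if "length w \<le> m" for w m using stab[of w "m - length w"] that by (simp add: \<tau>_def)
 have "word_form \<tau>" using F(1) unfolding word_form_def \<tau>_def by blast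
 moreover have "\<tau> [] = \<one>[K]" using F(1) by (simp add: \<tau>_def)
 moreover have "comm_rel \<tau> m \<and> pow_rel \<tau> m" for m
  using F(1)[of m] rel_cong[of m \<tau> "F m"] eq by simp
 ultimately show ?thesis by blast
qed

end

section \<open>Jacobson's formula for the power of a sum\<close>

context
 fixes K B p X Y
 assumes K: "field K" and p0: "0 < p" and char: "has_char K p" and B: "assoc_algebra K B"
  and X: "X \<in>[B]" and Y: "Y \<in>[B]"
begin

interpretation K: field K by (rule K)
interpretation B: ring B by (rule algD[OF B])
interpretation MB: module K B by (rule algD[OF B])

text \<open>Sequences are polynomials in a central indeterminate \<open>t\<close> with coefficients in \<open>B\<close>. These two maps are the left and
  the right multiplication by \<open>Q = tX + Y\<close>, and \<open>sum_power m\<close> is \<open>Q\<^sup>m\<close>.\<close>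

definition seq_lmult :: "(nat => _) => nat => _" where
 "seq_lmult f j = (case j of 0 => Y *[B] f 0 | Suc i => X *[B] f i +[B] Y *[B] f (Suc i))"

definition seq_rmult :: "(nat => _) => nat => _" where
 "seq_rmult f j = (case j of 0 => f 0 *[B] Y | Suc i => f i *[B] X +[B] f (Suc i) *[B] Y)"

private abbreviation "lQ == seq_lmult"
private abbreviation "rQ == seq_rmult"
private abbreviation "seq f == \<forall>j. f j \<in>[B]"
private abbreviation "const a == \<lambda>j::nat. if j = 0 then a else \<zero>[B]"

private lemmas XY [simp] = X Y
private lemmas defs = seq_lmult_def seq_rmult_def

private lemma lQ_seq: "seq f ==> seq (lQ f)" and rQ_seq: "seq f ==> seq (rQ f)"
 by (simp_all add: defs split: nat.split)

private lemma pow_seq: "seq f ==> seq ((lQ ^^ k) f)" "seq f ==> seq ((rQ ^^ k) f)"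
 by (induction k) (simp_all add: lQ_seq rQ_seq)

private lemma lr_commute: "seq f ==> lQ (rQ f) = rQ (lQ f)"
 by (rule ext) (simp add: defs B.m_assoc B.l_distr B.r_distr B.a_ac split: nat.split)

private lemma lr_pow_commute: "seq f ==> lQ ((rQ ^^ k) f) = (rQ ^^ k) (lQ f)"
 by (induction k) (simp_all add: lr_commute pow_seq)

private lemma lQ_diff: "seq f ==> seq g ==> lQ (\<lambda>j. f j -[B] g j) = (\<lambda>j. lQ f j -[B] lQ g j)"
 by (rule ext) (simp add: defs a_minus_def B.r_distr B.r_minus B.minus_add B.a_ac split: nat.split)

private lemma rQ_diff: "seq f ==> seq g ==> rQ (\<lambda>j. f j -[B] g j) = (\<lambda>j. rQ f j -[B] rQ g j)"
 by (rule ext) (simp add: defs a_minus_def B.l_distr B.l_minus B.minus_add B.a_ac split: nat.split)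

private lemma pow_diff:
 "seq f ==> seq g ==> (lQ ^^ k) (\<lambda>j. f j -[B] g j) = (\<lambda>j. (lQ ^^ k) f j -[B] (lQ ^^ k) g j)"
 "seq f ==> seq g ==> (rQ ^^ k) (\<lambda>j. f j -[B] g j) = (\<lambda>j. (rQ ^^ k) f j -[B] (rQ ^^ k) g j)"
 by (induction k) (simp_all add: lQ_diff rQ_diff pow_seq)

definition sum_power :: "nat => nat => _" where
 "sum_power m = (lQ ^^ m) (\<lambda>j. if j = 0 then \<one>[B] else \<zero>[B])"

private lemma sum_power_seq: "seq (sum_power m)"
 unfolding sum_power_def by (rule pow_seq) simp

private lemma sum_power_closed [simp]: "sum_power m j \<in>[B]" using sum_power_seq by blast

private lemma sum_power_simps:
 "sum_power 0 j = (if j = 0 then \<one>[B] else \<zero>[B])"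
 "sum_power (Suc m) 0 = Y *[B] sum_power m 0"
 "sum_power (Suc m) (Suc j) = X *[B] sum_power m j +[B] Y *[B] sum_power m (Suc j)"
 by (simp_all add: sum_power_def seq_lmult_def)

private lemma sum_power_right: "sum_power m = (rQ ^^ m) (\<lambda>j. if j = 0 then \<one>[B] else \<zero>[B])"
proof (induction m)
 case (Suc m)
 let ?o = "\<lambda>j::nat. if j = 0 then \<one>[B] else \<zero>[B]"
 have o: "seq ?o" by simp
 have "lQ ?o = rQ ?o" by (rule ext) (simp add: defs split: nat.split)
 then have "lQ ((rQ ^^ m) ?o) = (rQ ^^ Suc m) ?o" using lr_pow_commute[OF o, of m] by (simp add: funpow_swap1)
 then show ?case using Suc by (simp add: sum_power_def)
qed (simp add: sum_power_def)

private lemma sum_power_ends: "m < j ==> sum_power m j = \<zero>[B]" "sum_power m m = X ^[B] m" "sum_power m 0 = Y ^[B] m"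
proof -
 show 1: "m < j ==> sum_power m j = \<zero>[B]" for m j
 proof (induction m arbitrary: j)
  case (Suc m)
  then show ?case by (cases j) (simp_all add: sum_power_simps)
 qed (simp add: sum_power_simps)
 show "sum_power m m = X ^[B] m"
 proof (induction m)
  case (Suc m)
  then show ?case using 1[of m "Suc m"] B.nat_pow_Suc2[OF X, of m] by (simp add: sum_power_simps)
 qed (simp add: sum_power_simps)
 show "sum_power m 0 = Y ^[B] m"
 proof (induction m)
  case (Suc m)
  then show ?case using B.nat_pow_Suc2[OF Y, of m] by (simp add: sum_power_simps)
 qed (simp add: sum_power_simps)
qed

private lemma sum_power_sum: "(X +[B] Y) ^[B] m = (\<Oplus>\<^bsub>B\<^esub>j\<in>{..m}. sum_power m j)"
proof (induction m)
 case (Suc m)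
 have S: "(\<Oplus>\<^bsub>B\<^esub>j\<in>{..m}. sum_power m j) \<in>[B]" by (rule B.finsum_closed) simp
 have "(\<Oplus>\<^bsub>B\<^esub>j\<in>{..Suc m}. sum_power (Suc m) j)
   = (\<Oplus>\<^bsub>B\<^esub>j\<in>{..m}. X *[B] sum_power m j +[B] Y *[B] sum_power m (Suc j)) +[B] Y *[B] sum_power m 0"
  by (subst B.finsum_Suc2) (simp_all add: Pi_iff sum_power_simps)
 also have "(\<Oplus>\<^bsub>B\<^esub>j\<in>{..m}. X *[B] sum_power m j +[B] Y *[B] sum_power m (Suc j))
   = (\<Oplus>\<^bsub>B\<^esub>j\<in>{..m}. X *[B] sum_power m j) +[B] (\<Oplus>\<^bsub>B\<^esub>j\<in>{..m}. Y *[B] sum_power m (Suc j))"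
  by (rule B.finsum_addf) (simp_all add: Pi_iff)
 also have "... +[B] Y *[B] sum_power m 0
   = (\<Oplus>\<^bsub>B\<^esub>j\<in>{..m}. X *[B] sum_power m j) +[B] ((\<Oplus>\<^bsub>B\<^esub>j\<in>{..m}. Y *[B] sum_power m (Suc j)) +[B] Y *[B] sum_power m 0)"
  by (rule B.a_assoc) (simp_all add: Pi_iff)
 also have "(\<Oplus>\<^bsub>B\<^esub>j\<in>{..m}. Y *[B] sum_power m (Suc j)) +[B] Y *[B] sum_power m 0 = (\<Oplus>\<^bsub>B\<^esub>j\<in>{..Suc m}. Y *[B] sum_power m j)"
  by (subst B.finsum_Suc2) (simp_all add: Pi_iff)
 also have "... = (\<Oplus>\<^bsub>B\<^esub>j\<in>{..m}. Y *[B] sum_power m j)"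
  by (simp add: B.finsum_Suc Pi_iff sum_power_ends(1))
 also have "(\<Oplus>\<^bsub>B\<^esub>j\<in>{..m}. X *[B] sum_power m j) = X *[B] (\<Oplus>\<^bsub>B\<^esub>j\<in>{..m}. sum_power m j)"
  by (rule B.finsum_rdistr[symmetric]) (simp_all add: Pi_iff)
 also have "(\<Oplus>\<^bsub>B\<^esub>j\<in>{..m}. Y *[B] sum_power m j) = Y *[B] (\<Oplus>\<^bsub>B\<^esub>j\<in>{..m}. sum_power m j)"
  by (rule B.finsum_rdistr[symmetric]) (simp_all add: Pi_iff)
 finally have "(\<Oplus>\<^bsub>B\<^esub>j\<in>{..Suc m}. sum_power (Suc m) j) = (X +[B] Y) *[B] (X +[B] Y) ^[B] m"
  unfolding Suc using S by (simp add: B.l_distr)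
 then show ?case using B.nat_pow_Suc2[of "X +[B] Y" m] by simp
qed (simp add: sum_power_simps)

private lemma right_pow_const: "(rQ ^^ m) (const X) = (\<lambda>j. X *[B] sum_power m j)"
proof (induction m)
 case (Suc m)
 have "rQ (\<lambda>j. X *[B] sum_power m j) = (\<lambda>j. X *[B] rQ (sum_power m) j)"
  by (rule ext) (simp add: seq_rmult_def B.m_assoc B.r_distr split: nat.split)
 moreover have "rQ (sum_power m) = sum_power (Suc m)" unfolding sum_power_right by simp
 ultimately show ?case using Suc by simp
qed (auto simp: sum_power_simps)

text \<open>The derivative of \<open>(tX + Y)\<^sup>m\<close> with respect to \<open>t\<close>.\<close>

private lemma sum_power_deriv:
 "[(Suc j)] \<cdot>\<^bsub>B\<^esub> sum_power m (Suc j) = (\<Oplus>\<^bsub>B\<^esub>a\<in>{..<m}. (lQ ^^ a) ((rQ ^^ (m - 1 - a)) (const X)) j)"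
proof (induction m arbitrary: j)
 case (Suc m)
 have cX: "seq (const X)" by simp
 let ?S = "\<lambda>a l. (lQ ^^ a) ((rQ ^^ l) (const X))"
 have S: "?S a l j \<in>[B]" for a l j using pow_seq(1)[OF pow_seq(2)[OF cX]] by blast
 let ?d = "\<lambda>j. [(Suc j)] \<cdot>\<^bsub>B\<^esub> sum_power m (Suc j)"
 have D: "[(Suc j)] \<cdot>\<^bsub>B\<^esub> sum_power (Suc m) (Suc j) = X *[B] sum_power m j +[B] lQ ?d j"
 proof (cases j)
  case 0
  then show ?thesis by (simp add: sum_power_simps seq_lmult_def)
 next
  case (Suc i)
  have "[(Suc j)] \<cdot>\<^bsub>B\<^esub> sum_power (Suc m) (Suc j)
    = [(Suc j)] \<cdot>\<^bsub>B\<^esub> (X *[B] sum_power m j) +[B] [(Suc j)] \<cdot>\<^bsub>B\<^esub> (Y *[B] sum_power m (Suc j))"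
   unfolding sum_power_simps(3) by (rule B.add.nat_pow_distrib) simp_all
  also have "[(Suc j)] \<cdot>\<^bsub>B\<^esub> (X *[B] sum_power m j) = X *[B] sum_power m j +[B] X *[B] ([j] \<cdot>\<^bsub>B\<^esub> sum_power m j)"
   by (simp add: B.add_pow_rdistr B.a_comm)
  also have "[(Suc j)] \<cdot>\<^bsub>B\<^esub> (Y *[B] sum_power m (Suc j)) = Y *[B] ?d j" by (simp only: B.add_pow_rdistr[OF Y sum_power_closed])
  finally show ?thesis using Suc by (simp add: seq_lmult_def B.a_assoc del: B.add.nat_pow_Suc)
 qed
 have dm: "?d = (\<lambda>j. \<Oplus>\<^bsub>B\<^esub>a\<in>{..<m}. ?S a (m - 1 - a) j)" using Suc.IH by (simp del: B.add.nat_pow_Suc)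
 have lsum: "lQ (\<lambda>j. \<Oplus>\<^bsub>B\<^esub>a\<in>{..<m}. ?S a (m - 1 - a) j) j = (\<Oplus>\<^bsub>B\<^esub>a\<in>{..<m}. ?S (Suc a) (m - Suc a) j)"
 proof (cases j)
  case 0
  then show ?thesis by (simp add: seq_lmult_def[of _ 0] B.finsum_rdistr Pi_iff S)
 next
  case (Suc i)
  have "lQ (\<lambda>j. \<Oplus>\<^bsub>B\<^esub>a\<in>{..<m}. ?S a (m - 1 - a) j) (Suc i)
    = (\<Oplus>\<^bsub>B\<^esub>a\<in>{..<m}. X *[B] ?S a (m - 1 - a) i) +[B] (\<Oplus>\<^bsub>B\<^esub>a\<in>{..<m}. Y *[B] ?S a (m - 1 - a) (Suc i))"
   by (simp add: seq_lmult_def[of _ "Suc i"] B.finsum_rdistr Pi_iff S)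
  also have "... = (\<Oplus>\<^bsub>B\<^esub>a\<in>{..<m}. X *[B] ?S a (m - 1 - a) i +[B] Y *[B] ?S a (m - 1 - a) (Suc i))"
   by (rule B.finsum_addf[symmetric]) (simp_all add: Pi_iff S)
  also have "... = (\<Oplus>\<^bsub>B\<^esub>a\<in>{..<m}. ?S (Suc a) (m - Suc a) (Suc i))" by (simp add: seq_lmult_def[of _ "Suc i"])
  finally show ?thesis using Suc by simp
 qed
 have "X *[B] sum_power m j +[B] (\<Oplus>\<^bsub>B\<^esub>a\<in>{..<m}. ?S (Suc a) (m - Suc a) j) = (\<Oplus>\<^bsub>B\<^esub>a\<in>{..<Suc m}. ?S a (m - a) j)"
 proof (cases m)
  case 0
  have "(lQ ^^ a) (const X) j \<in>[B]" for a using S[of a 0 j] by simp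
  then show ?thesis using fun_cong[OF right_pow_const[of m], of j] 0 by (simp add: lessThan_Suc)
 next
  case (Suc l)
  have "(\<Oplus>\<^bsub>B\<^esub>a\<in>{..Suc l}. ?S a (m - a) j) = (\<Oplus>\<^bsub>B\<^esub>a\<in>{..l}. ?S (Suc a) (m - Suc a) j) +[B] ?S 0 m j"
   by (subst B.finsum_Suc2) (use S in \<open>simp_all add: Pi_iff del: funpow.simps(2)\<close>)
  moreover have "(\<Oplus>\<^bsub>B\<^esub>a\<in>{..l}. ?S (Suc a) (m - Suc a) j) \<in>[B]" by (rule B.finsum_closed) (use S in \<open>simp add: Pi_iff del: funpow.simps(2)\<close>)
  moreover have "?S 0 m j = X *[B] sum_power m j" using fun_cong[OF right_pow_const[of m], of j] by simp
  ultimately show ?thesis using Suc S by (simp add: lessThan_Suc_atMost B.a_comm del: funpow.simps(2))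
 qed
 then show ?case unfolding D dm lsum by (simp del: funpow.simps(2))
qed (simp add: sum_power_simps)

text \<open>Neighbouring entries in row \<open>p - 1\<close> of Pascal's triangle add up to an entry of row \<open>p\<close>, hence to \<open>0\<close>.\<close>

private lemma binomial_p1: "x \<in>[B] ==> d \<le> p - 1 ==> [((p - 1) choose (p - 1 - d))] \<cdot>\<^bsub>B\<^esub> (((a_inv B) ^^ d) x) = x"
proof (induction d)
 case (Suc d)
 let ?i = "p - 1 - Suc d"
 have i: "Suc ?i = p - 1 - d" "Suc ?i < p" using Suc.prems p0 by simp_all
 have yc: "((a_inv B) ^^ d) x \<in>[B]" using Suc.prems(1) by (induction d) simp_all
 let ?y = "((a_inv B) ^^ d) x"
 have "p choose Suc ?i = ((p - 1) choose ?i) + ((p - 1) choose Suc ?i)"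
  using binomial_Suc_Suc[of "p - 1" ?i] p0 by (simp only: Suc_diff_1)
 moreover have "[(p choose Suc ?i)] \<cdot>\<^bsub>B\<^esub> ?y = \<zero>[B]"
  by (rule char_add_pow[OF K p0 char MB.module_axioms yc char_dvd_choose[OF K p0 char _ i(2)]]) simp
 ultimately have z: "[((p - 1) choose ?i)] \<cdot>\<^bsub>B\<^esub> ?y +[B] [((p - 1) choose Suc ?i)] \<cdot>\<^bsub>B\<^esub> ?y = \<zero>[B]"
  using yc by (simp add: B.add.nat_pow_mult)
 have "[((p - 1) choose Suc ?i)] \<cdot>\<^bsub>B\<^esub> ?y = x" using Suc i(1) by simp
 then have z': "[((p - 1) choose ?i)] \<cdot>\<^bsub>B\<^esub> ?y +[B] x = \<zero>[B]" using z by simp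
 have "-[B] ([((p - 1) choose ?i)] \<cdot>\<^bsub>B\<^esub> ?y) = x"
  by (rule B.minus_equality) (use z' yc Suc.prems(1) in \<open>simp_all add: B.a_comm\<close>)
 then show ?case using yc by (simp add: B.add.nat_pow_inv)
qed simp

text \<open>The derivative of \<open>Q\<^sup>p\<close> is \<open>\<Sum> Q\<^sup>a X Q\<^sup>b\<close> over \<open>a + b = p - 1\<close>. With the commuting operators \<open>l\<close> and \<open>r\<close> of left and right
  multiplication by \<open>Q\<close>, the operator \<open>\<Sum> l\<^sup>a r\<^sup>b\<close> equals \<open>(l - r)\<^sup>p\<^sup>-\<^sup>1\<close> in characteristic \<open>p\<close>. So the derivative is
  \<open>ad(Q)\<^sup>p\<^sup>-\<^sup>1(X)\<close>, whose coefficients are the \<open>C (p - 1) j\<close>, and division by \<open>i < p\<close> gives the middle coefficients of \<open>Q\<^sup>p\<close>.\<close>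

theorem jacobson_formula:
 assumes C: "!!m j. C m j \<in>[B]" "C 0 0 = X" "!!j. C 0 (Suc j) = \<zero>[B]"
  "!!m. C (Suc m) 0 = Y *[B] C m 0 -[B] C m 0 *[B] Y"
  "!!m j. C (Suc m) (Suc j) = (X *[B] C m j -[B] C m j *[B] X) +[B] (Y *[B] C m (Suc j) -[B] C m (Suc j) *[B] Y)"
 shows "(X +[B] Y) ^[B] p = X ^[B] p +[B] Y ^[B] p +[B]
  (\<Oplus>\<^bsub>B\<^esub>i\<in>{1..<p}. inv\<^bsub>K\<^esub> ([i] \<cdot>\<^bsub>K\<^esub> \<one>[K]) \<odot>[B] C (p - 1) (i - 1))"
proof -
 have Cseq: "seq (C m)" for m using C(1) by simp
 have C0: "C 0 = const X"
 proof
  show "C 0 j = const X j" for j using C(2,3) by (cases j) simp_all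
 qed
 have CSuc: "C (Suc m) = (\<lambda>j. lQ (C m) j -[B] rQ (C m) j)" for m
 proof
  show "C (Suc m) j = lQ (C m) j -[B] rQ (C m) j" for j
   by (cases j) (simp_all add: C(1,4,5) defs a_minus_def B.minus_add B.a_ac)
 qed
 let ?S = "\<lambda>m k l. (lQ ^^ k) ((rQ ^^ l) (C m))"
 have S: "?S m k l j \<in>[B]" for m k l j using pow_seq(1)[OF pow_seq(2)[OF Cseq]] by blast
 have SSuc: "?S (Suc m) k l j = ?S m (Suc k) l j -[B] ?S m k (Suc l) j" for m k l j
 proof -
  have "?S (Suc m) k l = (\<lambda>j. (lQ ^^ k) ((rQ ^^ l) (lQ (C m))) j -[B] (lQ ^^ k) ((rQ ^^ l) (rQ (C m))) j)"
   unfolding CSuc using Cseq by (simp add: pow_diff pow_seq lQ_seq rQ_seq)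
  also have "(rQ ^^ l) (lQ (C m)) = lQ ((rQ ^^ l) (C m))" by (rule lr_pow_commute[OF Cseq, symmetric])
  finally show ?thesis by (simp add: funpow_swap1)
 qed
 have sum: "(\<Oplus>\<^bsub>B\<^esub>a\<in>{..<p}. ?S 0 a (p - 1 - a) j) = C (p - 1) j" for j
 proof -
  \<comment> \<open>The signs turn the difference of \<open>l\<close> and \<open>r\<close> into a sum, so that Pascal's triangle applies.\<close>
  let ?b = "\<lambda>m k l. ((a_inv B) ^^ l) (?S m k l j)"
  have neg: "((a_inv B) ^^ l) x \<in>[B]" if "x \<in>[B]" for l x using that by (induction l) simp_all
  have neg_add: "((a_inv B) ^^ l) (x +[B] y) = ((a_inv B) ^^ l) x +[B] ((a_inv B) ^^ l) y"
   if "x \<in>[B]" "y \<in>[B]" for l x y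
   using that by (induction l) (simp_all add: B.minus_add neg)
  have neg_diff: "((a_inv B) ^^ l) (x -[B] y) = ((a_inv B) ^^ l) x +[B] ((a_inv B) ^^ Suc l) y"
   if "x \<in>[B]" "y \<in>[B]" for l x y
   using that by (simp add: a_minus_def neg_add funpow_swap1)
  have "?b (p - 1) 0 0 = (\<Oplus>\<^bsub>B\<^esub>i\<in>{..p - 1}. [((p - 1) choose i)] \<cdot>\<^bsub>B\<^esub> ?b 0 (0 + i) (0 + (p - 1 - i)))"
  proof (rule B.pascal_expansion[where N = "p - 1"])
   show "?b 0 k l \<in>[B]" for k l by (rule neg[OF S])
   show "?b (Suc m) k l = ?b m (Suc k) l +[B] ?b m k (Suc l)" for m k l
    unfolding SSuc by (rule neg_diff[OF S S])
  qed simp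
  also have "... = (\<Oplus>\<^bsub>B\<^esub>i\<in>{..p - 1}. ?S 0 i (p - 1 - i) j)"
  proof (rule B.finsum_cong')
   fix i assume "i \<in> {..p - 1}"
   then have i: "p - 1 - (p - 1 - i) = i" by auto
   show "[((p - 1) choose i)] \<cdot>\<^bsub>B\<^esub> ?b 0 (0 + i) (0 + (p - 1 - i)) = ?S 0 i (p - 1 - i) j"
    using binomial_p1[OF S[of i "p - 1 - i" 0 j], of "p - 1 - i"] unfolding i by simp
  qed (simp_all add: Pi_iff S)
  also have "{..p - 1} = {..<p}" using p0 by auto
  finally show ?thesis by simp
 qed
 have coeff: "sum_power p i = inv\<^bsub>K\<^esub> ([i] \<cdot>\<^bsub>K\<^esub> \<one>[K]) \<odot>[B] C (p - 1) (i - 1)" if i: "i \<in> {1..<p}" for i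
 proof -
  obtain j where j: "i = Suc j" using i by (cases i) auto
  have "[i] \<cdot>\<^bsub>B\<^esub> sum_power p i = C (p - 1) (i - 1)"
   using sum_power_deriv[of j p] sum[of j] unfolding C0 j by simp
  then have e: "([i] \<cdot>\<^bsub>K\<^esub> \<one>[K]) \<odot>[B] sum_power p i = C (p - 1) (i - 1)" using MB.nat_smult[OF sum_power_closed] by simp
  have "\<not> p dvd i" using i by (auto dest: dvd_imp_le)
  then have u: "[i] \<cdot>\<^bsub>K\<^esub> \<one>[K] \<in> Units K" using char_nonzero[OF K p0 char] by (simp add: K.field_Units)
  then have "inv\<^bsub>K\<^esub> ([i] \<cdot>\<^bsub>K\<^esub> \<one>[K]) \<odot>[B] (([i] \<cdot>\<^bsub>K\<^esub> \<one>[K]) \<odot>[B] sum_power p i) = sum_power p i"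
   by (simp add: MB.smult_assoc1[symmetric])
  then show ?thesis unfolding e by simp
 qed
 have split: "{..p} = insert p (insert 0 {1..<p})" using p0 by auto
 have sums: "(\<Oplus>\<^bsub>B\<^esub>i\<in>{1..<p}. sum_power p i) = (\<Oplus>\<^bsub>B\<^esub>i\<in>{1..<p}. inv\<^bsub>K\<^esub> ([i] \<cdot>\<^bsub>K\<^esub> \<one>[K]) \<odot>[B] C (p - 1) (i - 1))"
 proof (rule B.finsum_cong'[OF refl _ coeff])
  show "(\<lambda>i. inv\<^bsub>K\<^esub> ([i] \<cdot>\<^bsub>K\<^esub> \<one>[K]) \<odot>[B] C (p - 1) (i - 1)) \<in> {1..<p} \<rightarrow> carrier B"
  proof (rule Pi_I)
   show "inv\<^bsub>K\<^esub> ([i] \<cdot>\<^bsub>K\<^esub> \<one>[K]) \<odot>[B] C (p - 1) (i - 1) \<in>[B]" if "i \<in> {1..<p}" for i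
    unfolding coeff[OF that, symmetric] by simp
  qed
 qed
 show ?thesis
  unfolding sum_power_sum split sums[symmetric] using p0 by (simp add: sum_power_ends B.a_assoc)
qed

end

section \<open>Reduced enveloping algebras do not vanish\<close>

text \<open>By Jacobson's formula in \<open>B\<close> and the axiom for the \<open>p\<close>-th power of a sum in \<open>L\<close>, the elements that satisfy the
  \<open>p\<close>-th power relation form a subspace.\<close>

lemma lie_rep_from_spanning:
 assumes L: "p_lie_algebra K L p" and B: "assoc_algebra K B" and span: "spanning K L S" and f: "f \<in> lin_maps K L B"
  and br: "!!x y. [|x \<in>[L]; y \<in>[L]|] ==> f x *[B] f y -[B] f y *[B] f x = f (lie_bracket L x y)"
  and \<xi>: "\<xi> \<in> dual_space K L"
  and pw: "!!x. x \<in> S ==> f x ^[B] p = f (p_power L x) +[B] ((\<xi> x ^[K] p) \<odot>[B] \<one>[B])"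
 shows "lie_rep K p L (\<lambda>x. \<xi> x ^[K] p) B f"
proof -
 interpret K: field K by (rule algD[OF B])
 interpret L: p_lie_algebra K L p by (rule L)
 interpret B: ring B by (rule algD[OF B])
 interpret MB: module K B by (rule algD[OF B])
 note mL = L.module_axioms
 note fr = lin_closed[OF f] lin_add[OF f] lin_smult[OF f] and xr = dual_space_rules[OF \<xi>]
 have all: "f x ^[B] p = f (p_power L x) +[B] ((\<xi> x ^[K] p) \<odot>[B] \<one>[B])" if "x \<in>[L]" for x
  using mL span that
 proof (induction rule: spanning_induct)
  case (gen x)
  then show ?case by (rule pw)
 next
  case zero
  have e: "\<zero>[L] = \<zero>[K] \<odot>[L] \<zero>[L]" by simp
  have f0: "f \<zero>[L] = \<zero>[B]" by (rule lin_zero[OF mL MB.module_axioms f])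
  have x0: "\<xi> \<zero>[L] = \<zero>[K]" using lin_zero[OF mL module_self[OF K.field_axioms] \<xi>] by simp
  have "p_power L \<zero>[L] = \<zero>[L]"
   using L.p_power_smult[OF K.zero_closed L.M.zero_closed] L.p_power_closed[OF L.M.zero_closed] L.p_pos
   by (simp add: K.nat_pow_zero)
  then show ?case using L.p_pos by (simp add: f0 x0 B.nat_pow_zero K.nat_pow_zero)
 next
  case (smult c x)
  have "(c \<odot>[B] f x) ^[B] m = (c ^[K] m) \<odot>[B] (f x ^[B] m)" for m :: nat
   using smult.hyps by (induction m) (simp_all add: fr alg_smult[OF B] MB.smult_assoc1[symmetric] K.m_comm)
  then show ?case using smult
   by (simp add: fr xr L.p_power_smult L.p_power_closed MB.smult_r_distr MB.smult_assoc1 K.nat_pow_distrib)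
 next
  case (add x y)
  note x = add.hyps(1) and y = add.hyps(2)
  define C where "C m j = f (jacobson_coeff L x y m j)" for m j
  have jc: "jacobson_coeff L x y m j \<in>[L]" for m j
  proof (induction m arbitrary: j)
   case 0
   show ?case using x by (cases j) simp_all
  next
   case (Suc m)
   then show ?case using x y by (cases j) (simp_all add: L.bracket_closed)
  qed
  have J: "(f x +[B] f y) ^[B] p = f x ^[B] p +[B] f y ^[B] p +[B]
    (\<Oplus>\<^bsub>B\<^esub>i\<in>{1..<p}. inv\<^bsub>K\<^esub> ([i] \<cdot>\<^bsub>K\<^esub> \<one>[K]) \<odot>[B] C (p - 1) (i - 1))"
  proof (rule jacobson_formula[OF K.field_axioms L.p_pos L.char_p B fr(1)[OF x] fr(1)[OF y]])
   show "C 0 (Suc j) = \<zero>[B]" for j using lin_zero[OF mL MB.module_axioms f] by (simp add: C_def)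
  qed (simp_all add: C_def jc x y fr br L.bracket_closed)
  have u: "inv\<^bsub>K\<^esub> ([i] \<cdot>\<^bsub>K\<^esub> \<one>[K]) \<in>[K]" if "i \<in> {1..<p}" for i
  proof -
   have "\<not> p dvd i" using that by (auto dest: dvd_imp_le)
   then have "[i] \<cdot>\<^bsub>K\<^esub> \<one>[K] \<in> Units K" using char_nonzero[OF K.field_axioms L.p_pos L.char_p] by (simp add: K.field_Units)
   then show ?thesis by (rule K.Units_inv_closed)
  qed
  have sc: "jacobson_s K p L i x y \<in>[L]" if "i \<in> {1..<p}" for i
   unfolding jacobson_s_def using u[OF that] jc by simp
  have sumc: "(\<Oplus>\<^bsub>L\<^esub>i\<in>{1..<p}. jacobson_s K p L i x y) \<in>[L]"
   by (rule L.M.finsum_closed) (use sc in \<open>simp add: Pi_iff\<close>)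
  have "f (\<Oplus>\<^bsub>L\<^esub>i\<in>{1..<p}. jacobson_s K p L i x y) = (\<Oplus>\<^bsub>B\<^esub>i\<in>{1..<p}. f (jacobson_s K p L i x y))"
   by (rule lin_finsum[OF mL MB.module_axioms f]) (use sc in \<open>simp_all add: Pi_iff\<close>)
  also have "... = (\<Oplus>\<^bsub>B\<^esub>i\<in>{1..<p}. inv\<^bsub>K\<^esub> ([i] \<cdot>\<^bsub>K\<^esub> \<one>[K]) \<odot>[B] C (p - 1) (i - 1))"
  proof (rule B.finsum_cong')
   fix i assume "i \<in> {1..<p}"
   then show "f (jacobson_s K p L i x y) = inv\<^bsub>K\<^esub> ([i] \<cdot>\<^bsub>K\<^esub> \<one>[K]) \<odot>[B] C (p - 1) (i - 1)"
    unfolding jacobson_s_def C_def by (intro fr(3) u jc)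
  next
   show "(\<lambda>i. inv\<^bsub>K\<^esub> ([i] \<cdot>\<^bsub>K\<^esub> \<one>[K]) \<odot>[B] C (p - 1) (i - 1)) \<in> {1..<p} \<rightarrow> carrier B"
    by (intro Pi_I MB.smult_closed u) (simp_all add: C_def fr(1) jc)
  qed simp
  finally have fs: "f (\<Oplus>\<^bsub>L\<^esub>i\<in>{1..<p}. jacobson_s K p L i x y) = (\<Oplus>\<^bsub>B\<^esub>i\<in>{1..<p}. inv\<^bsub>K\<^esub> ([i] \<cdot>\<^bsub>K\<^esub> \<one>[K]) \<odot>[B] C (p - 1) (i - 1))" .
  have xs: "\<xi> x ^[K] p +[K] \<xi> y ^[K] p = \<xi> (x +[L] y) ^[K] p"
  proof -
   have sp: "c ^[self_algebra K] m = c ^[K] m" for c and m :: nat by (induction m) simp_all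
   have "(\<xi> x +[self_algebra K] \<xi> y) ^[self_algebra K] p = \<xi> x ^[self_algebra K] p +[self_algebra K] \<xi> y ^[self_algebra K] p"
    by (rule frobenius_add[OF K.field_axioms L.p_pos L.char_p assoc_self[OF K.field_axioms]])
     (simp_all add: xr x y K.m_comm)
   then show ?thesis by (simp add: sp xr x y)
  qed
  let ?S = "\<Oplus>\<^bsub>L\<^esub>i\<in>{1..<p}. jacobson_s K p L i x y"
  have c: "f (p_power L x) \<in>[B]" "f (p_power L y) \<in>[B]" "f ?S \<in>[B]" "\<xi> x ^[K] p \<in>[K]" "\<xi> y ^[K] p \<in>[K]"
   using x y sumc by (simp_all add: fr xr L.p_power_closed)
  have "f (x +[L] y) ^[B] p = (f (p_power L x) +[B] ((\<xi> x ^[K] p) \<odot>[B] \<one>[B])) +[B]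
    (f (p_power L y) +[B] ((\<xi> y ^[K] p) \<odot>[B] \<one>[B])) +[B] f ?S"
   unfolding fr(2)[OF x y] J add.IH fs ..
  also have "... = f (p_power L x) +[B] f (p_power L y) +[B] f ?S +[B] ((\<xi> x ^[K] p +[K] \<xi> y ^[K] p) \<odot>[B] \<one>[B])"
   using c by (simp add: MB.smult_l_distr B.a_ac)
  also have "f (p_power L x) +[B] f (p_power L y) +[B] f ?S = f (p_power L (x +[L] y))"
   unfolding L.p_power_add[OF x y] using x y sumc by (simp only: fr(2) L.p_power_closed L.M.a_closed)
  finally show ?case unfolding xs .
 qed
 show ?thesis
  by (rule lie_repI) (simp_all add: all br fr xr)
qed

context letters
begin

definition form_module :: "('k, nat list => 'k) module" where
 "form_module = \<lparr>carrier = {\<tau>. word_form \<tau> \<and> (\<forall>m. comm_rel \<tau> m \<and> pow_rel \<tau> m)},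
   monoid.mult = (\<lambda>\<tau> \<sigma> w. \<zero>[K]), one = (\<lambda>w. \<zero>[K]), zero = (\<lambda>w. \<zero>[K]), add = (\<lambda>\<tau> \<sigma> w. \<tau> w +[K] \<sigma> w),
   smult = (\<lambda>a \<tau> w. a *[K] \<tau> w)\<rparr>"

lemma T_add_form:
 assumes \<tau>: "word_form \<tau>" and \<sigma>: "word_form \<sigma>" and y: "y \<in>[L]"
 shows "T (\<lambda>w. \<tau> w +[K] \<sigma> w) u y v = T \<tau> u y v +[K] T \<sigma> u y v"
proof -
 note c = word_formD(1)[OF \<tau>] word_formD(1)[OF \<sigma>] c_rules(1)[OF _ y]
 have "T (\<lambda>w. \<tau> w +[K] \<sigma> w) u y v = (\<Oplus>\<^bsub>K\<^esub>k\<in>{..<n}. c k y *[K] \<tau> (u @ k # v) +[K] c k y *[K] \<sigma> (u @ k # v))"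
  unfolding T_def by (rule K.finsum_cong') (simp_all add: Pi_iff c K.r_distr)
 also have "... = T \<tau> u y v +[K] T \<sigma> u y v" unfolding T_def by (rule K.finsum_addf) (simp_all add: Pi_iff c)
 finally show ?thesis .
qed

lemma T_smult_form:
 assumes \<tau>: "word_form \<tau>" and a: "a \<in>[K]" and y: "y \<in>[L]"
 shows "T (\<lambda>w. a *[K] \<tau> w) u y v = a *[K] T \<tau> u y v"
proof -
 note c = word_formD(1)[OF \<tau>] c_rules(1)[OF _ y] a
 have "T (\<lambda>w. a *[K] \<tau> w) u y v = (\<Oplus>\<^bsub>K\<^esub>k\<in>{..<n}. a *[K] (c k y *[K] \<tau> (u @ k # v)))"
  unfolding T_def by (rule K.finsum_cong') (simp_all add: Pi_iff c K.m_lcomm)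
 also have "... = a *[K] T \<tau> u y v" unfolding T_def by (rule K.finsum_rdistr[symmetric]) (simp_all add: Pi_iff c)
 finally show ?thesis .
qed

context
begin

private abbreviation "V == form_module"

private lemma V_iff: "\<tau> \<in>[V] \<longleftrightarrow> word_form \<tau> \<and> (\<forall>m. comm_rel \<tau> m \<and> pow_rel \<tau> m)"
 by (simp add: form_module_def)

private lemma V_ops [simp]: "\<tau> +[V] \<sigma> = (\<lambda>w. \<tau> w +[K] \<sigma> w)" "a \<odot>[V] \<tau> = (\<lambda>w. a *[K] \<tau> w)" "\<zero>[V] = (\<lambda>w. \<zero>[K])"
 by (simp_all add: form_module_def)

private lemma VD: "\<tau> \<in>[V] ==> word_form \<tau>" "\<tau> \<in>[V] ==> comm_rel \<tau> m" "\<tau> \<in>[V] ==> pow_rel \<tau> m"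
 "\<tau> \<in>[V] ==> \<tau> w \<in>[K]"
 using word_formD(1) by (simp_all add: V_iff)

private lemma V_add: "\<tau> \<in>[V] ==> \<sigma> \<in>[V] ==> (\<lambda>w. \<tau> w +[K] \<sigma> w) \<in>[V]"
proof -
 assume \<tau>: "\<tau> \<in>[V]" and \<sigma>: "\<sigma> \<in>[V]"
 note wf = VD(1)[OF \<tau>] VD(1)[OF \<sigma>] and cl = VD(4)[OF \<tau>] VD(4)[OF \<sigma>]
 note Tc = T_rules(1)[OF wf(1)] T_rules(1)[OF wf(2)]
 have P: "p_power L (e i) \<in>[L]" "lie_bracket L (e i) (e j) \<in>[L]" for i j by (simp_all add: L.p_power_closed e_closed L.bracket_closed)
 show ?thesis
  unfolding V_iff comm_rel_def pow_rel_def
 proof (intro conjI allI impI)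
  show "word_form (\<lambda>w. \<tau> w +[K] \<sigma> w)" using word_formD[OF wf(1)] word_formD[OF wf(2)] unfolding word_form_def by simp
  fix m :: nat and u v :: "nat list" and i j :: nat assume len: "length u + length v + 2 = m"
  have 1: "\<tau> (u @ i # j # v) -[K] \<tau> (u @ j # i # v) = T \<tau> u (lie_bracket L (e i) (e j)) v"
   using VD(2)[OF \<tau>] len unfolding comm_rel_def by blast
  have 2: "\<sigma> (u @ i # j # v) -[K] \<sigma> (u @ j # i # v) = T \<sigma> u (lie_bracket L (e i) (e j)) v"
   using VD(2)[OF \<sigma>] len unfolding comm_rel_def by blast
  show "\<tau> (u @ i # j # v) +[K] \<sigma> (u @ i # j # v) -[K] (\<tau> (u @ j # i # v) +[K] \<sigma> (u @ j # i # v)) =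
   T (\<lambda>w. \<tau> w +[K] \<sigma> w) u (lie_bracket L (e i) (e j)) v"
   unfolding T_add_form[OF wf P(2)] 1[symmetric] 2[symmetric] using cl by (simp add: a_minus_def K.minus_add K.a_ac)
 next
  fix m :: nat and u v :: "nat list" and i :: nat assume len: "length u + p + length v = m"
  have 1: "\<tau> (u @ replicate p i @ v) = T \<tau> u (p_power L (e i)) v +[K] s i *[K] \<tau> (u @ v)"
   using VD(3)[OF \<tau>] len unfolding pow_rel_def by blast
  have 2: "\<sigma> (u @ replicate p i @ v) = T \<sigma> u (p_power L (e i)) v +[K] s i *[K] \<sigma> (u @ v)"
   using VD(3)[OF \<sigma>] len unfolding pow_rel_def by blast
  show "\<tau> (u @ replicate p i @ v) +[K] \<sigma> (u @ replicate p i @ v) =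
   T (\<lambda>w. \<tau> w +[K] \<sigma> w) u (p_power L (e i)) v +[K] s i *[K] (\<tau> (u @ v) +[K] \<sigma> (u @ v))"
   unfolding T_add_form[OF wf P(1)] 1 2 using cl Tc P by (simp add: s_closed K.r_distr K.a_ac)
 qed
qed

private lemma V_smult: "a \<in>[K] ==> \<tau> \<in>[V] ==> (\<lambda>w. a *[K] \<tau> w) \<in>[V]"
proof -
 assume a: "a \<in>[K]" and \<tau>: "\<tau> \<in>[V]"
 note wf = VD(1)[OF \<tau>] and cl = VD(4)[OF \<tau>]
 note Tc = T_rules(1)[OF wf]
 have P: "p_power L (e i) \<in>[L]" "lie_bracket L (e i) (e j) \<in>[L]" for i j by (simp_all add: L.p_power_closed e_closed L.bracket_closed)
 show ?thesis
  unfolding V_iff comm_rel_def pow_rel_def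
 proof (intro conjI allI impI)
  show "word_form (\<lambda>w. a *[K] \<tau> w)" using word_formD[OF wf] a unfolding word_form_def by simp
  fix m :: nat and u v :: "nat list" and i j :: nat assume len: "length u + length v + 2 = m"
  have 1: "\<tau> (u @ i # j # v) -[K] \<tau> (u @ j # i # v) = T \<tau> u (lie_bracket L (e i) (e j)) v"
   using VD(2)[OF \<tau>] len unfolding comm_rel_def by blast
  show "a *[K] \<tau> (u @ i # j # v) -[K] a *[K] \<tau> (u @ j # i # v) = T (\<lambda>w. a *[K] \<tau> w) u (lie_bracket L (e i) (e j)) v"
   unfolding T_smult_form[OF wf a P(2)] 1[symmetric] using cl a by (simp add: a_minus_def K.r_distr K.r_minus)
 next
  fix m :: nat and u v :: "nat list" and i :: nat assume len: "length u + p + length v = m"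
  have 1: "\<tau> (u @ replicate p i @ v) = T \<tau> u (p_power L (e i)) v +[K] s i *[K] \<tau> (u @ v)"
   using VD(3)[OF \<tau>] len unfolding pow_rel_def by blast
  show "a *[K] \<tau> (u @ replicate p i @ v) = T (\<lambda>w. a *[K] \<tau> w) u (p_power L (e i)) v +[K] s i *[K] (a *[K] \<tau> (u @ v))"
   unfolding T_smult_form[OF wf a P(1)] 1 using cl a Tc P by (simp add: s_closed K.r_distr K.m_lcomm)
 qed
qed

lemma module_form: "module K form_module"
proof -
 have z: "(\<lambda>w. \<zero>[K]) \<in>[V]"
 proof -
  obtain \<tau> where \<tau>: "\<tau> \<in>[V]" using straightened_form by (auto simp: V_iff)
  from V_smult[OF K.zero_closed \<tau>] show ?thesis using VD(4)[OF \<tau>] by simp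
 qed
 show ?thesis
 proof (rule moduleI[OF K.is_cring])
  show "abelian_group V"
  proof (rule abelian_groupI)
   fix \<tau> assume \<tau>: "\<tau> \<in>[V]"
   have "(\<lambda>w. -[K] \<one>[K] *[K] \<tau> w) +[V] \<tau> = \<zero>[V]" using VD(4)[OF \<tau>] by (simp add: K.l_minus K.l_neg)
   then show "\<exists>\<sigma>\<in>carrier V. \<sigma> +[V] \<tau> = \<zero>[V]" using V_smult[OF _ \<tau>, of "-[K] \<one>[K]"] by (intro bexI) simp_all
  qed (simp_all add: V_add z VD(4) K.a_ac)
 qed (simp_all add: V_smult VD(4) K.l_distr K.r_distr K.m_assoc)
qed

text \<open>The transpose of right multiplication by \<open>y\<close> on the tensor algebra. As the relations are two-sided, it
  preserves them.\<close>

definition word_action :: "'g => (nat list => 'k) => nat list => 'k" where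
 "word_action y = (\<lambda>\<tau>\<in>carrier V. \<lambda>w. T \<tau> w y [])"

private abbreviation "\<rho> == word_action"
private abbreviation "E == end_algebra K form_module"

private lemma action_closed:
 assumes y: "y \<in>[L]" and \<tau>: "\<tau> \<in>[V]"
 shows "(\<lambda>w. T \<tau> w y []) \<in>[V]"
 unfolding V_iff comm_rel_def pow_rel_def
proof (intro conjI allI impI)
 note wf = VD(1)[OF \<tau>]
 have P: "p_power L (e i) \<in>[L]" "lie_bracket L (e i) (e j) \<in>[L]" for i j by (simp_all add: L.p_power_closed e_closed L.bracket_closed)
 have T2: "T (\<lambda>w. T \<tau> w y []) u z v = T2 \<tau> u z v y []" for u z v by (simp add: T_def[of "\<lambda>w. T \<tau> w y []"] T2_def)
 show "word_form (\<lambda>w. T \<tau> w y [])"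
  unfolding word_form_def using T_rules(1)[OF wf y] T_bad[OF wf y, where v = "[]"] by simp
 show "T \<tau> (u @ i # j # v) y [] -[K] T \<tau> (u @ j # i # v) y [] = T (\<lambda>w. T \<tau> w y []) u (lie_bracket L (e i) (e j)) v" for u i j v
  unfolding T2 by (rule T_swap_left[OF wf VD(2)[OF \<tau>] refl y])
 show "T \<tau> (u @ replicate p i @ v) y [] = T (\<lambda>w. T \<tau> w y []) u (p_power L (e i)) v +[K] s i *[K] T \<tau> (u @ v) y []" for u i v
  unfolding T2 by (rule pow_T_right[OF wf VD(2)[OF \<tau>] VD(3)[OF \<tau>] lessI y])
qed

private lemma action_lin: "y \<in>[L] ==> \<rho> y \<in> lin_maps K V V"
 unfolding word_action_def
 by (rule lin_restrictI[OF module_form]) (simp_all add: action_closed T_add_form T_smult_form VD(1))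

private lemma action_commutator:
 assumes \<tau>: "word_form \<tau>" and r: "comm_rel \<tau> (length w + 2)" and x: "x \<in>[L]" and y: "y \<in>[L]"
 shows "T2 \<tau> w x [] y [] -[K] T2 \<tau> w y [] x [] = T \<tau> w (lie_bracket L x y) []"
proof (rule lin_form_eqI[OF lin_form_diff[OF T2_lin_left[OF \<tau> y] T2_lin_right[OF \<tau> y]] _ _ x])
 show "lin_form (\<lambda>x. T \<tau> w (lie_bracket L x y) [])"
  by (rule lin_formI) (simp_all add: y L.bracket_closed T_rules[OF \<tau>] L.bracket_add_left L.bracket_smult_left)
 show "T2 \<tau> w (e i) [] y [] -[K] T2 \<tau> w y [] (e i) [] = T \<tau> w (lie_bracket L (e i) y) []" for i
  using T_commute[OF \<tau> r _ y, of w "[]" i] by (simp add: T2_e_left[OF \<tau> y] T2_e_right[OF \<tau> y])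
qed

private lemma action_pow:
 assumes \<tau>: "\<tau> \<in>[V]"
 shows "(\<rho> (e i) ^[E] k) \<tau> w = \<tau> (w @ replicate k i)"
proof -
 have E: "assoc_algebra K E" by (rule assoc_end[OF K.field_axioms module_form])
 interpret E: ring E by (rule algD[OF E])
 have re: "\<rho> (e i) \<in>[E]" using action_lin[OF e_closed] by simp
 show ?thesis using \<tau>
 proof (induction k arbitrary: \<tau>)
  case 0
  then show ?case by (simp add: end_apply)
 next
  case (Suc k)
  let ?\<sigma> = "\<rho> (e i) \<tau>"
  have \<sigma>: "?\<sigma> \<in>[V]" by (rule lin_closed[OF action_lin[OF e_closed] Suc.prems])
  have "(\<rho> (e i) ^[E] Suc k) \<tau> w = (\<rho> (e i) ^[E] k) ?\<sigma> w"
   using Suc.prems by (simp add: end_apply)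
  also have "... = \<tau> ((w @ replicate k i) @ [i])"
   unfolding Suc.IH[OF \<sigma>] using Suc.prems by (simp add: word_action_def T_e VD(1))
  finally show ?case by (simp add: replicate_append_same)
 qed
qed

lemma word_action_rep:
 assumes \<xi>: "\<xi> \<in> dual_space K L" and s: "!!i. s i = \<xi> (e i) ^[K] p"
 shows "lie_rep K p L (\<lambda>x. \<xi> x ^[K] p) (end_algebra K form_module) (\<lambda>x\<in>carrier L. word_action x)"
proof (rule lie_rep_from_spanning[OF L _ _ _ _ \<xi>])
 show E: "assoc_algebra K E" by (rule assoc_end[OF K.field_axioms module_form])
 interpret E: ring E by (rule algD[OF E])
 interpret ME: module K E by (rule algD[OF E])
 note ec = end_closed[OF module_form]
 note al = action_lin
 have T2: "T (\<lambda>w. T \<tau> w y []) u z v = T2 \<tau> u z v y []" for \<tau> y u z v by (simp add: T_def[of "\<lambda>w. T \<tau> w y []"] T2_def)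
 show "spanning K L (range e)"
  unfolding spanning_def
 proof (intro conjI allI impI)
  show "range e <= carrier L" using e_closed by auto
  fix N assume N: "submodule N K L" "range e <= N"
  show "carrier L <= N"
  proof
   fix y assume y: "y \<in>[L]"
   have "(\<Oplus>\<^bsub>L\<^esub>i\<in>{..<n}. c i y \<odot>[L] e i) \<in> N"
    by (rule submodule_finsum[OF mL N(1)]) (use N(2) c_rules(1)[OF _ y] in \<open>auto intro!: submoduleD(4)[OF N(1)]\<close>)
   then show "y \<in> N" using c_expand[OF y] by simp
  qed
 qed
 show "(\<lambda>x\<in>carrier L. \<rho> x) \<in> lin_maps K L E"
 proof (rule lin_restrictI[OF mL])
  show "\<rho> x \<in>[E]" if "x \<in>[L]" for x using al[OF that] by simp
  show "\<rho> (x +[L] y) = \<rho> x +[E] \<rho> y" if "x \<in>[L]" "y \<in>[L]" for x y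
   by (rule lin_ext[OF al ec(1)[OF al al]]) (use that in \<open>simp_all add: end_apply lin_closed[OF al] word_action_def T_rules VD(1)\<close>)
  show "\<rho> (a \<odot>[L] x) = a \<odot>[E] \<rho> x" if "a \<in>[K]" "x \<in>[L]" for a x
   by (rule lin_ext[OF al ec(3)[OF al al]]) (use that in \<open>simp_all add: end_apply lin_closed[OF al] word_action_def T_rules VD(1)\<close>)
 qed
 fix x y assume x: "x \<in>[L]" and y: "y \<in>[L]"
 have "\<rho> x *[E] \<rho> y -[E] \<rho> y *[E] \<rho> x = \<rho> (lie_bracket L x y)"
 proof -
  have xy: "\<rho> x *[E] \<rho> y \<in>[E]" "\<rho> y *[E] \<rho> x \<in>[E]" using al[OF x] al[OF y] ec(2) by simp_all
  have br: "\<rho> (lie_bracket L x y) \<in>[E]" using al[OF L.bracket_closed[OF x y]] by simp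
  have "\<rho> x *[E] \<rho> y = \<rho> (lie_bracket L x y) +[E] \<rho> y *[E] \<rho> x"
  proof (rule lin_ext)
   show "\<rho> x *[E] \<rho> y \<in> lin_maps K V V" "\<rho> (lie_bracket L x y) +[E] \<rho> y *[E] \<rho> x \<in> lin_maps K V V"
    using xy br ec(1) by simp_all
   fix \<tau> assume \<tau>: "\<tau> \<in>[V]"
   note wf = VD(1)[OF \<tau>]
   have app: "\<rho> a (\<rho> b \<tau>) = (\<lambda>w. T2 \<tau> w a [] b [])" if "a \<in>[L]" "b \<in>[L]" for a b
    using \<tau> action_closed[OF that(2) \<tau>] by (simp add: word_action_def T2)
   have "T2 \<tau> w x [] y [] = T \<tau> w (lie_bracket L x y) [] +[K] T2 \<tau> w y [] x []" for w
   proof -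
    have c: "T2 \<tau> w x [] y [] \<in>[K]" "T2 \<tau> w y [] x [] \<in>[K]"
     by (rule lin_formD(1)[OF T2_lin_left[OF wf y] x], rule lin_formD(1)[OF T2_lin_left[OF wf x] y])
    show ?thesis unfolding action_commutator[OF wf VD(2)[OF \<tau>] x y, symmetric] using c by (simp add: a_minus_def K.a_assoc K.l_neg)
   qed
   then show "(\<rho> x *[E] \<rho> y) \<tau> = (\<rho> (lie_bracket L x y) +[E] \<rho> y *[E] \<rho> x) \<tau>"
    using \<tau> x y xy by (simp add: end_apply app) (simp add: word_action_def)
  qed
  then show ?thesis using xy br by (simp add: a_minus_def E.a_assoc E.r_neg del: carrier_end)
 qed
 then show "(\<lambda>x\<in>carrier L. \<rho> x) x *[E] (\<lambda>x\<in>carrier L. \<rho> x) y -[E] (\<lambda>x\<in>carrier L. \<rho> x) y *[E] (\<lambda>x\<in>carrier L. \<rho> x) x = (\<lambda>x\<in>carrier L. \<rho> x) (lie_bracket L x y)"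
  using x y L.bracket_closed[OF x y] by simp
next
 fix x assume "x \<in> range e"
 then obtain i where i: "x = e i" by auto
 have E: "assoc_algebra K E" by (rule assoc_end[OF K.field_axioms module_form])
 interpret E: ring E by (rule algD[OF E])
 interpret ME: module K E by (rule algD[OF E])
 note ec = end_closed[OF module_form]
 have P: "p_power L (e i) \<in>[L]" by (rule L.p_power_closed[OF e_closed])
 have re: "\<rho> (e i) \<in>[E]" "\<rho> (p_power L (e i)) \<in>[E]" using action_lin[OF e_closed] action_lin[OF P] by simp_all
 have "\<rho> (e i) ^[E] p = \<rho> (p_power L (e i)) +[E] (s i \<odot>[E] \<one>[E])"
 proof (rule lin_ext)
  show "\<rho> (e i) ^[E] p \<in> lin_maps K V V" using E.nat_pow_closed[OF re(1)] by simp
  have "\<rho> (p_power L (e i)) +[E] (s i \<odot>[E] \<one>[E]) \<in>[E]" using re(2) s_closed[of i] by (intro E.a_closed ME.smult_closed E.one_closed)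
  then show "\<rho> (p_power L (e i)) +[E] (s i \<odot>[E] \<one>[E]) \<in> lin_maps K V V" by simp
  fix \<tau> assume \<tau>: "\<tau> \<in>[V]"
  show "(\<rho> (e i) ^[E] p) \<tau> = (\<rho> (p_power L (e i)) +[E] (s i \<odot>[E] \<one>[E])) \<tau>"
  proof
   fix w
   have "\<tau> (w @ replicate p i @ []) = T \<tau> w (p_power L (e i)) [] +[K] s i *[K] \<tau> (w @ [])"
    by (rule VD(3)[OF \<tau>, unfolded pow_rel_def, rule_format, OF refl])
   then show "(\<rho> (e i) ^[E] p) \<tau> w = (\<rho> (p_power L (e i)) +[E] (s i \<odot>[E] \<one>[E])) \<tau> w"
    unfolding action_pow[OF \<tau>] using \<tau> by (simp add: end_apply word_action_def)
  qed
 qed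
 then show "(\<lambda>x\<in>carrier L. \<rho> x) x ^[E] p = (\<lambda>x\<in>carrier L. \<rho> x) (p_power L x) +[E] ((\<xi> x ^[K] p) \<odot>[E] \<one>[E])"
  using i P e_closed by (simp add: s)
qed

lemma form_module_nonzero: "\<one>[end_algebra K form_module] ~= \<zero>[end_algebra K form_module]"
proof
 assume eq: "\<one>[E] = \<zero>[E]"
 obtain \<tau> where \<tau>: "\<tau> \<in>[V]" "\<tau> [] = \<one>[K]" using straightened_form by (auto simp: V_iff)
 have "\<one>[E] \<tau> [] = \<zero>[E] \<tau> []" unfolding eq ..
 then have "\<one>[K] = \<zero>[K]" using \<tau> by (simp add: end_apply)
 then show False by simp
qed

end

end

text \<open>The homomorphism into \<open>End form_module\<close> sends \<open>1\<close> to the identity, which is not zero because some form has the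
  value \<open>1\<close> at the empty word.\<close>

theorem red_env_nonzero:
 assumes L: "p_lie_algebra K L p" and fin: "finite_dim K L" and \<xi>: "\<xi> \<in> dual_space K L"
 shows "\<one>[red_env_algebra K p L \<xi>] ~= \<zero>[red_env_algebra K p L \<xi>]"
proof -
 interpret K: field K using L by (simp add: p_lie_algebra_def lie_algebra_def)
 interpret L: p_lie_algebra K L p by (rule L)
 note xr = dual_space_rules[OF \<xi>]
 have \<xi>': "\<xi> \<in> carrier L \<rightarrow> carrier K" using xr(1) by auto
 obtain n h where bas: "basis K L n h" using fin by (auto simp: finite_dim_def)
 obtain c where d: "dual_bases K L n h c" using dual_bases_exist[OF K.field_axioms L.module_axioms bas] by auto
 have h: "h i \<in>[L]" "c i \<in> dual_space K L" if "i < n" for i using d that by (auto simp: dual_bases_def basis_def)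
 define e where "e i = (if i < n then h i else \<zero>[L])" for i
 define s where "s i = \<xi> (e i) ^[K] p" for i
 have ec: "e i \<in>[L]" for i by (simp add: e_def h(1))
 have x0: "\<xi> \<zero>[L] = \<zero>[K]" using lin_zero[OF L.module_axioms module_self[OF K.field_axioms] \<xi>] by simp
 interpret letters K L p n e c s
 proof (rule letters.intro)
  show "p_lie_algebra K L p" by (rule L)
  show "c i (e j) = (if i = j then \<one>[K] else \<zero>[K])" if "i < n" "j < n" for i j
   using d that by (simp add: e_def dual_bases_def)
  show "y = (\<Oplus>\<^bsub>L\<^esub>i\<in>{..<n}. c i y \<odot>[L] e i)" if y: "y \<in>[L]" for y
  proof -
   have "(\<Oplus>\<^bsub>L\<^esub>i\<in>{..<n}. c i y \<odot>[L] e i) = (\<Oplus>\<^bsub>L\<^esub>i\<in>{..<n}. c i y \<odot>[L] h i)"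
    by (rule L.M.finsum_cong') (simp_all add: Pi_iff e_def h dual_space_rules(1)[OF h(2) y])
   then show ?thesis using dual_bases_expand[OF K.field_axioms L.module_axioms d y] by simp
  qed
  show "s i \<in>[K]" for i using xr(1)[OF ec] by (simp add: s_def)
  show "s i = \<zero>[K]" if "n \<le> i" for i using that L.p_pos by (simp add: s_def e_def x0 K.nat_pow_zero)
  show "e i = \<zero>[L]" if "n \<le> i" for i using that by (simp add: e_def)
 qed (simp_all add: ec h(2))
 have E: "assoc_algebra K (end_algebra K form_module)" by (rule assoc_end[OF K.field_axioms module_form])
 note l = red_env_lift_rep(1)[OF L \<xi>' E word_action_rep[OF \<xi> s_def]]
 show ?thesis
 proof
  assume "\<one>[red_env_algebra K p L \<xi>] = \<zero>[red_env_algebra K p L \<xi>]"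
  then have "\<one>[end_algebra K form_module] = \<zero>[end_algebra K form_module]"
   using hom_one[OF l] lin_zero[OF algD(2)[OF assoc_red_env[OF L \<xi>']] algD(2)[OF E] hom_lin[OF l]] by simp
  then show False using form_module_nonzero by simp
 qed
qed

section \<open>The Galois criterion and the Miyashita--Ulbrich action\<close>

theorem proposition6p1:
  fixes K :: "('k, 'm) ring_scheme" and L :: "('k, 'g, 'n) p_lie_scheme"
    and p :: nat and \<xi> :: "'g \<Rightarrow> 'k"
  assumes "field K" and "0 < p" and "has_char K p"
    and "p_lie_algebra K L p" and "finite_dim K L"
    and "\<xi> \<in> dual_space K L"
  shows "(lie_galois K p L \<xi> \<longleftrightarrow> central_simple K (red_env_algebra K p L \<xi>)) \<and>
    (lie_galois K p L \<xi> \<longrightarrow>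
      (let H = restr_env_algebra K p L; A = red_env_algebra K p L \<xi>;
           \<Delta>\<^sub>H = restr_comult K p L; \<epsilon>\<^sub>H = restr_counit K p L;
           \<Delta> = coaction K p L \<xi>
       in \<Delta> \<in> alg_homs K A (tensor K H A) \<and>
          (\<forall>x\<in>carrier L. \<Delta> (red_env_incl K p L \<xi> x) =
             tens K H A \<one>\<^bsub>H\<^esub> (red_env_incl K p L \<xi> x) \<oplus>\<^bsub>tensor K H A\<^esub>
             tens K H A (restr_env_incl K p L x) \<one>\<^bsub>A\<^esub>) \<and>
          left_comodule K H \<Delta>\<^sub>H \<epsilon>\<^sub>H A \<Delta> \<and>
          (\<exists>ract. miyashita_ulbrich K H \<Delta>\<^sub>H \<epsilon>\<^sub>H A (adjoint_action K p L \<xi>) ract \<and>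
                  corresponds K H A \<Delta> ract)))"
proof -
 note L = assms(4)
 have \<xi>: "\<xi> \<in> carrier L \<rightarrow> carrier K" using dual_space_rules(1)[OF assms(6)] by auto
 interpret red_env_setup K L p \<xi> by (rule red_env_setup.intro[OF L \<xi>])
 interpret zero: red_env_setup K L p "zero_form K L" by (rule red_env_setup.intro[OF L zero_form_closed[OF L]])
 have fin0: "finite_dim K U0" by (rule zero.finite_dim_Uxi[OF assms(5)])
 have fin: "finite_dim K Ux" by (rule finite_dim_Uxi[OF assms(5)])
 have nonzero: "\<one>[Ux] ~= \<zero>[Ux]" by (rule red_env_nonzero[OF L assms(5,6)])
 note criterion = central_simple_iff_bij[OF assoc_Uxi fin nonzero]
 have iff: "lie_galois K p L \<xi> \<longleftrightarrow> central_simple K Ux"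
  unfolding lie_galois_def dual_galois_def criterion galois_bij_iff[symmetric]
  using restr_hopf_algebra[OF L] fin0 adjoint_module_algebra by simp
 have mu: "miyashita_ulbrich K U0 \<Delta>\<^sub>0 \<epsilon>\<^sub>0 Ux ad dual_action" if cs: "central_simple K Ux"
 proof -
  note cso = central_simple_op[OF cs]
  have "finite_dim K (op_algebra Ux)" using cso by (simp add: central_simple_def)
  from central_simple_iff_bij[OF assoc_op[OF assoc_Uxi] this] cso nonzero
  have "bij_betw (two_sided_mult K (op_algebra Ux)) (carrier (tensor K (op_algebra Ux) (op_algebra (op_algebra Ux)))) (carrier (end_algebra K (op_algebra Ux)))"
   by simp
  then have bij: "bij_betw (galois_map K U0 (op_algebra Ux) ad) (carrier (tensor K (op_algebra Ux) U0)) (carrier (end_algebra K (op_algebra Ux)))"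
   by (simp only: op_galois_bij_iff)
  show ?thesis
   unfolding miyashita_ulbrich_def using dual_action_mu_compatible dual_action_unique[OF bij fin0] by blast
 qed
 show ?thesis
  unfolding Let_def
  using iff mu coact_hom coact_incl coact_comodule dual_action_corresponds by blast
qed

end
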